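(* Let $\phi$ be a complete GMN quadratic differential on a closed Riemann surface $C$ whose spectral curve $\Sigma_\phi$ is exact with respect to the real Liouville form. Given $E\gg0$ and $0<\delta\ll1$, there exist a metric $g^\phi_\delta$ on $\tilde C$ (a conformal desingularization of $g^\phi$ as described in the context) and a deformation retract $C(\delta;E)$ of $\tilde C-\mathcal S(0)$ (as described in the context) over which $g^\phi_\delta=g^\phi$, such that the following holds. Let $J$ be the Sasaki almost complex structure on $T^*\tilde C$ associated to $g^\phi_\delta$. Then there exists a scaling parameter $\epsilon_0=\epsilon_0(\delta;E)>0$ such that for $0<\epsilon\le\epsilon_0$ there are no non-constant $J$-holomorphic strips bounded between $F_z$ and $\epsilon\Sigma_\phi$ for $z\in C(\delta;E)$.
   Context: **Quadratic differentials.** A quadratic differential is a meromorphic section $\phi$ of $\omega_C^{\otimes2}$. It is GMN if its zeroes are simple, it has at least one pole and at least one finite critical point (zero or simple pole); complete if it has no simple poles. $\tilde C$: complement of the poles; $C^\circ$: complement of zeroes and poles. $\Sigma_\phi=\{\lambda^2=\pi^*\phi\}\subset(T^*_{\mathbb C})^{1,0}\tilde C$ with $\lambda=p^zdz$. The bundle $T^*\tilde C$ is identified with $(T^*_{\mathbb C})^{1,0}\tilde C$ by $dx\mapsto dz$, $dy\mapsto-i\,dz$, so that $\mathrm{Re}\,\lambda=\lambda_{re}=p\,dq$; $\omega=d\lambda_{re}$. $\epsilon\Sigma_\phi$ is the fibrewise rescaling and $F_z=T^*_z\tilde C$. **Flat metric and spectral network.** $g^\phi=|\phi||dz|^2$ on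 $C^\circ$ is flat with flat coordinate $\int\sqrt\phi$; horizontal trajectories are maximal curves with $\mathrm{Im}\int\sqrt\phi$ constant. $\mathcal S(0)$ is the union of the zeroes and of the horizontal trajectories with exactly one end at a zero. When $\Sigma_\phi$ is exact there are no horizontal trajectories joining zeroes, and each component of $\tilde C-\mathcal S(0)$ is conformally equivalent, with $\phi$ going to $dz^2$, to a strip $\mathcal Z(a,b)=\{a<\mathrm{Im}\,z<b\}$ or to the upper half plane $\mathcal H$; the equivalence extends continuously to the boundary, with exactly one zero of $\phi$ on each boundary line, and by exactness it can be normalized so that these zeroes lie on $\mathrm{Re}\,z=0$. **Desingularized metric.** Around each zero $b_i$ fix disjoint holomorphic charts $\xi_i:\{|\xi|<r_i\}\to U_i$ with $\xi_i(0)=b_i$, in which $\phi=\xi\,d\xi^2$, and set $U(r)=\bigcup_i\xi_i(\{|\xi|<r\})$. For small $\delta>0$, $g_\delta^\phi$ is the smooth metric on $\tilde C$ equal to $g^\phi$ outside $U(\tfrac32\delta)$ and given in each chart, in polar coordinates, by $\frac{r}{\psi_\delta(r)}(dr^2+r^2d\theta^2)$, with $\psi_\delta$ smooth, non-decreasing, positive for $r>0$, $\psi_\delta(r)=r$ for $r<\delta$, $\psi_\delta(r)=1$ for $r>\frac32\delta$. **The region $C(\delta;E)$.** Choose $e(\delta),h(\delta),\eta(\delta)>0$ such that $g^\phi_\delta=g^\phi$ outside $U((2-\eta)\delta)$ and the $h(\delta)$-neighbourhoods of the horizontal trajectories contained in the sets $\mathcal Z(a+e(\delta),b-e(\delta))$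 and $\mathcal H\cap\{\mathrm{Im}\,z>e(\delta)\}$ never enter $U((2+\eta)\delta)$. $C(\delta;E)$ is the union over all components of $\tilde C-\mathcal S(0)$ of the sets $\{a+e(\delta)<\mathrm{Im}\,z<b-e(\delta),\,|\mathrm{Re}\,z|<E\}$ (strips) and $\{\mathrm{Im}\,z>e(\delta),\,|\mathrm{Re}\,z|<E,\,|\mathrm{Im}\,z|<E\}$ (half planes). **Sasaki structure.** For a metric $g$, in the Levi-Civita splitting $TT^*M=H\oplus V\cong\pi^*TM\oplus\pi^*T^*M$, $J_g=\begin{pmatrix}0&g^{-1}\\-g&0\end{pmatrix}$, where $g:TM\to T^*M$. **Strips.** A $J$-holomorphic strip bounded between $F_z$ and $\epsilon\Sigma_\phi$ is a $J$-holomorphic map $u:\mathbb R\times[0,1]\to T^*\tilde C$ (conformal coordinate $s+it$) with $u(s,0)\in\epsilon\Sigma_\phi$, $u(s,1)\in F_z$ and $\lim_{s\to\pm\infty}u(s,t)\in F_z\cap\epsilon\Sigma_\phi$.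
   Formalization: "Deformation retract" is taken in the weak sense (the homotopy preserves C(δ;E) but need not fix it pointwise), as C(δ;E) is open and so no strict retract; limits of strips as s→±∞ are single points, uniform in t, since with limits for each t separately non-constant strips exist. *)

theory Defs
  imports "HOL-Complex_Analysis.Complex_Analysis"
begin

text \<open>
  Smoothness relative to a set: all iterated derivatives are taken within \<open>S\<close>, so that on the
  closed strip or on a closed interval this is smoothness up to the boundary.
\<close>

primrec Ck_on :: "nat \<Rightarrow> 'a::euclidean_space set \<Rightarrow> ('a \<Rightarrow> 'b::real_normed_vector) \<Rightarrow> bool" where
  "Ck_on 0 S f \<longleftrightarrow> continuous_on S f"
| "Ck_on (Suc n) S f \<longleftrightarrow>
     (\<exists>f'. (\<forall>x\<in>S. (f has_derivative f' x) (at x within S)) \<and> (\<forall>v. Ck_on n S (\<lambda>x. f' x v)))"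

definition smooth_on :: "'a::euclidean_space set \<Rightarrow> ('a \<Rightarrow> 'b::real_normed_vector) \<Rightarrow> bool" where
  "smooth_on S f \<longleftrightarrow> (\<forall>n. Ck_on n S f)"


section \<open>Riemann surfaces\<close>

text \<open>
  The underlying space is the whole type \<open>'c\<close>.  A local coordinate is stored as its inverse: an open
  set \<open>D\<close> of complex numbers with a parametrization \<open>D \<rightarrow> C\<close> (only the values on \<open>D\<close> matter).  A
  complex structure is a maximal holomorphic atlas.
\<close>

type_synonym 'c coord = "complex set \<times> (complex \<Rightarrow> 'c)"

abbreviation cdom :: "'c coord \<Rightarrow> complex set" where "cdom k \<equiv> fst k"
abbreviation cmap :: "'c coord \<Rightarrow> complex \<Rightarrow> 'c" where "cmap k \<equiv> snd k"
abbreviation cim :: "'c coord \<Rightarrow> 'c set" where "cim k \<equiv> cmap k ` cdom k"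

definition cinv :: "'c coord \<Rightarrow> 'c \<Rightarrow> complex" where
  "cinv k = inv_into (cdom k) (cmap k)"

definition overlap :: "'c coord \<Rightarrow> 'c coord \<Rightarrow> complex set" where
  "overlap k k' = {z \<in> cdom k. cmap k z \<in> cim k'}"

definition transition :: "'c coord \<Rightarrow> 'c coord \<Rightarrow> complex \<Rightarrow> complex" where
  "transition k k' = cinv k' \<circ> cmap k"

definition local_coordinate :: "'c::topological_space coord \<Rightarrow> bool" where
  "local_coordinate k \<longleftrightarrow>
     open (cdom k) \<and> open (cim k) \<and> inj_on (cmap k) (cdom k) \<and>
     homeomorphism (cdom k) (cim k) (cmap k) (cinv k)"

definition compatible :: "'c coord \<Rightarrow> 'c coord \<Rightarrow> bool" where
  "compatible k k' \<longleftrightarrow>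
     transition k k' holomorphic_on overlap k k' \<and> transition k' k holomorphic_on overlap k' k"

definition complex_structure :: "'c::topological_space coord set \<Rightarrow> bool" where
  "complex_structure A \<longleftrightarrow>
     (\<forall>k\<in>A. local_coordinate k) \<and>
     (\<forall>x. \<exists>k\<in>A. x \<in> cim k) \<and>
     (\<forall>k\<in>A. \<forall>k'\<in>A. compatible k k') \<and>
     (\<forall>k. local_coordinate k \<and> (\<forall>k'\<in>A. compatible k k') \<longrightarrow> k \<in> A)"

definition closed_riemann_surface :: "'c::t2_space coord set \<Rightarrow> bool" where
  "closed_riemann_surface A \<longleftrightarrow>
     compact (UNIV :: 'c set) \<and> connected (UNIV :: 'c set) \<and> complex_structure A"


section \<open>Quadratic differentials\<close>

text \<open>
  \<open>\<phi> k\<close> is the coefficient of \<open>dz\<^sup>2\<close> in the coordinate \<open>k\<close>.  Being nicely meromorphic, it takes the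
  value 0 at its poles, hence the exclusion of poles in \<open>qd_zeros\<close>.
\<close>

type_synonym 'c qd = "'c coord \<Rightarrow> complex \<Rightarrow> complex"

definition quadratic_differential :: "'c coord set \<Rightarrow> 'c qd \<Rightarrow> bool" where
  "quadratic_differential A \<phi> \<longleftrightarrow>
     (\<forall>k\<in>A. \<phi> k nicely_meromorphic_on cdom k) \<and>
     (\<forall>k\<in>A. \<forall>k'\<in>A. \<forall>z\<in>overlap k k'.
        \<phi> k z = \<phi> k' (transition k k' z) * (deriv (transition k k') z)\<^sup>2)"

definition qd_poles :: "'c coord set \<Rightarrow> 'c qd \<Rightarrow> 'c set" where
  "qd_poles A \<phi> = {cmap k z | k z. k \<in> A \<and> z \<in> cdom k \<and> is_pole (\<phi> k) z}"

definition qd_simple_poles :: "'c coord set \<Rightarrow> 'c qd \<Rightarrow> 'c set" where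
  "qd_simple_poles A \<phi> =
     {cmap k z | k z. k \<in> A \<and> z \<in> cdom k \<and> is_pole (\<phi> k) z \<and> zorder (\<phi> k) z = -1}"

definition qd_zeros :: "'c coord set \<Rightarrow> 'c qd \<Rightarrow> 'c set" where
  "qd_zeros A \<phi> = {cmap k z | k z. k \<in> A \<and> z \<in> cdom k \<and> \<not> is_pole (\<phi> k) z \<and> \<phi> k z = 0}"

definition qd_simple_zeros :: "'c coord set \<Rightarrow> 'c qd \<Rightarrow> 'c set" where
  "qd_simple_zeros A \<phi> =
     {cmap k z | k z. k \<in> A \<and> z \<in> cdom k \<and> isolated_zero (\<phi> k) z \<and> zorder (\<phi> k) z = 1}"

text \<open>\<open>C_tilde\<close> is the complement of the poles, \<open>C_circ\<close> that of the zeroes and poles.\<close>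

definition C_tilde :: "'c coord set \<Rightarrow> 'c qd \<Rightarrow> 'c set" where
  "C_tilde A \<phi> = - qd_poles A \<phi>"

definition C_circ :: "'c coord set \<Rightarrow> 'c qd \<Rightarrow> 'c set" where
  "C_circ A \<phi> = - (qd_zeros A \<phi> \<union> qd_poles A \<phi>)"

definition GMN :: "'c coord set \<Rightarrow> 'c qd \<Rightarrow> bool" where
  "GMN A \<phi> \<longleftrightarrow>
     quadratic_differential A \<phi> \<and>
     qd_zeros A \<phi> \<subseteq> qd_simple_zeros A \<phi> \<and>
     qd_poles A \<phi> \<noteq> {} \<and>
     qd_zeros A \<phi> \<union> qd_simple_poles A \<phi> \<noteq> {}"

definition complete_GMN :: "'c coord set \<Rightarrow> 'c qd \<Rightarrow> bool" where
  "complete_GMN A \<phi> \<longleftrightarrow> GMN A \<phi> \<and> qd_simple_poles A \<phi> = {}"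


section \<open>The cotangent bundle and the spectral curve\<close>

text \<open>
  A point is a pair \<open>(x, \<eta>)\<close> where \<open>\<eta> k\<close> is the coefficient \<open>p\<close> of the (1,0)-covector \<open>p dz\<close> at \<open>x\<close> in
  the coordinate \<open>k\<close>; \<open>\<eta>\<close> is 0 on coordinates that do not cover \<open>x\<close>, so that equality of points is
  equality of pairs.  Under \<open>dx \<mapsto> dz\<close>, \<open>dy \<mapsto> - i dz\<close> the coefficient \<open>p\<close> stands for the real covector
  \<open>w \<mapsto> Re (p w)\<close>, and \<open>covector_coeff\<close> recovers \<open>p\<close> from it.
\<close>

type_synonym 'c cot = "'c \<times> ('c coord \<Rightarrow> complex)"

definition covector_coeff :: "(complex \<Rightarrow> real) \<Rightarrow> complex" where
  "covector_coeff \<alpha> = of_real (\<alpha> 1) - \<i> * of_real (\<alpha> \<i>)"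

definition cot_fibre :: "'c coord set \<Rightarrow> 'c \<Rightarrow> ('c coord \<Rightarrow> complex) set" where
  "cot_fibre A x = {\<eta>.
     (\<forall>k\<in>A. \<forall>k'\<in>A. \<forall>z\<in>overlap k k'. cmap k z = x \<longrightarrow> \<eta> k = \<eta> k' * deriv (transition k k') z) \<and>
     (\<forall>k. \<not> (k \<in> A \<and> x \<in> cim k) \<longrightarrow> \<eta> k = 0)}"

definition cotangent_bundle :: "'c coord set \<Rightarrow> 'c qd \<Rightarrow> 'c cot set" where
  "cotangent_bundle A \<phi> = {(x, \<eta>). x \<in> C_tilde A \<phi> \<and> \<eta> \<in> cot_fibre A x}"

definition cot_chart :: "'c coord \<Rightarrow> 'c cot \<Rightarrow> complex \<times> complex" where
  "cot_chart k y = (cinv k (fst y), snd y k)"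

definition cot_topology :: "'c coord set \<Rightarrow> 'c qd \<Rightarrow> 'c cot topology" where
  "cot_topology A \<phi> = topology_generated_by
     {{y \<in> cotangent_bundle A \<phi>. fst y \<in> cim k \<and> cot_chart k y \<in> W} | k W. k \<in> A \<and> open W}"

definition cofibre :: "'c coord set \<Rightarrow> 'c qd \<Rightarrow> 'c \<Rightarrow> 'c cot set" where
  "cofibre A \<phi> z = {y \<in> cotangent_bundle A \<phi>. fst y = z}"

definition spectral_curve :: "'c coord set \<Rightarrow> 'c qd \<Rightarrow> 'c cot set" where
  "spectral_curve A \<phi> = {(x, \<eta>) \<in> cotangent_bundle A \<phi>.
     \<forall>k\<in>A. \<forall>z\<in>cdom k. cmap k z = x \<longrightarrow> (\<eta> k)\<^sup>2 = \<phi> k z}"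

definition rescale :: "real \<Rightarrow> 'c cot \<Rightarrow> 'c cot" where
  "rescale \<epsilon> y = (fst y, \<lambda>k. of_real \<epsilon> * snd y k)"

text \<open>
  Exactness: the restriction of the real Liouville form \<open>Re (p dz)\<close> to the spectral curve is \<open>df\<close>.
  The identity of 1-forms is expressed by pulling back along arbitrary holomorphic maps \<open>s\<close> from
  plane domains into the curve; these include its local parametrizations, also at the branch points.
\<close>

definition exact_spectral_curve :: "'c coord set \<Rightarrow> 'c qd \<Rightarrow> bool" where
  "exact_spectral_curve A \<phi> \<longleftrightarrow>
     (\<exists>f :: 'c cot \<Rightarrow> real. \<forall>k\<in>A. \<forall>W s q p.
        open W \<and> s ` W \<subseteq> spectral_curve A \<phi> \<and> (\<forall>w\<in>W. fst (s w) \<in> cim k) \<and>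
        (\<forall>w\<in>W. cot_chart k (s w) = (q w, p w)) \<and> q holomorphic_on W \<and> p holomorphic_on W \<longrightarrow>
        (\<forall>w\<in>W. ((\<lambda>w. f (s w)) has_derivative (\<lambda>\<zeta>. Re (p w * (deriv q w * \<zeta>)))) (at w)))"


section \<open>Riemannian metrics and the Sasaki structure\<close>

text \<open>\<open>g k z v w\<close> is the inner product, in the coordinate \<open>k\<close> at \<open>z\<close>, of the tangent vectors \<open>v\<close>, \<open>w\<close>.\<close>

type_synonym 'c metric_field = "'c coord \<Rightarrow> complex \<Rightarrow> complex \<Rightarrow> complex \<Rightarrow> real"

definition riemannian_metric_on :: "'c coord set \<Rightarrow> 'c set \<Rightarrow> 'c metric_field \<Rightarrow> bool" where
  "riemannian_metric_on A X g \<longleftrightarrow>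
     (\<forall>k\<in>A. \<forall>v w. smooth_on {z \<in> cdom k. cmap k z \<in> X} (\<lambda>z. g k z v w)) \<and>
     (\<forall>k\<in>A. \<forall>z\<in>cdom k. cmap k z \<in> X \<longrightarrow>
        bilinear (g k z) \<and> (\<forall>v w. g k z v w = g k z w v) \<and> (\<forall>v. v \<noteq> 0 \<longrightarrow> g k z v v > 0)) \<and>
     (\<forall>k\<in>A. \<forall>k'\<in>A. \<forall>z\<in>overlap k k'. cmap k z \<in> X \<longrightarrow>
        (\<forall>v w. g k z v w = g k' (transition k k' z)
                  (deriv (transition k k') z * v) (deriv (transition k k') z * w)))"

definition metrics_agree_on :: "'c coord set \<Rightarrow> 'c set \<Rightarrow> 'c metric_field \<Rightarrow> 'c metric_field \<Rightarrow> bool" where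
  "metrics_agree_on A X g g' \<longleftrightarrow> (\<forall>k\<in>A. \<forall>z\<in>cdom k. cmap k z \<in> X \<longrightarrow> g k z = g' k z)"

definition smooth_path_in :: "'c::topological_space coord set \<Rightarrow> 'c set \<Rightarrow> (real \<Rightarrow> 'c) \<Rightarrow> bool" where
  "smooth_path_in A X c \<longleftrightarrow>
     continuous_on {0..1} c \<and> c ` {0..1} \<subseteq> X \<and>
     (\<forall>k\<in>A. smooth_on {t \<in> {0..1}. c t \<in> cim k} (cinv k \<circ> c))"

definition path_speed :: "'c coord set \<Rightarrow> 'c metric_field \<Rightarrow> (real \<Rightarrow> 'c) \<Rightarrow> real \<Rightarrow> real" where
  "path_speed A g c t =
     (let k = (SOME k. k \<in> A \<and> c t \<in> cim k);
          v = vector_derivative (cinv k \<circ> c) (at t within {0..1})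
      in sqrt (g k (cinv k (c t)) v v))"

text \<open>The set of points of \<open>X\<close> at Riemannian distance less than \<open>h\<close> from \<open>S\<close>.\<close>

definition riemannian_nhd ::
  "'c::topological_space coord set \<Rightarrow> 'c set \<Rightarrow> 'c metric_field \<Rightarrow> real \<Rightarrow> 'c set \<Rightarrow> 'c set" where
  "riemannian_nhd A X g h S =
     {c 1 | c. smooth_path_in A X c \<and> c 0 \<in> S \<and> integral {0..1} (path_speed A g c) < h}"

text \<open>
  From here on \<open>G\<close> is the expression of a metric in one coordinate.  The Levi-Civita
  connection \<open>\<nabla>\<^sub>a b = \<Gamma>(a, b)\<close> of constant vector fields is given by Koszul's formula.
\<close>

definition christoffel ::
  "(complex \<Rightarrow> complex \<Rightarrow> complex \<Rightarrow> real) \<Rightarrow> complex \<Rightarrow> complex \<Rightarrow> complex \<Rightarrow> complex" where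
  "christoffel G z a b =
     (let d = (\<lambda>a b c. frechet_derivative (\<lambda>x. G x b c) (at z) a)
      in THE v. \<forall>c. G z v c = (d a b c + d b a c - d c a b) / 2)"

definition flat_op :: "(complex \<Rightarrow> complex \<Rightarrow> complex \<Rightarrow> real) \<Rightarrow> complex \<Rightarrow> complex \<Rightarrow> complex" where
  "flat_op G z v = covector_coeff (G z v)"

definition sharp_op :: "(complex \<Rightarrow> complex \<Rightarrow> complex \<Rightarrow> real) \<Rightarrow> complex \<Rightarrow> complex \<Rightarrow> complex" where
  "sharp_op G z \<alpha> = (THE v. \<forall>w. G z v w = Re (\<alpha> * w))"

text \<open>
  The splitting of \<open>TT\<^sup>*M\<close>: a vector \<open>(v, \<pi>)\<close> at \<open>(z, p)\<close> is a velocity of the base point together with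
  a velocity of the coefficient; its vertical component is the covariant derivative
  \<open>w \<mapsto> \<pi>(w) - p(\<Gamma>(v, w))\<close>, and its horizontal component is \<open>v\<close>.
\<close>

definition connection_term ::
  "(complex \<Rightarrow> complex \<Rightarrow> complex \<Rightarrow> real) \<Rightarrow> complex \<times> complex \<Rightarrow> complex \<Rightarrow> complex" where
  "connection_term G y v = covector_coeff (\<lambda>w. Re (snd y * christoffel G (fst y) v w))"

definition to_splitting ::
  "(complex \<Rightarrow> complex \<Rightarrow> complex \<Rightarrow> real) \<Rightarrow> complex \<times> complex \<Rightarrow> complex \<times> complex \<Rightarrow> complex \<times> complex" where
  "to_splitting G y X = (fst X, snd X - connection_term G y (fst X))"

definition from_splitting ::
  "(complex \<Rightarrow> complex \<Rightarrow> complex \<Rightarrow> real) \<Rightarrow> complex \<times> complex \<Rightarrow> complex \<times> complex \<Rightarrow> complex \<times> complex" where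
  "from_splitting G y X = (fst X, snd X + connection_term G y (fst X))"

definition sasaki ::
  "(complex \<Rightarrow> complex \<Rightarrow> complex \<Rightarrow> real) \<Rightarrow> complex \<times> complex \<Rightarrow> complex \<times> complex \<Rightarrow> complex \<times> complex" where
  "sasaki G y X =
     (let (v, \<alpha>) = to_splitting G y X
      in from_splitting G y (sharp_op G (fst y) \<alpha>, - flat_op G (fst y) v))"


section \<open>The flat metric and the spectral network\<close>

definition flat_metric :: "'c qd \<Rightarrow> 'c metric_field" where
  "flat_metric \<phi> k z v w = cmod (\<phi> k z) * (v \<bullet> w)"

text \<open>Coordinates in which \<open>\<phi> = dz\<^sup>2\<close>, i.e. branches of \<open>\<integral>\<surd>\<phi>\<close>.\<close>

definition flat_coordinates :: "'c coord set \<Rightarrow> 'c qd \<Rightarrow> 'c coord set" where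
  "flat_coordinates A \<phi> = {k \<in> A. \<forall>z\<in>cdom k. \<phi> k z = 1}"

text \<open>Horizontal curves are parametrized by arc length of the flat metric.\<close>

definition horizontal_curve ::
  "'c::topological_space coord set \<Rightarrow> 'c qd \<Rightarrow> real set \<Rightarrow> (real \<Rightarrow> 'c) \<Rightarrow> bool" where
  "horizontal_curve A \<phi> I \<gamma> \<longleftrightarrow>
     open I \<and> is_interval I \<and> I \<noteq> {} \<and> continuous_on I \<gamma> \<and> \<gamma> ` I \<subseteq> C_circ A \<phi> \<and>
     (\<forall>k\<in>flat_coordinates A \<phi>. \<forall>I'. is_interval I' \<and> I' \<subseteq> I \<and> \<gamma> ` I' \<subseteq> cim k \<longrightarrow>
        (\<forall>s\<in>I'. \<forall>t\<in>I'. Im (cinv k (\<gamma> s)) = Im (cinv k (\<gamma> t)) \<and>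
           \<bar>Re (cinv k (\<gamma> s)) - Re (cinv k (\<gamma> t))\<bar> = \<bar>s - t\<bar>))"

definition horizontal_trajectory ::
  "'c::topological_space coord set \<Rightarrow> 'c qd \<Rightarrow> real set \<Rightarrow> (real \<Rightarrow> 'c) \<Rightarrow> bool" where
  "horizontal_trajectory A \<phi> I \<gamma> \<longleftrightarrow>
     horizontal_curve A \<phi> I \<gamma> \<and>
     \<not> (\<exists>I' \<gamma>'. I \<subset> I' \<and> horizontal_curve A \<phi> I' \<gamma>' \<and> (\<forall>t\<in>I. \<gamma>' t = \<gamma> t))"

text \<open>The filters of the two ends of an interval, which may be infinite.\<close>

definition left_end :: "real set \<Rightarrow> real filter" where
  "left_end I = (INF t\<in>I. principal (I \<inter> {..t}))"

definition right_end :: "real set \<Rightarrow> real filter" where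
  "right_end I = (INF t\<in>I. principal (I \<inter> {t..}))"

definition spectral_network :: "'c::topological_space coord set \<Rightarrow> 'c qd \<Rightarrow> 'c set" where
  "spectral_network A \<phi> = qd_zeros A \<phi> \<union>
     \<Union> {\<gamma> ` I | I \<gamma>. horizontal_trajectory A \<phi> I \<gamma> \<and>
          (\<exists>b\<in>qd_zeros A \<phi>. (\<gamma> \<longlongrightarrow> b) (left_end I)) \<noteq> (\<exists>b\<in>qd_zeros A \<phi>. (\<gamma> \<longlongrightarrow> b) (right_end I))}"

definition open_strip :: "real \<Rightarrow> real \<Rightarrow> complex set" where
  "open_strip a b = {z. a < Im z \<and> Im z < b}"

definition upper_half_plane :: "complex set" where
  "upper_half_plane = {z. Im z > 0}"

text \<open>
  The normalized flat coordinates of the components of the complement of the spectral network.  They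
  are unique up to translations in the imaginary direction and rotations by \<open>\<pi>\<close> (strips), and unique
  (half planes), so the regions defined from them below do not depend on choices.
\<close>

definition strip_coordinate ::
  "'c::topological_space coord set \<Rightarrow> 'c qd \<Rightarrow> real \<Rightarrow> real \<Rightarrow> (complex \<Rightarrow> 'c) \<Rightarrow> bool" where
  "strip_coordinate A \<phi> a b \<psi> \<longleftrightarrow>
     a < b \<and> (open_strip a b, \<psi>) \<in> flat_coordinates A \<phi> \<and>
     \<psi> ` open_strip a b \<in> components (C_tilde A \<phi> - spectral_network A \<phi>) \<and>
     (\<exists>\<Psi>. continuous_on (closure (open_strip a b)) \<Psi> \<and> (\<forall>z\<in>open_strip a b. \<Psi> z = \<psi> z) \<and>
        {z. Im z = a \<and> \<Psi> z \<in> qd_zeros A \<phi>} = {Complex 0 a} \<and>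
        {z. Im z = b \<and> \<Psi> z \<in> qd_zeros A \<phi>} = {Complex 0 b})"

definition half_plane_coordinate ::
  "'c::topological_space coord set \<Rightarrow> 'c qd \<Rightarrow> (complex \<Rightarrow> 'c) \<Rightarrow> bool" where
  "half_plane_coordinate A \<phi> \<psi> \<longleftrightarrow>
     (upper_half_plane, \<psi>) \<in> flat_coordinates A \<phi> \<and>
     \<psi> ` upper_half_plane \<in> components (C_tilde A \<phi> - spectral_network A \<phi>) \<and>
     (\<exists>\<Psi>. continuous_on (closure upper_half_plane) \<Psi> \<and> (\<forall>z\<in>upper_half_plane. \<Psi> z = \<psi> z) \<and>
        {z. Im z = 0 \<and> \<Psi> z \<in> qd_zeros A \<phi>} = {0})"


section \<open>The desingularized metric and the region\<close>

text \<open>For each zero \<open>b\<close>, \<open>\<xi> b\<close> is the chart on the disc of radius \<open>\<rho> b\<close> with \<open>\<phi> = \<xi> d\<xi>\<^sup>2\<close>.\<close>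

definition zero_charts ::
  "'c coord set \<Rightarrow> 'c qd \<Rightarrow> ('c \<Rightarrow> complex \<Rightarrow> 'c) \<Rightarrow> ('c \<Rightarrow> real) \<Rightarrow> bool" where
  "zero_charts A \<phi> \<xi> \<rho> \<longleftrightarrow>
     (\<forall>b\<in>qd_zeros A \<phi>. \<rho> b > 0 \<and> (ball 0 (\<rho> b), \<xi> b) \<in> A \<and> \<xi> b 0 = b \<and>
        (\<forall>w\<in>ball 0 (\<rho> b). \<phi> (ball 0 (\<rho> b), \<xi> b) w = w)) \<and>
     disjoint_family_on (\<lambda>b. \<xi> b ` ball 0 (\<rho> b)) (qd_zeros A \<phi>)"

definition zero_nhd ::
  "'c coord set \<Rightarrow> 'c qd \<Rightarrow> ('c \<Rightarrow> complex \<Rightarrow> 'c) \<Rightarrow> ('c \<Rightarrow> real) \<Rightarrow> real \<Rightarrow> 'c set" where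
  "zero_nhd A \<phi> \<xi> \<rho> r = (\<Union>b\<in>qd_zeros A \<phi>. \<xi> b ` (ball 0 (\<rho> b) \<inter> ball 0 r))"

definition cutoff_profile :: "real \<Rightarrow> (real \<Rightarrow> real) \<Rightarrow> bool" where
  "cutoff_profile \<delta> \<psi> \<longleftrightarrow>
     smooth_on {0..} \<psi> \<and> mono_on {0..} \<psi> \<and> (\<forall>r>0. \<psi> r > 0) \<and>
     (\<forall>r. 0 \<le> r \<and> r < \<delta> \<longrightarrow> \<psi> r = r) \<and> (\<forall>r. r > 3/2 * \<delta> \<longrightarrow> \<psi> r = 1)"

text \<open>
  The quotient \<open>r / \<psi> r\<close> is only used for \<open>r > 0\<close>; at the zeroes themselves \<open>g\<close> is determined by
  smoothness.  Note that \<open>dr\<^sup>2 + r\<^sup>2 d\<theta>\<^sup>2\<close> is the Euclidean metric of the chart.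
\<close>

definition desingularized_metric ::
  "'c coord set \<Rightarrow> 'c qd \<Rightarrow> ('c \<Rightarrow> complex \<Rightarrow> 'c) \<Rightarrow> ('c \<Rightarrow> real) \<Rightarrow> real \<Rightarrow> 'c metric_field \<Rightarrow> bool" where
  "desingularized_metric A \<phi> \<xi> \<rho> \<delta> g \<longleftrightarrow>
     riemannian_metric_on A (C_tilde A \<phi>) g \<and>
     metrics_agree_on A (C_tilde A \<phi> - zero_nhd A \<phi> \<xi> \<rho> (3/2 * \<delta>)) g (flat_metric \<phi>) \<and>
     (\<exists>\<psi>. cutoff_profile \<delta> \<psi> \<and>
        (\<forall>b\<in>qd_zeros A \<phi>. \<forall>w\<in>ball 0 (\<rho> b) - {0}. \<forall>v v'.
           g (ball 0 (\<rho> b), \<xi> b) w v v' = cmod w / \<psi> (cmod w) * (v \<bullet> v')))"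

text \<open>
  The neighbourhoods are taken for \<open>g\<close>, the desingularized metric, which agrees with the flat metric
  where the condition is decided, namely outside the neighbourhood of the zeroes of radius
  \<open>(2 - \<eta>) \<delta>\<close>.
\<close>

definition admissible_parameters ::
  "'c::topological_space coord set \<Rightarrow> 'c qd \<Rightarrow> ('c \<Rightarrow> complex \<Rightarrow> 'c) \<Rightarrow> ('c \<Rightarrow> real) \<Rightarrow> real \<Rightarrow> 'c metric_field
    \<Rightarrow> real \<Rightarrow> real \<Rightarrow> real \<Rightarrow> bool" where
  "admissible_parameters A \<phi> \<xi> \<rho> \<delta> g e h \<eta> \<longleftrightarrow>
     e > 0 \<and> h > 0 \<and> \<eta> > 0 \<and>
     metrics_agree_on A (C_tilde A \<phi> - zero_nhd A \<phi> \<xi> \<rho> ((2 - \<eta>) * \<delta>)) g (flat_metric \<phi>) \<and>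
     (\<forall>I \<gamma>. horizontal_trajectory A \<phi> I \<gamma> \<and>
        ((\<exists>a b \<psi>. strip_coordinate A \<phi> a b \<psi> \<and> \<gamma> ` I \<subseteq> \<psi> ` open_strip (a + e) (b - e)) \<or>
         (\<exists>\<psi>. half_plane_coordinate A \<phi> \<psi> \<and> \<gamma> ` I \<subseteq> \<psi> ` {z. Im z > e})) \<longrightarrow>
        riemannian_nhd A (C_tilde A \<phi>) g h (\<gamma> ` I) \<inter> zero_nhd A \<phi> \<xi> \<rho> ((2 + \<eta>) * \<delta>) = {})"

definition C_region :: "'c::topological_space coord set \<Rightarrow> 'c qd \<Rightarrow> real \<Rightarrow> real \<Rightarrow> 'c set" where
  "C_region A \<phi> e E =
     \<Union> {\<psi> ` {z. a + e < Im z \<and> Im z < b - e \<and> \<bar>Re z\<bar> < E} | a b \<psi>. strip_coordinate A \<phi> a b \<psi>} \<union>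
     \<Union> {\<psi> ` {z. Im z > e \<and> \<bar>Re z\<bar> < E \<and> \<bar>Im z\<bar> < E} | \<psi>. half_plane_coordinate A \<phi> \<psi>}"

text \<open>
  Deformation retract in the weak sense: the homotopy keeps \<open>R\<close> inside \<open>R\<close>, but need not fix it
  pointwise.  The region above is a union of open boxes; it is not closed in the surrounding space,
  and so it cannot be a retract in the strict sense.
\<close>

definition weak_deformation_retract_of :: "'c::topological_space set \<Rightarrow> 'c set \<Rightarrow> bool" where
  "weak_deformation_retract_of R X \<longleftrightarrow>
     R \<subseteq> X \<and> (\<exists>r. homotopic_with_canon (\<lambda>f. f ` R \<subseteq> R) X X id r \<and> r ` X \<subseteq> R)"


section \<open>Holomorphic strips\<close>

definition closed_strip :: "complex set" where
  "closed_strip = {w. 0 \<le> Im w \<and> Im w \<le> 1}"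

definition J_holomorphic_on ::
  "'c coord set \<Rightarrow> 'c qd \<Rightarrow> 'c metric_field \<Rightarrow> complex set \<Rightarrow> (complex \<Rightarrow> 'c cot) \<Rightarrow> bool" where
  "J_holomorphic_on A \<phi> g S u \<longleftrightarrow>
     continuous_map (top_of_set S) (cot_topology A \<phi>) u \<and>
     (\<forall>k\<in>A. let S' = {w \<in> S. fst (u w) \<in> cim k} in
        smooth_on S' (cot_chart k \<circ> u) \<and>
        (\<forall>w\<in>S'. \<exists>L. ((cot_chart k \<circ> u) has_derivative L) (at w within S') \<and>
           (\<forall>\<zeta>. L (\<i> * \<zeta>) = sasaki (g k) (cot_chart k (u w)) (L \<zeta>))))"

text \<open>
  The coordinate on the strip is \<open>w = s + i t\<close>.  The limits for \<open>s \<rightarrow> \<plusminus>\<infinity>\<close> are single points, attained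
  uniformly in \<open>t\<close>, as usual for Floer strips; with limits taken separately for each \<open>t\<close> there would
  be strips of infinite energy.
\<close>

definition holomorphic_strip ::
  "'c coord set \<Rightarrow> 'c qd \<Rightarrow> 'c metric_field \<Rightarrow> real \<Rightarrow> 'c \<Rightarrow> (complex \<Rightarrow> 'c cot) \<Rightarrow> bool" where
  "holomorphic_strip A \<phi> g \<epsilon> z u \<longleftrightarrow>
     J_holomorphic_on A \<phi> g closed_strip u \<and>
     (\<forall>s. u (Complex s 0) \<in> rescale \<epsilon> ` spectral_curve A \<phi>) \<and>
     (\<forall>s. u (Complex s 1) \<in> cofibre A \<phi> z) \<and>
     (\<exists>y \<in> cofibre A \<phi> z \<inter> rescale \<epsilon> ` spectral_curve A \<phi>.
        limitin (cot_topology A \<phi>) u y (inf (filtercomap Re at_top) (principal closed_strip))) \<and>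
     (\<exists>y \<in> cofibre A \<phi> z \<inter> rescale \<epsilon> ` spectral_curve A \<phi>.
        limitin (cot_topology A \<phi>) u y (inf (filtercomap Re at_bot) (principal closed_strip)))"

end

theory Submission
  imports Defs
begin

text \<open>
  Where \<open>g\<close> is flat, let \<open>q\<close> be a flat coordinate and \<open>p\<close> the corresponding fibre coordinate.  There the
  Sasaki structure is the standard one, and for a \<open>J\<close>-holomorphic map both \<open>- Im p + \<i> Im q\<close> and
  \<open>Re p + \<i> Re q\<close> are holomorphic functions of \<open>s + \<i> t\<close>.  On the boundary \<open>Im p = 0\<close> and \<open>Re p = \<plusminus>\<epsilon>\<close> over
  \<open>t = 0\<close>, while \<open>q = z\<close> over \<open>t = 1\<close>.  A level set \<open>Im q = Im z + r\<close> with small \<open>r \<noteq> 0\<close> lies in the flat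
  region.  It is compact, because the strip converges to the fibre over \<open>z\<close>, and \<open>Im p\<close> vanishes at
  its boundary points; an interior extremum of \<open>Im p\<close> on it would contradict the open mapping theorem.
  Hence the strip stays on the horizontal trajectory through \<open>z\<close>, and the same argument for the level
  sets of \<open>Re p\<close> shows that it is constant.

  The components of the complement of the network come from the odd primitive \<open>f\<close> of the
  Liouville form: a straight segment in a flat coordinate can be continued until it meets a zero, where
  \<open>f = 0\<close>.  As \<open>f\<close> agrees with the real part of the flat coordinate, a point with \<open>f > 0\<close> sees a whole right
  half plane, and leftward rays are blocked only on the network.
\<close>

section \<open>Calculus of smooth functions\<close>

text \<open>Over the desingularized part of the surface the equation of a strip is out of control,
  and a strip might wander there. It need not be followed: only level sets of \<open>Im q\<close>
  are examined, and those inside the flat band are closed in the whole closed strip, because a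
  horizontal line at positive distance from the edges of its band has closed image in
  \<open>C_tilde A \<phi>\<close>. Once the levels off \<open>Im z\<close> are empty, the part of
  the open strip over the band is both open and closed.

  A flat coordinate is determined up to sign and translation. The sign is carried by
  \<open>lift\<close>, which turns a local branch of the integral of the root of \<phi> into a
  section of the spectral curve; lifts continue uniquely, and the odd primitive fixes the real
  translation. A component of the complement of the network is thus a map \<psi> of a band with
  \<open>f (lift \<psi> z) = Re z\<close>, unique up to half turns and vertical translations.

  In a chart w with \<phi> = w dw^2 the point w has flat distance 2/3 |w|^(3/2) from the zero. This
  is the origin of all comparisons of 4/9 |w|^3 with squares of lengths.\<close>

lemma Ck_on_cong:
  assumes "\<And>x. x \<in> S \<Longrightarrow> f x = g x"
  shows "Ck_on n S f \<longleftrightarrow> Ck_on n S g"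
proof (cases n)
  case 0
  then show ?thesis using assms by (auto cong: continuous_on_cong)
next
  case (Suc m)
  have "(f has_derivative D) (at x within S) \<longleftrightarrow> (g has_derivative D) (at x within S)" if "x \<in> S" for x D
    using that assms by (metis has_derivative_transform)
  then show ?thesis by (auto simp: Suc)
qed

lemma Ck_on_SucD: "Ck_on (Suc n) S f \<Longrightarrow> Ck_on n S f"
proof (induction n arbitrary: f)
  case 0
  then show ?case using has_derivative_continuous_on by fastforce
next
  case (Suc n)
  then obtain f' where "\<forall>x\<in>S. (f has_derivative f' x) (at x within S)" "\<forall>v. Ck_on (Suc n) S (\<lambda>x. f' x v)"
    by (subst (asm) Ck_on.simps) blast
  then show ?case unfolding Ck_on.simps(2)[of n] by (intro exI[of _ f'] conjI allI Suc.IH) auto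
qed

lemma Ck_on_const [simp]: "Ck_on n S (\<lambda>x. c)"
proof (induction n arbitrary: c)
  case (Suc n)
  then show ?case by (auto intro!: exI[of _ "\<lambda>x v. 0"])
qed auto

lemma Ck_on_ident [simp]: "Ck_on n S (\<lambda>x. x)"
proof (cases n)
  case (Suc m)
  then show ?thesis by (auto intro!: exI[of _ "\<lambda>x v. v"])
qed auto

lemma Ck_on_bounded_linear:
  assumes "bounded_linear h" "Ck_on n S f"
  shows "Ck_on n S (\<lambda>x. h (f x))"
  using assms(2)
proof (induction n arbitrary: f)
  case 0
  then show ?case using assms(1) by (auto intro: bounded_linear.continuous_on)
next
  case (Suc n)
  then obtain f' where "\<forall>x\<in>S. (f has_derivative f' x) (at x within S)" "\<forall>v. Ck_on n S (\<lambda>x. f' x v)"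
    by auto
  then show ?case unfolding Ck_on.simps(2)
    by (intro exI[of _ "\<lambda>x v. h (f' x v)"] conjI allI ballI Suc.IH bounded_linear.has_derivative[OF assms(1)]) auto
qed

lemma Ck_on_add:
  assumes "Ck_on n S f" "Ck_on n S g"
  shows "Ck_on n S (\<lambda>x. f x + g x)"
  using assms
proof (induction n arbitrary: f g)
  case 0
  then show ?case by (auto intro: continuous_on_add)
next
  case (Suc n)
  from Suc.prems(1) obtain f' where "\<forall>x\<in>S. (f has_derivative f' x) (at x within S)" "\<forall>v. Ck_on n S (\<lambda>x. f' x v)"
    by auto
  moreover from Suc.prems(2) obtain g' where "\<forall>x\<in>S. (g has_derivative g' x) (at x within S)" "\<forall>v. Ck_on n S (\<lambda>x. g' x v)"
    by auto
  ultimately show ?case using Suc.IH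
    by (auto intro!: exI[of _ "\<lambda>x v. f' x v + g' x v"] has_derivative_add)
qed

lemma Ck_on_bilinear:
  assumes "bounded_bilinear pr" "Ck_on n S f" "Ck_on n S g"
  shows "Ck_on n S (\<lambda>x. pr (f x) (g x))"
  using assms(2,3)
proof (induction n arbitrary: f g)
  case 0
  then show ?case using bounded_bilinear.continuous_on[OF assms(1)] by auto
next
  case (Suc n)
  from Suc.prems(1) obtain f' where f': "\<forall>x\<in>S. (f has_derivative f' x) (at x within S)" "\<forall>v. Ck_on n S (\<lambda>x. f' x v)"
    by auto
  from Suc.prems(2) obtain g' where g': "\<forall>x\<in>S. (g has_derivative g' x) (at x within S)" "\<forall>v. Ck_on n S (\<lambda>x. g' x v)"
    by auto
  have "Ck_on n S (\<lambda>x. pr (f x) (g' x v) + pr (f' x v) (g x))" for v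
    using Ck_on_SucD[OF Suc.prems(1)] Ck_on_SucD[OF Suc.prems(2)] f'(2) g'(2) by (intro Ck_on_add Suc.IH) auto
  then show ?case using f'(1) g'(1) unfolding Ck_on.simps(2)
    by (intro exI[of _ "\<lambda>x v. pr (f x) (g' x v) + pr (f' x v) (g x)"] conjI ballI allI
        bounded_bilinear.FDERIV[OF assms(1)]) auto
qed

lemma Ck_on_mult:
  fixes f g :: "'a::euclidean_space \<Rightarrow> real"
  assumes "Ck_on n S f" "Ck_on n S g"
  shows "Ck_on n S (\<lambda>x. f x * g x)"
  using Ck_on_bilinear[OF bounded_bilinear_mult assms] .

lemma Ck_on_diff:
  fixes f g :: "'a::euclidean_space \<Rightarrow> real"
  assumes "Ck_on n S f" "Ck_on n S g"
  shows "Ck_on n S (\<lambda>x. f x - g x)"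
  using Ck_on_add[OF assms(1) Ck_on_mult[OF Ck_on_const[of _ _ "-1"] assms(2)]] by simp

text \<open>A real inner variable makes the derivative of \<open>g\<close> multiplication by
  \<open>g' y 1\<close>, so the chain rule turns into a product and the induction closes with
  \<open>Ck_on_mult\<close>.\<close>

lemma Ck_on_compose_real:
  fixes g :: "real \<Rightarrow> real"
  assumes "Ck_on n T g" "Ck_on n S f" "f ` S \<subseteq> T"
  shows "Ck_on n S (\<lambda>x. g (f x))"
  using assms(1,2)
proof (induction n arbitrary: g)
  case 0
  then show ?case using assms(3) continuous_on_compose2 by auto
next
  case (Suc n)
  from Suc.prems(1) obtain g' where g': "\<forall>x\<in>T. (g has_derivative g' x) (at x within T)" "\<forall>v. Ck_on n T (\<lambda>x. g' x v)"
    by auto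
  from Suc.prems(2) obtain f' where f': "\<forall>x\<in>S. (f has_derivative f' x) (at x within S)" "\<forall>v. Ck_on n S (\<lambda>x. f' x v)"
    by auto
  have lin: "g' y a = a * g' y 1" if "y \<in> T" for y a
    using g'(1) that has_derivative_linear linear_scale[of "g' y" a 1] by fastforce
  have d: "((\<lambda>x. g (f x)) has_derivative (\<lambda>v. f' x v * g' (f x) 1)) (at x within S)" if x: "x \<in> S" for x
  proof -
    have "f x \<in> T" using assms(3) x by auto
    have e: "g' (f x) \<circ> f' x = (\<lambda>v. f' x v * g' (f x) 1)"
      unfolding o_def by (rule ext) (rule lin[OF \<open>f x \<in> T\<close>])
    have "(g has_derivative g' (f x)) (at (f x) within f ` S)"
      by (rule has_derivative_subset[OF g'(1)[rule_format, OF \<open>f x \<in> T\<close>] assms(3)])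
    from diff_chain_within[OF f'(1)[rule_format, OF x] this]
    show ?thesis unfolding e unfolding o_def .
  qed
  have "Ck_on n S (\<lambda>x. f' x v * g' (f x) 1)" for v
    by (intro Ck_on_mult f'(2)[rule_format] Suc.IH[OF g'(2)[rule_format] Ck_on_SucD[OF Suc.prems(2)]])
  then show ?case using d unfolding Ck_on.simps(2)
    by (intro exI[of _ "\<lambda>x v. f' x v * g' (f x) 1"]) simp
qed

text \<open>The functions c x^a with varying c and a are closed under differentiation, hence the
  induction over both. Roots and reciprocals of positive quantities are obtained from it.\<close>

lemma Ck_on_powr: "Ck_on n {0<..} (\<lambda>x::real. c * x powr a)"
proof (induction n arbitrary: c a)
  case 0
  then show ?case by (auto intro!: continuous_intros)
next
  case (Suc n)
  have "((\<lambda>x. c * x powr a) has_derivative (\<lambda>v. v * ((c * a) * x powr (a - 1)))) (at x within {0<..})"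
    if "x > 0" for x
  proof -
    have "((\<lambda>x. c * x powr a) has_real_derivative ((c * a) * x powr (a - 1))) (at x)"
      using that by (auto intro!: derivative_eq_intros simp: powr_diff)
    moreover have "(*) ((c * a) * x powr (a - 1)) = (\<lambda>v. v * ((c * a) * x powr (a - 1)))"
      by (simp add: fun_eq_iff)
    ultimately have "((\<lambda>x. c * x powr a) has_derivative (\<lambda>v. v * ((c * a) * x powr (a - 1)))) (at x)"
      unfolding has_field_derivative_def by simp
    then show ?thesis by (rule has_derivative_at_withinI)
  qed
  moreover have "Ck_on n {0<..} (\<lambda>x. v * ((c * a) * x powr (a - 1)))" for v
    using Suc[of "v * (c * a)" "a - 1"] by (simp add: mult.assoc)
  ultimately show ?case
    by (auto intro!: exI[of _ "\<lambda>x v. v * ((c * a) * x powr (a - 1))"])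
qed

lemma Ck_on_holomorphic:
  assumes "f holomorphic_on S" "open S"
  shows "Ck_on n S f"
  using assms(1)
proof (induction n arbitrary: f)
  case 0
  then show ?case by (simp add: holomorphic_on_imp_continuous_on)
next
  case (Suc n)
  have "(f has_derivative (\<lambda>v. deriv f x * v)) (at x within S)" if "x \<in> S" for x
    using holomorphic_derivI[OF Suc.prems assms(2) that] by (simp add: has_field_derivative_def has_derivative_at_withinI)
  moreover have "Ck_on n S (\<lambda>x. deriv f x * v)" for v
    using Suc assms(2) by (intro Suc.IH holomorphic_intros)
  ultimately show ?case by (auto intro!: exI[of _ "\<lambda>x v. deriv f x * v"])
qed

text \<open>Derivatives within open sets are unique, so the derivative families given on the pieces
  \<open>U\<close> all coincide with \<open>frechet_derivative\<close>, which is defined globally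
  and glues them.\<close>

lemma Ck_on_local:
  assumes "open S" "\<And>x. x \<in> S \<Longrightarrow> \<exists>U. open U \<and> x \<in> U \<and> U \<subseteq> S \<and> Ck_on n U f"
  shows "Ck_on n S f"
  using assms(2)
proof (induction n arbitrary: f)
  case 0
  have "continuous (at x) f" if x: "x \<in> S" for x
  proof -
    obtain U where "open U" "x \<in> U" "Ck_on 0 U f" using 0[OF x] by blast
    then show ?thesis using continuous_on_eq_continuous_at[of U f] by simp
  qed
  then show ?case by (simp add: continuous_on_eq_continuous_at[OF assms(1)])
next
  case (Suc n)
  have fd: "(f has_derivative D) (at x within U) \<longleftrightarrow> D = frechet_derivative f (at x) \<and> f differentiable (at x)"
    if "open U" "x \<in> U" for x U D
    unfolding at_within_open[OF that(2,1)]
    using frechet_derivative_at[of f D x] frechet_derivative_works[of f "at x"] differentiableI[of f D "at x"] by auto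
  have *: "\<exists>U. open U \<and> x \<in> U \<and> U \<subseteq> S \<and> (\<forall>y\<in>U. f differentiable (at y)) \<and>
        (\<forall>v. Ck_on n U (\<lambda>y. frechet_derivative f (at y) v))" if x: "x \<in> S" for x
  proof -
    obtain U where U: "open U" "x \<in> U" "U \<subseteq> S" "Ck_on (Suc n) U f" using Suc.prems[OF x] by blast
    then obtain f' where f': "\<forall>y\<in>U. (f has_derivative f' y) (at y within U)" "\<forall>v. Ck_on n U (\<lambda>y. f' y v)"
      by auto
    have e: "f' y = frechet_derivative f (at y)" "f differentiable (at y)" if "y \<in> U" for y
      using f'(1)[rule_format, OF that] fd[OF U(1) that] by simp_all
    have "Ck_on n U (\<lambda>y. frechet_derivative f (at y) v)" for v
      by (rule iffD1[OF Ck_on_cong f'(2)[rule_format, of v]]) (simp add: e(1))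
    then show ?thesis using U(1-3) e(2) by (intro exI[of _ U]) simp
  qed
  have "\<forall>x\<in>S. (f has_derivative frechet_derivative f (at x)) (at x within S)"
  proof
    fix x assume x: "x \<in> S"
    then have "f differentiable (at x)" using * by fast
    then show "(f has_derivative frechet_derivative f (at x)) (at x within S)"
      using fd[OF assms(1) x] by simp
  qed
  moreover have "Ck_on n S (\<lambda>y. frechet_derivative f (at y) v)" for v
  proof (rule Suc.IH)
    fix x assume "x \<in> S"
    from *[OF this] obtain U where "open U" "x \<in> U" "U \<subseteq> S" "\<forall>v. Ck_on n U (\<lambda>y. frechet_derivative f (at y) v)"
      by (elim exE conjE)
    then show "\<exists>U. open U \<and> x \<in> U \<and> U \<subseteq> S \<and> Ck_on n U (\<lambda>y. frechet_derivative f (at y) v)"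
      by (intro exI[of _ U]) simp
  qed
  ultimately show ?case unfolding Ck_on.simps(2)
    by (intro exI[of _ "\<lambda>x. frechet_derivative f (at x)"]) simp
qed

subsection \<open>A smooth step\<close>

text \<open>The class of functions P(1/x) exp(-1/x), extended by 0, contains exp(-1/x) and is stable
  under differentiation and under division by x; this replaces a computation of the higher
  derivatives at 0.\<close>

definition flat_exp :: "real poly \<Rightarrow> real \<Rightarrow> real" where
  "flat_exp p x = (if x > 0 then poly p (inverse x) * exp (- inverse x) else 0)"

lemma poly_exp_tendsto_0: "((\<lambda>x. poly p x * exp (- x)) \<longlongrightarrow> 0) at_top" for p :: "real poly"
proof -
  have "((\<lambda>x. coeff p i * (x ^ i / exp x)) \<longlongrightarrow> coeff p i * 0) at_top" for i
    by (intro tendsto_mult_left tendsto_power_div_exp_0)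
  then have "((\<lambda>x. \<Sum>i\<le>degree p. coeff p i * (x ^ i / exp x)) \<longlongrightarrow> (\<Sum>i\<le>degree p. coeff p i * 0)) at_top"
    by (intro tendsto_sum)
  moreover have "(\<Sum>i\<le>degree p. coeff p i * (x ^ i / exp x)) = poly p x * exp (- x)" for x
    by (simp add: poly_altdef sum_distrib_right exp_minus divide_inverse mult.assoc)
  ultimately show ?thesis by simp
qed

lemma flat_exp_tendsto_0: "(flat_exp p \<longlongrightarrow> 0) (at 0)"
proof -
  have "((\<lambda>x. poly p (inverse x) * exp (- inverse x)) \<longlongrightarrow> 0) (at_right 0)"
    using filterlim_compose[OF poly_exp_tendsto_0 filterlim_inverse_at_top_right] .
  then have "(flat_exp p \<longlongrightarrow> 0) (at_right 0)"
    by (rule Lim_transform_eventually) (rule eventually_mono[OF eventually_at_right_less], simp add: flat_exp_def)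
  moreover have "(flat_exp p \<longlongrightarrow> 0) (at_left 0)"
    by (rule Lim_transform_eventually[OF tendsto_const])
       (auto simp: flat_exp_def eventually_at_filter)
  ultimately show ?thesis by (simp add: filterlim_split_at)
qed

lemma flat_exp_has_derivative:
  "(flat_exp p has_real_derivative flat_exp ([:0,0,1:] * (p - pderiv p)) x) (at x)"
proof (cases "x = 0")
  case True
  \<comment> \<open>Dividing by h multiplies the polynomial by the variable, so the difference
    quotient at 0 belongs to the same class.\<close>
  have "flat_exp p h / h = flat_exp ([:0,1:] * p) h" for h
    by (auto simp: flat_exp_def field_simps)
  then have "((\<lambda>h. (flat_exp p (0 + h) - flat_exp p 0) / h) \<longlongrightarrow> 0) (at 0)"
    using flat_exp_tendsto_0[of "[:0,1:] * p"] by (simp add: flat_exp_def[of p 0])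
  moreover have "flat_exp ([:0,0,1:] * (p - pderiv p)) 0 = 0" by (simp add: flat_exp_def)
  ultimately show ?thesis using True by (simp add: DERIV_def)
next
  case False
  show ?thesis
  proof (cases "x > 0")
    case True
    have "((\<lambda>x. poly p (inverse x) * exp (- inverse x)) has_real_derivative
        flat_exp ([:0,0,1:] * (p - pderiv p)) x) (at x)"
      using True by (auto intro!: derivative_eq_intros DERIV_chain2[OF poly_DERIV] simp: flat_exp_def field_simps power2_eq_square)
    then show ?thesis
      by (rule has_field_derivative_transform_within_open[where S = "{0<..}"]) (use True in \<open>auto simp: flat_exp_def\<close>)
  next
    case f: False
    have "((\<lambda>x. 0) has_real_derivative 0) (at x)" by simp
    then have "(flat_exp p has_real_derivative 0) (at x)"
      by (rule has_field_derivative_transform_within_open[where S = "{..<0}"]) (use f False in \<open>auto simp: flat_exp_def\<close>)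
    then show ?thesis using f by (simp add: flat_exp_def)
  qed
qed

lemma Ck_on_flat_exp: "Ck_on n S (\<lambda>x. c * flat_exp p x)"
proof (induction n arbitrary: p c)
  case 0
  have "continuous_on UNIV (flat_exp p)"
    using flat_exp_has_derivative DERIV_continuous_on by blast
  then show ?case by (auto intro!: continuous_intros intro: continuous_on_subset[OF _ subset_UNIV])
next
  case (Suc n)
  let ?q = "[:0,0,1:] * (p - pderiv p)"
  have "((\<lambda>x. c * flat_exp p x) has_derivative (\<lambda>v. (v * c) * flat_exp ?q x)) (at x within S)" for x
  proof -
    have "((\<lambda>x. c * flat_exp p x) has_real_derivative c * flat_exp ?q x) (at x)"
      using flat_exp_has_derivative by (rule DERIV_cmult)
    moreover have "(*) (c * flat_exp ?q x) = (\<lambda>v. (v * c) * flat_exp ?q x)"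
      by (simp add: fun_eq_iff)
    ultimately have "((\<lambda>x. c * flat_exp p x) has_derivative (\<lambda>v. (v * c) * flat_exp ?q x)) (at x)"
      unfolding has_field_derivative_def by simp
    then show ?thesis by (rule has_derivative_at_withinI)
  qed
  then show ?case using Suc
    by (auto intro!: exI[of _ "\<lambda>x v. (v * c) * flat_exp ?q x"])
qed

text \<open>The quotient h(x) / (h(x) + h(1 - x)) with h(x) = exp(-1/x) for x > 0; the power -1
  stands for division so that \<open>Ck_on_powr\<close> gives smoothness.\<close>

definition smooth_step :: "real \<Rightarrow> real" where
  "smooth_step x = flat_exp 1 x * (flat_exp 1 x + flat_exp 1 (1 - x)) powr (-1)"

lemma smooth_step_altdef: "smooth_step x = flat_exp 1 x / (flat_exp 1 x + flat_exp 1 (1 - x))"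
proof -
  have "flat_exp 1 x + flat_exp 1 (1 - x) \<ge> 0"
    by (simp add: flat_exp_def)
  then show ?thesis by (simp add: smooth_step_def powr_minus_divide)
qed

lemma smooth_step_0: "x \<le> 0 \<Longrightarrow> smooth_step x = 0"
  by (simp add: smooth_step_altdef flat_exp_def)

lemma smooth_step_1: "x \<ge> 1 \<Longrightarrow> smooth_step x = 1"
  by (simp add: smooth_step_altdef flat_exp_def)

lemma smooth_step_mono: "x \<le> y \<Longrightarrow> smooth_step x \<le> smooth_step y"
proof -
  assume xy: "x \<le> y"
  consider "x \<le> 0" | "y \<ge> 1" | "0 < x" "y < 1" by linarith
  then show ?thesis
  proof cases
    case 1
    then show ?thesis by (simp add: smooth_step_0) (simp add: smooth_step_altdef flat_exp_def)
  next
    case 2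
    have "a / (a + b) \<le> 1" if "a \<ge> 0" "b \<ge> 0" for a b :: real
      using that by (cases "a + b = 0") (simp_all add: divide_le_eq_1)
    then have "smooth_step x \<le> 1"
      by (simp add: smooth_step_altdef flat_exp_def)
    then show ?thesis using 2 by (simp add: smooth_step_1)
  next
    case 3
    let ?h = "\<lambda>x::real. exp (- inverse x)"
    have frac: "a / d \<le> c / d'" if "d > 0" "d' > 0" "a * d' \<le> c * d" for a c d d' :: real
      using that by (simp add: field_simps)
    have m: "?h u \<le> ?h v" if "0 < u" "u \<le> v" for u v
      using that by (simp add: le_imp_inverse_le)
    \<comment> \<open>After cross-multiplication the term h(x) h(y) cancels and only this inequality
      remains.\<close>
    have "?h x * ?h (1 - y) \<le> ?h y * ?h (1 - x)"
      using m[of x y] m[of "1 - y" "1 - x"] 3 xy by (intro mult_mono) auto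
    then have "?h x * (?h y + ?h (1 - y)) \<le> ?h y * (?h x + ?h (1 - x))"
      by (simp add: algebra_simps)
    then have "?h x / (?h x + ?h (1 - x)) \<le> ?h y / (?h y + ?h (1 - y))"
      using frac[of "?h x + ?h (1 - x)" "?h y + ?h (1 - y)" "?h x" "?h y"] by (simp add: add_pos_pos)
    then show ?thesis using 3 xy by (simp add: smooth_step_altdef flat_exp_def)
  qed
qed

lemma Ck_on_smooth_step: "Ck_on n S smooth_step"
proof -
  have a: "Ck_on n S (flat_exp 1)" for S using Ck_on_flat_exp[of n S 1 1] by simp
  have "Ck_on n S (\<lambda>x. 1 - x)" by (intro Ck_on_diff) auto
  then have b: "Ck_on n S (\<lambda>x. flat_exp 1 (1 - x))"
    by (rule Ck_on_compose_real[OF a[of UNIV]]) simp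
  have pos: "flat_exp 1 x + flat_exp 1 (1 - x) > 0" for x
    by (cases "x > 0") (auto simp: flat_exp_def add_pos_nonneg)
  have "Ck_on n S (\<lambda>x. 1 * (flat_exp 1 x + flat_exp 1 (1 - x)) powr (-1))"
    by (rule Ck_on_compose_real[OF Ck_on_powr Ck_on_add[OF a b]]) (use pos in auto)
  then show ?thesis using Ck_on_mult[OF a, of S "\<lambda>x. (flat_exp 1 x + flat_exp 1 (1 - x)) powr (-1)"]
    unfolding smooth_step_def by simp
qed

text \<open>The argument 2 r / \<delta> - 2 maps the interval from \<delta> to 3/2 \<delta> onto the
  unit interval. Writing the interpolation between r and 1 as 1 - (1 - s)(1 - r) exhibits
  monotonicity for r \<le> 1: both factors are decreasing and nonnegative.\<close>

definition profile :: "real \<Rightarrow> real \<Rightarrow> real" where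
  "profile \<delta> r = 1 - (1 - smooth_step ((2 / \<delta>) * r - 2)) * (1 - r)"

lemma Ck_on_profile: "Ck_on n S (profile \<delta>)"
proof -
  have "Ck_on n S (\<lambda>r. (2 / \<delta>) * r - 2)" by (intro Ck_on_diff Ck_on_mult Ck_on_const Ck_on_ident)
  then have "Ck_on n S (\<lambda>r. smooth_step ((2 / \<delta>) * r - 2))"
    by (rule Ck_on_compose_real[OF Ck_on_smooth_step[of n UNIV]]) simp
  then show ?thesis unfolding profile_def[abs_def] by (intro Ck_on_diff Ck_on_mult Ck_on_const Ck_on_ident)
qed

text \<open>The bound \<delta> \<le> 2/3 puts the end 3/2 \<delta> of the transition at or below 1,
  so the profile is already constant where the factor 1 - r becomes negative.\<close>

lemma cutoff_profile_profile:
  assumes "0 < \<delta>" "\<delta> \<le> 2/3"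
  shows "cutoff_profile \<delta> (profile \<delta>)"
proof -
  have s: "0 \<le> smooth_step x" "smooth_step x \<le> 1" for x
    using smooth_step_mono[of "min x 0" x] smooth_step_mono[of x "max x 1"]
    by (simp_all add: smooth_step_0 smooth_step_1)
  have one: "profile \<delta> r = 1" if "r \<ge> 3/2 * \<delta>" for r
    using that assms by (simp add: profile_def smooth_step_1 field_simps)
  have id: "profile \<delta> r = r" if "r \<le> \<delta>" for r
    using that assms by (simp add: profile_def smooth_step_0 field_simps)
  have mono: "profile \<delta> r \<le> profile \<delta> r'" if "0 \<le> r" "r \<le> r'" "r' \<le> 1" for r r'
  proof -
    have "smooth_step (2 / \<delta> * r - 2) \<le> smooth_step (2 / \<delta> * r' - 2)"
      using that assms by (intro smooth_step_mono) (simp add: divide_right_mono)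
    then show ?thesis unfolding profile_def using that s by (auto intro!: mult_mono)
  qed
  have "mono_on {0..} (profile \<delta>)"
  proof (rule mono_onI)
    fix r r' :: real assume r: "r \<in> {0..}" "r' \<in> {0..}" "r \<le> r'"
    show "profile \<delta> r \<le> profile \<delta> r'"
    proof (cases "r' \<le> 1")
      case False
      have "profile \<delta> r \<le> 1"
        using mono[of r 1] one[of 1] one[of r] r assms by (cases "r \<le> 1") auto
      then show ?thesis using False one assms by simp
    qed (use mono r in auto)
  qed
  moreover have "profile \<delta> r > 0" if "r > 0" for r
  proof (cases "r < \<delta>")
    case False
    then show ?thesis using mono[of \<delta> r] id[of \<delta>] one[of r] assms by (cases "r \<le> 1") auto
  qed (use that id in auto)
  ultimately show ?thesis
    using one id Ck_on_profile unfolding cutoff_profile_def smooth_on_def by auto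
qed

section \<open>Charts and flat maps\<close>

lemma cinv_in_cdom: "x \<in> cim k \<Longrightarrow> cinv k x \<in> cdom k"
  unfolding cinv_def by (rule inv_into_into)

lemma cmap_cinv: "x \<in> cim k \<Longrightarrow> cmap k (cinv k x) = x"
  unfolding cinv_def by (rule f_inv_into_f)

locale gmn_surface =
  fixes A :: "'c::t2_space coord set" and \<phi> :: "'c qd"
    and \<xi> :: "'c \<Rightarrow> complex \<Rightarrow> 'c" and \<rho> :: "'c \<Rightarrow> real"
  assumes closed_surface: "closed_riemann_surface A"
    and complete: "complete_GMN A \<phi>"
    and zero_charts: "zero_charts A \<phi> \<xi> \<rho>"
begin

section \<open>Charts, transition maps and the transformation rule of \<phi>\<close>

lemma local_coordinate: "k \<in> A \<Longrightarrow> local_coordinate k"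
  using closed_surface by (auto simp: closed_riemann_surface_def complex_structure_def)

lemma exists_chart: "\<exists>k\<in>A. x \<in> cim k"
  using closed_surface by (auto simp: closed_riemann_surface_def complex_structure_def)

lemma compatible: "k \<in> A \<Longrightarrow> k' \<in> A \<Longrightarrow> compatible k k'"
  using closed_surface by (auto simp: closed_riemann_surface_def complex_structure_def)

lemma maximal_atlas: "local_coordinate k \<Longrightarrow> (\<And>k'. k' \<in> A \<Longrightarrow> compatible k k') \<Longrightarrow> k \<in> A"
  using closed_surface unfolding closed_riemann_surface_def complex_structure_def by blast

lemma quad: "quadratic_differential A \<phi>"
  using complete by (auto simp: complete_GMN_def GMN_def)

lemma cinv_cmap: "k \<in> A \<Longrightarrow> z \<in> cdom k \<Longrightarrow> cinv k (cmap k z) = z"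
  using local_coordinate[of k] unfolding cinv_def local_coordinate_def by (simp add: inv_into_f_f)

lemma open_cdom: "k \<in> A \<Longrightarrow> open (cdom k)" and open_cim: "k \<in> A \<Longrightarrow> open (cim k)"
  and cmap_continuous: "k \<in> A \<Longrightarrow> continuous_on (cdom k) (cmap k)"
  and cinv_continuous: "k \<in> A \<Longrightarrow> continuous_on (cim k) (cinv k)"
  and cmap_inj: "k \<in> A \<Longrightarrow> inj_on (cmap k) (cdom k)"
  using local_coordinate[of k] unfolding local_coordinate_def homeomorphism_def by auto

lemma overlap_altdef: "overlap k k' = cdom k \<inter> cmap k -` cim k'"
  by (auto simp: overlap_def)

lemma open_overlap: "k \<in> A \<Longrightarrow> k' \<in> A \<Longrightarrow> open (overlap k k')"
  unfolding overlap_altdef by (intro continuous_open_preimage cmap_continuous open_cdom open_cim)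

lemma transition_holomorphic: "k \<in> A \<Longrightarrow> k' \<in> A \<Longrightarrow> transition k k' holomorphic_on overlap k k'"
  using compatible by (simp add: compatible_def)

lemma transition_DERIV:
  "k \<in> A \<Longrightarrow> k' \<in> A \<Longrightarrow> z \<in> overlap k k' \<Longrightarrow>
    (transition k k' has_field_derivative deriv (transition k k') z) (at z)"
  using transition_holomorphic open_overlap holomorphic_derivI by blast

lemma transition_overlap:
  "k \<in> A \<Longrightarrow> z \<in> overlap k k' \<Longrightarrow> transition k k' z \<in> overlap k' k"
  by (auto simp: overlap_def transition_def cmap_cinv cinv_in_cdom)

lemma cmap_transition: "z \<in> overlap k k' \<Longrightarrow> cmap k' (transition k k' z) = cmap k z"
  by (auto simp: overlap_def transition_def cmap_cinv)

lemma transition_transition: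
  "k \<in> A \<Longrightarrow> z \<in> overlap k k' \<Longrightarrow> transition k' k (transition k k' z) = z"
  by (auto simp: overlap_def transition_def cmap_cinv cinv_cmap)

lemma transition_deriv_inverse:
  assumes "k \<in> A" "k' \<in> A" "z \<in> overlap k k'"
  shows "deriv (transition k' k) (transition k k' z) * deriv (transition k k') z = 1"
proof -
  have "((transition k' k \<circ> transition k k') has_field_derivative
      deriv (transition k' k) (transition k k' z) * deriv (transition k k') z) (at z)"
    using assms transition_overlap by (intro DERIV_chain transition_DERIV) auto
  moreover have "((\<lambda>z. z) has_field_derivative 1) (at z)" by simp
  then have "((transition k' k \<circ> transition k k') has_field_derivative 1) (at z)"
    by (rule has_field_derivative_transform_within_open[OF _ open_overlap[OF assms(1,2)] assms(3)])
       (simp add: transition_transition assms(1))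
  ultimately show ?thesis using DERIV_unique by blast
qed

lemma transition_deriv_nonzero:
  "k \<in> A \<Longrightarrow> k' \<in> A \<Longrightarrow> z \<in> overlap k k' \<Longrightarrow> deriv (transition k k') z \<noteq> 0"
  using transition_deriv_inverse by fastforce

lemma transition_deriv_comp:
  assumes "k \<in> A" "k' \<in> A" "k'' \<in> A" "z \<in> overlap k k'" "z \<in> overlap k k''"
  shows "deriv (transition k k'') z =
    deriv (transition k' k'') (transition k k' z) * deriv (transition k k') z"
proof -
  have t: "transition k k' z \<in> overlap k' k''"
    using assms(4,5) by (auto simp: overlap_def transition_def cmap_cinv cinv_in_cdom)
  have "((transition k' k'' \<circ> transition k k') has_field_derivative
      deriv (transition k' k'') (transition k k' z) * deriv (transition k k') z) (at z)"
    using assms t by (intro DERIV_chain transition_DERIV) auto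
  then have "(transition k k'' has_field_derivative
      deriv (transition k' k'') (transition k k' z) * deriv (transition k k') z) (at z)"
    by (rule has_field_derivative_transform_within_open[OF _ open_Int[OF open_overlap[OF assms(1,2)] open_overlap[OF assms(1,3)]]])
       (use assms in \<open>auto simp: overlap_def transition_def cmap_cinv\<close>)
  then show ?thesis by (rule DERIV_imp_deriv)
qed

lemma transition_same: "k \<in> A \<Longrightarrow> z \<in> cdom k \<Longrightarrow> transition k k z = z"
  by (simp add: transition_def cinv_cmap)

lemma phi_transition:
  "k \<in> A \<Longrightarrow> k' \<in> A \<Longrightarrow> z \<in> overlap k k' \<Longrightarrow>
    \<phi> k z = \<phi> k' (transition k k' z) * (deriv (transition k k') z)\<^sup>2"
  using quad unfolding quadratic_differential_def by blast

lemma phi_nicely: "k \<in> A \<Longrightarrow> \<phi> k nicely_meromorphic_on cdom k"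
  using quad by (simp add: quadratic_differential_def)

lemma phi_pole: "k \<in> A \<Longrightarrow> z \<in> cdom k \<Longrightarrow> is_pole (\<phi> k) z \<Longrightarrow> \<phi> k z = 0"
  using phi_nicely[of k] not_tendsto_and_filterlim_at_infinity[of "at z" "\<phi> k"]
  unfolding nicely_meromorphic_on_def is_pole_def by auto

lemma phi_analytic: "k \<in> A \<Longrightarrow> z \<in> cdom k \<Longrightarrow> \<not> is_pole (\<phi> k) z \<Longrightarrow> \<phi> k analytic_on {z}"
  using nicely_meromorphic_on_imp_analytic_at phi_nicely by blast

lemma phi_eq_0_overlap:
  assumes "k \<in> A" "k' \<in> A" "z \<in> cdom k" "z' \<in> cdom k'" "cmap k z = cmap k' z'"
  shows "\<phi> k z = 0 \<longleftrightarrow> \<phi> k' z' = 0"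
proof -
  have "z \<in> overlap k k'" "transition k k' z = z'"
    using assms by (auto simp: overlap_def transition_def cinv_cmap)
  then show ?thesis
    using phi_transition[OF assms(1,2)] transition_deriv_nonzero[OF assms(1,2)] by fastforce
qed

text \<open>Otherwise the coefficient in \<open>k'\<close> would be continuous at the image point,
  and the transformation rule would give \<open>\<phi> k\<close> a finite limit at the pole.\<close>

lemma is_pole_transition:
  assumes "k \<in> A" "k' \<in> A" "z \<in> overlap k k'" "is_pole (\<phi> k) z"
  shows "is_pole (\<phi> k') (transition k k' z)"
proof (rule ccontr)
  assume n: "\<not> is_pole (\<phi> k') (transition k k' z)"
  have "transition k k' z \<in> cdom k'"
    using assms(3) by (simp add: overlap_def transition_def cinv_in_cdom)
  then have a: "isCont (\<phi> k') (transition k k' z)"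
    using phi_analytic[OF assms(2) _ n] analytic_at_imp_isCont by blast
  have b: "isCont (transition k k') z"
    using transition_DERIV[OF assms(1-3)] by (rule DERIV_isCont)
  have "isCont (deriv (transition k k')) z"
    using holomorphic_on_imp_continuous_on[OF holomorphic_deriv[OF transition_holomorphic[OF assms(1,2)] open_overlap[OF assms(1,2)]]]
      assms(3) continuous_on_eq_continuous_at[OF open_overlap[OF assms(1,2)]] by blast
  from isCont_mult[OF isCont_o2[OF b a] isCont_power[OF this, of 2]]
  have "isCont (\<lambda>z. \<phi> k' (transition k k' z) * (deriv (transition k k') z)\<^sup>2) z" .
  then have "((\<lambda>z. \<phi> k' (transition k k' z) * (deriv (transition k k') z)\<^sup>2) \<longlongrightarrow> \<phi> k' (transition k k' z) * (deriv (transition k k') z)\<^sup>2) (at z)"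
    by (simp add: isCont_def)
  moreover have "\<forall>\<^sub>F w in at z. \<phi> k' (transition k k' w) * (deriv (transition k k') w)\<^sup>2 = \<phi> k w"
    using eventually_at_in_open'[OF open_overlap[OF assms(1,2)] assms(3)]
    by eventually_elim (simp add: phi_transition[OF assms(1,2)])
  ultimately have "(\<phi> k \<longlongrightarrow> \<phi> k' (transition k k' z) * (deriv (transition k k') z)\<^sup>2) (at z)"
    by (rule Lim_transform_eventually)
  then show False using assms(4) not_tendsto_and_filterlim_at_infinity[of "at z"]
    unfolding is_pole_def by auto
qed

lemma poles_chart:
  assumes "k \<in> A" "z \<in> cdom k"
  shows "cmap k z \<in> qd_poles A \<phi> \<longleftrightarrow> is_pole (\<phi> k) z"
proof
  assume "cmap k z \<in> qd_poles A \<phi>"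
  then obtain k' z' where k': "k' \<in> A" "z' \<in> cdom k'" "cmap k z = cmap k' z'" "is_pole (\<phi> k') z'"
    by (auto simp: qd_poles_def)
  then have "z' \<in> overlap k' k" "transition k' k z' = z"
    using assms by (auto simp: overlap_def transition_def cinv_cmap intro: image_eqI[of _ _ z])
       (metis cinv_cmap)
  then show "is_pole (\<phi> k) z" using is_pole_transition[OF k'(1) assms(1) _ k'(4)] by simp
next
  assume "is_pole (\<phi> k) z"
  then show "cmap k z \<in> qd_poles A \<phi>" unfolding qd_poles_def using assms by blast
qed

lemma zeros_poles_disjoint: "qd_zeros A \<phi> \<inter> qd_poles A \<phi> = {}"
  using poles_chart by (auto simp: qd_zeros_def)

lemma C_circ_chart:
  assumes "k \<in> A" "z \<in> cdom k"
  shows "cmap k z \<in> C_circ A \<phi> \<longleftrightarrow> \<phi> k z \<noteq> 0"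
proof
  assume "cmap k z \<in> C_circ A \<phi>"
  then show "\<phi> k z \<noteq> 0" using assms unfolding C_circ_def qd_zeros_def qd_poles_def by blast
next
  assume nz: "\<phi> k z \<noteq> 0"
  show "cmap k z \<in> C_circ A \<phi>"
  proof (rule ccontr)
    assume "cmap k z \<notin> C_circ A \<phi>"
    then obtain k' z' where "k' \<in> A" "z' \<in> cdom k'" "cmap k z = cmap k' z'" "\<phi> k' z' = 0"
      by (auto simp: C_circ_def qd_zeros_def qd_poles_def phi_pole)
    then show False using nz phi_eq_0_overlap assms by blast
  qed
qed

lemma C_circ_iff: "k \<in> A \<Longrightarrow> x \<in> cim k \<Longrightarrow> x \<in> C_circ A \<phi> \<longleftrightarrow> \<phi> k (cinv k x) \<noteq> 0"
  using C_circ_chart[of k "cinv k x"] by (simp add: cinv_in_cdom cmap_cinv)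

lemma C_circ_subset: "C_circ A \<phi> \<subseteq> C_tilde A \<phi>"
  by (auto simp: C_circ_def C_tilde_def)

lemma C_tilde_eq: "C_tilde A \<phi> = C_circ A \<phi> \<union> qd_zeros A \<phi>"
  using zeros_poles_disjoint by (auto simp: C_circ_def C_tilde_def)

lemma chart_change:
  assumes "k \<in> A" "k' \<in> A" "open U" "z \<in> U" "continuous_on U h" "h z \<in> cim k" "h z \<in> cim k'"
    and d: "((cinv k \<circ> h) has_field_derivative d) (at z)"
  shows "((cinv k' \<circ> h) has_field_derivative deriv (transition k k') (cinv k (h z)) * d) (at z)"
proof -
  have z: "cinv k (h z) \<in> overlap k k'"
    using assms by (auto simp: overlap_def cinv_in_cdom cmap_cinv)
  have "((transition k k' \<circ> (cinv k \<circ> h)) has_field_derivative deriv (transition k k') (cinv k (h z)) * d) (at z)"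
    using DERIV_chain[OF transition_DERIV[OF assms(1,2), unfolded o_apply] d] z by simp
  moreover have "open (U \<inter> h -` (cim k \<inter> cim k'))"
    using assms by (intro continuous_open_preimage open_Int open_cim)
  ultimately show ?thesis
    by (rule has_field_derivative_transform_within_open)
       (use assms(4,6,7) in \<open>simp_all add: transition_def cmap_cinv\<close>)
qed

text \<open>A local inverse of a branch of the integral of the root of \<phi>: in every chart the
  pull-back of \<phi> is dz^2. Developing maps are in general only immersions, so injectivity is
  treated separately.\<close>

definition flatmap :: "complex set \<Rightarrow> (complex \<Rightarrow> 'c) \<Rightarrow> bool" where
  "flatmap U \<psi> \<longleftrightarrow> open U \<and> continuous_on U \<psi> \<and>
     (\<forall>k\<in>A. \<forall>z\<in>U. \<psi> z \<in> cim k \<longrightarrow>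
        ((cinv k \<circ> \<psi>) has_field_derivative deriv (cinv k \<circ> \<psi>) z) (at z) \<and>
        \<phi> k (cinv k (\<psi> z)) * (deriv (cinv k \<circ> \<psi>) z)\<^sup>2 = 1)"

text \<open>The defining equation is invariant under the transformation rule of \<phi>, so one chart
  around each point suffices.\<close>

lemma flatmapI:
  assumes "open U" "continuous_on U \<psi>"
    and "\<And>z. z \<in> U \<Longrightarrow> \<exists>k\<in>A. \<psi> z \<in> cim k \<and>
      (\<exists>d. ((cinv k \<circ> \<psi>) has_field_derivative d) (at z) \<and> \<phi> k (cinv k (\<psi> z)) * d\<^sup>2 = 1)"
  shows "flatmap U \<psi>"
  unfolding flatmap_def
proof (intro conjI ballI impI)
  fix k' z assume k': "k' \<in> A" "z \<in> U" "\<psi> z \<in> cim k'"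
  from assms(3)[OF k'(2)] obtain k d where k: "k \<in> A" "\<psi> z \<in> cim k"
    "((cinv k \<circ> \<psi>) has_field_derivative d) (at z)" "\<phi> k (cinv k (\<psi> z)) * d\<^sup>2 = 1" by blast
  let ?t = "deriv (transition k k') (cinv k (\<psi> z))"
  have ov: "cinv k (\<psi> z) \<in> overlap k k'" "transition k k' (cinv k (\<psi> z)) = cinv k' (\<psi> z)"
    using k k' by (auto simp: overlap_def transition_def cinv_in_cdom cmap_cinv)
  have D: "((cinv k' \<circ> \<psi>) has_field_derivative ?t * d) (at z)"
    using chart_change[OF k(1) k'(1) assms(1) k'(2) assms(2) k(2) k'(3) k(3)] .
  then have e: "deriv (cinv k' \<circ> \<psi>) z = ?t * d" by (rule DERIV_imp_deriv)
  show "((cinv k' \<circ> \<psi>) has_field_derivative deriv (cinv k' \<circ> \<psi>) z) (at z)"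
    using D e by simp
  show "\<phi> k' (cinv k' (\<psi> z)) * (deriv (cinv k' \<circ> \<psi>) z)\<^sup>2 = 1"
    using phi_transition[OF k(1) k'(1) ov(1)] k(4) ov(2) e by (simp add: power_mult_distrib mult.assoc)
qed (use assms in auto)

lemma flatmap_open: "flatmap U \<psi> \<Longrightarrow> open U"
  and flatmap_continuous: "flatmap U \<psi> \<Longrightarrow> continuous_on U \<psi>"
  and flatmap_DERIV: "flatmap U \<psi> \<Longrightarrow> k \<in> A \<Longrightarrow> z \<in> U \<Longrightarrow> \<psi> z \<in> cim k \<Longrightarrow>
        ((cinv k \<circ> \<psi>) has_field_derivative deriv (cinv k \<circ> \<psi>) z) (at z)"
  and flatmap_eq: "flatmap U \<psi> \<Longrightarrow> k \<in> A \<Longrightarrow> z \<in> U \<Longrightarrow> \<psi> z \<in> cim k \<Longrightarrow>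
        \<phi> k (cinv k (\<psi> z)) * (deriv (cinv k \<circ> \<psi>) z)\<^sup>2 = 1"
  unfolding flatmap_def by blast+

lemma flatmap_deriv_nonzero:
  assumes "flatmap U \<psi>" "k \<in> A" "z \<in> U" "\<psi> z \<in> cim k"
  shows "deriv (cinv k \<circ> \<psi>) z \<noteq> 0"
  using flatmap_eq[OF assms] by auto

lemma flatmap_C_circ:
  assumes "flatmap U \<psi>" "z \<in> U"
  shows "\<psi> z \<in> C_circ A \<phi>"
proof -
  obtain k where k: "k \<in> A" "\<psi> z \<in> cim k" using exists_chart by blast
  show ?thesis using flatmap_eq[OF assms(1) k(1) assms(2) k(2)] C_circ_iff[OF k] by auto
qed

lemma flatmap_preimage_open: "flatmap U \<psi> \<Longrightarrow> open W \<Longrightarrow> open {z \<in> U. \<psi> z \<in> W}"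
  using continuous_open_preimage[OF flatmap_continuous[of U \<psi>] flatmap_open[of U \<psi>], of W]
  by (simp add: vimage_def Int_def)

lemma flatmap_holomorphic:
  assumes "flatmap U \<psi>" "k \<in> A"
  shows "(cinv k \<circ> \<psi>) holomorphic_on {z \<in> U. \<psi> z \<in> cim k}"
  using flatmap_DERIV[OF assms] flatmap_preimage_open[OF assms(1) open_cim[OF assms(2)]]
  by (subst holomorphic_on_open) auto

text \<open>The sheaf property. It allows maps given by different formulas on overlapping domains to
  be glued, \<open>Exp\<close> and the bands of \<open>maxstrip_exists\<close> among them.\<close>

lemma flatmap_cong_local:
  assumes "open U" "\<And>z. z \<in> U \<Longrightarrow> \<exists>V \<theta>. flatmap V \<theta> \<and> z \<in> V \<and> (\<forall>w\<in>V \<inter> U. \<psi> w = \<theta> w)"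
  shows "flatmap U \<psi>"
proof (rule flatmapI)
  have loc: "\<exists>V \<theta>. flatmap V \<theta> \<and> z \<in> V \<and> V \<subseteq> U \<and> (\<forall>w\<in>V. \<psi> w = \<theta> w)" if z: "z \<in> U" for z
  proof -
    obtain V \<theta> where V: "flatmap V \<theta>" "z \<in> V" "\<forall>w\<in>V \<inter> U. \<psi> w = \<theta> w" using assms(2)[OF z] by blast
    have "flatmap (V \<inter> U) \<theta>"
      using V(1) assms(1) unfolding flatmap_def by (auto intro: continuous_on_subset)
    then show ?thesis using V z by blast
  qed
  show "continuous_on U \<psi>"
    unfolding continuous_on_eq_continuous_at[OF assms(1)]
  proof
    fix z assume "z \<in> U"
    then obtain V \<theta> where V: "flatmap V \<theta>" "z \<in> V" "V \<subseteq> U" "\<forall>w\<in>V. \<psi> w = \<theta> w" using loc by blast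
    have "continuous_on V \<psi>" using flatmap_continuous[OF V(1)] V(4) by (metis continuous_on_cong)
    then show "isCont \<psi> z" using V(2) flatmap_open[OF V(1)] by (simp add: continuous_on_eq_continuous_at)
  qed
  fix z assume "z \<in> U"
  then obtain V \<theta> where V: "flatmap V \<theta>" "z \<in> V" "V \<subseteq> U" "\<forall>w\<in>V. \<psi> w = \<theta> w" using loc by blast
  obtain k where k: "k \<in> A" "\<psi> z \<in> cim k" using exists_chart by blast
  have e: "\<theta> z = \<psi> z" using V by simp
  have "((cinv k \<circ> \<theta>) has_field_derivative deriv (cinv k \<circ> \<theta>) z) (at z)"
    using flatmap_DERIV[OF V(1) k(1) V(2)] k e by simp
  then have "((cinv k \<circ> \<psi>) has_field_derivative deriv (cinv k \<circ> \<theta>) z) (at z)"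
    by (rule has_field_derivative_transform_within_open[OF _ flatmap_open[OF V(1)] V(2)]) (use V in auto)
  then show "\<exists>k\<in>A. \<psi> z \<in> cim k \<and>
      (\<exists>d. ((cinv k \<circ> \<psi>) has_field_derivative d) (at z) \<and> \<phi> k (cinv k (\<psi> z)) * d\<^sup>2 = 1)"
    using k flatmap_eq[OF V(1) k(1) V(2)] e by auto
qed (use assms in auto)

lemma flatmap_subset: "flatmap U \<psi> \<Longrightarrow> open V \<Longrightarrow> V \<subseteq> U \<Longrightarrow> flatmap V \<psi>"
  by (rule flatmap_cong_local) auto

lemma open_affine_preimage: "open U \<Longrightarrow> open {z::complex. \<sigma> * z + c \<in> U}"
  using continuous_open_preimage[of UNIV "\<lambda>z. \<sigma> * z + c" U] by (simp add: vimage_def continuous_intros)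

text \<open>These are the symmetries of dz^2. Together with
  \<open>flatmap_in_flat_coordinate\<close> they account for the entire ambiguity of flat
  coordinates.\<close>

lemma flatmap_affine:
  assumes f: "flatmap U \<psi>" and s: "\<sigma>\<^sup>2 = 1"
  shows "flatmap {z. \<sigma> * z + c \<in> U} (\<lambda>z. \<psi> (\<sigma> * z + c))"
    and "\<And>k z. k \<in> A \<Longrightarrow> \<sigma> * z + c \<in> U \<Longrightarrow> \<psi> (\<sigma> * z + c) \<in> cim k \<Longrightarrow>
      deriv (cinv k \<circ> (\<lambda>z. \<psi> (\<sigma> * z + c))) z = \<sigma> * deriv (cinv k \<circ> \<psi>) (\<sigma> * z + c)"
proof -
  have D: "((cinv k \<circ> (\<lambda>z. \<psi> (\<sigma> * z + c))) has_field_derivative \<sigma> * deriv (cinv k \<circ> \<psi>) (\<sigma> * z + c)) (at z)"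
    if "k \<in> A" "\<sigma> * z + c \<in> U" "\<psi> (\<sigma> * z + c) \<in> cim k" for k z
  proof -
    have "((\<lambda>z. \<sigma> * z + c) has_field_derivative \<sigma>) (at z)" by (auto intro!: derivative_eq_intros)
    from DERIV_chain[OF flatmap_DERIV[OF f that] this] show ?thesis by (simp add: o_def mult.commute)
  qed
  show "flatmap {z. \<sigma> * z + c \<in> U} (\<lambda>z. \<psi> (\<sigma> * z + c))"
  proof (rule flatmapI)
    show "open {z. \<sigma> * z + c \<in> U}" using flatmap_open[OF f] by (rule open_affine_preimage)
    show "continuous_on {z. \<sigma> * z + c \<in> U} (\<lambda>z. \<psi> (\<sigma> * z + c))"
      by (rule continuous_on_compose2[OF flatmap_continuous[OF f]]) (auto intro!: continuous_intros)
    fix z assume z: "z \<in> {z. \<sigma> * z + c \<in> U}"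
    obtain k where k: "k \<in> A" "\<psi> (\<sigma> * z + c) \<in> cim k" using exists_chart by blast
    show "\<exists>k\<in>A. \<psi> (\<sigma> * z + c) \<in> cim k \<and> (\<exists>d. ((cinv k \<circ> (\<lambda>z. \<psi> (\<sigma> * z + c))) has_field_derivative d) (at z) \<and>
            \<phi> k (cinv k (\<psi> (\<sigma> * z + c))) * d\<^sup>2 = 1)"
      using D[OF k(1) _ k(2)] flatmap_eq[OF f k(1) _ k(2)] z s
      by (intro bexI[OF _ k(1)] conjI[OF k(2)] exI[of _ "\<sigma> * deriv (cinv k \<circ> \<psi>) (\<sigma> * z + c)"])
         (simp add: power_mult_distrib)
  qed
  show "deriv (cinv k \<circ> (\<lambda>z. \<psi> (\<sigma> * z + c))) z = \<sigma> * deriv (cinv k \<circ> \<psi>) (\<sigma> * z + c)"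
    if "k \<in> A" "\<sigma> * z + c \<in> U" "\<psi> (\<sigma> * z + c) \<in> cim k" for k z
    using D[OF that] by (rule DERIV_imp_deriv)
qed

subsection \<open>Lifts to the spectral curve\<close>

lemma cotangent_bundle_iff: "y \<in> cotangent_bundle A \<phi> \<longleftrightarrow> fst y \<in> C_tilde A \<phi> \<and> snd y \<in> cot_fibre A (fst y)"
  by (cases y) (simp add: cotangent_bundle_def)

lemma spectral_curve_iff: "y \<in> spectral_curve A \<phi> \<longleftrightarrow> y \<in> cotangent_bundle A \<phi> \<and>
    (\<forall>k\<in>A. \<forall>z\<in>cdom k. cmap k z = fst y \<longrightarrow> (snd y k)\<^sup>2 = \<phi> k z)"
  by (cases y) (simp add: spectral_curve_def)

lemma cot_fibre_0: "\<eta> \<in> cot_fibre A x \<Longrightarrow> \<not> (k \<in> A \<and> x \<in> cim k) \<Longrightarrow> \<eta> k = 0"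
  unfolding cot_fibre_def by blast

lemma cot_fibre_transition:
  "\<eta> \<in> cot_fibre A x \<Longrightarrow> k \<in> A \<Longrightarrow> k' \<in> A \<Longrightarrow> z \<in> overlap k k' \<Longrightarrow> cmap k z = x \<Longrightarrow>
    \<eta> k = \<eta> k' * deriv (transition k k') z"
  unfolding cot_fibre_def by blast

text \<open>For \<sigma> = -1 this is the sheet interchange of the spectral curve.\<close>

definition smul :: "complex \<Rightarrow> 'c cot \<Rightarrow> 'c cot" where
  "smul \<sigma> y = (fst y, \<lambda>k. \<sigma> * snd y k)"

text \<open>With w the local coordinate of \<psi>, the covector p dw with p = 1 / w' pulls back to
  dz along \<psi>. The lift remembers which of the two signs of the root of \<phi> has been chosen;
  the point \<open>\<psi> z\<close> alone does not.\<close>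

definition lift :: "(complex \<Rightarrow> 'c) \<Rightarrow> complex \<Rightarrow> 'c cot" where
  "lift \<psi> z = (\<psi> z, \<lambda>k. if k \<in> A \<and> \<psi> z \<in> cim k then 1 / deriv (cinv k \<circ> \<psi>) z else 0)"

lemma fst_lift [simp]: "fst (lift \<psi> z) = \<psi> z"
  by (simp add: lift_def)

lemma fst_smul [simp]: "fst (smul \<sigma> y) = fst y"
  by (simp add: smul_def)

lemma smul_1 [simp]: "smul 1 y = y" and smul_smul [simp]: "smul \<sigma> (smul \<tau> y) = smul (\<sigma> * \<tau>) y"
  by (simp_all add: smul_def mult.assoc)

lemma deriv_chart_change:
  assumes "flatmap U \<psi>" "z \<in> U" "k \<in> A" "k' \<in> A" "\<psi> z \<in> cim k" "\<psi> z \<in> cim k'"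
  shows "deriv (cinv k' \<circ> \<psi>) z = deriv (transition k k') (cinv k (\<psi> z)) * deriv (cinv k \<circ> \<psi>) z"
  using chart_change[OF assms(3,4) flatmap_open[OF assms(1)] assms(2) flatmap_continuous[OF assms(1)] assms(5,6)
      flatmap_DERIV[OF assms(1,3,2,5)]] by (rule DERIV_imp_deriv)

lemma lift_in_spectral_curve:
  assumes "flatmap U \<psi>" "z \<in> U"
  shows "lift \<psi> z \<in> spectral_curve A \<phi>"
proof -
  have "\<psi> z \<in> C_tilde A \<phi>" using flatmap_C_circ[OF assms] C_circ_subset by auto
  moreover have "snd (lift \<psi> z) \<in> cot_fibre A (\<psi> z)"
    unfolding cot_fibre_def
  proof (intro CollectI conjI ballI allI impI)
    fix k k' w assume k: "k \<in> A" "k' \<in> A" "w \<in> overlap k k'" "cmap k w = \<psi> z"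
    have "\<psi> z \<in> cim k" "\<psi> z \<in> cim k'" "cinv k (\<psi> z) = w"
      using k cinv_cmap[OF k(1), of w] by (simp_all add: overlap_def) (metis imageI)
    then show "snd (lift \<psi> z) k = snd (lift \<psi> z) k' * deriv (transition k k') w"
      using deriv_chart_change[OF assms k(1,2)] k(1,2) transition_deriv_nonzero[OF k(1-3)]
      by (simp add: lift_def)
  next
    fix k assume "\<not> (k \<in> A \<and> \<psi> z \<in> cim k)"
    then show "snd (lift \<psi> z) k = 0" by (simp only: lift_def snd_conv if_False)
  qed
  moreover have "(snd (lift \<psi> z) k)\<^sup>2 = \<phi> k w" if "k \<in> A" "w \<in> cdom k" "cmap k w = \<psi> z" for k w
  proof -
    have "\<psi> z \<in> cim k" "cinv k (\<psi> z) = w" using that cinv_cmap by (metis imageI)+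
    then show ?thesis using flatmap_eq[OF assms(1) that(1) assms(2)] flatmap_deriv_nonzero[OF assms(1) that(1) assms(2)] that
      by (simp add: lift_def power_divide divide_eq_eq)
  qed
  ultimately show ?thesis unfolding spectral_curve_iff cotangent_bundle_iff fst_lift by blast
qed

lemma lift_nonzero: "flatmap U \<psi> \<Longrightarrow> z \<in> U \<Longrightarrow> k \<in> A \<Longrightarrow> \<psi> z \<in> cim k \<Longrightarrow> snd (lift \<psi> z) k \<noteq> 0"
  using flatmap_deriv_nonzero by (simp add: lift_def)

lemma lift_affine:
  assumes "flatmap U \<psi>" "\<sigma>\<^sup>2 = 1" "\<sigma> * z + c \<in> U"
  shows "lift (\<lambda>z. \<psi> (\<sigma> * z + c)) z = smul \<sigma> (lift \<psi> (\<sigma> * z + c))"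
proof -
  have "\<sigma> * \<sigma> = 1" using assms(2) by (simp add: power2_eq_square)
  then have "1 / (\<sigma> * d) = \<sigma> * (1 / d)" for d by (auto simp: divide_simps)
  then have "snd (lift (\<lambda>z. \<psi> (\<sigma> * z + c)) z) k = \<sigma> * snd (lift \<psi> (\<sigma> * z + c)) k" for k
    using flatmap_affine(2)[OF assms(1,2) _ assms(3), of k] by (simp add: lift_def)
  then show ?thesis by (intro prod_eqI ext) (simp_all add: smul_def)
qed

lemma lift_cong:
  assumes "open U" "z \<in> U" "\<And>w. w \<in> U \<Longrightarrow> \<psi> w = \<theta> w"
  shows "lift \<psi> z = lift \<theta> z"
proof -
  have "deriv (cinv k \<circ> \<psi>) z = deriv (cinv k \<circ> \<theta>) z" for k
    by (rule deriv_cong_ev[OF eventually_mono[OF eventually_nhds_in_open[OF assms(1,2)]]]) (simp_all add: assms(3))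
  then show ?thesis using assms(3)[OF assms(2)] by (simp only: lift_def)
qed

lemma cot_eqI:
  assumes "y \<in> cotangent_bundle A \<phi>" "y' \<in> cotangent_bundle A \<phi>" "fst y = fst y'"
    and "k \<in> A" "fst y \<in> cim k" "snd y k = snd y' k"
  shows "y = y'"
proof -
  have "snd y k' = snd y' k'" for k'
  proof (cases "k' \<in> A \<and> fst y \<in> cim k'")
    case True
    let ?w = "cinv k' (fst y)"
    have w: "?w \<in> overlap k' k" "cmap k' ?w = fst y"
      using True assms(5) by (auto simp: overlap_def cinv_in_cdom cmap_cinv)
    have "snd u k' = snd u k * deriv (transition k' k) ?w"
      if "u \<in> cotangent_bundle A \<phi>" "fst u = fst y" for u
      using that True assms(4) w cot_fibre_transition[of "snd u" "fst y" k' k ?w] by (simp add: cotangent_bundle_iff)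
    from this[of y] this[of y'] show ?thesis using assms by simp
  next
    case False
    moreover have "snd u k' = 0" if "u \<in> cotangent_bundle A \<phi>" "fst u = fst y" for u
      using that cot_fibre_0[OF _ False] by (simp add: cotangent_bundle_iff)
    ultimately show ?thesis using assms(1-3) by simp
  qed
  then show ?thesis using assms(3) by (simp add: prod_eq_iff fun_eq_iff)
qed

lemma spectral_cotangent: "y \<in> spectral_curve A \<phi> \<Longrightarrow> y \<in> cotangent_bundle A \<phi>"
  by (simp add: spectral_curve_iff)

lemma cotangent_smul: "y \<in> cotangent_bundle A \<phi> \<Longrightarrow> smul \<sigma> y \<in> cotangent_bundle A \<phi>"
  unfolding cotangent_bundle_iff cot_fibre_def smul_def by (simp add: mult.assoc)

lemma spectral_smul:
  assumes "y \<in> spectral_curve A \<phi>" "\<sigma>\<^sup>2 = 1"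
  shows "smul \<sigma> y \<in> spectral_curve A \<phi>"
  using assms cotangent_smul[OF spectral_cotangent[OF assms(1)], of \<sigma>]
  by (simp add: spectral_curve_iff smul_def power_mult_distrib)

lemma spectral_sq: "y \<in> spectral_curve A \<phi> \<Longrightarrow> k \<in> A \<Longrightarrow> fst y \<in> cim k \<Longrightarrow> (snd y k)\<^sup>2 = \<phi> k (cinv k (fst y))"
  using spectral_curve_iff[of y] cinv_in_cdom[of "fst y" k] cmap_cinv[of "fst y" k] by simp

text \<open>In one chart both covectors are square roots of the same number; \<open>cot_eqI\<close>
  carries the sign to the remaining charts.\<close>

lemma spectral_same_fibre:
  assumes "y \<in> spectral_curve A \<phi>" "y' \<in> spectral_curve A \<phi>" "fst y = fst y'"
  shows "\<exists>\<sigma>\<in>{1,-1}. y = smul \<sigma> y'"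
proof -
  obtain k where k: "k \<in> A" "fst y \<in> cim k" using exists_chart by blast
  have "(snd y k)\<^sup>2 = (snd y' k)\<^sup>2" using spectral_sq assms k by simp
  then obtain \<sigma> where s: "\<sigma> \<in> {1,-1}" "snd y k = \<sigma> * snd y' k"
    by (metis insertCI mult_1 mult_minus1 power2_eq_iff)
  have "y = smul \<sigma> y'"
    by (rule cot_eqI[OF spectral_cotangent[OF assms(1)] cotangent_smul[OF spectral_cotangent[OF assms(2)]] _ k])
       (use assms(3) s(2) in \<open>simp_all add: smul_def\<close>)
  then show ?thesis using s by blast
qed

section \<open>Flat maps as charts, and their unique continuation\<close>

lemma cmap_open_image:
  assumes "k \<in> A" "open V" "V \<subseteq> cdom k"
  shows "open (cmap k ` V)"
proof -
  have "cmap k ` V = cim k \<inter> cinv k -` V"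
    using assms(3) cinv_cmap[OF assms(1)] by (force simp: cmap_cinv)
  then show ?thesis
    using continuous_open_preimage[OF cinv_continuous[OF assms(1)] open_cim[OF assms(1)] assms(2)] by simp
qed

text \<open>Open mapping theorem chart by chart: the derivative of a flat map has no zeroes, so the
  map is nowhere locally constant.\<close>

lemma flatmap_open_image:
  assumes "flatmap U \<psi>"
  shows "open (\<psi> ` U)"
proof -
  have "open (\<psi> ` {z \<in> U. \<psi> z \<in> cim k})" (is "open (\<psi> ` ?W)") if k: "k \<in> A" for k
  proof -
    have W: "open ?W" using flatmap_preimage_open[OF assms open_cim[OF k]] .
    have "open ((cinv k \<circ> \<psi>) ` ?W)"
    proof (rule open_mapping_thm2[OF flatmap_holomorphic[OF assms k] W W order_refl])
      fix X assume X: "open X" "X \<subseteq> ?W" "X \<noteq> {}"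
      then obtain z where z: "z \<in> X" by auto
      show "\<not> (cinv k \<circ> \<psi>) constant_on X"
      proof
        assume "(cinv k \<circ> \<psi>) constant_on X"
        then obtain c where c: "\<And>w. w \<in> X \<Longrightarrow> (cinv k \<circ> \<psi>) w = c" by (auto simp: constant_on_def)
        have "((\<lambda>w. c) has_field_derivative 0) (at z)" by simp
        then have "((cinv k \<circ> \<psi>) has_field_derivative 0) (at z)"
          by (rule has_field_derivative_transform_within_open[OF _ X(1) z]) (simp only: c)
        then have "deriv (cinv k \<circ> \<psi>) z = 0" by (rule DERIV_imp_deriv)
        then show False using flatmap_deriv_nonzero[OF assms k, of z] z X by auto
      qed
    qed
    moreover have "(cinv k \<circ> \<psi>) ` ?W \<subseteq> cdom k" by (auto simp: cinv_in_cdom)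
    ultimately have "open (cmap k ` (cinv k \<circ> \<psi>) ` ?W)" by (intro cmap_open_image k)
    moreover have "cmap k ` (cinv k \<circ> \<psi>) ` ?W = \<psi> ` ?W"
      unfolding image_image by (rule image_cong) (simp_all add: cmap_cinv)
    ultimately show ?thesis by simp
  qed
  then have "open (\<Union>k\<in>A. \<psi> ` {z \<in> U. \<psi> z \<in> cim k})" by (intro open_UN ballI)
  moreover have "(\<Union>k\<in>A. \<psi> ` {z \<in> U. \<psi> z \<in> cim k}) = \<psi> ` U" using exists_chart by blast
  ultimately show ?thesis by simp
qed

text \<open>The atlas is maximal, so an injective flat map is a chart as soon as its transitions to
  known charts are holomorphic in both directions; the inverse direction comes from the holomorphic
  inverse of an injective map.\<close>

lemma flatmap_flat_coordinate:
  assumes f: "flatmap U \<psi>" and inj: "inj_on \<psi> U"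
  shows "(U, \<psi>) \<in> flat_coordinates A \<phi>"
proof -
  let ?k = "(U, \<psi>)"
  have cinv: "cinv ?k (\<psi> z) = z" if "z \<in> U" for z
    using inj that by (simp add: cinv_def)
  have op: "open (\<psi> ` V)" if "open V" "V \<subseteq> U" for V
    using flatmap_open_image[OF flatmap_subset[OF f that]] .
  have "continuous_on (\<psi> ` U) (cinv ?k)"
  proof (rule continuous_on_inverse_open_map[OF flatmap_continuous[OF f] refl])
    fix V assume "openin (top_of_set U) V"
    then have "open V" "V \<subseteq> U" using flatmap_open[OF f] by (auto simp: openin_open_eq)
    then show "openin (top_of_set (\<psi> ` U)) (\<psi> ` V)"
      using op flatmap_open[OF f] by (simp add: openin_open_eq image_mono)
  qed (simp add: cinv)
  then have "homeomorphism U (\<psi> ` U) \<psi> (cinv ?k)"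
    using flatmap_continuous[OF f] cinv unfolding homeomorphism_def by force
  then have lc: "local_coordinate ?k"
    using flatmap_open[OF f] op[of U] inj by (simp add: local_coordinate_def)
  have comp: "compatible ?k k'" if k': "k' \<in> A" for k'
  proof -
    let ?W = "{z \<in> U. \<psi> z \<in> cim k'}" and ?t = "cinv k' \<circ> \<psi>"
    have ov: "overlap ?k k' = ?W" by (auto simp: overlap_def)
    have hol: "?t holomorphic_on ?W" by (rule flatmap_holomorphic[OF f k'])
    have injt: "inj_on ?t ?W"
    proof (rule inj_onI)
      fix x y assume xy: "x \<in> ?W" "y \<in> ?W" "?t x = ?t y"
      then have "cmap k' (cinv k' (\<psi> x)) = cmap k' (cinv k' (\<psi> y))" by simp
      moreover have "cmap k' (cinv k' (\<psi> x)) = \<psi> x" "cmap k' (cinv k' (\<psi> y)) = \<psi> y"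
        using xy by (simp_all only: mem_Collect_eq cmap_cinv)
      ultimately have "\<psi> x = \<psi> y" by (simp only:)
      then show "x = y" using inj_onD[OF inj, of x y] xy(1,2) by simp
    qed
    obtain g where g: "g holomorphic_on ?t ` ?W" "\<And>z. z \<in> ?W \<Longrightarrow> deriv ?t z * deriv g (?t z) = 1"
        "\<And>z. z \<in> ?W \<Longrightarrow> g (?t z) = z"
      by (rule holomorphic_has_inverse[OF hol flatmap_preimage_open[OF f open_cim[OF k']] injt]) blast
    have ov': "overlap k' ?k = ?t ` ?W"
    proof (intro equalityI subsetI)
      fix w assume w: "w \<in> overlap k' ?k"
      then obtain z where z: "z \<in> U" "cmap k' w = \<psi> z" "w \<in> cdom k'" by (auto simp: overlap_def)
      then have "?t z = w" using cinv_cmap[OF k' z(3)] by simp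
      moreover have "z \<in> ?W" using z by (metis (mono_tags, lifting) imageI mem_Collect_eq)
      ultimately show "w \<in> ?t ` ?W" by blast
    next
      fix w assume "w \<in> ?t ` ?W"
      then obtain z where z: "z \<in> U" "\<psi> z \<in> cim k'" "w = cinv k' (\<psi> z)" by auto
      then show "w \<in> overlap k' ?k"
        using cinv_in_cdom[OF z(2)] cmap_cinv[OF z(2)] by (simp add: overlap_def)
    qed
    have "transition k' ?k holomorphic_on overlap k' ?k"
      unfolding ov'
    proof (rule holomorphic_transform[OF g(1)])
      fix w assume "w \<in> ?t ` ?W"
      then obtain z where z: "z \<in> ?W" "w = ?t z" by blast
      then show "g w = transition k' ?k w"
        using g(3)[OF z(1)] cinv[of z] by (simp add: transition_def cmap_cinv)
    qed
    moreover have "transition ?k k' holomorphic_on overlap ?k k'"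
      unfolding ov using hol by (simp add: transition_def)
    ultimately show ?thesis by (simp add: compatible_def)
  qed
  have kA: "?k \<in> A" using maximal_atlas[OF lc comp] .
  have "\<phi> ?k z = 1" if z: "z \<in> U" for z
  proof -
    obtain k where k: "k \<in> A" "\<psi> z \<in> cim k" using exists_chart by blast
    then have "z \<in> overlap ?k k" using z by (simp add: overlap_def)
    from phi_transition[OF kA k(1) this] show ?thesis
      using flatmap_eq[OF f k(1) z k(2)] by (simp add: transition_def)
  qed
  then show ?thesis using kA by (simp add: flat_coordinates_def)
qed

text \<open>A quantitative inverse function theorem for the primitive G of the root of \<phi>. If
  \<phi> varies by at most half of its central value, G stays within half of the linear map a (z -
  z1), hence is injective and covers a disc of radius R |a| / 2. The explicit radius is what yields
  flat discs of uniform size near the poles.\<close>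

lemma flatmap_disc:
  assumes k: "k \<in> A" and R: "R > 0" "ball z1 R \<subseteq> cdom k"
    and hol: "\<phi> k holomorphic_on ball z1 R" and nz: "\<phi> k z1 \<noteq> 0"
    and close: "\<And>z. z \<in> ball z1 R \<Longrightarrow> cmod (\<phi> k z / \<phi> k z1 - 1) \<le> 1/2"
  obtains \<theta> where "flatmap (ball 0 (R * sqrt (cmod (\<phi> k z1)) / 2)) \<theta>"
    "inj_on \<theta> (ball 0 (R * sqrt (cmod (\<phi> k z1)) / 2))" "\<theta> 0 = cmap k z1"
proof -
  define a where "a = csqrt (\<phi> k z1)"
  define q where "q z = csqrt (\<phi> k z / \<phi> k z1)" for z
  have a: "a \<noteq> 0" "a\<^sup>2 = \<phi> k z1" "cmod a = sqrt (cmod (\<phi> k z1))"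
    using nz by (simp_all add: a_def)
  have Re: "Re (\<phi> k z / \<phi> k z1) > 0" if "z \<in> ball z1 R" for z
  proof -
    define u where "u = \<phi> k z / \<phi> k z1 - 1"
    have "cmod u \<le> 1/2" using close[OF that] by (simp only: u_def)
    moreover have "\<bar>Re u\<bar> \<le> cmod u" by (rule abs_Re_le_cmod)
    ultimately have "Re (u + 1) > 0" unfolding plus_complex.sel one_complex.sel by linarith
    then show ?thesis by (simp add: u_def)
  qed
  have qh: "q holomorphic_on ball z1 R"
    unfolding q_def using hol nz
    by (intro holomorphic_on_csqrt' holomorphic_intros) (use Re in \<open>force simp: complex_nonpos_Reals_iff\<close>)+
  have q1: "cmod (q z - 1) \<le> 1/2" if "z \<in> ball z1 R" for z
  proof -
    \<comment> \<open>The principal root has nonnegative real part, so |q + 1| \<ge> 1 and the bound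
      on q^2 - 1 passes to q - 1.\<close>
    have "(q z - 1) * (q z + 1) = \<phi> k z / \<phi> k z1 - 1"
      by (simp add: q_def algebra_simps flip: power2_eq_square)
    then have "cmod (q z - 1) * cmod (q z + 1) \<le> 1/2" using close[OF that] by (metis norm_mult)
    moreover have "Re (q z) \<ge> 0" using csqrt_principal[of "\<phi> k z / \<phi> k z1"] by (auto simp: q_def)
    then have "cmod (q z + 1) \<ge> 1" using complex_Re_le_cmod[of "q z + 1"] by simp
    then have "cmod (q z - 1) * 1 \<le> cmod (q z - 1) * cmod (q z + 1)"
      by (rule mult_left_mono) simp
    ultimately show ?thesis by simp
  qed
  obtain G0 where G0: "\<And>z. z \<in> ball z1 R \<Longrightarrow> (G0 has_field_derivative a * q z) (at z within ball z1 R)"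
  proof (rule holomorphic_convex_primitive'[OF convex_ball open_ball holomorphic_on_mult[OF holomorphic_on_const qh, of a]])
    fix g assume "\<And>z. z \<in> ball z1 R \<Longrightarrow> (g has_field_derivative a * q z) (at z within ball z1 R)"
    then show thesis by (rule that)
  qed
  define G where "G = (\<lambda>z. G0 z - G0 z1)"
  have G': "(G has_field_derivative a * q z) (at z within ball z1 R)" if "z \<in> ball z1 R" for z
    using DERIV_diff[OF G0[OF that] DERIV_const[of "G0 z1"]] unfolding G_def diff_0_right .
  have G: "(G has_field_derivative a * q z) (at z)" if "z \<in> ball z1 R" for z
    using G'[OF that] by (simp only: at_within_open[OF that open_ball])
  have Gh: "G holomorphic_on ball z1 R" using G' unfolding holomorphic_on_def field_differentiable_def by blast
  \<comment> \<open>Mean value inequality for G - a z, whose derivative a (q - 1) has modulus at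
    most |a| / 2.\<close>
  have lin: "cmod (G z - G w - a * (z - w)) \<le> cmod a / 2 * cmod (z - w)" if "z \<in> ball z1 R" "w \<in> ball z1 R" for z w
  proof -
    have "cmod ((G z - a * z) - (G w - a * w)) \<le> cmod a / 2 * cmod (z - w)"
    proof (rule field_differentiable_bound[of "ball z1 R" "\<lambda>z. G z - a * z" "\<lambda>z. a * q z - a"])
      fix u assume u: "u \<in> ball z1 R"
      show "((\<lambda>z. G z - a * z) has_field_derivative a * q u - a) (at u within ball z1 R)"
        using DERIV_diff[OF G'[OF u] DERIV_cmult[OF DERIV_ident, of a]] by simp
      have "cmod (a * q u - a) = cmod a * cmod (q u - 1)"
        by (simp add: right_diff_distrib flip: norm_mult)
      then show "cmod (a * q u - a) \<le> cmod a / 2"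
        using mult_left_mono[OF q1[OF u], of "cmod a"] by simp
    qed (use that in auto)
    then show ?thesis by (simp add: algebra_simps)
  qed
  have low: "cmod (G z - G w) \<ge> cmod a / 2 * cmod (z - w)" if "z \<in> ball z1 R" "w \<in> ball z1 R" for z w
  proof -
    have "cmod (a * (z - w)) \<le> cmod (G z - G w) + cmod (a * (z - w) - (G z - G w))"
      by (rule norm_triangle_sub)
    then show ?thesis using lin[OF that] norm_minus_commute[of "a * (z - w)" "G z - G w"] norm_mult[of a "z - w"] by linarith
  qed
  have Ginj: "inj_on G (ball z1 R)"
  proof (rule inj_onI)
    fix z w assume "z \<in> ball z1 R" "w \<in> ball z1 R" "G z = G w"
    then show "z = w" using low[of z w] a nz by (simp add: mult_le_0_iff)
  qed
  obtain g where g: "g holomorphic_on G ` ball z1 R" "\<And>z. z \<in> ball z1 R \<Longrightarrow> deriv G z * deriv g (G z) = 1"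
     "\<And>z. z \<in> ball z1 R \<Longrightarrow> g (G z) = z"
    by (rule holomorphic_has_inverse[OF Gh open_ball Ginj]) blast
  let ?r = "R * sqrt (cmod (\<phi> k z1)) / 2"
  have sub: "ball (0::complex) ?r \<subseteq> G ` ball z1 R"
  proof
    fix v :: complex assume v: "v \<in> ball 0 ?r"
    have a0: "cmod a > 0" using a(1) by simp
    have "cmod v < R * cmod a / 2" using v by (simp add: a(3))
    then have "2 * cmod v / cmod a < R" using a0 by (simp add: pos_divide_less_eq mult.commute)
    \<comment> \<open>A slightly smaller closed disc is used, on whose boundary G is still
      defined.\<close>
    then obtain r where r: "2 * cmod v / cmod a < r" "r < R" using dense by blast
    have r0: "0 < r" using r(1) by (smt (verit) divide_nonneg_nonneg norm_ge_zero)
    have cb: "cball z1 r \<subseteq> ball z1 R" using r by auto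
    have "ball (G z1) (cmod a * r / 2) \<subseteq> G ` ball z1 r"
    proof (rule ball_subset_open_map_image)
      show "continuous_on (closure (ball z1 r)) G"
        using holomorphic_on_imp_continuous_on[OF Gh] cb r0 by (simp add: continuous_on_subset)
      show "open (G ` interior (ball z1 r))"
        using open_mapping_thm3[OF holomorphic_on_subset[OF Gh] open_ball inj_on_subset[OF Ginj], of z1 r] r(2)
        by (simp add: subset_ball)
      show "cmod a * r / 2 \<le> norm (G z - G z1)" if "z \<in> frontier (ball z1 r)" for z
        using low[of z z1] that r0 r(2) R(1) by (simp add: frontier_ball dist_norm norm_minus_commute)
    qed (use r0 a0 in simp_all)
    moreover have "v \<in> ball (G z1) (cmod a * r / 2)"
      using r(1) a0 by (simp add: G_def pos_divide_less_eq mult.commute)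
    moreover have "ball z1 r \<subseteq> ball z1 R" using r by auto
    ultimately show "v \<in> G ` ball z1 R" by blast
  qed
  have r0: "?r > 0" using R nz by simp
  have gim: "g v \<in> ball z1 R \<and> G (g v) = v" if "v \<in> ball 0 ?r" for v
    using subsetD[OF sub that] g(3) by auto
  have gD: "(g has_field_derivative inverse (a * q (g v))) (at v)" if "v \<in> ball 0 ?r" for v
  proof -
    have "(g has_field_derivative deriv g v) (at v)"
      using holomorphic_on_subset[OF g(1) sub] holomorphic_derivI open_ball that by blast
    moreover have "deriv G (g v) = a * q (g v)" using G gim[OF that] DERIV_imp_deriv by blast
    then have "a * q (g v) * deriv g v = 1" using g(2)[of "g v"] gim[OF that] by metis
    then have "deriv g v = inverse (a * q (g v))" by (metis inverse_unique)
    ultimately show ?thesis by simp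
  qed
  define \<theta> where "\<theta> v = cmap k (g v)" for v
  have dom: "g v \<in> cdom k" if "v \<in> ball 0 ?r" for v using gim[OF that] R by blast
  have "flatmap (ball 0 ?r) \<theta>"
  proof (rule flatmapI)
    show "continuous_on (ball 0 ?r) \<theta>" unfolding \<theta>_def
      using dom holomorphic_on_imp_continuous_on[OF holomorphic_on_subset[OF g(1) sub]]
      by (intro continuous_on_compose2[OF cmap_continuous[OF k]]) auto
    fix v :: complex assume v: "v \<in> ball 0 ?r"
    have "((cinv k \<circ> \<theta>) has_field_derivative inverse (a * q (g v))) (at v)"
      by (rule has_field_derivative_transform_within_open[OF gD[OF v] open_ball v])
         (use dom in \<open>simp add: \<theta>_def cinv_cmap[OF k]\<close>)
    moreover have "\<phi> k (cinv k (\<theta> v)) * (inverse (a * q (g v)))\<^sup>2 = 1"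
    proof -
      have "\<phi> k (g v) / \<phi> k z1 \<noteq> 0" using Re[of "g v"] gim[OF v] by force
      then show ?thesis
        using a(2) nz cinv_cmap[OF k dom[OF v]]
        by (simp add: \<theta>_def q_def power_mult_distrib power_inverse)
    qed
    moreover have "\<theta> v \<in> cim k" using dom[OF v] by (simp add: \<theta>_def)
    ultimately show "\<exists>k\<in>A. \<theta> v \<in> cim k \<and> (\<exists>d. ((cinv k \<circ> \<theta>) has_field_derivative d) (at v) \<and>
          \<phi> k (cinv k (\<theta> v)) * d\<^sup>2 = 1)" using k by blast
  qed simp
  moreover have "inj_on \<theta> (ball 0 ?r)"
  proof (rule inj_onI)
    fix u v assume uv: "u \<in> ball 0 ?r" "v \<in> ball 0 ?r" "\<theta> u = \<theta> v"
    then have "g u = g v" using inj_onD[OF cmap_inj[OF k], of "g u" "g v"] dom by (simp add: \<theta>_def)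
    then show "u = v" using gim uv by metis
  qed
  moreover have "\<theta> 0 = cmap k z1"
    using g(3)[of z1] R by (simp add: \<theta>_def G_def)
  ultimately show ?thesis using that by blast
qed

lemma flat_disc_C_circ:
  assumes "x \<in> C_circ A \<phi>"
  obtains r \<theta> where "r > 0" "flatmap (ball 0 r) \<theta>" "inj_on \<theta> (ball 0 r)" "\<theta> 0 = x"
proof -
  obtain k where k: "k \<in> A" "x \<in> cim k" using exists_chart by blast
  let ?z = "cinv k x"
  have z: "?z \<in> cdom k" "cmap k ?z = x" "\<phi> k ?z \<noteq> 0"
    using k assms C_circ_iff[OF k] by (auto simp: cinv_in_cdom cmap_cinv)
  then have "\<not> is_pole (\<phi> k) ?z" using phi_pole[OF k(1)] by blast
  then have an: "\<phi> k analytic_on {?z}" using phi_analytic[OF k(1) z(1)] by blast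
  then obtain R1 where R1: "R1 > 0" "\<phi> k holomorphic_on ball ?z R1"
    by (auto simp: analytic_on_def)
  obtain R2 where R2: "R2 > 0" "ball ?z R2 \<subseteq> cdom k"
    using open_cdom[OF k(1)] z(1) by (auto simp: open_contains_ball)
  have "isCont (\<lambda>w. \<phi> k w / \<phi> k ?z) ?z"
    using analytic_at_imp_isCont[OF an] z(3) by (intro isCont_divide) auto
  from this[unfolded continuous_at_eps_delta, rule_format, of "1/2"]
  obtain R3 where R3: "R3 > 0" "\<And>w. dist w ?z < R3 \<Longrightarrow> dist (\<phi> k w / \<phi> k ?z) (\<phi> k ?z / \<phi> k ?z) < 1/2"
    by auto
  define R where "R = min R1 (min R2 R3)"
  have R: "R > 0" "ball ?z R \<subseteq> cdom k" "\<phi> k holomorphic_on ball ?z R"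
    using R1 R2 R3(1) by (auto simp: R_def intro: holomorphic_on_subset)
  have "cmod (\<phi> k w / \<phi> k ?z - 1) \<le> 1/2" if "w \<in> ball ?z R" for w
    using R3(2)[of w] that z(3) by (simp add: R_def dist_norm norm_minus_commute)
  then obtain \<theta> where t: "flatmap (ball 0 (R * sqrt (cmod (\<phi> k ?z)) / 2)) \<theta>"
    "inj_on \<theta> (ball 0 (R * sqrt (cmod (\<phi> k ?z)) / 2))" "\<theta> 0 = cmap k ?z"
    using flatmap_disc[OF k(1) R(1,2,3) z(3)] by blast
  show ?thesis using that[OF _ t(1,2)] t(3) R(1) z by simp
qed

lemma flat_coordinate_near:
  assumes "x \<in> C_circ A \<phi>"
  obtains k where "k \<in> flat_coordinates A \<phi>" "x \<in> cim k"
proof -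
  obtain r \<theta> where "r > 0" "flatmap (ball 0 r) \<theta>" "inj_on \<theta> (ball 0 r)" "\<theta> 0 = x"
    using flat_disc_C_circ[OF assms] .
  then show ?thesis using that[OF flatmap_flat_coordinate] by force
qed

lemma flat_coordinates_atlas: "k \<in> flat_coordinates A \<phi> \<Longrightarrow> k \<in> A"
  by (simp add: flat_coordinates_def)

text \<open>In a flat coordinate the derivative of a flat map squares to 1; being continuous with at
  most the two values 1 and -1, it is constant on a convex set.\<close>

lemma flatmap_in_flat_coordinate:
  assumes f: "flatmap U \<psi>" and k: "k \<in> flat_coordinates A \<phi>" and X: "convex X" "X \<subseteq> U" "\<psi> ` X \<subseteq> cim k"
  obtains \<sigma> c where "\<sigma> \<in> {1, -1}" "\<And>z. z \<in> X \<Longrightarrow> deriv (cinv k \<circ> \<psi>) z = \<sigma>" "\<And>z. z \<in> X \<Longrightarrow> cinv k (\<psi> z) = \<sigma> * z + c"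
proof -
  have kA: "k \<in> A" using k by (rule flat_coordinates_atlas)
  let ?h = "cinv k \<circ> \<psi>" and ?Y = "{z \<in> U. \<psi> z \<in> cim k}"
  have XY: "X \<subseteq> ?Y" using X by auto
  have Y: "open ?Y" using flatmap_preimage_open[OF f open_cim[OF kA]] .
  have d: "deriv ?h z \<in> {1, -1}" if "z \<in> X" for z
  proof -
    have "\<phi> k (cinv k (\<psi> z)) = 1" using k that X cinv_in_cdom[of "\<psi> z" k] by (auto simp: flat_coordinates_def)
    then have "(deriv ?h z)\<^sup>2 = 1" using flatmap_eq[OF f kA, of z] that X by auto
    then show ?thesis by (simp add: power2_eq_1_iff)
  qed
  have "continuous_on X (deriv ?h)"
    using holomorphic_on_imp_continuous_on[OF holomorphic_deriv[OF flatmap_holomorphic[OF f kA] Y]] XY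
    by (rule continuous_on_subset)
  moreover have "finite (deriv ?h ` X)" by (rule finite_subset[of _ "{1,-1}"]) (use d in auto)
  ultimately have "deriv ?h constant_on X"
    using continuous_finite_range_constant convex_connected[OF X(1)] by blast
  then obtain \<sigma>0 where s0: "\<And>z. z \<in> X \<Longrightarrow> deriv ?h z = \<sigma>0" by (auto simp: constant_on_def)
  \<comment> \<open>On the empty set \<open>\<sigma>0\<close> is arbitrary; the default 1 keeps
    \<sigma> a sign.\<close>
  define \<sigma> where "\<sigma> = (if X = {} then 1 else \<sigma>0)"
  have s: "\<sigma> \<in> {1,-1}" "\<And>z. z \<in> X \<Longrightarrow> deriv ?h z = \<sigma>" using s0 d by (auto simp: \<sigma>_def)
  have "((\<lambda>z. ?h z - \<sigma> * z) has_field_derivative 0) (at z within X)" if z: "z \<in> X" for z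
  proof -
    have "(?h has_field_derivative \<sigma>) (at z)"
      using flatmap_DERIV[OF f kA, of z] z XY s(2)[OF z] by auto
    from DERIV_diff[OF this DERIV_cmult[OF DERIV_ident, of \<sigma>]]
    show ?thesis by (simp add: has_field_derivative_at_within)
  qed
  then obtain c where "\<And>z. z \<in> X \<Longrightarrow> ?h z - \<sigma> * z = c"
    using has_field_derivative_zero_constant[OF X(1), of "\<lambda>z. ?h z - \<sigma> * z"] by blast
  then have "cinv k (\<psi> z) = \<sigma> * z + c" if "z \<in> X" for z
    using that by (auto simp: algebra_simps)
  then show ?thesis using that[OF s(1) s(2)] by blast
qed

text \<open>The set E where the lifts agree is open, and so is its complement. At a common base
  point both maps are affine in a flat coordinate: equal signs give equality nearby, opposite signs
  make the lifts differ nearby. Different base points are separated by the Hausdorff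
  property.\<close>

lemma flatmap_unique:
  assumes f: "flatmap U \<psi>" "flatmap U \<theta>" and U: "connected U" "z0 \<in> U" "lift \<psi> z0 = lift \<theta> z0" and z: "z \<in> U"
  shows "\<psi> z = \<theta> z" "lift \<psi> z = lift \<theta> z"
proof -
  define E where "E = {z \<in> U. lift \<psi> z = lift \<theta> z}"
  have "\<exists>W. open W \<and> z \<in> W \<and> W \<subseteq> U \<and> (W \<subseteq> E \<or> W \<inter> E = {})" if z: "z \<in> U" for z
  proof (cases "\<psi> z = \<theta> z")
    case True
    obtain k where k: "k \<in> flat_coordinates A \<phi>" "\<psi> z \<in> cim k"
      using flat_coordinate_near[OF flatmap_C_circ[OF f(1) z]] .
    note kA = flat_coordinates_atlas[OF k(1)]
    let ?O = "{z \<in> U. \<psi> z \<in> cim k} \<inter> {z \<in> U. \<theta> z \<in> cim k}"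
    have "open ?O" using flatmap_preimage_open[OF f(1) open_cim[OF kA]] flatmap_preimage_open[OF f(2) open_cim[OF kA]]
      by (rule open_Int)
    moreover have "z \<in> ?O" using z k True by auto
    ultimately obtain r where r: "r > 0" "ball z r \<subseteq> ?O" using openE by blast
    let ?W = "ball z r"
    have W: "?W \<subseteq> U" "\<psi> ` ?W \<subseteq> cim k" "\<theta> ` ?W \<subseteq> cim k" using r(2) by auto
    obtain \<sigma> c where 1: "\<sigma> \<in> {1, -1}" "\<And>z. z \<in> ?W \<Longrightarrow> deriv (cinv k \<circ> \<psi>) z = \<sigma>" "\<And>z. z \<in> ?W \<Longrightarrow> cinv k (\<psi> z) = \<sigma> * z + c"
      by (rule flatmap_in_flat_coordinate[OF f(1) k(1) convex_ball W(1,2)]) blast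
    obtain \<tau> d where 2: "\<tau> \<in> {1, -1}" "\<And>z. z \<in> ?W \<Longrightarrow> deriv (cinv k \<circ> \<theta>) z = \<tau>" "\<And>z. z \<in> ?W \<Longrightarrow> cinv k (\<theta> z) = \<tau> * z + d"
      by (rule flatmap_in_flat_coordinate[OF f(2) k(1) convex_ball W(1,3)]) blast
    have zW: "z \<in> ?W" using r by simp
    show ?thesis
    proof (cases "\<sigma> = \<tau>")
      case t: True
      have "c = d" using 1(3)[OF zW] 2(3)[OF zW] True t by simp
      then have "cinv k (\<psi> w) = cinv k (\<theta> w)" if "w \<in> ?W" for w using 1(3) 2(3) t that by simp
      then have "\<psi> w = \<theta> w" if "w \<in> ?W" for w
        using W that by (metis cmap_cinv image_subset_iff)
      then have "lift \<psi> w = lift \<theta> w" if "w \<in> ?W" for w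
        using lift_cong[OF open_ball that] by blast
      then have "?W \<subseteq> E" using W by (auto simp: E_def)
      then show ?thesis using W zW by blast
    next
      case False
      have "lift \<psi> w \<noteq> lift \<theta> w" if "w \<in> ?W" for w
      proof
        assume "lift \<psi> w = lift \<theta> w"
        then have "snd (lift \<psi> w) k = snd (lift \<theta> w) k" by simp
        moreover have "\<psi> w \<in> cim k" "\<theta> w \<in> cim k" using W that by auto
        ultimately have "1 / \<sigma> = 1 / \<tau>" using 1(2)[OF that] 2(2)[OF that] kA by (simp add: lift_def)
        then show False using False by simp
      qed
      then have "?W \<inter> E = {}" by (auto simp: E_def)
      then show ?thesis using W zW by blast
    qed
  next
    case False
    obtain P Q where PQ: "open P" "open Q" "\<psi> z \<in> P" "\<theta> z \<in> Q" "P \<inter> Q = {}" using hausdorff[OF False] by blast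
    let ?W = "{z \<in> U. \<psi> z \<in> P} \<inter> {z \<in> U. \<theta> z \<in> Q}"
    have "open ?W" using flatmap_preimage_open f PQ by (intro open_Int) auto
    moreover have "?W \<inter> E = {}"
    proof (rule ccontr)
      assume "?W \<inter> E \<noteq> {}"
      then obtain w where w: "w \<in> ?W" "lift \<psi> w = lift \<theta> w" by (auto simp: E_def)
      then have "\<psi> w = \<theta> w" using fst_lift by metis
      then show False using w PQ by auto
    qed
    moreover have "z \<in> ?W" using z PQ by auto
    ultimately show ?thesis by blast
  qed
  then obtain W where W: "\<And>z. z \<in> U \<Longrightarrow> open (W z) \<and> z \<in> W z \<and> W z \<subseteq> U \<and> (W z \<subseteq> E \<or> W z \<inter> E = {})"
    by metis
  have "E = (\<Union>z\<in>E. W z)" "U - E = (\<Union>z\<in>U - E. W z)" using W E_def by blast+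
  then have "open E" "open (U - E)" using W E_def by (metis (no_types, lifting) DiffD1 mem_Collect_eq open_UN)+
  moreover have "E \<inter> (U - E) \<inter> U = {}" "U \<subseteq> E \<union> (U - E)" "E \<inter> U \<noteq> {}" using U by (auto simp: E_def)
  ultimately have "(U - E) \<inter> U = {}" using connectedD[OF U(1)] by blast
  then have "z \<in> E" using z by blast
  then show "lift \<psi> z = lift \<theta> z" by (simp add: E_def)
  then show "\<psi> z = \<theta> z" using fst_lift by metis
qed

text \<open>Unique continuation for two maps recentred at z and v: q is the common displacement, and
  \<sigma> is the sign relating the two coordinates.\<close>

lemma flatmap_matching:
  assumes f: "flatmap U \<psi>" "flatmap V \<theta>" "z \<in> U" "v \<in> V" "\<sigma>\<^sup>2 = 1" "lift \<psi> z = smul \<sigma> (lift \<theta> v)"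
    and Q: "open Q" "connected Q" "0 \<in> Q" "\<And>q. q \<in> Q \<Longrightarrow> z + q \<in> U \<and> v + \<sigma> * q \<in> V" "q \<in> Q"
  shows "\<psi> (z + q) = \<theta> (v + \<sigma> * q)" "lift \<psi> (z + q) = smul \<sigma> (lift \<theta> (v + \<sigma> * q))"
proof -
  have 1: "flatmap Q (\<lambda>q. \<psi> (1 * q + z))"
    by (rule flatmap_subset[OF flatmap_affine(1)[OF f(1)] Q(1)]) (use Q in \<open>auto simp: add.commute\<close>)
  have 2: "flatmap Q (\<lambda>q. \<theta> (\<sigma> * q + v))"
    by (rule flatmap_subset[OF flatmap_affine(1)[OF f(2,5)] Q(1)]) (use Q in \<open>auto simp: add.commute\<close>)
  have l1: "lift (\<lambda>q. \<psi> (1 * q + z)) q = lift \<psi> (z + q)" if "q \<in> Q" for q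
    using lift_affine[OF f(1), of 1 q z] Q(4)[OF that] by (simp add: add.commute)
  have l2: "lift (\<lambda>q. \<theta> (\<sigma> * q + v)) q = smul \<sigma> (lift \<theta> (v + \<sigma> * q))" if "q \<in> Q" for q
    using lift_affine[OF f(2,5), of q v] Q(4)[OF that] by (simp add: add.commute)
  have "lift (\<lambda>q. \<psi> (1 * q + z)) 0 = lift (\<lambda>q. \<theta> (\<sigma> * q + v)) 0"
    using l1[OF Q(3)] l2[OF Q(3)] f(6) by simp
  note u = flatmap_unique[OF 1 2 Q(2,3) this Q(5)]
  show "\<psi> (z + q) = \<theta> (v + \<sigma> * q)" using u(1) by (simp add: add.commute)
  show "lift \<psi> (z + q) = smul \<sigma> (lift \<theta> (v + \<sigma> * q))" using u(2) l1[OF Q(5)] l2[OF Q(5)] by simp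
qed

lemma lift_sign:
  assumes "flatmap U \<psi>" "flatmap V \<theta>" "z \<in> U" "v \<in> V" "\<psi> z = \<theta> v"
  obtains \<sigma> where "\<sigma> \<in> {1,-1}" "\<sigma>\<^sup>2 = 1" "lift \<psi> z = smul \<sigma> (lift \<theta> v)"
proof -
  obtain \<sigma> where "\<sigma> \<in> {1,-1}" "lift \<psi> z = smul \<sigma> (lift \<theta> v)"
    using spectral_same_fibre[OF lift_in_spectral_curve[OF assms(1,3)] lift_in_spectral_curve[OF assms(2,4)]] assms(5)
    by (metis fst_lift)
  then show ?thesis using that[of \<sigma>] by auto
qed

subsection \<open>Behaviour near the zeroes\<close>

abbreviation zchart :: "'c \<Rightarrow> 'c coord" where "zchart b \<equiv> (ball 0 (\<rho> b), \<xi> b)"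

lemma zchart:
  assumes "b \<in> qd_zeros A \<phi>"
  shows "zchart b \<in> A" "\<rho> b > 0" "\<xi> b 0 = b" "\<And>w. w \<in> ball 0 (\<rho> b) \<Longrightarrow> \<phi> (zchart b) w = w"
  using zero_charts assms by (auto simp: zero_charts_def)

lemma zchart_disjoint:
  assumes "b \<in> qd_zeros A \<phi>" "b' \<in> qd_zeros A \<phi>" "b \<noteq> b'"
  shows "cim (zchart b) \<inter> cim (zchart b') = {}"
  using zero_charts assms by (auto simp: zero_charts_def disjoint_family_on_def)

text \<open>
  In the chart \<open>w\<close> at a zero, \<open>2/3 w\<^bsup>3/2\<^esup>\<close> is a flat coordinate.  In terms of a flat map it is
  \<open>2/3 w\<^sup>2 w'\<close>, which involves no choice of a branch.
\<close>

definition zdisp :: "'c \<Rightarrow> (complex \<Rightarrow> 'c) \<Rightarrow> complex \<Rightarrow> complex" where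
  "zdisp b \<psi> z = 2/3 * (cinv (zchart b) (\<psi> z))\<^sup>2 * deriv (cinv (zchart b) \<circ> \<psi>) z"

text \<open>Differentiating w w'^2 = 1 and cancelling w' gives w'^2 + 2 w w'' = 0, which is exactly
  what makes 2/3 w^2 w' have derivative 1. Its square is 4/9 w^3 by the first equation. So
  \<open>zdisp\<close> is the flat displacement from the zero.\<close>

lemma zdisp:
  assumes b: "b \<in> qd_zeros A \<phi>" and f: "flatmap U \<psi>" and z: "z \<in> U" "\<psi> z \<in> cim (zchart b)"
  shows "(zdisp b \<psi> has_field_derivative 1) (at z)"
    and "(zdisp b \<psi> z)\<^sup>2 = 4/9 * (cinv (zchart b) (\<psi> z)) ^ 3"
    and "4/9 * (cmod (cinv (zchart b) (\<psi> z))) ^ 3 = (cmod (zdisp b \<psi> z))\<^sup>2"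
    and "cinv (zchart b) (\<psi> z) \<noteq> 0"
proof -
  let ?k = "zchart b"
  note k = zchart[OF b]
  define Y where "Y = {z \<in> U. \<psi> z \<in> cim ?k}"
  define w where "w = cinv ?k \<circ> \<psi>"
  have Y: "open Y" unfolding Y_def using flatmap_preimage_open[OF f open_cim[OF k(1)]] .
  have zY: "z \<in> Y" using z by (simp add: Y_def)
  have hw: "w holomorphic_on Y" unfolding w_def Y_def by (rule flatmap_holomorphic[OF f k(1)])
  have eq: "w y * (deriv w y)\<^sup>2 = 1" if "y \<in> Y" for y
    using flatmap_eq[OF f k(1), of y] that k(4)[of "w y"] cinv_in_cdom[of "\<psi> y" ?k] by (simp add: Y_def w_def)
  have dw: "(w has_field_derivative deriv w z) (at z)" using holomorphic_derivI[OF hw Y zY] .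
  have ddw: "(deriv w has_field_derivative deriv (deriv w) z) (at z)"
    using holomorphic_derivI[OF holomorphic_deriv[OF hw Y] Y zY] .
  let ?d = "deriv w z" and ?e = "deriv (deriv w) z"
  have nz: "w z \<noteq> 0" "?d \<noteq> 0" using eq[OF zY] by auto
  have "((\<lambda>y. w y * (deriv w y)\<^sup>2) has_field_derivative ?d * ?d\<^sup>2 + 2 * w z * ?d * ?e) (at z)"
    using DERIV_mult[OF dw DERIV_power[OF ddw, of 2]] by (simp add: algebra_simps)
  moreover have "((\<lambda>y. w y * (deriv w y)\<^sup>2) has_field_derivative 0) (at z)"
    by (rule has_field_derivative_transform_within_open[of "\<lambda>y. 1" _ _ Y]) (use Y zY eq in auto)
  ultimately have "?d * ?d\<^sup>2 + 2 * w z * ?d * ?e = 0" using DERIV_unique by blast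
  then have "?d * (?d\<^sup>2 + 2 * w z * ?e) = 0" by (simp add: algebra_simps)
  then have e: "?d\<^sup>2 + 2 * w z * ?e = 0" using nz by simp
  have "((\<lambda>y. 2/3 * ((w y)\<^sup>2 * deriv w y)) has_field_derivative 2/3 * (2 * w z * ?d * ?d + (w z)\<^sup>2 * ?e)) (at z)"
    using DERIV_cmult[OF DERIV_mult[OF DERIV_power[OF dw, of 2] ddw], of "2/3"] by (simp add: algebra_simps)
  moreover have "2/3 * (2 * w z * ?d * ?d + (w z)\<^sup>2 * ?e) = 1"
  proof -
    have "2 * (w z)\<^sup>2 * ?e = - (w z * ?d\<^sup>2)" using e by algebra
    then show ?thesis using eq[OF zY] by algebra
  qed
  ultimately show "(zdisp b \<psi> has_field_derivative 1) (at z)"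
    by (simp add: zdisp_def[abs_def] w_def o_def mult.assoc)
  have "(2/3 * (w z)\<^sup>2 * ?d)\<^sup>2 = 4/9 * (w z)^3 * (w z * ?d\<^sup>2)" by (simp add: power2_eq_square power3_eq_cube)
  then show sq: "(zdisp b \<psi> z)\<^sup>2 = 4/9 * (cinv ?k (\<psi> z)) ^ 3"
    using eq[OF zY] by (simp add: zdisp_def w_def)
  show "4/9 * (cmod (cinv ?k (\<psi> z))) ^ 3 = (cmod (zdisp b \<psi> z))\<^sup>2"
    using arg_cong[OF sq, of cmod] by (simp add: norm_mult norm_power)
  show "cinv ?k (\<psi> z) \<noteq> 0" using nz by (simp add: w_def)
qed

lemma compact_zchart_image:
  assumes "b \<in> qd_zeros A \<phi>" "r < \<rho> b"
  shows "compact (\<xi> b ` cball 0 r)"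
proof (rule compact_continuous_image)
  show "continuous_on (cball 0 r) (\<xi> b)"
    by (rule continuous_on_subset[OF cmap_continuous[OF zchart(1)[OF assms(1)], unfolded fst_conv snd_conv]])
       (use assms(2) in auto)
qed simp

text \<open>The relation \<open>zdisp b \<psi> z = z - c\<close> propagates over Q. It is an open
  condition because the difference of both sides is locally constant. It is a closed one because,
  while it holds, 4/9 |w|^3 = |z - c|^2 < r^2 confines w to the compact disc of radius \<rho>1
  inside the chart. The value z = c would force w = 0, that is, the zero itself.\<close>

lemma zero_chart_extend:
  assumes b: "b \<in> qd_zeros A \<phi>" and f: "flatmap Q \<psi>" and Q: "connected Q" "Q \<subseteq> ball c r"
    and r: "9 * r\<^sup>2 \<le> 4 * \<rho>1 ^ 3" "\<rho>1 < \<rho> b" "0 < \<rho>1"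
    and z0: "z0 \<in> Q" "\<psi> z0 \<in> cim (zchart b)" "zdisp b \<psi> z0 = z0 - c" and z: "z \<in> Q"
  shows "\<psi> z \<in> cim (zchart b)" "zdisp b \<psi> z = z - c"
    "4/9 * (cmod (cinv (zchart b) (\<psi> z))) ^ 3 = (cmod (z - c))\<^sup>2" "z \<noteq> c"
proof -
  let ?k = "zchart b"
  note k = zchart[OF b]
  define Y where "Y = {z \<in> Q. \<psi> z \<in> cim ?k}"
  define E where "E = {z \<in> Y. zdisp b \<psi> z = z - c}"
  have Y: "open Y" unfolding Y_def using flatmap_preimage_open[OF f open_cim[OF k(1)]] .
  have DY: "(zdisp b \<psi> has_field_derivative 1) (at y)" if "y \<in> Y" for y
    using zdisp(1)[OF b f] that by (simp add: Y_def)
  have opE: "open E"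
    unfolding open_contains_ball
  proof
    fix y assume y: "y \<in> E"
    then obtain e where e: "e > 0" "ball y e \<subseteq> Y" using Y by (auto simp: E_def open_contains_ball)
    have "((\<lambda>z. zdisp b \<psi> z - z) has_field_derivative 0) (at u within ball y e)" if "u \<in> ball y e" for u
      using DERIV_diff[OF DY[OF subsetD[OF e(2) that]] DERIV_ident]
      by (simp only: diff_self has_field_derivative_at_within)
    then obtain d where d: "\<And>u. u \<in> ball y e \<Longrightarrow> zdisp b \<psi> u - u = d"
      using has_field_derivative_zero_constant[OF convex_ball[of y e], of "\<lambda>z. zdisp b \<psi> z - z"] by blast
    moreover have "zdisp b \<psi> y = y - c" using y by (simp add: E_def)
    ultimately have "d = - c" using e by (metis centre_in_ball diff_add_cancel add_diff_cancel_left' uminus_add_conv_diff add.commute)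
    then have "ball y e \<subseteq> E" using d e by (auto simp: E_def algebra_simps subset_iff)
    then show "\<exists>e>0. ball y e \<subseteq> E" using e by blast
  qed
  define K where "K = {z \<in> Q. \<psi> z \<in> \<xi> b ` cball 0 \<rho>1}"
  have K1: "closedin (top_of_set Q) K"
  proof -
    have "closed (\<xi> b ` cball 0 \<rho>1)" using compact_imp_closed[OF compact_zchart_image[OF b r(2)]] .
    then have "closedin (top_of_set Q) (Q \<inter> \<psi> -` (\<xi> b ` cball 0 \<rho>1))"
      by (rule continuous_closedin_preimage[OF flatmap_continuous[OF f]])
    then show ?thesis by (simp add: K_def Int_def vimage_def)
  qed
  have KY: "K \<subseteq> Y" using r by (auto simp: K_def Y_def)
  have EK: "E \<subseteq> K"
  proof
    fix y assume y: "y \<in> E"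
    let ?w = "cinv ?k (\<psi> y)"
    have yQ: "y \<in> Q" "\<psi> y \<in> cim ?k" "zdisp b \<psi> y = y - c" using y by (auto simp: E_def Y_def)
    have "dist c y < r" using yQ(1) Q(2) by auto
    then have "(cmod (y - c))\<^sup>2 \<le> r\<^sup>2" by (intro power_mono) (simp_all add: dist_norm norm_minus_commute)
    then have "(cmod ?w) ^ 3 \<le> \<rho>1 ^ 3"
      using zdisp(3)[OF b f yQ(1,2)] yQ(3) r(1) by simp
    then have "cmod ?w \<le> \<rho>1" using r(3) power_le_imp_le_base[of "cmod ?w" 2 \<rho>1] by (simp add: numeral_3_eq_3)
    moreover have "\<psi> y = \<xi> b ?w" using cmap_cinv[OF yQ(2)] by simp
    ultimately show "y \<in> K" using yQ by (auto simp: K_def)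
  qed
  have "closedin (top_of_set K) (K \<inter> (\<lambda>z. zdisp b \<psi> z - z) -` {- c})"
  proof (rule continuous_closedin_preimage)
    have "isCont (zdisp b \<psi>) y" if "y \<in> K" for y using DERIV_isCont[OF DY] that KY by blast
    then show "continuous_on K (\<lambda>z. zdisp b \<psi> z - z)"
      by (intro continuous_intros continuous_at_imp_continuous_on) auto
  qed simp
  moreover have "K \<inter> (\<lambda>z. zdisp b \<psi> z - z) -` {- c} = E"
    using EK KY by (auto simp: E_def algebra_simps)
  ultimately have "closedin (top_of_set Q) E" using closedin_trans K1 by metis
  moreover have "openin (top_of_set Q) E" using opE flatmap_open[OF f] by (auto simp: openin_open_eq E_def Y_def)
  moreover have "z0 \<in> E" using z0 by (simp add: E_def Y_def)
  ultimately have EQ: "E = Q" using Q(1) connected_clopen by blast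
  then show 1: "\<psi> z \<in> cim ?k" "zdisp b \<psi> z = z - c" using z by (auto simp: E_def Y_def)
  then show 2: "4/9 * (cmod (cinv ?k (\<psi> z))) ^ 3 = (cmod (z - c))\<^sup>2" using zdisp(3)[OF b f z] by simp
  show "z \<noteq> c" using 2 zdisp(4)[OF b f z 1(1)] by auto
qed

text \<open>The zero would have the flat position c = z - \<open>zdisp b \<psi> z\<close>, which
  lies in the disc; but continuing the chart of b over the disc shows that no point of it can be c.
  Since the disc lies in \<open>ball c (2 * e)\<close>, the smallness needed is 9 (2 e)^2 < 4
  \<rho>^3.\<close>

lemma no_zero_near:
  assumes f: "flatmap U \<psi>" and e: "ball z e \<subseteq> U" "0 < e"
    and b: "b \<in> qd_zeros A \<phi>" "9 * e\<^sup>2 < \<rho> b ^ 3"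
    and w: "\<psi> z = \<xi> b w" "w \<in> ball 0 (\<rho> b)" "4/9 * cmod w ^ 3 < e\<^sup>2"
  shows False
proof -
  note k = zchart[OF b(1)]
  have zU: "z \<in> U" "\<psi> z \<in> cim (zchart b)" using e w by auto
  have cw: "cinv (zchart b) (\<psi> z) = w" using cinv_cmap[OF k(1), of w] w by simp
  define c where "c = z - zdisp b \<psi> z"
  have "(cmod (z - c))\<^sup>2 < e\<^sup>2" using zdisp(3)[OF b(1) f zU] cw w(3) by (simp add: c_def)
  then have c: "c \<in> ball z e" using e(2) by (simp add: dist_norm power2_less_imp_less)
  obtain x where x: "9 * e\<^sup>2 < x" "x < \<rho> b ^ 3" using dense[OF b(2)] by blast
  define \<rho>1 where "\<rho>1 = root 3 x"
  have x0: "x > 0" using x(1) e(2) by (smt (verit) zero_less_power)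
  have r1: "\<rho>1 ^ 3 = x" "\<rho>1 > 0" using x0 by (simp_all add: \<rho>1_def odd_real_root_pow)
  have r1b: "\<rho>1 < \<rho> b" using x(2) r1 k(2) power_less_imp_less_base[of \<rho>1 3 "\<rho> b"] by simp
  have r9: "9 * (2 * e)\<^sup>2 \<le> 4 * \<rho>1 ^ 3" using x(1) r1(1) by (simp add: power_mult_distrib)
  have sub: "ball z e \<subseteq> ball c (2 * e)"
  proof
    fix x assume "x \<in> ball z e"
    then show "x \<in> ball c (2 * e)" using c dist_triangle[of c x z] by (simp add: dist_commute)
  qed
  have zin: "z \<in> ball z e" using e by simp
  have disp: "zdisp b \<psi> z = z - c" by (simp add: c_def)
  have fl: "flatmap (ball z e) \<psi>" by (rule flatmap_subset[OF f open_ball e(1)])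
  have "c \<noteq> c" by (rule zero_chart_extend(4)[OF b(1) fl connected_ball sub r9 r1b r1(2) zin zU(2) disp c])
  then show False by simp
qed

subsection \<open>Poles and compactness\<close>

text \<open>Completeness enters here: in the absence of simple poles the order m is at least
  2.\<close>

lemma pole_chart:
  assumes "x \<in> qd_poles A \<phi>"
  obtains k z0 r g m where "k \<in> A" "z0 \<in> cdom k" "cmap k z0 = x" "r > 0" "cball z0 r \<subseteq> cdom k"
    "g holomorphic_on cball z0 r" "\<forall>w\<in>cball z0 r. g w \<noteq> 0" "m \<ge> (2::nat)"
    "\<forall>w\<in>cball z0 r - {z0}. \<phi> k w = g w / (w - z0) ^ m"
proof -
  obtain k z0 where k: "k \<in> A" "z0 \<in> cdom k" "cmap k z0 = x" "is_pole (\<phi> k) z0"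
    using assms by (auto simp: qd_poles_def)
  have "\<phi> k meromorphic_on {z0}"
    using phi_nicely[OF k(1)] k(2) unfolding nicely_meromorphic_on_def by (auto intro: meromorphic_on_subset)
  then have "isolated_singularity_at (\<phi> k) z0" by (simp add: meromorphic_at_iff)
  then obtain r1 where r1: "r1 > 0" "\<phi> k analytic_on ball z0 r1 - {z0}" by (auto simp: isolated_singularity_at_def)
  obtain r2 where r2: "r2 > 0" "ball z0 r2 \<subseteq> cdom k" using open_cdom[OF k(1)] k(2) openE by blast
  let ?S = "ball z0 (min r1 r2)"
  have "\<phi> k holomorphic_on ?S - {z0}"
    using analytic_imp_holomorphic[OF r1(2)] by (rule holomorphic_on_subset) auto
  moreover have "z0 \<in> ?S" using r1 r2 by simp
  ultimately have z: "zorder (\<phi> k) z0 < 0 \<and> zor_poly (\<phi> k) z0 z0 \<noteq> 0 \<and> (\<exists>r. r > 0 \<and> cball z0 r \<subseteq> ?S \<and>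
      zor_poly (\<phi> k) z0 holomorphic_on cball z0 r \<and>
      (\<forall>w\<in>cball z0 r - {z0}. \<phi> k w = zor_poly (\<phi> k) z0 w / (w - z0) ^ nat (- zorder (\<phi> k) z0) \<and> zor_poly (\<phi> k) z0 w \<noteq> 0))"
    by (intro zorder_exist_pole k(4)) auto
  then obtain r where r: "r > 0" "cball z0 r \<subseteq> ?S" "zor_poly (\<phi> k) z0 holomorphic_on cball z0 r"
      "\<And>w. w \<in> cball z0 r - {z0} \<Longrightarrow> \<phi> k w = zor_poly (\<phi> k) z0 w / (w - z0) ^ nat (- zorder (\<phi> k) z0)"
      "\<And>w. w \<in> cball z0 r - {z0} \<Longrightarrow> zor_poly (\<phi> k) z0 w \<noteq> 0" by blast
  have "zorder (\<phi> k) z0 \<noteq> -1"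
    using complete k unfolding complete_GMN_def qd_simple_poles_def by blast
  then have m: "nat (- zorder (\<phi> k) z0) \<ge> 2" using z by linarith
  have nz: "zor_poly (\<phi> k) z0 w \<noteq> 0" if "w \<in> cball z0 r" for w
    using r(5)[of w] z that by (cases "w = z0") auto
  have sub: "cball z0 r \<subseteq> cdom k" using r(2) r2(2) by (meson ball_subset_ball_iff min.cobounded2 order_trans subset_ball)
  show ?thesis by (rule that[OF k(1-3) r(1) sub r(3) _ m]) (use nz r(4) in blast)+
qed

text \<open>A punctured disc, connected and free of zeroes; it serves both the finiteness of the
  zeroes and the connectedness of \<open>C_tilde A \<phi>\<close>.\<close>

lemma pole_neighbourhood:
  assumes "x \<in> qd_poles A \<phi>"
  obtains N where "open N" "x \<in> N" "N - {x} \<subseteq> C_circ A \<phi>" "connected (N - {x})" "N - {x} \<noteq> {}"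
proof -
  obtain k z0 r g m where k: "k \<in> A" "z0 \<in> cdom k" "cmap k z0 = x" "r > 0" "cball z0 r \<subseteq> cdom k"
    "g holomorphic_on cball z0 r" "\<forall>w\<in>cball z0 r. g w \<noteq> 0" "m \<ge> (2::nat)"
    "\<forall>w\<in>cball z0 r - {z0}. \<phi> k w = g w / (w - z0) ^ m"
    using pole_chart[OF assms] .
  let ?N = "cmap k ` ball z0 r"
  have sub: "ball z0 r \<subseteq> cdom k" using k(5) by auto
  have eq: "?N - {x} = cmap k ` (ball z0 r - {z0})"
    using inj_on_image_set_diff[OF cmap_inj[OF k(1)], of "ball z0 r" "{z0}"] sub k(2,3) by auto
  have "connected (cmap k ` (ball z0 r - {z0}))"
    by (rule connected_continuous_image[OF continuous_on_subset[OF cmap_continuous[OF k(1)]] connected_punctured_ball])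
       (use sub in auto)
  moreover have "cmap k ` (ball z0 r - {z0}) \<subseteq> C_circ A \<phi>"
  proof
    fix y assume "y \<in> cmap k ` (ball z0 r - {z0})"
    then obtain w where w: "w \<in> ball z0 r" "w \<noteq> z0" "y = cmap k w" by blast
    then have "w \<in> cball z0 r - {z0}" by auto
    then have "\<phi> k w \<noteq> 0" using bspec[OF k(7), of w] bspec[OF k(9), of w] by auto
    then show "y \<in> C_circ A \<phi>" using C_circ_chart[OF k(1), of w] w sub by auto
  qed
  moreover have "z0 + of_real (r/2) \<in> ball z0 r - {z0}" using k(4) by (simp add: dist_norm)
  then have "cmap k ` (ball z0 r - {z0}) \<noteq> {}" by blast
  moreover have "open ?N" using cmap_open_image[OF k(1) open_ball sub] .
  moreover have "x \<in> ?N" using k(3,4) by force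
  ultimately show ?thesis using that[of ?N] eq by metis
qed

text \<open>A point at small distance d from a pole of order m \<ge> 2 has a coordinate disc of
  radius \<kappa> d on which \<phi> is nearly constant, with modulus at least (a/2) / d^2 at the
  centre. Its flat radius is therefore bounded below independently of d: poles are infinitely far
  away.\<close>

lemma pole_discs:
  assumes "x \<in> qd_poles A \<phi>"
  obtains N r where "open N" "x \<in> N" "r > 0" "\<And>y. y \<in> N - {x} \<Longrightarrow> \<exists>\<theta>. flatmap (ball 0 r) \<theta> \<and> \<theta> 0 = y"
proof -
  obtain k z0 r g m where k: "k \<in> A" "z0 \<in> cdom k" "cmap k z0 = x" "r > 0" "cball z0 r \<subseteq> cdom k"
    "g holomorphic_on cball z0 r" "\<forall>w\<in>cball z0 r. g w \<noteq> 0" "m \<ge> (2::nat)"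
    "\<forall>w\<in>cball z0 r - {z0}. \<phi> k w = g w / (w - z0) ^ m"
    using pole_chart[OF assms] .
  define a where "a = cmod (g z0)"
  have a: "a > 0" using k(4) bspec[OF k(7), of z0] by (simp add: a_def)
  have "isCont g z0"
    using holomorphic_on_imp_continuous_on[OF holomorphic_on_subset[OF k(6) ball_subset_cball]] k(4)
    by (simp add: continuous_on_eq_continuous_at)
  from this[unfolded continuous_at_eps_delta, rule_format, of "a / 20"] a
  obtain d1 where d1: "d1 > 0" "\<And>w. dist w z0 < d1 \<Longrightarrow> dist (g w) (g z0) < a / 20" by auto
  \<comment> \<open>The ratio of two values of \<phi> is a ratio of values of g times (1/t)^m with t
    = (w - z0) / (z1 - z0); on a disc of radius \<kappa> d around z1 the number t is within \<kappa>
    of 1, uniformly in d.\<close>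
  have "isCont (\<lambda>t. (1 / t) ^ m) (1::complex)" by (intro isCont_power isCont_divide) auto
  from this[unfolded continuous_at_eps_delta, rule_format, of "1/8"]
  obtain d2 where d2: "d2 > 0" "\<And>t. dist t 1 < d2 \<Longrightarrow> dist ((1 / t) ^ m) (1::complex) < 1/8" by auto
  define \<kappa> where "\<kappa> = min d2 (1/2)"
  have \<kappa>: "0 < \<kappa>" "\<kappa> \<le> 1/2" "\<kappa> \<le> d2" using d2(1) by (auto simp: \<kappa>_def)
  define s where "s = min (r/2) (min (d1/2) (1/2))"
  have s: "0 < s" "s \<le> r/2" "s \<le> d1/2" "s \<le> 1/2" using k(4) d1(1) by (auto simp: s_def)
  \<comment> \<open>Half of \<kappa> d times sqrt ((a/2) / d^2), a lower bound for the radius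
    supplied by \<open>flatmap_disc\<close>.\<close>
  define r' where "r' = \<kappa> * sqrt (a / 2) / 2"
  let ?N = "cmap k ` ball z0 s"
  have sub: "ball z0 s \<subseteq> cdom k" using k(5) s by force
  have "\<exists>\<theta>. flatmap (ball 0 r') \<theta> \<and> \<theta> 0 = y" if y: "y \<in> ?N - {x}" for y
  proof -
    obtain z1 where z1: "z1 \<in> ball z0 s" "y = cmap k z1" using y by blast
    have z10: "z1 \<noteq> z0" using y k(3) z1(2) by blast
    define d where "d = cmod (z1 - z0)"
    have d: "0 < d" "d < s" using z1 z10 by (auto simp: d_def dist_norm norm_minus_commute)
    define R where "R = \<kappa> * d"
    have R: "R > 0" "R \<le> d / 2" using \<kappa> d by (auto simp: R_def)
    have near: "w \<in> cball z0 r - {z0} \<and> dist w z0 < d1" if "w \<in> ball z1 R" for w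
    proof -
      have "dist w z0 < 2 * d" "w \<noteq> z0"
        using that dist_triangle[of w z0 z1] R d by (auto simp: d_def dist_norm norm_minus_commute)
      then show ?thesis using d s by (auto simp: dist_commute)
    qed
    have z1b: "z1 \<in> ball z1 R" using R by simp
    have gz1: "cmod (g z1) \<ge> 19/20 * a"
      using d1(2)[of z1] near[OF z1b] norm_triangle_ineq2[of "g z0" "g z0 - g z1"]
      by (simp add: a_def dist_norm norm_minus_commute)
    have nz: "\<phi> k z1 \<noteq> 0" using bspec[OF k(7), of z1] bspec[OF k(9), of z1] near[OF z1b] by auto
    have hol: "\<phi> k holomorphic_on ball z1 R"
    proof -
      have "(\<lambda>w. g w / (w - z0) ^ m) holomorphic_on ball z1 R"
        using near by (intro holomorphic_intros holomorphic_on_subset[OF k(6)]) auto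
      then show ?thesis by (rule holomorphic_transform) (use k(9) near in auto)
    qed
    have ratio: "cmod (\<phi> k w / \<phi> k z1 - 1) \<le> 1/2" if w: "w \<in> ball z1 R" for w
    proof -
      define u where "u = g w / g z1"
      define t where "t = (w - z0) / (z1 - z0)"
      have "\<phi> k w / \<phi> k z1 = u * (1 / t) ^ m"
      proof -
        have "\<phi> k w = g w / (w - z0) ^ m" "\<phi> k z1 = g z1 / (z1 - z0) ^ m"
          using bspec[OF k(9), of w] bspec[OF k(9), of z1] near[OF w] near[OF z1b] by blast+
        then show ?thesis by (simp add: u_def t_def power_divide mult.commute)
      qed
      moreover have "cmod (u - 1) \<le> 1/8"
      proof -
        have "cmod (g w - g z1) \<le> a / 10"
          using d1(2)[of w] d1(2)[of z1] near[OF w] near[OF z1b] dist_triangle[of "g w" "g z1" "g z0"]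
          by (simp add: dist_norm norm_minus_commute)
        moreover have "u - 1 = (g w - g z1) / g z1" using bspec[OF k(7), of z1] near[OF z1b] by (auto simp: u_def field_simps)
        then have "cmod (u - 1) = cmod (g w - g z1) / cmod (g z1)" by (simp add: norm_divide)
        moreover have "cmod (g w - g z1) / cmod (g z1) \<le> (a / 10) / (19/20 * a)"
          using calculation(1) gz1 a by (intro frac_le) auto
        ultimately show ?thesis using a by simp
      qed
      moreover have "cmod ((1 / t) ^ m - 1) \<le> 1/8"
      proof -
        have "t - 1 = (w - z1) / (z1 - z0)" using z10 by (simp add: t_def field_simps)
        then have "dist t 1 = cmod (w - z1) / d" by (simp add: dist_norm norm_divide d_def)
        also have "\<dots> < \<kappa>" using w d by (simp add: R_def dist_norm norm_minus_commute pos_divide_less_eq)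
        finally show ?thesis using d2(2)[of t] \<kappa>(3) by (simp add: dist_norm)
      qed
      \<comment> \<open>Two relative errors of at most 1/8 combine to at most 1/64 + 1/8 + 1/8,
        below the 1/2 required by \<open>flatmap_disc\<close>.\<close>
      moreover have "cmod (u * v - 1) \<le> 1/2" if "cmod (u - 1) \<le> 1/8" "cmod (v - 1) \<le> 1/8" for v
      proof -
        have "u * v - 1 = (u - 1) * (v - 1) + (u - 1) + (v - 1)" by (simp add: algebra_simps)
        then have "cmod (u * v - 1) \<le> cmod (u - 1) * cmod (v - 1) + cmod (u - 1) + cmod (v - 1)"
          by (metis norm_mult norm_triangle_ineq order_trans add_right_mono)
        moreover have "cmod (u - 1) * cmod (v - 1) \<le> 1/8 * (1/8)" using that by (intro mult_mono) auto
        ultimately show ?thesis using that by linarith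
      qed
      ultimately show ?thesis by simp
    qed
    have "ball z1 R \<subseteq> cdom k" using near k(5) by blast
    from flatmap_disc[OF k(1) R(1) this hol nz ratio]
    obtain \<theta> where \<theta>: "flatmap (ball 0 (R * sqrt (cmod (\<phi> k z1)) / 2)) \<theta>" "\<theta> 0 = cmap k z1" by blast
    have "r' \<le> R * sqrt (cmod (\<phi> k z1)) / 2"
    proof -
      have "cmod (\<phi> k z1) = cmod (g z1) / d ^ m"
        using bspec[OF k(9), of z1] near[OF z1b] by (simp add: norm_divide norm_power d_def)
      moreover have "d ^ m \<le> d ^ 2" using power_decreasing[OF k(8), of d] d s by simp
      then have "cmod (g z1) / d ^ 2 \<le> cmod (g z1) / d ^ m" using d by (intro divide_left_mono) auto
      moreover have "(a / 2) / d ^ 2 \<le> cmod (g z1) / d ^ 2" using gz1 a by (intro divide_right_mono) auto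
      ultimately have "sqrt ((a / 2) / d ^ 2) \<le> sqrt (cmod (\<phi> k z1))" by (intro real_sqrt_le_mono) linarith
      then have "sqrt (a / 2) / d \<le> sqrt (cmod (\<phi> k z1))" using d
        unfolding real_sqrt_divide[of _ "d\<^sup>2"] by simp
      then have "R * (sqrt (a / 2) / d) \<le> R * sqrt (cmod (\<phi> k z1))" using R by (intro mult_left_mono) auto
      then show ?thesis using d by (simp add: r'_def R_def)
    qed
    then have "flatmap (ball 0 r') \<theta>" by (intro flatmap_subset[OF \<theta>(1)]) auto
    then show ?thesis using \<theta>(2) z1(2) by blast
  qed
  moreover have "open ?N" using cmap_open_image[OF k(1) open_ball sub] .
  moreover have "x \<in> ?N" using k(3) s(1) by force
  moreover have "r' > 0" using \<kappa> a by (simp add: r'_def)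
  ultimately show ?thesis using that[of ?N r'] by blast
qed

section \<open>Openness, finiteness of the zeroes, connectedness and uniform flat discs\<close>

lemma zchart_subset: "b \<in> qd_zeros A \<phi> \<Longrightarrow> cim (zchart b) - {b} \<subseteq> C_circ A \<phi>"
proof
  fix x assume b: "b \<in> qd_zeros A \<phi>" and "x \<in> cim (zchart b) - {b}"
  then obtain w where w: "w \<in> ball 0 (\<rho> b)" "x = \<xi> b w" "x \<noteq> b" by auto
  then have "w \<noteq> 0" using zchart(3)[OF b] by auto
  then show "x \<in> C_circ A \<phi>" using C_circ_chart[OF zchart(1)[OF b], of w] zchart(4)[OF b w(1)] w by simp
qed

lemma zero_in_zchart: "b \<in> qd_zeros A \<phi> \<Longrightarrow> b \<in> cim (zchart b)"
  by (rule image_eqI[of _ _ 0]) (simp_all add: zchart(2,3))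

lemma zeros_C_circ_disjoint: "qd_zeros A \<phi> \<inter> C_circ A \<phi> = {}"
  by (auto simp: C_circ_def)

lemma open_C_circ: "open (C_circ A \<phi>)"
proof (subst open_subopen, intro ballI)
  fix x assume "x \<in> C_circ A \<phi>"
  then obtain r \<theta> where r: "r > 0" "flatmap (ball 0 r) \<theta>" "inj_on \<theta> (ball 0 r)" "\<theta> 0 = x" by (rule flat_disc_C_circ)
  then have "x \<in> \<theta> ` ball 0 r" by force
  moreover have "\<theta> ` ball 0 r \<subseteq> C_circ A \<phi>" using flatmap_C_circ[OF r(2)] by blast
  ultimately show "\<exists>T. open T \<and> x \<in> T \<and> T \<subseteq> C_circ A \<phi>" using flatmap_open_image[OF r(2)] by blast
qed

lemma open_C_tilde: "open (C_tilde A \<phi>)"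
proof (subst open_subopen, intro ballI)
  fix x assume "x \<in> C_tilde A \<phi>"
  then consider "x \<in> C_circ A \<phi>" | "x \<in> qd_zeros A \<phi>" unfolding C_tilde_eq by blast
  then show "\<exists>T. open T \<and> x \<in> T \<and> T \<subseteq> C_tilde A \<phi>"
  proof cases
    case 1
    then show ?thesis using open_C_circ C_circ_subset by blast
  next
    case 2
    have "cim (zchart x) \<subseteq> C_tilde A \<phi>"
    proof
      fix y assume "y \<in> cim (zchart x)"
      then have "y = x \<or> y \<in> C_circ A \<phi>" using zchart_subset[OF 2] by blast
      then show "y \<in> C_tilde A \<phi>" using 2 unfolding C_tilde_eq by blast
    qed
    then show ?thesis
      by (intro exI[of _ "cim (zchart x)"] conjI open_cim[OF zchart(1)[OF 2]] zero_in_zchart[OF 2])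
  qed
qed

lemma finite_cover:
  assumes "\<And>x. \<exists>N. open N \<and> x \<in> N \<and> P N"
  shows "\<exists>\<N>. finite \<N> \<and> (\<forall>N\<in>\<N>. P N) \<and> \<Union>\<N> = (UNIV :: 'c set)"
proof -
  have "compact (UNIV :: 'c set)" using closed_surface by (simp add: closed_riemann_surface_def)
  moreover have "UNIV \<subseteq> \<Union>{N. open N \<and> P N}" using assms by blast
  ultimately obtain \<N> where "\<N> \<subseteq> {N. open N \<and> P N}" "finite \<N>" "UNIV \<subseteq> \<Union>\<N>"
    by (rule compactE) auto
  then show ?thesis by (intro exI[of _ \<N>]) blast
qed

text \<open>Every point, poles included, has a neighbourhood with at most one zero, and the surface
  is compact.\<close>

lemma finite_zeros: "finite (qd_zeros A \<phi>)"
proof -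
  have "\<exists>N. open N \<and> x \<in> N \<and> finite (N \<inter> qd_zeros A \<phi>)" for x
  proof -
    consider "x \<in> C_circ A \<phi>" | "x \<in> qd_zeros A \<phi>" | "x \<in> qd_poles A \<phi>" by (auto simp: C_circ_def)
    then show ?thesis
    proof cases
      case 1
      then show ?thesis using open_C_circ zeros_C_circ_disjoint
        by (intro exI[of _ "C_circ A \<phi>"]) (simp add: Int_commute)
    next
      case 2
      have "cim (zchart x) \<inter> qd_zeros A \<phi> \<subseteq> {x}"
        using zchart_subset[OF 2] zeros_C_circ_disjoint by blast
      then have "finite (cim (zchart x) \<inter> qd_zeros A \<phi>)" by (rule finite_subset) simp
      then show ?thesis
        by (intro exI[of _ "cim (zchart x)"] conjI open_cim[OF zchart(1)[OF 2]] zero_in_zchart[OF 2])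
    next
      case 3
      then obtain N where N: "open N" "x \<in> N" "N - {x} \<subseteq> C_circ A \<phi>" by (rule pole_neighbourhood)
      have "N \<inter> qd_zeros A \<phi> \<subseteq> {x}" using N(3) zeros_C_circ_disjoint by blast
      then have "finite (N \<inter> qd_zeros A \<phi>)" by (rule finite_subset) simp
      then show ?thesis using N by blast
    qed
  qed
  from finite_cover[of "\<lambda>N. finite (N \<inter> qd_zeros A \<phi>)", OF this]
  obtain \<N> where N: "finite \<N>" "\<forall>N\<in>\<N>. finite (N \<inter> qd_zeros A \<phi>)" "\<Union>\<N> = (UNIV :: 'c set)"
    by (elim exE conjE)
  then have "qd_zeros A \<phi> = (\<Union>N\<in>\<N>. N \<inter> qd_zeros A \<phi>)" by blast
  moreover have "finite (\<Union>N\<in>\<N>. N \<inter> qd_zeros A \<phi>)" using N(1,2) by (intro finite_UN_I) auto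
  ultimately show ?thesis by simp
qed

lemma zeros_nonempty: "qd_zeros A \<phi> \<noteq> {}"
  using complete by (auto simp: complete_GMN_def GMN_def)

text \<open>Punctured neighbourhoods of poles are connected, so each falls entirely to one side of a
  separation of \<open>C_tilde A \<phi>\<close>. Adding the poles to their sides would separate the
  connected surface.\<close>

lemma connected_C_tilde: "connected (C_tilde A \<phi>)"
proof (rule connectedI)
  fix U V assume UV: "open U" "open V" "U \<inter> C_tilde A \<phi> \<noteq> {}" "V \<inter> C_tilde A \<phi> \<noteq> {}"
    "U \<inter> V \<inter> C_tilde A \<phi> = {}" "C_tilde A \<phi> \<subseteq> U \<union> V"
  have "\<exists>N. open N \<and> p \<in> N \<and> N - {p} \<subseteq> C_tilde A \<phi> \<and> (N - {p} \<subseteq> U \<or> N - {p} \<subseteq> V) \<and> N - {p} \<noteq> {}"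
    if "p \<in> qd_poles A \<phi>" for p
  proof -
    obtain N where N: "open N" "p \<in> N" "N - {p} \<subseteq> C_circ A \<phi>" "connected (N - {p})" "N - {p} \<noteq> {}"
      using pole_neighbourhood[OF \<open>p \<in> qd_poles A \<phi>\<close>] .
    then have "N - {p} \<subseteq> C_tilde A \<phi>" using C_circ_subset by blast
    moreover have "U \<inter> (N - {p}) = {} \<or> V \<inter> (N - {p}) = {}"
      using connectedD[OF N(4) UV(1,2)] UV(5,6) calculation by blast
    ultimately show ?thesis using N UV(6) by (intro exI[of _ N]) blast
  qed
  then obtain N where N: "\<And>p. p \<in> qd_poles A \<phi> \<Longrightarrow> open (N p) \<and> p \<in> N p \<and> N p - {p} \<subseteq> C_tilde A \<phi> \<and>
      (N p - {p} \<subseteq> U \<or> N p - {p} \<subseteq> V) \<and> N p - {p} \<noteq> {}" by metis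
  let ?P = "\<lambda>W. {p \<in> qd_poles A \<phi>. N p - {p} \<subseteq> W}"
  let ?U = "(U \<inter> C_tilde A \<phi>) \<union> (\<Union>p\<in>?P U. N p)" and ?V = "(V \<inter> C_tilde A \<phi>) \<union> (\<Union>p\<in>?P V. N p)"
  have conn: "connected (UNIV :: 'c set)" using closed_surface by (simp add: closed_riemann_surface_def)
  have op: "open ?U" "open ?V" using UV(1,2) open_C_tilde N by (auto intro!: open_Un open_Int open_UN)
  have cov: "UNIV \<subseteq> ?U \<union> ?V"
  proof
    fix x
    show "x \<in> ?U \<union> ?V"
    proof (cases "x \<in> C_tilde A \<phi>")
      case True
      then show ?thesis using UV(6) by blast
    next
      case False
      then have "x \<in> qd_poles A \<phi>" by (simp add: C_tilde_def)
      then show ?thesis using N[of x] by blast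
    qed
  qed
  have dis: "?U \<inter> ?V \<inter> UNIV = {}"
  proof -
    have pole: "p \<notin> C_tilde A \<phi>" if "p \<in> qd_poles A \<phi>" for p using that by (simp add: C_tilde_def)
    have 1: "N p \<inter> V \<inter> C_tilde A \<phi> = {}" if p: "p \<in> ?P U" for p
    proof -
      have "N p - {p} \<subseteq> U" "p \<notin> C_tilde A \<phi>" using p pole by auto
      then show ?thesis using UV(5) by blast
    qed
    have 2: "N p \<inter> U \<inter> C_tilde A \<phi> = {}" if p: "p \<in> ?P V" for p
    proof -
      have "N p - {p} \<subseteq> V" "p \<notin> C_tilde A \<phi>" using p pole by auto
      then show ?thesis using UV(5) by blast
    qed
    have 3: "N p \<inter> N q = {}" if p: "p \<in> ?P U" and q: "q \<in> ?P V" for p q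
    proof -
      have p': "N p - {p} \<subseteq> U" "N p - {p} \<subseteq> C_tilde A \<phi>" "p \<notin> C_tilde A \<phi>" "N p - {p} \<noteq> {}"
        using p N[of p] pole by auto
      have q': "N q - {q} \<subseteq> V" "N q - {q} \<subseteq> C_tilde A \<phi>" "q \<notin> C_tilde A \<phi>" using q N[of q] pole by auto
      \<comment> \<open>A common pole would put its nonempty punctured neighbourhood on both
        sides.\<close>
      have "p \<noteq> q" using p' q' UV(5) by blast
      then show ?thesis using p' q' UV(5) by blast
    qed
    show ?thesis using 1 2 3 UV(5) by blast
  qed
  from connectedD[OF conn op dis cov] show False
  proof
    assume "?U \<inter> UNIV = {}"
    then have "U \<inter> C_tilde A \<phi> = {}" by simp
    then show False using UV(3) by simp
  next
    assume "?V \<inter> UNIV = {}"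
    then have "V \<inter> C_tilde A \<phi> = {}" by simp
    then show False using UV(4) by simp
  qed
qed

text \<open>Completeness of the flat metric in uniform form: flat discs of locally uniform size
  exist at regular points and near poles, and compactness selects one radius.\<close>

lemma flatmap_unif:
  assumes "\<delta> > 0"
  obtains r where "r > 0" "\<And>x. x \<in> C_tilde A \<phi> \<Longrightarrow> x \<notin> zero_nhd A \<phi> \<xi> \<rho> \<delta> \<Longrightarrow> \<exists>\<theta>. flatmap (ball 0 r) \<theta> \<and> \<theta> 0 = x"
proof -
  let ?G = "\<lambda>r x. \<exists>\<theta>. flatmap (ball 0 r) \<theta> \<and> \<theta> 0 = x"
  let ?P = "\<lambda>N. \<exists>r>0. \<forall>x\<in>N. x \<in> C_tilde A \<phi> \<and> x \<notin> zero_nhd A \<phi> \<xi> \<rho> \<delta> \<longrightarrow> ?G r x"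
  have "\<exists>N. open N \<and> x \<in> N \<and> ?P N" for x
  proof -
    consider "x \<in> C_circ A \<phi>" | "x \<in> qd_zeros A \<phi>" | "x \<in> qd_poles A \<phi>" by (auto simp: C_circ_def)
    then show ?thesis
    proof cases
      case 1
      then obtain r \<theta> where r: "r > 0" "flatmap (ball 0 r) \<theta>" "inj_on \<theta> (ball 0 r)" "\<theta> 0 = x" by (rule flat_disc_C_circ)
      let ?N = "\<theta> ` ball 0 (r/2)"
      have "?G (r/2) y" if y: "y \<in> ?N" for y
      proof -
        obtain v where v: "v \<in> ball 0 (r/2)" "y = \<theta> v" using y by blast
        have "flatmap (ball 0 (r/2)) (\<lambda>q. \<theta> (1 * q + v))"
        proof (rule flatmap_subset[OF flatmap_affine(1)[OF r(2)]])
          show "ball 0 (r/2) \<subseteq> {z. 1 * z + v \<in> ball 0 r}"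
            using v(1) by (auto intro: order_le_less_trans[OF norm_triangle_ineq])
        qed auto
        then show ?thesis using v(2) by (intro exI[of _ "\<lambda>q. \<theta> (1 * q + v)"]) simp
      qed
      moreover have "open ?N"
        by (rule flatmap_open_image[OF flatmap_subset[OF r(2)]]) (use r in auto)
      moreover have "x \<in> ?N" using r by force
      ultimately show ?thesis using r(1) by (intro exI[of _ ?N] conjI exI[of _ "r/2"]) auto
    next
      case 2
      let ?N = "\<xi> x ` (ball 0 (\<rho> x) \<inter> ball 0 \<delta>)"
      have "open ?N" using cmap_open_image[OF zchart(1)[OF 2], of "ball 0 (\<rho> x) \<inter> ball 0 \<delta>"] by auto
      moreover have "x \<in> ?N" using zchart(2,3)[OF 2] assms by (intro image_eqI[of _ _ 0]) simp_all
      moreover have "?N \<subseteq> zero_nhd A \<phi> \<xi> \<rho> \<delta>" using 2 by (auto simp: zero_nhd_def)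
      \<comment> \<open>Inside \<open>zero_nhd\<close> nothing is claimed, so the radius 1 is a
        placeholder.\<close>
      ultimately show ?thesis by (intro exI[of _ ?N] conjI exI[of _ 1]) auto
    next
      case 3
      then obtain N r where "open N" "x \<in> N" "r > 0" "\<forall>y\<in>N - {x}. ?G r y" using pole_discs[OF 3] by metis
      moreover have "x \<notin> C_tilde A \<phi>" using 3 by (simp add: C_tilde_def)
      ultimately show ?thesis by (intro exI[of _ N] conjI exI[of _ r]) auto
    qed
  qed
  from finite_cover[of ?P, OF this]
  obtain \<N> where N: "finite \<N>" "\<forall>N\<in>\<N>. ?P N" "\<Union>\<N> = (UNIV :: 'c set)"
    by (elim exE conjE)
  from bchoice[OF N(2)] obtain R where R: "\<forall>N\<in>\<N>. R N > 0 \<and> (\<forall>x\<in>N. x \<in> C_tilde A \<phi> \<and> x \<notin> zero_nhd A \<phi> \<xi> \<rho> \<delta> \<longrightarrow> ?G (R N) x)"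
    by (elim exE)
  have ne: "\<N> \<noteq> {}" using N(3) by auto
  define r where "r = Min (R ` \<N>)"
  have pos: "\<forall>N\<in>\<N>. R N > 0" using R by simp
  have fin: "finite (R ` \<N>)" using N(1) by (rule finite_imageI)
  have "r \<in> R ` \<N>" unfolding r_def by (rule Min_in[OF fin]) (simp only: image_is_empty ne not_False_eq_True)
  then have r: "r > 0" using pos by blast
  have "?G r x" if x: "x \<in> C_tilde A \<phi>" "x \<notin> zero_nhd A \<phi> \<xi> \<rho> \<delta>" for x
  proof -
    have "x \<in> \<Union>\<N>" unfolding N(3) by simp
    then obtain N where NN: "N \<in> \<N>" "x \<in> N" by (elim UnionE)
    from mp[OF bspec[OF conjunct2[OF bspec[OF R NN(1)]] NN(2)] conjI[OF x]]
    obtain \<theta> where \<theta>: "flatmap (ball 0 (R N)) \<theta>" "\<theta> 0 = x" by (elim exE conjE)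
    have "r \<le> R N" unfolding r_def by (rule Min_le[OF fin imageI[OF NN(1)]])
    then have "ball (0::complex) r \<subseteq> ball 0 (R N)" by (simp add: subset_ball)
    then have "flatmap (ball 0 r) \<theta>" by (rule flatmap_subset[OF \<theta>(1) open_ball])
    then show ?thesis using \<theta>(2) by (intro exI[of _ \<theta>] conjI)
  qed
  then show ?thesis using that[OF r] by simp
qed

end

section \<open>Exactness and the developing map\<close>

locale exact_surface = gmn_surface A \<phi> \<xi> \<rho>
  for A :: "'c::t2_space coord set" and \<phi> \<xi> \<rho> +
  fixes f :: "'c cot \<Rightarrow> real"
  assumes f_exact: "\<And>k W s q p w. k \<in> A \<Longrightarrow> open W \<Longrightarrow> s ` W \<subseteq> spectral_curve A \<phi> \<Longrightarrow> (\<And>w. w \<in> W \<Longrightarrow> fst (s w) \<in> cim k) \<Longrightarrow>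
      (\<And>w. w \<in> W \<Longrightarrow> cot_chart k (s w) = (q w, p w)) \<Longrightarrow> q holomorphic_on W \<Longrightarrow> p holomorphic_on W \<Longrightarrow> w \<in> W \<Longrightarrow>
      ((\<lambda>w. f (s w)) has_derivative (\<lambda>\<zeta>. Re (p w * (deriv q w * \<zeta>)))) (at w)"
    and f_odd: "f (smul (-1) y) = - f y"

text \<open>The primitive can be taken odd: subtract from it its pull-back under the sheet interchange.\<close>

lemma (in gmn_surface) exact_surface_exists:
  assumes "exact_spectral_curve A \<phi>"
  shows "\<exists>f. exact_surface A \<phi> \<xi> \<rho> f"
proof -
  obtain f :: "'c cot \<Rightarrow> real" where f: "\<forall>k\<in>A. \<forall>W s q p.
        open W \<and> s ` W \<subseteq> spectral_curve A \<phi> \<and> (\<forall>w\<in>W. fst (s w) \<in> cim k) \<and>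
        (\<forall>w\<in>W. cot_chart k (s w) = (q w, p w)) \<and> q holomorphic_on W \<and> p holomorphic_on W \<longrightarrow>
        (\<forall>w\<in>W. ((\<lambda>w. f (s w)) has_derivative (\<lambda>\<zeta>. Re (p w * (deriv q w * \<zeta>)))) (at w))"
    using assms unfolding exact_spectral_curve_def by (elim exE)
  let ?F = "\<lambda>y. (f y - f (smul (-1) y)) / 2"
  have "((\<lambda>w. ?F (s w)) has_derivative (\<lambda>\<zeta>. Re (p w * (deriv q w * \<zeta>)))) (at w)"
    if k: "k \<in> A" and W: "open W" and s: "s ` W \<subseteq> spectral_curve A \<phi>" and im: "\<And>w. w \<in> W \<Longrightarrow> fst (s w) \<in> cim k"
      and ch: "\<And>w. w \<in> W \<Longrightarrow> cot_chart k (s w) = (q w, p w)" and hol: "q holomorphic_on W" "p holomorphic_on W" and w: "w \<in> W"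
    for k W s q p w
  proof -
    let ?s = "\<lambda>w. smul (-1) (s w)"
    have 1: "((\<lambda>w. f (s w)) has_derivative (\<lambda>\<zeta>. Re (p w * (deriv q w * \<zeta>)))) (at w)"
      using f[rule_format, OF k, of W s q p w] W s im ch hol w by simp
    have "?s ` W \<subseteq> spectral_curve A \<phi>"
    proof
      fix y assume "y \<in> ?s ` W"
      then obtain v where v: "v \<in> W" "y = smul (-1) (s v)" by blast
      then have "s v \<in> spectral_curve A \<phi>" using s by blast
      then show "y \<in> spectral_curve A \<phi>" using spectral_smul[of "s v" "-1"] v(2) by simp
    qed
    moreover have "cot_chart k (?s v) = (q v, - p v)" if "v \<in> W" for v
      using ch[OF that] by (simp add: cot_chart_def smul_def)
    moreover have "(\<lambda>w. - p w) holomorphic_on W" using hol(2) by (rule holomorphic_on_minus)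
    ultimately have 2: "((\<lambda>w. f (?s w)) has_derivative (\<lambda>\<zeta>. Re (- p w * (deriv q w * \<zeta>)))) (at w)"
      using f[rule_format, OF k, of W ?s q "\<lambda>w. - p w" w] W im hol w by simp
    have "((\<lambda>w. (1/2) * (f (s w) - f (?s w))) has_derivative
        (\<lambda>\<zeta>. (1/2) * (Re (p w * (deriv q w * \<zeta>)) - Re (- p w * (deriv q w * \<zeta>))))) (at w)"
      by (intro has_derivative_mult_right has_derivative_diff 1 2)
    moreover have "(\<lambda>\<zeta>. (1/2) * (Re (p w * (deriv q w * \<zeta>)) - Re (- p w * (deriv q w * \<zeta>)))) =
        (\<lambda>\<zeta>. Re (p w * (deriv q w * \<zeta>)))"
    proof
      fix \<zeta>
      have "(1/2) * (Re a - Re (- a)) = Re a" for a by simp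
      then show "(1/2) * (Re (p w * (deriv q w * \<zeta>)) - Re (- p w * (deriv q w * \<zeta>))) = Re (p w * (deriv q w * \<zeta>))"
        by (simp only: mult_minus_left)
    qed
    moreover have "(\<lambda>w. (1/2) * (f (s w) - f (?s w))) = (\<lambda>w. ?F (s w))" by (rule ext) linarith
    ultimately show ?thesis by (simp only:)
  qed
  moreover have "?F (smul (-1) y) = - ?F y" for y
  proof -
    have "smul (-1) (smul (-1) y) = y" by simp
    then show ?thesis by (simp only: minus_divide_left minus_diff_eq)
  qed
  ultimately have "exact_surface A \<phi> \<xi> \<rho> ?F"
    by (intro exact_surface.intro exact_surface_axioms.intro gmn_surface_axioms) blast+
  then show ?thesis by (intro exI[of _ ?F])
qed

context exact_surface
begin

lemma f_smul: "\<sigma> \<in> {1,-1} \<Longrightarrow> f (smul \<sigma> y) = Re \<sigma> * f y"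
  using f_odd[of y] by auto

lemma f_sq_same_fibre:
  assumes "y \<in> spectral_curve A \<phi>" "y' \<in> spectral_curve A \<phi>" "fst y = fst y'"
  shows "\<bar>f y\<bar> = \<bar>f y'\<bar>"
  using spectral_same_fibre[OF assms] f_odd[of y'] by auto

text \<open>By construction \<open>lift\<close> pulls p dw back to dz, so a primitive of Re (p dw)
  becomes a function with differential Re.\<close>

lemma f_lift_derivative:
  assumes fl: "flatmap U \<psi>" and z: "z \<in> U"
  shows "((\<lambda>z. f (lift \<psi> z)) has_derivative Re) (at z)"
proof -
  obtain k where k: "k \<in> A" "\<psi> z \<in> cim k" using exists_chart by blast
  define W where "W = {w \<in> U. \<psi> w \<in> cim k}"
  define q where "q = cinv k \<circ> \<psi>"
  define p where "p w = 1 / deriv q w" for w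
  have W: "open W" unfolding W_def using flatmap_preimage_open[OF fl open_cim[OF k(1)]] .
  have zW: "z \<in> W" using z k by (simp add: W_def)
  have q: "q holomorphic_on W" unfolding q_def W_def by (rule flatmap_holomorphic[OF fl k(1)])
  have nz: "deriv q w \<noteq> 0" if "w \<in> W" for w
    using flatmap_deriv_nonzero[OF fl k(1), of w] that by (simp add: W_def q_def)
  have p: "p holomorphic_on W"
    unfolding p_def using nz by (intro holomorphic_intros holomorphic_deriv[OF q W]) auto
  have "lift \<psi> ` W \<subseteq> spectral_curve A \<phi>" using lift_in_spectral_curve[OF fl] by (auto simp: W_def)
  moreover have "fst (lift \<psi> w) \<in> cim k" if "w \<in> W" for w using that by (simp add: W_def)
  moreover have "cot_chart k (lift \<psi> w) = (q w, p w)" if "w \<in> W" for w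
    using that k(1) by (simp add: cot_chart_def lift_def W_def p_def q_def)
  ultimately have "((\<lambda>w. f (lift \<psi> w)) has_derivative (\<lambda>\<zeta>. Re (p z * (deriv q z * \<zeta>)))) (at z)"
    by (intro f_exact[OF k(1) W _ _ _ q p zW])
  moreover have "p z * (deriv q z * \<zeta>) = \<zeta>" for \<zeta> using nz[OF zW] by (simp add: p_def)
  ultimately show ?thesis by simp
qed

lemma f_lift:
  assumes fl: "flatmap U \<psi>" and U: "convex U" and z: "z \<in> U" "w \<in> U"
  shows "f (lift \<psi> w) - f (lift \<psi> z) = Re w - Re z"
proof -
  have "((\<lambda>z. f (lift \<psi> z) - Re z) has_derivative (\<lambda>h. 0)) (at x within U)" if "x \<in> U" for x
  proof -
    have "(Re has_derivative Re) (at x)"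
      by (rule bounded_linear.has_derivative[OF bounded_linear_Re has_derivative_ident])
    from has_derivative_diff[OF f_lift_derivative[OF fl that] this]
    show ?thesis by (simp add: has_derivative_at_withinI)
  qed
  from has_derivative_zero_constant[OF U this] obtain c where "\<forall>x\<in>U. f (lift \<psi> x) - Re x = c" by blast
  then have "f (lift \<psi> w) - Re w = c" "f (lift \<psi> z) - Re z = c" using z by blast+
  then show ?thesis by linarith
qed

text \<open>
  Near a zero the curve is parametrized by \<open>v = w\<^bsup>1/2\<^esup>\<close>; exactness across the branch point makes the
  odd primitive equal to \<open>Re (2/3 v\<^sup>3)\<close> there.
\<close>

lemma f_near_zero:
  assumes b: "b \<in> qd_zeros A \<phi>" and y: "y \<in> spectral_curve A \<phi>" "fst y = \<xi> b w" "w \<in> ball 0 (\<rho> b)"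
  shows "(f y)\<^sup>2 \<le> 4/9 * cmod w ^ 3"
proof -
  let ?k = "zchart b"
  note k = zchart[OF b]
  let ?B = "ball 0 (sqrt (\<rho> b))"
  have sq: "v\<^sup>2 \<in> cdom ?k" if "v \<in> ?B" for v :: complex
  proof -
    have "cmod v < sqrt (\<rho> b)" using that by simp
    then have "(cmod v)\<^sup>2 < \<rho> b" using k(2) by (metis norm_ge_zero power_strict_mono real_sqrt_pow2 less_imp_le zero_less_numeral)
    then show ?thesis by (simp add: norm_power)
  qed
  \<comment> \<open>The branched parametrization in the chart of b: base point v^2 and covector v
    dw. The cocycle rule supplies the components in the other charts.\<close>
  define s where "s v = (\<xi> b (v\<^sup>2), \<lambda>k'. if k' \<in> A \<and> \<xi> b (v\<^sup>2) \<in> cim k'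
      then v * deriv (transition k' ?k) (cinv k' (\<xi> b (v\<^sup>2))) else 0)" for v
  have sS: "s v \<in> spectral_curve A \<phi>" if v: "v \<in> ?B" for v
    unfolding spectral_curve_iff cotangent_bundle_iff
  proof (intro conjI ballI impI)
    let ?x = "\<xi> b (v\<^sup>2)"
    have x: "?x \<in> cim ?k" using sq[OF v] by simp
    show "fst (s v) \<in> C_tilde A \<phi>"
      unfolding C_tilde_eq s_def using zchart_subset[OF b] x b by auto
    have ov: "z \<in> overlap k1 ?k" if "k1 \<in> A" "z \<in> cdom k1" "cmap k1 z = ?x" for k1 z
      using that x by (simp add: overlap_def)
    have sv: "snd (s v) k1 = v * deriv (transition k1 ?k) z" if "k1 \<in> A" "z \<in> cdom k1" "cmap k1 z = ?x" for k1 z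
    proof -
      have "?x \<in> cim k1" using that by (metis imageI)
      moreover have "cinv k1 ?x = z" using cinv_cmap[OF that(1,2)] that(3) by simp
      ultimately show ?thesis using that(1) by (simp add: s_def)
    qed
    show "snd (s v) \<in> cot_fibre A (fst (s v))"
      unfolding cot_fibre_def
    proof (intro CollectI conjI ballI allI impI)
      fix k1 k2 z assume h: "k1 \<in> A" "k2 \<in> A" "z \<in> overlap k1 k2" "cmap k1 z = fst (s v)"
      have z: "z \<in> cdom k1" "cmap k1 z = ?x" using h by (auto simp: overlap_def s_def)
      let ?t = "transition k1 k2 z"
      have t: "?t \<in> cdom k2" "cmap k2 ?t = ?x"
        using transition_overlap[OF h(1,3)] cmap_transition[OF h(3)] z by (auto simp: overlap_def)
      show "snd (s v) k1 = snd (s v) k2 * deriv (transition k1 k2) z"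
        using sv[OF h(1) z] sv[OF h(2) t] transition_deriv_comp[OF h(1,2) k(1) h(3) ov[OF h(1) z]] by simp
    next
      fix k1 assume "\<not> (k1 \<in> A \<and> fst (s v) \<in> cim k1)"
      then show "snd (s v) k1 = 0" by (simp only: s_def fst_conv snd_conv if_False)
    qed
    fix k1 z assume h: "k1 \<in> A" "z \<in> cdom k1" "cmap k1 z = fst (s v)"
    have z: "cmap k1 z = ?x" using h(3) by (simp add: s_def)
    have "transition k1 ?k z = v\<^sup>2" using z cinv_cmap[OF k(1) sq[OF v]] by (simp add: transition_def)
    then have "\<phi> k1 z = v\<^sup>2 * (deriv (transition k1 ?k) z)\<^sup>2"
      using phi_transition[OF h(1) k(1) ov[OF h(1,2) z]] k(4)[of "v\<^sup>2"] sq[OF v] by simp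
    then show "(snd (s v) k1)\<^sup>2 = \<phi> k1 z" using sv[OF h(1,2) z] by (simp add: power_mult_distrib)
  qed
  have chart: "cot_chart ?k (s v) = (v\<^sup>2, v)" if v: "v \<in> ?B" for v
  proof -
    have c: "cinv ?k (\<xi> b (v\<^sup>2)) = v\<^sup>2" using cinv_cmap[OF k(1) sq[OF v]] by simp
    have "((\<lambda>z. z) has_field_derivative 1) (at (v\<^sup>2))" by simp
    then have "(transition ?k ?k has_field_derivative 1) (at (v\<^sup>2))"
      by (rule has_field_derivative_transform_within_open[OF _ open_cdom[OF k(1)] sq[OF v]])
         (simp add: transition_same[OF k(1)])
    then have "deriv (transition ?k ?k) (v\<^sup>2) = 1" by (rule DERIV_imp_deriv)
    moreover have "\<xi> b (v\<^sup>2) \<in> cim ?k" using sq[OF v] by simp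
    ultimately show ?thesis using c k(1) by (simp add: cot_chart_def s_def)
  qed
  have D: "((\<lambda>v. f (s v)) has_derivative (\<lambda>\<zeta>. Re (v * (deriv (\<lambda>v. v\<^sup>2) v * \<zeta>)))) (at v)" if v: "v \<in> ?B" for v
  proof (rule f_exact[OF k(1) open_ball _ _ _ _ _ v])
    show "fst (s v) \<in> cim ?k" if "v \<in> ?B" for v using sq[OF that] by (simp add: s_def)
  qed (use sS chart in \<open>auto intro!: holomorphic_intros\<close>)
  have D0: "((\<lambda>v. f (s v) - Re (2/3 * v^3)) has_derivative (\<lambda>\<zeta>. 0)) (at v within ?B)" if v: "v \<in> ?B" for v
  proof -
    have d2: "deriv (\<lambda>v. v\<^sup>2) v = 2 * v" by (rule DERIV_imp_deriv) (auto intro!: derivative_eq_intros)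
    have "((\<lambda>v. 2/3 * v^3) has_field_derivative 2 * v\<^sup>2) (at v)" by (auto intro!: derivative_eq_intros)
    then have "((\<lambda>v. 2/3 * v^3) has_derivative (\<lambda>\<zeta>. 2 * v\<^sup>2 * \<zeta>)) (at v)"
      by (simp only: has_field_derivative_def)
    from bounded_linear.has_derivative[OF bounded_linear_Re this]
    have "((\<lambda>v. Re (2/3 * v^3)) has_derivative (\<lambda>\<zeta>. Re (2 * v\<^sup>2 * \<zeta>))) (at v)" .
    moreover have "v * (deriv (\<lambda>v. v\<^sup>2) v * \<zeta>) = 2 * v\<^sup>2 * \<zeta>" for \<zeta>
      unfolding d2 by (simp add: power2_eq_square)
    ultimately have "((\<lambda>v. f (s v) - Re (2/3 * v^3)) has_derivative (\<lambda>\<zeta>. Re (2 * v\<^sup>2 * \<zeta>) - Re (2 * v\<^sup>2 * \<zeta>))) (at v)"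
      using has_derivative_diff[OF D[OF v]] by (simp only:)
    then show ?thesis unfolding diff_self by (rule has_derivative_at_withinI)
  qed
  obtain c where c: "\<forall>v\<in>?B. f (s v) - Re (2/3 * v^3) = c"
    using has_derivative_zero_constant[OF convex_ball D0] by blast
  have zero: "(0::complex) \<in> ?B" using k(2) by simp
  \<comment> \<open>At the branch point the two sheets meet, so the odd function vanishes; this
    fixes the constant c.\<close>
  have "s 0 = smul (-1) (s 0)" by (auto simp: s_def smul_def)
  then have "f (s 0) = 0" using f_odd[of "s 0"] by simp
  then have "c = 0" using c[rule_format, OF zero] by simp
  then have fs: "f (s v) = Re (2/3 * v^3)" if "v \<in> ?B" for v using c[rule_format, OF that] by simp
  define v where "v = csqrt w"
  have v2: "v\<^sup>2 = w" by (simp add: v_def)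
  have cv: "cmod v = sqrt (cmod w)" by (simp add: v_def)
  have vB: "v \<in> ?B" using y(3) cv by simp
  have "\<bar>f y\<bar> = \<bar>f (s v)\<bar>"
    by (rule f_sq_same_fibre[OF y(1) sS[OF vB]]) (simp add: y(2) s_def v2)
  also have "\<dots> \<le> cmod (2/3 * v^3)" using fs[OF vB] abs_Re_le_cmod[of "2/3 * v^3"] by simp
  also have "\<dots> = 2/3 * cmod v ^ 3" by (simp add: norm_mult norm_power)
  finally have "\<bar>f y\<bar>\<^sup>2 \<le> (2/3 * cmod v ^ 3)\<^sup>2" by (rule power_mono) simp
  also have "\<dots> = 4/9 * ((cmod v)\<^sup>2) ^ 3" by (simp add: power_mult_distrib flip: power_mult) (simp add: power2_eq_square)
  also have "(cmod v)\<^sup>2 = cmod w" by (simp add: cv)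
  finally show ?thesis by simp
qed

subsection \<open>Development along straight segments\<close>

text \<open>The initial value is a point of the spectral curve, so the sign is prescribed along with
  the base point. Convexity of the domains makes the overlap of two developments connected, and they
  agree there by unique continuation.\<close>

definition dev :: "'c cot \<Rightarrow> complex set \<Rightarrow> (complex \<Rightarrow> 'c) \<Rightarrow> bool" where
  "dev y U \<psi> \<longleftrightarrow> convex U \<and> 0 \<in> U \<and> flatmap U \<psi> \<and> lift \<psi> 0 = y"

definition devdom :: "'c cot \<Rightarrow> complex set" where
  "devdom y = \<Union>{U. \<exists>\<psi>. dev y U \<psi>}"

text \<open>The exponential map of the flat metric; \<open>dev_agree\<close> makes the choice
  immaterial on \<open>devdom y\<close>.\<close>

definition Exp :: "'c cot \<Rightarrow> complex \<Rightarrow> 'c" where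
  "Exp y z = (SOME x. \<exists>U \<psi>. dev y U \<psi> \<and> z \<in> U \<and> x = \<psi> z)"

lemma dev_agree:
  assumes "dev y U \<psi>" "dev y V \<theta>" "z \<in> U" "z \<in> V"
  shows "\<psi> z = \<theta> z"
proof -
  have UV: "convex U" "convex V" "0 \<in> U" "0 \<in> V" "flatmap U \<psi>" "flatmap V \<theta>" "lift \<psi> 0 = lift \<theta> 0"
    using assms by (auto simp: dev_def)
  have o: "open (U \<inter> V)" using UV flatmap_open by blast
  show ?thesis
    by (rule flatmap_unique(1)[of "U \<inter> V" \<psi> \<theta> 0])
       (use UV o assms(3,4) in \<open>auto intro: flatmap_subset convex_connected convex_Int\<close>)
qed

lemma Exp_eq: "dev y U \<psi> \<Longrightarrow> z \<in> U \<Longrightarrow> Exp y z = \<psi> z"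
proof -
  assume h: "dev y U \<psi>" "z \<in> U"
  then have "\<exists>x U \<psi>. dev y U \<psi> \<and> z \<in> U \<and> x = \<psi> z" by blast
  from someI_ex[OF this] obtain V \<theta> where "dev y V \<theta>" "z \<in> V" "Exp y z = \<theta> z" unfolding Exp_def by blast
  then show ?thesis using dev_agree[of y V \<theta> U \<psi> z] h by simp
qed

lemma dev_subset_devdom: "dev y U \<psi> \<Longrightarrow> U \<subseteq> devdom y"
  unfolding devdom_def by blast

lemma devdomE:
  assumes "z \<in> devdom y"
  obtains U \<psi> where "dev y U \<psi>" "z \<in> U"
  using assms unfolding devdom_def by blast

lemma dev_open: "dev y U \<psi> \<Longrightarrow> open U"
  unfolding dev_def using flatmap_open by blast

lemma open_devdom: "open (devdom y)"
  unfolding devdom_def by (rule open_Union) (use dev_open in blast)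

lemma flatmap_Exp: "flatmap (devdom y) (Exp y)"
proof (rule flatmap_cong_local[OF open_devdom])
  fix z assume "z \<in> devdom y"
  then obtain U \<psi> where U: "dev y U \<psi>" "z \<in> U" by (rule devdomE)
  then have "flatmap U \<psi>" by (simp add: dev_def)
  moreover have "\<forall>w\<in>U \<inter> devdom y. Exp y w = \<psi> w" using Exp_eq[OF U(1)] by blast
  ultimately show "\<exists>V \<theta>. flatmap V \<theta> \<and> z \<in> V \<and> (\<forall>w\<in>V \<inter> devdom y. Exp y w = \<theta> w)" using U(2) by blast
qed

lemma lift_Exp_eq: "dev y U \<psi> \<Longrightarrow> z \<in> U \<Longrightarrow> lift (Exp y) z = lift \<psi> z"
  using lift_cong[OF dev_open[of y U \<psi>], of z "Exp y" \<psi>] Exp_eq[of y U \<psi>] by simp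

lemma lift_Exp_0: "0 \<in> devdom y \<Longrightarrow> lift (Exp y) 0 = y"
proof -
  assume "0 \<in> devdom y"
  then obtain U \<psi> where U: "dev y U \<psi>" "0 \<in> U" by (rule devdomE)
  then show ?thesis using lift_Exp_eq[OF U] by (simp add: dev_def)
qed

lemma dev_exists:
  assumes "y \<in> spectral_curve A \<phi>" "fst y \<in> C_circ A \<phi>"
  shows "0 \<in> devdom y"
proof -
  obtain r \<theta> where r: "r > 0" "flatmap (ball 0 r) \<theta>" "inj_on \<theta> (ball 0 r)" "\<theta> 0 = fst y"
    using flat_disc_C_circ[OF assms(2)] .
  have z: "0 \<in> ball (0::complex) r" using r by simp
  obtain \<sigma> where s: "\<sigma> \<in> {1,-1}" "y = smul \<sigma> (lift \<theta> 0)"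
    using spectral_same_fibre[OF assms(1) lift_in_spectral_curve[OF r(2) z]] r(4) fst_lift[of \<theta> 0] by metis
  then have s2: "\<sigma>\<^sup>2 = 1" by auto
  have "flatmap (ball 0 r) (\<lambda>z. \<theta> (\<sigma> * z + 0))"
    by (rule flatmap_subset[OF flatmap_affine(1)[OF r(2) s2]]) (use s in auto)
  moreover have "lift (\<lambda>z. \<theta> (\<sigma> * z + 0)) 0 = y" using lift_affine[OF r(2) s2, of 0 0] s z by simp
  ultimately have "dev y (ball 0 r) (\<lambda>z. \<theta> (\<sigma> * z + 0))" using z by (simp add: dev_def)
  then show ?thesis using dev_subset_devdom z by blast
qed

lemma f_Exp:
  assumes "z \<in> devdom y"
  shows "f (lift (Exp y) z) = f y + Re z"
proof -
  obtain U \<psi> where U: "dev y U \<psi>" "z \<in> U" using assms by (rule devdomE)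
  then have "f (lift \<psi> z) - f (lift \<psi> 0) = Re z - Re 0"
    by (intro f_lift[of U]) (auto simp: dev_def)
  then show ?thesis using lift_Exp_eq[OF U] U by (simp add: dev_def)
qed

text \<open>The union of a convex domain and a disc need not be convex. A segment inside it has a
  convex neighbourhood, the sum of the segment and a small ball, and the glued map restricted to
  that neighbourhood is again a development.\<close>

lemma dev_extend:
  assumes U: "dev y U \<psi>" "p \<in> U" and V: "flatmap (ball p r) \<theta>" "lift \<theta> p = lift \<psi> p" and z: "closed_segment 0 z \<subseteq> U \<union> ball p r" "0 < r"
  shows "z \<in> devdom y"
proof -
  have u: "convex U" "0 \<in> U" "flatmap U \<psi>" "lift \<psi> 0 = y" using U by (auto simp: dev_def)
  define h where "h w = (if w \<in> U then \<psi> w else \<theta> w)" for w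
  have oU: "open U" using flatmap_open[OF u(3)] .
  have ag: "\<psi> w = \<theta> w" if "w \<in> U" "w \<in> ball p r" for w
    by (rule flatmap_unique(1)[of "U \<inter> ball p r" \<psi> \<theta> p])
       (use u U(2) V z(2) that oU in \<open>auto intro: flatmap_subset convex_connected convex_Int\<close>)
  have fh: "flatmap (U \<union> ball p r) h"
  proof (rule flatmap_cong_local)
    show "open (U \<union> ball p r)" by (rule open_Un[OF oU open_ball])
    fix w assume "w \<in> U \<union> ball p r"
    then consider "w \<in> U" | "w \<in> ball p r" by blast
    then show "\<exists>W \<eta>. flatmap W \<eta> \<and> w \<in> W \<and> (\<forall>v\<in>W \<inter> (U \<union> ball p r). h v = \<eta> v)"
    proof cases
      case 1
      then show ?thesis using u(3) by (intro exI[of _ U] exI[of _ \<psi>]) (simp add: h_def)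
    next
      case 2
      then show ?thesis using V(1) ag by (intro exI[of _ "ball p r"] exI[of _ \<theta>]) (simp add: h_def)
    qed
  qed
  obtain e where e: "e > 0" "(\<Union>x\<in>closed_segment 0 z. ball x e) \<subseteq> U \<union> ball p r"
    using compact_subset_open_imp_ball_epsilon_subset[OF compact_segment flatmap_open[OF fh] z(1)] .
  let ?W = "\<Union>x\<in>closed_segment 0 z. ball x e"
  have "(\<Union>x\<in>closed_segment 0 z. \<Union>y\<in>ball 0 e. {x + y}) = ?W"
  proof -
    have "(\<Union>y\<in>ball 0 e. {x + y}) = ball x e" for x :: complex
    proof (intro equalityI subsetI)
      fix u assume "u \<in> ball x e"
      then have "u - x \<in> ball 0 e" "u = x + (u - x)" by (simp_all add: dist_norm norm_minus_commute)
      then show "u \<in> (\<Union>y\<in>ball 0 e. {x + y})" by blast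
    qed (auto simp: dist_norm)
    then show ?thesis by simp
  qed
  then have "convex ?W" using convex_sums[OF convex_closed_segment[of 0 z] convex_ball[of "0::complex" e]] by simp
  moreover have "0 \<in> ?W" "z \<in> ?W" by (rule UN_I[of 0], simp, simp add: e(1), rule UN_I[of z], simp, simp add: e(1))
  moreover have "flatmap ?W h" by (rule flatmap_subset[OF fh _ e(2)]) auto
  moreover have "lift h 0 = y"
    using lift_cong[OF oU u(2), of h \<psi>] u(4) by (simp add: h_def)
  ultimately have "dev y ?W h" by (simp add: dev_def)
  then show ?thesis using dev_subset_devdom \<open>z \<in> ?W\<close> by blast
qed

text \<open>Completeness: a straight segment can be developed until it runs into a zero.\<close>

lemma blocked_near_zeros:
  assumes z: "z \<notin> devdom y" and t: "\<And>t. 0 \<le> t \<Longrightarrow> t < 1 \<Longrightarrow> of_real t * z \<in> devdom y" and \<delta>: "\<delta> > 0"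
  obtains t0 where "t0 < 1" "0 \<le> t0" "\<And>t. t0 < t \<Longrightarrow> t < 1 \<Longrightarrow> Exp y (of_real t * z) \<in> zero_nhd A \<phi> \<xi> \<rho> \<delta>"
proof -
  obtain r where r: "r > 0" "\<And>x. x \<in> C_tilde A \<phi> \<Longrightarrow> x \<notin> zero_nhd A \<phi> \<xi> \<rho> \<delta> \<Longrightarrow> \<exists>\<theta>. flatmap (ball 0 r) \<theta> \<and> \<theta> 0 = x"
    using flatmap_unif[OF \<delta>] by blast
  have "0 \<in> devdom y" using t[of 0] by simp
  then have z0: "cmod z > 0" using z by auto
  \<comment> \<open>Beyond \<open>t0\<close> the remaining length (1 - t) |z| is below r, so a flat
    disc of radius r at that point would carry the development as far as z.\<close>
  define t0 where "t0 = max 0 (1 - r / cmod z)"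
  have "Exp y (of_real t * z) \<in> zero_nhd A \<phi> \<xi> \<rho> \<delta>" if tt: "t0 < t" "t < 1" for t
  proof (rule ccontr)
    assume n: "Exp y (of_real t * z) \<notin> zero_nhd A \<phi> \<xi> \<rho> \<delta>"
    let ?p = "of_real t * z"
    have t': "0 \<le> t" "(1 - t) * cmod z < r" using tt z0 by (auto simp: t0_def field_simps)
    have pd: "?p \<in> devdom y" using t t'(1) tt(2) by blast
    have "Exp y ?p \<in> C_tilde A \<phi>" using flatmap_C_circ[OF flatmap_Exp pd] C_circ_subset by blast
    then obtain \<theta> where \<theta>: "flatmap (ball 0 r) \<theta>" "\<theta> 0 = Exp y ?p" using r(2) n by blast
    obtain U \<psi> where U: "dev y U \<psi>" "?p \<in> U" using pd by (rule devdomE)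
    have fU: "flatmap U \<psi>" using U by (simp add: dev_def)
    have z0: "0 \<in> ball (0::complex) r" using r by simp
    have "\<psi> ?p = \<theta> 0" using \<theta>(2) Exp_eq[OF U] by simp
    then obtain \<sigma> where s: "\<sigma> \<in> {1,-1}" "\<sigma>\<^sup>2 = 1" "lift \<psi> ?p = smul \<sigma> (lift \<theta> 0)"
      using lift_sign[OF fU \<theta>(1) U(2) z0] by blast
    let ?\<theta> = "\<lambda>w. \<theta> (\<sigma> * w + - \<sigma> * ?p)"
    have nm: "cmod (\<sigma> * w + - \<sigma> * ?p) = dist ?p w" for w
    proof -
      have "\<sigma> * w + - \<sigma> * ?p = \<sigma> * (w - ?p)" by (simp add: algebra_simps)
      moreover have "cmod \<sigma> = 1" using s(1) by auto
      ultimately show ?thesis by (simp only: norm_mult dist_norm norm_minus_commute mult_1)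
    qed
    have V: "flatmap (ball ?p r) ?\<theta>"
      by (rule flatmap_subset[OF flatmap_affine(1)[OF \<theta>(1) s(2)]]) (use nm in auto)
    have l: "lift ?\<theta> ?p = lift \<psi> ?p"
      using lift_affine[OF \<theta>(1) s(2), of ?p "- \<sigma> * ?p"] s(3) z0 by simp
    have "closed_segment 0 z \<subseteq> U \<union> ball ?p r"
    proof
      fix x assume "x \<in> closed_segment 0 z"
      then obtain u where u: "0 \<le> u" "u \<le> 1" "x = of_real u * z"
        by (auto simp: in_segment scaleR_conv_of_real)
      show "x \<in> U \<union> ball ?p r"
      proof (cases "u \<le> t")
        case True
        have "x \<in> closed_segment 0 ?p"
        proof (cases "t = 0")
          case False
          then have "x = (1 - u / t) *\<^sub>R 0 + (u / t) *\<^sub>R ?p" using u(3) by (simp add: scaleR_conv_of_real)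
          then show ?thesis using True u t'(1) False by (auto simp: in_segment intro!: exI[of _ "u / t"])
        qed (use True u in auto)
        moreover have "closed_segment 0 ?p \<subseteq> U" using U by (intro closed_segment_subset) (auto simp: dev_def)
        ultimately show ?thesis by blast
      next
        case False
        have "dist ?p x = \<bar>t - u\<bar> * cmod z" using u(3) by (simp add: dist_norm norm_mult flip: left_diff_distrib of_real_diff)
        also have "\<dots> \<le> (1 - t) * cmod z" using False u by (intro mult_right_mono) auto
        finally show ?thesis using t'(2) by simp
      qed
    qed
    from dev_extend[OF U V l this r(1)] show False using z by simp
  qed
  moreover have "t0 < 1" "0 \<le> t0" using r z0 by (auto simp: t0_def)
  ultimately show ?thesis using that by blast
qed

text \<open>Close to the blocked end the curve lies in ever smaller neighbourhoods of the zeroes;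
  being connected it stays near a single one, b. There f is small by \<open>f_near_zero\<close>,
  whereas along the curve it equals f y + t Re z, so the limit value is 0.\<close>

lemma blocked:
  assumes z: "z \<notin> devdom y" and t: "\<And>t. 0 \<le> t \<Longrightarrow> t < 1 \<Longrightarrow> of_real t * z \<in> devdom y"
  shows "\<exists>b\<in>qd_zeros A \<phi>. ((\<lambda>t. Exp y (of_real t * z)) \<longlongrightarrow> b) (at_left 1)" "f y + Re z = 0"
proof -
  let ?c = "\<lambda>t. Exp y (of_real t * z)"
  define \<delta>0 where "\<delta>0 = Min (\<rho> ` qd_zeros A \<phi>)"
  have fin: "finite (\<rho> ` qd_zeros A \<phi>)" using finite_zeros by (rule finite_imageI)
  have "\<delta>0 \<in> \<rho> ` qd_zeros A \<phi>" unfolding \<delta>0_def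
    by (rule Min_in[OF fin]) (simp only: image_is_empty zeros_nonempty not_False_eq_True)
  then have \<delta>0: "\<delta>0 > 0" using zchart(2) by auto
  have \<delta>0': "\<delta>0 \<le> \<rho> b" if "b \<in> qd_zeros A \<phi>" for b unfolding \<delta>0_def by (rule Min_le[OF fin imageI[OF that]])
  obtain t0 where t0: "t0 < 1" "0 \<le> t0" "\<And>t. t0 < t \<Longrightarrow> t < 1 \<Longrightarrow> ?c t \<in> zero_nhd A \<phi> \<xi> \<rho> \<delta>0"
    using blocked_near_zeros[OF z t \<delta>0] by blast
  let ?I = "{t0<..<1}"
  have cont: "continuous_on ?I ?c"
    by (rule continuous_on_compose2[OF flatmap_continuous[OF flatmap_Exp]]) (use t t0 in \<open>auto intro!: continuous_intros\<close>)
  have conn: "connected (?c ` ?I)" by (rule connected_continuous_image[OF cont]) simp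
  obtain t1 where t1: "t1 \<in> ?I" using dense[OF t0(1)] by auto
  obtain b where b: "b \<in> qd_zeros A \<phi>" "?c t1 \<in> cim (zchart b)"
    using t0(3)[of t1] t1 by (auto simp: zero_nhd_def)
  let ?O = "\<Union>b'\<in>qd_zeros A \<phi> - {b}. cim (zchart b')"
  have "cim (zchart b) \<inter> (?c ` ?I) = {} \<or> ?O \<inter> (?c ` ?I) = {}"
  proof (rule connectedD[OF conn])
    show "open (cim (zchart b))" using open_cim[OF zchart(1)[OF b(1)]] .
    show "open ?O" by (intro open_UN ballI open_cim zchart(1)) auto
    have "cim (zchart b) \<inter> ?O = {}" using zchart_disjoint[OF b(1)] by fastforce
    then show "cim (zchart b) \<inter> ?O \<inter> ?c ` ?I = {}" by blast
    show "?c ` ?I \<subseteq> cim (zchart b) \<union> ?O"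
    proof
      fix x assume "x \<in> ?c ` ?I"
      then have "x \<in> zero_nhd A \<phi> \<xi> \<rho> \<delta>0" using t0(3) by auto
      then obtain b' w where "b' \<in> qd_zeros A \<phi>" "w \<in> ball 0 (\<rho> b')" "x = \<xi> b' w" by (auto simp: zero_nhd_def)
      moreover from this have "x \<in> cim (zchart b')" by simp
      ultimately show "x \<in> cim (zchart b) \<union> ?O" by blast
    qed
  qed
  then have other: "?O \<inter> (?c ` ?I) = {}" using b(2) t1 by blast
  have inb: "\<exists>t2<1. t0 \<le> t2 \<and> (\<forall>t. t2 < t \<and> t < 1 \<longrightarrow> (\<exists>w. w \<in> ball 0 (\<rho> b) \<and> w \<in> ball 0 d \<and> ?c t = \<xi> b w))"
    if d: "d > 0" for d
  proof -
    obtain t3 where t3: "t3 < 1" "0 \<le> t3" "\<And>t. t3 < t \<Longrightarrow> t < 1 \<Longrightarrow> ?c t \<in> zero_nhd A \<phi> \<xi> \<rho> d"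
      using blocked_near_zeros[OF z t d] by blast
    have "\<exists>w. w \<in> ball 0 (\<rho> b) \<and> w \<in> ball 0 d \<and> ?c t = \<xi> b w" if tt: "max t0 t3 < t \<and> t < 1" for t
    proof -
      obtain b' w where w: "b' \<in> qd_zeros A \<phi>" "w \<in> ball 0 (\<rho> b')" "w \<in> ball 0 d" "?c t = \<xi> b' w"
        using t3(3)[of t] tt by (auto simp: zero_nhd_def)
      have "t \<in> ?I" using tt by simp
      then have "?c t \<notin> ?O" using other by blast
      moreover have "?c t \<in> cim (zchart b')" using w(2,4) by simp
      ultimately have "b' = b" using w(1) by blast
      then show ?thesis using w by blast
    qed
    then show ?thesis using t0(1) t3(1) by (intro exI[of _ "max t0 t3"]) auto
  qed
  have "(?c \<longlongrightarrow> b) (at_left 1)"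
  proof (rule topological_tendstoI)
    fix S assume S: "open S" "b \<in> S"
    have "isCont (\<xi> b) 0"
      using cmap_continuous[OF zchart(1)[OF b(1)]] zchart(2)[OF b(1)] by (simp add: continuous_on_eq_continuous_at)
    then have "(\<xi> b \<longlongrightarrow> b) (nhds 0)" using zchart(3)[OF b(1)] by (simp add: continuous_at tendsto_nhds_iff)
    then have "eventually (\<lambda>w. \<xi> b w \<in> S) (nhds 0)" using S by (auto dest: topological_tendstoD)
    then obtain d where d: "d > 0" "\<And>w. dist w 0 < d \<Longrightarrow> \<xi> b w \<in> S" by (auto simp: eventually_nhds_metric)
    obtain t2 where t2: "t2 < 1" "\<forall>t. t2 < t \<and> t < 1 \<longrightarrow> (\<exists>w. w \<in> ball 0 (\<rho> b) \<and> w \<in> ball 0 d \<and> ?c t = \<xi> b w)"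
      using inb[OF d(1)] by blast
    have "?c t \<in> S" if tt: "t2 < t" "t < 1" for t
    proof -
      obtain w where "w \<in> ball 0 d" "?c t = \<xi> b w" using t2(2) tt by blast
      then show ?thesis using d(2)[of w] by simp
    qed
    then show "eventually (\<lambda>t. ?c t \<in> S) (at_left 1)"
      unfolding eventually_at_left[OF t2(1)] using t2(1) by (intro exI[of _ t2]) simp
  qed
  then show "\<exists>b\<in>qd_zeros A \<phi>. (?c \<longlongrightarrow> b) (at_left 1)" using b(1) by blast
  have "(f y + Re z)\<^sup>2 \<le> e" if e: "e > 0" for e
  proof -
    define d where "d = min e 1"
    have d: "0 < d" "d \<le> 1" "d \<le> e" using e by (auto simp: d_def)
    obtain t2 where t2: "t2 < 1" "t0 \<le> t2" "\<forall>t. t2 < t \<and> t < 1 \<longrightarrow> (\<exists>w. w \<in> ball 0 (\<rho> b) \<and> w \<in> ball 0 d \<and> ?c t = \<xi> b w)"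
      using inb[OF d(1)] by blast
    have le: "(f y + t * Re z)\<^sup>2 \<le> e" if tt: "t2 < t" "t < 1" for t
    proof -
      obtain w where w: "w \<in> ball 0 (\<rho> b)" "w \<in> ball 0 d" "?c t = \<xi> b w" using t2(3) tt by blast
      have td: "of_real t * z \<in> devdom y" using t[of t] tt t2(2) t0(2) by simp
      have "(f (lift (Exp y) (of_real t * z)))\<^sup>2 \<le> 4/9 * cmod w ^ 3"
        by (rule f_near_zero[OF b(1) lift_in_spectral_curve[OF flatmap_Exp td] _ w(1)]) (simp add: w(3))
      also have "\<dots> \<le> 1 * d ^ 3" using w(2) by (intro mult_mono power_mono) auto
      also have "d ^ 3 \<le> d ^ 1" using d by (intro power_decreasing) auto
      finally show ?thesis using f_Exp[OF td] d(3) by simp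
    qed
    have "((\<lambda>t. (f y + t * Re z)\<^sup>2) \<longlongrightarrow> (f y + 1 * Re z)\<^sup>2) (at_left 1)" by (intro tendsto_intros)
    moreover have "eventually (\<lambda>t. (f y + t * Re z)\<^sup>2 \<le> e) (at_left 1)"
      unfolding eventually_at_left[OF t2(1)] using le t2(1) by (intro exI[of _ t2]) simp
    ultimately have "(f y + 1 * Re z)\<^sup>2 \<le> e" by (rule tendsto_upperbound) simp
    then show ?thesis by simp
  qed
  then have "(f y + Re z)\<^sup>2 \<le> 0" using field_le_epsilon[of "(f y + Re z)\<^sup>2" 0] by simp
  then show "f y + Re z = 0" by simp
qed

end

section \<open>Maximal strips\<close>

definition band :: "real set \<Rightarrow> complex set" where
  "band J = {z. Im z \<in> J}"

lemma open_band: "open J \<Longrightarrow> open (band J)"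
  using continuous_open_preimage[of UNIV Im J] by (simp add: band_def vimage_def continuous_intros)

lemma convex_band: "is_interval J \<Longrightarrow> convex (band J)"
  using convex_linear_vimage[of Im J] bounded_linear.linear[OF bounded_linear_Im]
  by (simp add: band_def vimage_def is_interval_convex_1)

lemma connected_band: "is_interval J \<Longrightarrow> connected (band J)"
  by (rule convex_connected[OF convex_band])

lemma convex_right_half_plane: "convex {z. Re z > a}" and convex_left_half_plane: "convex {z. Re z < a}"
  by (rule convex_halfspace_Re_gt convex_halfspace_Re_lt)+

definition edge :: "real set \<Rightarrow> real \<Rightarrow> bool" where
  "edge J c \<longleftrightarrow> c \<notin> J \<and> (\<forall>e>0. \<exists>t\<in>J. dist t c < e)"

text \<open>Only the line Re z = 0 is tested: f tends to 0 at a zero, so in a coordinate with f = Re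
  this is the only vertical line that can run into one.\<close>

definition ends_at :: "(complex \<Rightarrow> 'c::topological_space) \<Rightarrow> real set \<Rightarrow> real \<Rightarrow> 'c \<Rightarrow> bool" where
  "ends_at \<psi> J c b \<longleftrightarrow> (\<forall>S. open S \<and> b \<in> S \<longrightarrow> (\<exists>e>0. \<forall>t\<in>J. dist t c < e \<longrightarrow> \<psi> (Complex 0 t) \<in> S))"

lemma edge_segment:
  assumes J: "is_interval J" "open J" and c: "edge J c" and t: "t \<in> J" and s: "0 < s" "s \<le> 1"
  shows "c + s * (t - c) \<in> J"
proof -
  have "c \<in> closure J" using c by (auto simp: edge_def closure_approachable)
  moreover have "t \<in> interior J" using t J(2) by (simp add: interior_open)
  ultimately have "c - s *\<^sub>R (c - t) \<in> interior J"
    using J(1) s by (intro mem_interior_closure_convex_shrink) (simp_all add: is_interval_convex_1)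
  moreover have "c - s *\<^sub>R (c - t) = c + s * (t - c)" by (simp add: algebra_simps)
  ultimately have "c + s * (t - c) \<in> interior J" by (simp only:)
  then show ?thesis using interior_subset by blast
qed

section \<open>Flat maps near corners, and limit points of their images\<close>

context gmn_surface
begin

text \<open>The strict inequality leaves room for the smaller radius \<rho>1 on which the
  compactness argument of \<open>zero_chart_extend\<close> rests.\<close>

lemma zero_chart_extend':
  assumes b: "b \<in> qd_zeros A \<phi>" and f: "flatmap Q \<psi>" and Q: "connected Q" "Q \<subseteq> ball c r"
    and r: "9 * r\<^sup>2 < 4 * \<rho> b ^ 3"
    and z0: "z0 \<in> Q" "\<psi> z0 \<in> cim (zchart b)" "zdisp b \<psi> z0 = z0 - c" and z: "z \<in> Q"
  shows "\<psi> z \<in> cim (zchart b)" "zdisp b \<psi> z = z - c"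
    "4/9 * (cmod (cinv (zchart b) (\<psi> z))) ^ 3 = (cmod (z - c))\<^sup>2" "z \<noteq> c"
proof -
  have "dist c z0 < r" using z0(1) Q(2) by auto
  then have r0: "0 < r" using zero_le_dist[of c z0] by linarith
  obtain x where x: "9 * r\<^sup>2 / 4 < x" "x < \<rho> b ^ 3" using dense[of "9 * r\<^sup>2 / 4" "\<rho> b ^ 3"] r by auto
  define \<rho>1 where "\<rho>1 = root 3 x"
  have x0: "x > 0" using x(1) r0 zero_less_power[of r 2] by linarith
  have r1: "\<rho>1 ^ 3 = x" "\<rho>1 > 0" using x0 by (simp_all add: \<rho>1_def odd_real_root_pow)
  have r1b: "\<rho>1 < \<rho> b" using x(2) r1 zchart(2)[OF b] power_less_imp_less_base[of \<rho>1 3 "\<rho> b"] by simp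
  have r9: "9 * r\<^sup>2 \<le> 4 * \<rho>1 ^ 3" using x(1) r1(1) by simp
  show "\<psi> z \<in> cim (zchart b)" by (rule zero_chart_extend(1)[OF b f Q r9 r1b r1(2) z0 z])
  show "zdisp b \<psi> z = z - c" by (rule zero_chart_extend(2)[OF b f Q r9 r1b r1(2) z0 z])
  show "4/9 * (cmod (cinv (zchart b) (\<psi> z))) ^ 3 = (cmod (z - c))\<^sup>2" by (rule zero_chart_extend(3)[OF b f Q r9 r1b r1(2) z0 z])
  show "z \<noteq> c" by (rule zero_chart_extend(4)[OF b f Q r9 r1b r1(2) z0 z])
qed

text \<open>Along the approaching segment \<open>zdisp\<close> differs from the identity by a
  constant d. The two sides of the distance formula tend to 0 and to |c + d|^2, so d = - c, and
  \<open>zero_chart_extend'\<close> spreads the resulting relation over Q.\<close>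

lemma corner:
  assumes b: "b \<in> qd_zeros A \<phi>" and f: "flatmap Q \<psi>" and Q: "convex Q" "Q \<subseteq> ball c r"
    and r: "9 * r\<^sup>2 < 4 * \<rho> b ^ 3"
    and v: "\<And>s. 0 < s \<Longrightarrow> s \<le> 1 \<Longrightarrow> c + of_real s * v \<in> Q"
    and lim: "((\<lambda>s. \<psi> (c + of_real s * v)) \<longlongrightarrow> b) (at_right 0)" and z: "z \<in> Q"
  shows "\<psi> z \<in> cim (zchart b)" "zdisp b \<psi> z = z - c"
    "4/9 * (cmod (cinv (zchart b) (\<psi> z))) ^ 3 = (cmod (z - c))\<^sup>2"
proof -
  let ?k = "zchart b"
  note k = zchart[OF b]
  have oc: "open (cim ?k)" "b \<in> cim ?k" using open_cim[OF k(1)] zero_in_zchart[OF b] .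
  have "eventually (\<lambda>s. \<psi> (c + of_real s * v) \<in> cim ?k) (at_right 0)" using topological_tendstoD[OF lim oc] .
  then obtain s0 where s0: "s0 > 0" "\<And>s. 0 < s \<Longrightarrow> s < s0 \<Longrightarrow> \<psi> (c + of_real s * v) \<in> cim ?k"
    by (auto simp: eventually_at_right[of 0 1])
  define s1 where "s1 = min s0 1"
  have s1: "0 < s1" "s1 \<le> 1" "s1 \<le> s0" using s0 by (auto simp: s1_def)
  define X where "X = (\<lambda>s. c + of_real s * v) ` {0<..<s1}"
  have "X = (\<lambda>x. c + x) ` (\<lambda>s. s *\<^sub>R v) ` {0<..<s1}"
    unfolding X_def image_image by (simp add: scaleR_conv_of_real)
  then have cX: "convex X"
    by (simp only: convex_translation convex_linear_image linear_scaleR_left convex_real_interval)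
  have XQ: "X \<subseteq> Q" using v s1 by (auto simp: X_def)
  have Xk: "\<psi> x \<in> cim ?k" if "x \<in> X" for x using that s0(2) s1 by (auto simp: X_def)
  have "((\<lambda>z. zdisp b \<psi> z - z) has_field_derivative 0) (at x within X)" if x: "x \<in> X" for x
    using DERIV_diff[OF zdisp(1)[OF b f subsetD[OF XQ x] Xk[OF x]] DERIV_ident]
    by (simp only: diff_self has_field_derivative_at_within)
  from has_field_derivative_zero_constant[OF cX this] obtain d where d: "\<forall>x\<in>X. zdisp b \<psi> x - x = d" by blast
  have dist: "4/9 * (cmod (cinv ?k (\<psi> (c + of_real s * v)))) ^ 3 = (cmod (c + of_real s * v + d))\<^sup>2"
    if s: "0 < s" "s < s1" for s
  proof -
    have x: "c + of_real s * v \<in> X" unfolding X_def using s by (intro imageI) simp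
    have "zdisp b \<psi> (c + of_real s * v) = c + of_real s * v + d"
      using bspec[OF d x] by (simp add: algebra_simps)
    then show ?thesis using zdisp(3)[OF b f subsetD[OF XQ x] Xk[OF x]] by simp
  qed
  have "isCont (cinv ?k) b" using iffD1[OF continuous_on_eq_continuous_at[OF oc(1)] cinv_continuous[OF k(1)]] oc(2) by blast
  then have l1: "((\<lambda>s. cinv ?k (\<psi> (c + of_real s * v))) \<longlongrightarrow> cinv ?k b) (at_right 0)"
    using isCont_tendsto_compose[OF _ lim] by blast
  have "cinv ?k b = 0" using cinv_cmap[OF k(1), of 0] k(2,3) by simp
  with l1 have "((\<lambda>s. 4/9 * (cmod (cinv ?k (\<psi> (c + of_real s * v)))) ^ 3) \<longlongrightarrow> 4/9 * (cmod 0)^3) (at_right 0)"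
    by (intro tendsto_intros) simp
  moreover have "eventually (\<lambda>s. 4/9 * (cmod (cinv ?k (\<psi> (c + of_real s * v)))) ^ 3 = (cmod (c + of_real s * v + d))\<^sup>2) (at_right 0)"
    unfolding eventually_at_right[OF s1(1)] using dist s1(1) by (intro exI[of _ s1]) simp
  ultimately have "((\<lambda>s. (cmod (c + of_real s * v + d))\<^sup>2) \<longlongrightarrow> 4/9 * (cmod 0)^3) (at_right 0)"
    by (rule Lim_transform_eventually)
  moreover have "((\<lambda>s. (cmod (c + of_real s * v + d))\<^sup>2) \<longlongrightarrow> (cmod (c + of_real 0 * v + d))\<^sup>2) (at_right 0)"
    by (intro tendsto_intros)
  ultimately have "4/9 * (cmod 0)^3 = (cmod (c + of_real 0 * v + d))\<^sup>2"
    by (rule tendsto_unique[OF trivial_limit_at_right_real])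
  then have dc: "c + d = 0" by simp
  define s2 where "s2 = s1 / 2"
  have s2: "0 < s2" "s2 < s1" "s2 \<le> 1" using s1 by (auto simp: s2_def)
  let ?z0 = "c + of_real s2 * v"
  have z0: "?z0 \<in> X" unfolding X_def using s2 by (intro imageI) simp
  have z0d: "zdisp b \<psi> ?z0 = ?z0 - c" using bspec[OF d z0] dc by (simp add: algebra_simps eq_neg_iff_add_eq_0)
  note e = zero_chart_extend'[OF b f convex_connected[OF Q(1)] Q(2) r subsetD[OF XQ z0] Xk[OF z0] z0d z]
  show "\<psi> z \<in> cim ?k" "zdisp b \<psi> z = z - c" "4/9 * (cmod (cinv ?k (\<psi> z))) ^ 3 = (cmod (z - c))\<^sup>2"
    using e(1-3) .
qed

lemma zero_neighbourhood_basis: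
  assumes b: "b \<in> qd_zeros A \<phi>" and S: "open S" "b \<in> S"
  obtains d where "d > 0" "\<And>w. w \<in> ball 0 (\<rho> b) \<Longrightarrow> cmod w < d \<Longrightarrow> \<xi> b w \<in> S"
proof -
  have "isCont (\<xi> b) 0"
    using cmap_continuous[OF zchart(1)[OF b]] zchart(2)[OF b] by (simp add: continuous_on_eq_continuous_at)
  then have "(\<xi> b \<longlongrightarrow> b) (nhds 0)" using zchart(3)[OF b] by (simp add: continuous_at tendsto_nhds_iff)
  then have "eventually (\<lambda>w. \<xi> b w \<in> S) (nhds 0)" using S by (auto dest: topological_tendstoD)
  then obtain d where "d > 0" "\<And>w. dist w 0 < d \<Longrightarrow> \<xi> b w \<in> S" by (auto simp: eventually_nhds_metric)
  then show ?thesis using that[of d] by simp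
qed

lemma zero_near_distance:
  assumes b: "b \<in> qd_zeros A \<phi>" and S: "open S" "b \<in> S"
  obtains e where "e > 0" "\<And>x d. x \<in> cim (zchart b) \<Longrightarrow> 4/9 * (cmod (cinv (zchart b) x)) ^ 3 = d\<^sup>2 \<Longrightarrow> \<bar>d\<bar> < e \<Longrightarrow> x \<in> S"
proof -
  obtain d0 where d0: "d0 > 0" "\<And>w. w \<in> ball 0 (\<rho> b) \<Longrightarrow> cmod w < d0 \<Longrightarrow> \<xi> b w \<in> S"
    using zero_neighbourhood_basis[OF b S] by blast
  define e where "e = sqrt (4/9 * d0 ^ 3)"
  have e: "e > 0" "e\<^sup>2 = 4/9 * d0 ^ 3" using d0 by (simp_all add: e_def)
  have "x \<in> S" if x: "x \<in> cim (zchart b)" "4/9 * (cmod (cinv (zchart b) x)) ^ 3 = d\<^sup>2" "\<bar>d\<bar> < e" for x d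
  proof -
    have "\<bar>d\<bar>\<^sup>2 < e\<^sup>2" using x(3) by (intro power_strict_mono) auto
    then have "(cmod (cinv (zchart b) x)) ^ 3 < d0 ^ 3" using x(2) e(2) by simp
    then have "cmod (cinv (zchart b) x) < d0" using d0(1) by (simp add: power_less_imp_less_base)
    then show ?thesis using d0(2)[of "cinv (zchart b) x"] cinv_in_cdom[OF x(1)] cmap_cinv[OF x(1)] by simp
  qed
  then show ?thesis using that e(1) by blast
qed

text \<open>A limit point x cannot be a zero: \<psi> is defined on a disc of radius e around every
  point of X, and \<open>no_zero_near\<close> keeps zeroes away. At a regular point a small flat
  disc around x meets the image, and matching the two flat maps gives a preimage of x close to
  X.\<close>

lemma near_closure:
  assumes f: "flatmap U \<psi>" and e: "e > 0" "\<And>z. z \<in> X \<Longrightarrow> ball z e \<subseteq> U"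
    and x: "x \<in> C_tilde A \<phi>" "x \<in> closure (\<psi> ` X)" and d: "d > 0"
  obtains z z' where "z \<in> X" "z' \<in> U" "dist z z' < d" "\<psi> z' = x"
proof -
  have meet: "\<exists>z\<in>X. \<psi> z \<in> S" if "open S" "x \<in> S" for S
    using x(2) that open_Int_closure_eq_empty[OF that(1), of "\<psi> ` X"] by blast
  have "x \<notin> qd_zeros A \<phi>"
  proof
    assume b: "x \<in> qd_zeros A \<phi>"
    have "\<rho> x ^ 3 > 0" using zchart(2)[OF b] by simp
    then have "((\<lambda>e::real. 9 * e\<^sup>2) \<longlongrightarrow> 9 * 0\<^sup>2) (at_right 0)" by (intro tendsto_intros)
    then have "eventually (\<lambda>e::real. 9 * e\<^sup>2 < \<rho> x ^ 3) (at_right 0)"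
      using \<open>\<rho> x ^ 3 > 0\<close> by (intro order_tendstoD(2)) auto
    then obtain e0 where e0: "e0 > 0" "\<And>y. 0 < y \<Longrightarrow> y < e0 \<Longrightarrow> 9 * y\<^sup>2 < \<rho> x ^ 3" by (auto simp: eventually_at_right[of 0 1])
    define e1 where "e1 = min e (e0 / 2)"
    have e1: "e1 > 0" "e1 \<le> e" "9 * e1\<^sup>2 < \<rho> x ^ 3" using e(1) e0 by (auto simp: e1_def)
    let ?S = "\<xi> x ` {w \<in> ball 0 (\<rho> x). 4/9 * cmod w ^ 3 < e1\<^sup>2}"
    have "open {w::complex. 4/9 * cmod w ^ 3 < e1\<^sup>2}" by (intro open_Collect_less continuous_intros)
    then have "open (ball 0 (\<rho> x) \<inter> {w::complex. 4/9 * cmod w ^ 3 < e1\<^sup>2})" by (intro open_Int open_ball)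
    moreover have "ball 0 (\<rho> x) \<inter> {w::complex. 4/9 * cmod w ^ 3 < e1\<^sup>2} = {w \<in> ball 0 (\<rho> x). 4/9 * cmod w ^ 3 < e1\<^sup>2}" by blast
    ultimately have "open ?S" using cmap_open_image[OF zchart(1)[OF b], of "{w \<in> ball 0 (\<rho> x). 4/9 * cmod w ^ 3 < e1\<^sup>2}"] by auto
    moreover have "x \<in> ?S" using zchart(2,3)[OF b] e1(1) by (intro image_eqI[of _ _ 0]) simp_all
    ultimately obtain z where z: "z \<in> X" "\<psi> z \<in> ?S" using meet by blast
    then obtain w where w: "w \<in> ball 0 (\<rho> x)" "4/9 * cmod w ^ 3 < e1\<^sup>2" "\<psi> z = \<xi> x w" by blast
    have "ball z e1 \<subseteq> U" using e(2)[OF z(1)] e1(2) subset_ball[of e1 e z] by blast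
    from no_zero_near[OF f this e1(1) b e1(3) w(3,1,2)] show False .
  qed
  then have "x \<in> C_circ A \<phi>" using x(1) unfolding C_tilde_eq by blast
  then obtain r \<theta> where r: "r > 0" "flatmap (ball 0 r) \<theta>" "inj_on \<theta> (ball 0 r)" "\<theta> 0 = x" by (rule flat_disc_C_circ)
  define m where "m = min (r/2) (min e d)"
  have m: "m > 0" "m \<le> r/2" "m \<le> e" "m \<le> d" using r e d by (auto simp: m_def)
  have sub: "ball (0::complex) m \<subseteq> ball 0 r" using m r by (intro subset_ball) auto
  have "open (\<theta> ` ball 0 m)" using flatmap_open_image[OF flatmap_subset[OF r(2) open_ball sub]] .
  moreover have "x \<in> \<theta> ` ball 0 m" using r(4) m(1) by (intro image_eqI[of _ _ 0]) simp_all
  ultimately obtain z where z: "z \<in> X" "\<psi> z \<in> \<theta> ` ball 0 m" using meet by blast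
  then obtain v where v: "v \<in> ball 0 m" "\<psi> z = \<theta> v" by blast
  have zU: "z \<in> U" using e z(1) by force
  have vr: "v \<in> ball 0 r" using v sub by blast
  obtain \<sigma> where s: "\<sigma> \<in> {1,-1}" "\<sigma>\<^sup>2 = 1" "lift \<psi> z = smul \<sigma> (lift \<theta> v)"
    using lift_sign[OF f r(2) zU vr v(2)] .
  have cs: "cmod \<sigma> = 1" using s(1) by auto
  let ?q = "- \<sigma> * v"
  have q: "?q \<in> ball 0 m" using v(1) cs by (simp add: norm_mult)
  have dom: "z + p \<in> U \<and> v + \<sigma> * p \<in> ball 0 r" if "p \<in> ball 0 m" for p
  proof -
    have "z + p \<in> ball z e" using that m(3) by (simp add: dist_norm)
    moreover have "cmod (v + \<sigma> * p) \<le> cmod v + cmod p" using norm_triangle_ineq[of v "\<sigma> * p"] cs by (simp add: norm_mult)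
    ultimately show ?thesis using e(2)[OF z(1)] v(1) that m(2) by auto
  qed
  have "\<psi> (z + ?q) = \<theta> (v + \<sigma> * ?q)"
    by (rule flatmap_matching(1)[OF f r(2) zU vr s(2,3) open_ball connected_ball _ dom q]) (use m(1) in simp)
  moreover have "v + \<sigma> * ?q = v - \<sigma>\<^sup>2 * v" by (simp add: power2_eq_square)
  then have "v + \<sigma> * ?q = 0" using s(2) by simp
  ultimately have "\<psi> (z + ?q) = x" using r(4) by (simp only:)
  moreover have "dist z (z + ?q) < d" using q m(4) by (simp add: dist_norm)
  ultimately show ?thesis using that[OF z(1)] dom[OF q] by blast
qed

text \<open>By injectivity the preimages of x found arbitrarily close to X are one and the same
  point, which therefore lies in the closure of X.\<close>

lemma closed_flat_image:
  assumes f: "flatmap U \<psi>" "inj_on \<psi> U" and e: "e > 0" "\<And>z. z \<in> X \<Longrightarrow> ball z e \<subseteq> U" and X: "closed X"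
    and x: "x \<in> C_tilde A \<phi>" "x \<in> closure (\<psi> ` X)"
  shows "x \<in> \<psi> ` X"
proof -
  obtain z z' where z: "z \<in> X" "z' \<in> U" "dist z z' < 1" "\<psi> z' = x"
    using near_closure[OF f(1) e x, of 1] by auto
  have "\<exists>y\<in>X. dist y z' < d" if d: "d > 0" for d
  proof -
    obtain y y' where y: "y \<in> X" "y' \<in> U" "dist y y' < d" "\<psi> y' = x" using near_closure[OF f(1) e x d] by blast
    then have "y' = z'" using inj_onD[OF f(2), of y' z'] z by simp
    then show ?thesis using y by blast
  qed
  then have "z' \<in> closure X" by (simp add: closure_approachable)
  then have "z' \<in> X" using X by simp
  then show ?thesis using z(4) by (intro image_eqI[of x \<psi> z']) simp_all
qed

text \<open>The image of a flat plane would be open, and closed in \<open>C_tilde A \<phi>\<close>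
  by \<open>near_closure\<close>, hence all of this connected set, zeroes included; but flat maps
  avoid the zeroes.\<close>

lemma no_flat_plane: "\<not> flatmap UNIV \<psi>"
proof
  assume f: "flatmap UNIV \<psi>"
  let ?D = "range \<psi>"
  have o: "open ?D" using flatmap_open_image[OF f] .
  have sub: "?D \<subseteq> C_circ A \<phi>" using flatmap_C_circ[OF f] by blast
  have cl: "closure ?D \<inter> C_tilde A \<phi> \<subseteq> ?D"
  proof
    fix x assume "x \<in> closure ?D \<inter> C_tilde A \<phi>"
    then show "x \<in> ?D" using near_closure[OF f, of 1 UNIV x 1] by (metis IntD1 IntD2 UNIV_I rangeI subset_UNIV zero_less_one)
  qed
  have "?D \<inter> C_tilde A \<phi> = {} \<or> - closure ?D \<inter> C_tilde A \<phi> = {}"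
  proof (rule connectedD[OF connected_C_tilde o])
    show "open (- closure ?D)" by (rule open_Compl[OF closed_closure])
    show "?D \<inter> - closure ?D \<inter> C_tilde A \<phi> = {}" using closure_subset[of ?D] by blast
    show "C_tilde A \<phi> \<subseteq> ?D \<union> - closure ?D" using cl by blast
  qed
  then have "C_tilde A \<phi> \<subseteq> ?D" using sub C_circ_subset cl by blast
  then have "qd_zeros A \<phi> \<subseteq> C_circ A \<phi>" using sub unfolding C_tilde_eq by blast
  then show False using zeros_C_circ_disjoint zeros_nonempty by blast
qed

lemma flat_horizontal:
  assumes f: "flatmap U \<psi>" and k: "k \<in> flat_coordinates A \<phi>" and I: "is_interval I" "\<And>s. s \<in> I \<Longrightarrow> Complex s t \<in> U \<and> \<psi> (Complex s t) \<in> cim k"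
    and s: "s \<in> I" "s' \<in> I"
  shows "Im (cinv k (\<psi> (Complex s t))) = Im (cinv k (\<psi> (Complex s' t)))"
    "\<bar>Re (cinv k (\<psi> (Complex s t))) - Re (cinv k (\<psi> (Complex s' t)))\<bar> = \<bar>s - s'\<bar>"
proof -
  define X where "X = {z. Re z \<in> I} \<inter> band {t}"
  have "convex {z. Re z \<in> I}"
    using convex_linear_vimage[of Re I] bounded_linear.linear[OF bounded_linear_Re] I(1)
    by (simp add: vimage_def is_interval_convex_1)
  then have "convex X" unfolding X_def by (intro convex_Int convex_band) (simp_all add: is_interval_1)
  moreover have X: "X \<subseteq> U" "\<psi> ` X \<subseteq> cim k"
    using I(2) complex_eqI[of _ "Complex _ t"] by (auto simp: X_def band_def) (metis complex.exhaust_sel)+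
  ultimately obtain \<sigma> c where h: "\<sigma> \<in> {1, -1}" "\<And>z. z \<in> X \<Longrightarrow> cinv k (\<psi> z) = \<sigma> * z + c"
    by (metis flatmap_in_flat_coordinate[OF f k])
  have "Complex s t \<in> X" "Complex s' t \<in> X" using s by (auto simp: X_def band_def)
  from this[THEN h(2)] h(1)
  show "Im (cinv k (\<psi> (Complex s t))) = Im (cinv k (\<psi> (Complex s' t)))"
    "\<bar>Re (cinv k (\<psi> (Complex s t))) - Re (cinv k (\<psi> (Complex s' t)))\<bar> = \<bar>s - s'\<bar>" by auto
qed

end

section \<open>Developed half planes and the rays of the network\<close>

context exact_surface
begin

text \<open>Continuity of f at a branch point, stated on neighbourhoods in the base so that it
  applies to both sheets at once.\<close>

lemma f_near_zero_point:
  assumes b: "b \<in> qd_zeros A \<phi>" and e: "e > 0"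
  obtains S where "open S" "b \<in> S" "\<And>y. y \<in> spectral_curve A \<phi> \<Longrightarrow> fst y \<in> S \<Longrightarrow> \<bar>f y\<bar> < e"
proof -
  define d where "d = min 1 (e\<^sup>2)"
  have d: "0 < d" "d \<le> 1" "d \<le> e\<^sup>2" using e by (auto simp: d_def)
  let ?S = "\<xi> b ` (ball 0 (\<rho> b) \<inter> ball 0 d)"
  have "open ?S" using cmap_open_image[OF zchart(1)[OF b], of "ball 0 (\<rho> b) \<inter> ball 0 d"] by auto
  moreover have "b \<in> ?S" using zchart(2,3)[OF b] d by (intro image_eqI[of _ _ 0]) simp_all
  moreover have "\<bar>f y\<bar> < e" if y: "y \<in> spectral_curve A \<phi>" "fst y \<in> ?S" for y
  proof -
    obtain w where w: "w \<in> ball 0 (\<rho> b)" "cmod w < d" "fst y = \<xi> b w" using y(2) by auto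
    have "(f y)\<^sup>2 \<le> 4/9 * cmod w ^ 3" by (rule f_near_zero[OF b y(1) w(3,1)])
    also have "cmod w ^ 3 \<le> cmod w ^ 1" using w(2) d by (intro power_decreasing) auto
    finally have "(f y)\<^sup>2 \<le> 4/9 * cmod w" by simp
    also have "\<dots> < e\<^sup>2" using w(2) d norm_ge_zero[of w] by linarith
    finally have "\<bar>f y\<bar>\<^sup>2 < e\<^sup>2" by simp
    then show ?thesis using e by (simp add: power2_less_imp_less)
  qed
  ultimately show ?thesis using that by blast
qed

text \<open>The blocked parameters form a compact set; its least element shortens the segment to one
  that is blocked only at its end, the form treated by \<open>blocked\<close>.\<close>

lemma first_blocked:
  assumes "0 \<in> devdom y" "z \<notin> devdom y"
  obtains t1 where "0 < t1" "t1 \<le> 1" "of_real t1 * z \<notin> devdom y" "\<And>t. 0 \<le> t \<Longrightarrow> t < 1 \<Longrightarrow> of_real t * (of_real t1 * z) \<in> devdom y"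
proof -
  define T where "T = {0..1} \<inter> (\<lambda>t. of_real t * z) -` (- devdom y)"
  have "closed T" unfolding T_def
    by (intro continuous_closed_preimage continuous_intros) (use open_devdom in \<open>auto simp: closed_def\<close>)
  then have "compact T" unfolding T_def using compact_Int_closed[of "{0..1::real}"] by (metis T_def compact_Icc inf_le1 compact_eq_bounded_closed bounded_subset)
  moreover have "1 \<in> T" using assms(2) by (simp add: T_def)
  ultimately obtain t1 where t1: "t1 \<in> T" "\<And>t. t \<in> T \<Longrightarrow> t1 \<le> t" using compact_attains_inf[of T] by blast
  have "t1 \<noteq> 0" using t1(1) assms(1) by (auto simp: T_def)
  then have p: "0 < t1" "t1 \<le> 1" "of_real t1 * z \<notin> devdom y" using t1(1) by (auto simp: T_def)
  have "of_real t * (of_real t1 * z) \<in> devdom y" if t: "0 \<le> t" "t < 1" for t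
  proof (rule ccontr)
    assume n: "of_real t * (of_real t1 * z) \<notin> devdom y"
    have "t * t1 \<le> 1 * 1" using t p by (intro mult_mono) auto
    then have "t * t1 \<in> T" using n t p by (simp add: T_def mult.assoc)
    then have "t1 \<le> t * t1" by (rule t1(2))
    then show False using p t by simp
  qed
  then show ?thesis using that p by blast
qed

lemma blocked_first:
  assumes "0 \<in> devdom y" "z \<notin> devdom y"
  obtains t1 b where "0 < t1" "t1 \<le> 1" "of_real t1 * z \<notin> devdom y" "f y + t1 * Re z = 0" "b \<in> qd_zeros A \<phi>"
    "((\<lambda>t. Exp y (of_real t * (of_real t1 * z))) \<longlongrightarrow> b) (at_left 1)"
proof -
  obtain t1 where t1: "0 < t1" "t1 \<le> 1" "of_real t1 * z \<notin> devdom y" "\<And>t. 0 \<le> t \<Longrightarrow> t < 1 \<Longrightarrow> of_real t * (of_real t1 * z) \<in> devdom y"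
    using first_blocked[OF assms] by blast
  from blocked[OF t1(3,4)] obtain b where "b \<in> qd_zeros A \<phi>" "((\<lambda>t. Exp y (of_real t * (of_real t1 * z))) \<longlongrightarrow> b) (at_left 1)"
    "f y + Re (of_real t1 * z) = 0" by blast
  then show ?thesis using that[OF t1(1-3)] by simp
qed

text \<open>A segment from y can only be blocked where f y + t Re z = 0. This affine function of t
  is nonnegative at 0 and positive at 1, hence positive for 0 < t \<le> 1.\<close>

lemma devdom_half_plane:
  assumes y: "0 \<in> devdom y" "f y \<ge> 0" and z: "f y + Re z > 0"
  shows "z \<in> devdom y"
proof (rule ccontr)
  assume "z \<notin> devdom y"
  from blocked_first[OF y(1) this] obtain t1 where t1: "0 < t1" "t1 \<le> 1" "f y + t1 * Re z = 0" by blast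
  show False
  proof (cases "Re z \<ge> 0")
    case True
    then show ?thesis using t1 y(2) z by (smt (verit) mult_pos_pos mult_nonneg_nonneg)
  next
    case False
    then have "t1 * Re z \<ge> 1 * Re z" using t1 by (intro mult_right_mono_neg) auto
    then show ?thesis using t1 z by simp
  qed
qed

definition half_plane_map :: "(complex \<Rightarrow> 'c) \<Rightarrow> bool" where
  "half_plane_map \<Psi> \<longleftrightarrow> flatmap {z. Re z > 0} \<Psi> \<and> (\<forall>z. Re z > 0 \<longrightarrow> f (lift \<Psi> z) = Re z)"

text \<open>The shift by \<open>f y\<close> makes f equal to the real part; its domain is the half
  plane of \<open>devdom_half_plane\<close>.\<close>

lemma half_plane_map_Exp:
  assumes y: "0 \<in> devdom y" "f y \<ge> 0"
  shows "half_plane_map (\<lambda>z. Exp y (1 * z + - of_real (f y)))"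
    "\<And>z. Re z > 0 \<Longrightarrow> lift (\<lambda>z. Exp y (1 * z + - of_real (f y))) z = lift (Exp y) (z - of_real (f y))"
proof -
  let ?\<Psi> = "\<lambda>z. Exp y (1 * z + - of_real (f y))"
  have dom: "1 * z + - of_real (f y) \<in> devdom y" if "Re z > 0" for z
    by (rule devdom_half_plane[OF y]) (use that in simp)
  have fl: "flatmap {z. Re z > 0} ?\<Psi>"
    by (rule flatmap_subset[OF flatmap_affine(1)[OF flatmap_Exp]]) (use dom in \<open>auto intro: open_halfspace_Re_gt\<close>)
  show l: "lift ?\<Psi> z = lift (Exp y) (z - of_real (f y))" if "Re z > 0" for z
    using lift_affine[OF flatmap_Exp, of 1 z "- of_real (f y)" y] dom[OF that] by simp
  have "f (lift ?\<Psi> z) = Re z" if "Re z > 0" for z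
    using l[OF that] f_Exp[of "z - of_real (f y)" y] dom[OF that] by simp
  then show "half_plane_map ?\<Psi>" using fl by (simp add: half_plane_map_def)
qed

lemma half_plane_dev:
  assumes h: "half_plane_map \<Psi>" and p: "Re p > 0"
  shows "0 \<in> devdom (lift \<Psi> p)" "f (lift \<Psi> p) = Re p"
    "\<And>w. Re w > - Re p \<Longrightarrow> w \<in> devdom (lift \<Psi> p) \<and> Exp (lift \<Psi> p) w = \<Psi> (p + w) \<and> lift (Exp (lift \<Psi> p)) w = lift \<Psi> (p + w)"
proof -
  have fl: "flatmap {z. Re z > 0} \<Psi>" using h by (simp add: half_plane_map_def)
  have fl': "flatmap {z. 1 * z + p \<in> {z. Re z > 0}} (\<lambda>w. \<Psi> (1 * w + p))" by (rule flatmap_affine(1)[OF fl]) simp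
  have l: "lift (\<lambda>w. \<Psi> (1 * w + p)) w = lift \<Psi> (p + w)" if "Re w > - Re p" for w
    using lift_affine[OF fl, of 1 w p] that by (simp add: add.commute)
  have "{z. 1 * z + p \<in> {z. Re z > 0}} = {z. Re z > - Re p}" by auto
  then have dv: "dev (lift \<Psi> p) {z. Re z > - Re p} (\<lambda>w. \<Psi> (1 * w + p))"
    using fl' l[of 0] p by (simp add: dev_def convex_halfspace_Re_gt)
  then show "0 \<in> devdom (lift \<Psi> p)" using dev_subset_devdom[OF dv] p by auto
  show "f (lift \<Psi> p) = Re p" using h p by (simp add: half_plane_map_def)
  fix w assume w: "Re w > - Re p"
  then have wd: "w \<in> {z. Re z > - Re p}" by simp
  show "w \<in> devdom (lift \<Psi> p) \<and> Exp (lift \<Psi> p) w = \<Psi> (p + w) \<and> lift (Exp (lift \<Psi> p)) w = lift \<Psi> (p + w)"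
    using subsetD[OF dev_subset_devdom[OF dv] wd] Exp_eq[OF dv wd] lift_Exp_eq[OF dv wd] l[OF w] by (simp add: add.commute)
qed

text \<open>The ray starts at b, so it cannot be prolonged inside \<open>C_circ A \<phi>\<close>.
  Towards its other end f = s grows without bound, while f is small near every zero; so exactly one
  end lies at a zero.\<close>

lemma half_plane_ray_in_network:
  assumes h: "half_plane_map \<Psi>" and b: "b \<in> qd_zeros A \<phi>" and lim: "((\<lambda>s. \<Psi> (Complex s t)) \<longlongrightarrow> b) (at_right 0)" and s: "s > 0"
  shows "\<Psi> (Complex s t) \<in> spectral_network A \<phi>"
proof -
  have fl: "flatmap {z. Re z > 0} \<Psi>" and fv: "\<And>z. Re z > 0 \<Longrightarrow> f (lift \<Psi> z) = Re z" using h by (auto simp: half_plane_map_def)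
  let ?g = "\<lambda>s. \<Psi> (Complex s t)" and ?I = "{0<..} :: real set"
  have cont: "continuous_on ?I ?g"
    by (rule continuous_on_compose2[OF flatmap_continuous[OF fl]]) (auto intro!: continuous_intros simp: Complex_eq)
  have hc: "horizontal_curve A \<phi> ?I ?g"
    unfolding horizontal_curve_def
  proof (intro conjI ballI allI impI)
    show "?g ` ?I \<subseteq> C_circ A \<phi>" using flatmap_C_circ[OF fl] by auto
    fix k I' s s' assume k: "k \<in> flat_coordinates A \<phi>" and I': "is_interval I' \<and> I' \<subseteq> ?I \<and> ?g ` I' \<subseteq> cim k" and s: "s \<in> I'" "s' \<in> I'"
    have dom: "Complex s t \<in> {z. Re z > 0} \<and> ?g s \<in> cim k" if "s \<in> I'" for s using I' that by auto
    note fh = flat_horizontal[OF fl k conjunct1[OF I'] dom s]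
    show "Im (cinv k (?g s)) = Im (cinv k (?g s'))" by (rule fh(1))
    show "\<bar>Re (cinv k (?g s)) - Re (cinv k (?g s'))\<bar> = \<bar>s - s'\<bar>" by (rule fh(2))
  qed (use cont in \<open>auto simp: is_interval_1\<close>)
  have ht: "horizontal_trajectory A \<phi> ?I ?g"
    unfolding horizontal_trajectory_def
  proof (intro conjI hc notI)
    assume "\<exists>I' \<gamma>'. ?I \<subset> I' \<and> horizontal_curve A \<phi> I' \<gamma>' \<and> (\<forall>t\<in>?I. \<gamma>' t = ?g t)"
    then obtain I' g' where g': "?I \<subset> I'" "horizontal_curve A \<phi> I' g'" "\<forall>t\<in>?I. g' t = ?g t" by blast
    then obtain u where u: "u \<in> I'" "u \<le> 0" by force
    have I': "open I'" "is_interval I'" "continuous_on I' g'" "g' ` I' \<subseteq> C_circ A \<phi>" using g'(2) by (auto simp: horizontal_curve_def)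
    have "1 \<in> I'" using g'(1) by (meson greaterThan_iff psubsetD zero_less_one)
    then have z: "0 \<in> I'" using I'(2) u unfolding is_interval_1 by (metis zero_le_one)
    then have "isCont g' 0" using I'(1,3) by (simp add: continuous_on_eq_continuous_at)
    then have "(g' \<longlongrightarrow> g' 0) (at_right 0)" by (simp add: isCont_def filterlim_at_split)
    moreover have "(g' \<longlongrightarrow> b) (at_right 0)"
      by (rule Lim_transform_eventually[OF lim]) (rule eventually_mono[OF eventually_at_right_less], use g'(3) in simp)
    ultimately have "g' 0 = b" by (rule tendsto_unique[OF trivial_limit_at_right_real])
    then show False using I'(4) z b zeros_C_circ_disjoint by blast
  qed
  have "left_end ?I \<le> at_right 0"
  proof (rule filter_leI)
    fix P :: "real \<Rightarrow> bool" assume "eventually P (at_right 0)"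
    then obtain e where e: "e > 0" "\<And>s. 0 < s \<Longrightarrow> s < e \<Longrightarrow> P s" by (auto simp: eventually_at_right[of 0 1])
    have "left_end ?I \<le> principal (?I \<inter> {..e/2})" unfolding left_end_def by (rule INF_lower) (use e in simp)
    moreover have "eventually P (principal (?I \<inter> {..e/2}))" using e by (auto simp: eventually_principal)
    ultimately show "eventually P (left_end ?I)" by (simp add: le_filter_def)
  qed
  then have L: "(?g \<longlongrightarrow> b) (left_end ?I)" using lim by (rule tendsto_mono)
  have R: "\<not> (\<exists>b'\<in>qd_zeros A \<phi>. (?g \<longlongrightarrow> b') (right_end ?I))"
  proof
    assume "\<exists>b'\<in>qd_zeros A \<phi>. (?g \<longlongrightarrow> b') (right_end ?I)"
    then obtain b' where b': "b' \<in> qd_zeros A \<phi>" "(?g \<longlongrightarrow> b') (right_end ?I)" by blast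
    have "at_top \<le> right_end ?I" unfolding right_end_def
    proof (rule INF_greatest)
      fix u :: real assume "u \<in> ?I"
      then show "at_top \<le> principal (?I \<inter> {u..})"
        unfolding le_principal by (auto intro: eventually_mono[OF eventually_ge_at_top[of u]])
    qed
    then have l: "(?g \<longlongrightarrow> b') at_top" using b'(2) by (rule tendsto_mono)
    obtain S where S: "open S" "b' \<in> S" "\<And>y. y \<in> spectral_curve A \<phi> \<Longrightarrow> fst y \<in> S \<Longrightarrow> \<bar>f y\<bar> < 1"
      by (rule f_near_zero_point[OF b'(1) zero_less_one]) blast
    have "eventually (\<lambda>s. ?g s \<in> S \<and> s \<ge> 1) at_top"
      using topological_tendstoD[OF l S(1,2)] eventually_ge_at_top[of 1] by (rule eventually_conj)
    from eventually_happens[OF this] obtain s where s: "?g s \<in> S" "s \<ge> 1" by auto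
    have "\<bar>f (lift \<Psi> (Complex s t))\<bar> < 1"
      by (rule S(3)[OF lift_in_spectral_curve[OF fl]]) (use s in auto)
    then show False using fv[of "Complex s t"] s by simp
  qed
  have m: "?g s \<in> ?g ` ?I" using s by (intro imageI) simp
  have ends: "(\<exists>b\<in>qd_zeros A \<phi>. (?g \<longlongrightarrow> b) (left_end ?I)) \<noteq> (\<exists>b\<in>qd_zeros A \<phi>. (?g \<longlongrightarrow> b) (right_end ?I))"
  proof -
    have ex: "\<exists>b\<in>qd_zeros A \<phi>. (?g \<longlongrightarrow> b) (left_end ?I)"
    proof (rule bexI)
      show "(?g \<longlongrightarrow> b) (left_end ?I)" by (rule L)
    qed (rule b)
    show ?thesis
    proof
      assume "(\<exists>b\<in>qd_zeros A \<phi>. (?g \<longlongrightarrow> b) (left_end ?I)) = (\<exists>b\<in>qd_zeros A \<phi>. (?g \<longlongrightarrow> b) (right_end ?I))"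
      from R ex[unfolded this] show False by (rule notE)
    qed
  qed
  show ?thesis unfolding spectral_network_def
    by (intro UnI2 UnionI[OF _ m] CollectI exI[of _ ?I] exI[of _ ?g] conjI refl ht ends)
qed

text \<open>A common notion for strips and half planes of either orientation: J is any nonempty open
  proper interval, and maximality is expressed by a zero at every edge. The condition f = Re is the
  normalization that puts these zeroes on Re z = 0.\<close>

definition maxstrip :: "real set \<Rightarrow> (complex \<Rightarrow> 'c) \<Rightarrow> bool" where
  "maxstrip J \<psi> \<longleftrightarrow> open J \<and> is_interval J \<and> J \<noteq> {} \<and> J \<noteq> UNIV \<and> flatmap (band J) \<psi> \<and>
     (\<forall>z\<in>band J. f (lift \<psi> z) = Re z) \<and> (\<forall>c. edge J c \<longrightarrow> (\<exists>b\<in>qd_zeros A \<phi>. ends_at \<psi> J c b))"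

lemma maxstripD:
  assumes "maxstrip J \<psi>"
  shows "open J" "is_interval J" "J \<noteq> {}" "J \<noteq> UNIV" "flatmap (band J) \<psi>" "\<And>z. z \<in> band J \<Longrightarrow> f (lift \<psi> z) = Re z"
    "\<And>c. edge J c \<Longrightarrow> \<exists>b\<in>qd_zeros A \<phi>. ends_at \<psi> J c b"
  using assms by (auto simp: maxstrip_def)

lemma maxstrip_affine:
  assumes m: "maxstrip J \<psi>" and s: "\<sigma> \<in> {1,-1::real}"
  shows "maxstrip {t. \<sigma> * t + \<tau> \<in> J} (\<lambda>z. \<psi> (of_real \<sigma> * z + \<i> * of_real \<tau>))"
    "\<And>z. of_real \<sigma> * z + \<i> * of_real \<tau> \<in> band J \<Longrightarrow>
      lift (\<lambda>z. \<psi> (of_real \<sigma> * z + \<i> * of_real \<tau>)) z = smul (of_real \<sigma>) (lift \<psi> (of_real \<sigma> * z + \<i> * of_real \<tau>))"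
proof -
  note d = maxstripD[OF m]
  let ?J = "{t. \<sigma> * t + \<tau> \<in> J}" and ?\<psi> = "\<lambda>z. \<psi> (of_real \<sigma> * z + \<i> * of_real \<tau>)"
  have s2: "(of_real \<sigma> :: complex)\<^sup>2 = 1" "\<sigma> * \<sigma> = 1" using s by auto
  have band: "band ?J = {z. of_real \<sigma> * z + \<i> * of_real \<tau> \<in> band J}" by (auto simp: band_def)
  show l: "lift ?\<psi> z = smul (of_real \<sigma>) (lift \<psi> (of_real \<sigma> * z + \<i> * of_real \<tau>))"
    if "of_real \<sigma> * z + \<i> * of_real \<tau> \<in> band J" for z
    by (rule lift_affine[OF d(5) s2(1) that])
  have fl: "flatmap (band ?J) ?\<psi>" unfolding band by (rule flatmap_affine(1)[OF d(5) s2(1)])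
  have op: "open ?J"
    using continuous_open_preimage[of UNIV "\<lambda>t. \<sigma> * t + \<tau>" J] d(1) by (simp add: vimage_def continuous_intros)
  have iv: "is_interval ?J" using d(2) s unfolding is_interval_1
  proof (intro ballI allI impI)
    fix u v x assume j: "\<forall>a\<in>J. \<forall>b\<in>J. \<forall>x. a \<le> x \<and> x \<le> b \<longrightarrow> x \<in> J" and h: "u \<in> ?J" "v \<in> ?J" "u \<le> x \<and> x \<le> v"
    from s consider "\<sigma> = 1" | "\<sigma> = -1" by blast
    then show "x \<in> ?J"
    proof cases
      case 1
      then show ?thesis using j[rule_format, of "u + \<tau>" "v + \<tau>" "x + \<tau>"] h by simp
    next
      case 2
      then show ?thesis using j[rule_format, of "- v + \<tau>" "- u + \<tau>" "- x + \<tau>"] h by simp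
    qed
  qed
  have pre: "\<sigma> * (\<sigma> * (t - \<tau>)) + \<tau> = t" for t
  proof -
    have "\<sigma> * (\<sigma> * (t - \<tau>)) = (\<sigma> * \<sigma>) * (t - \<tau>)" by (rule mult.assoc[symmetric])
    then show ?thesis by (simp only: s2(2) mult_1 diff_add_cancel)
  qed
  have ne: "?J \<noteq> {}"
  proof -
    obtain t where "t \<in> J" using d(3) by blast
    then have "\<sigma> * (t - \<tau>) \<in> ?J" by (simp add: pre)
    then show ?thesis by blast
  qed
  have nu: "?J \<noteq> UNIV"
  proof -
    obtain t where "t \<notin> J" using d(4) by blast
    then have "\<sigma> * (t - \<tau>) \<notin> ?J" by (simp add: pre)
    then show ?thesis by blast
  qed
  have fv: "f (lift ?\<psi> z) = Re z" if "z \<in> band ?J" for z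
  proof -
    have z: "of_real \<sigma> * z + \<i> * of_real \<tau> \<in> band J" using that band by blast
    have "(of_real \<sigma> :: complex) \<in> {1,-1}" using s by auto
    from f_smul[OF this] have "f (lift ?\<psi> z) = \<sigma> * Re (of_real \<sigma> * z + \<i> * of_real \<tau>)"
      using l[OF z] d(6)[OF z] by simp
    also have "\<dots> = (\<sigma> * \<sigma>) * Re z" by simp
    finally show ?thesis using s2(2) by simp
  qed
  have e: "\<exists>b\<in>qd_zeros A \<phi>. ends_at ?\<psi> ?J c b" if c: "edge ?J c" for c
  proof -
    have ds: "dist (\<sigma> * t + \<tau>) (\<sigma> * c + \<tau>) = dist t c" for t using s by (auto simp: dist_real_def)
    have "edge J (\<sigma> * c + \<tau>)"
      unfolding edge_def
    proof (intro conjI allI impI)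
      show "\<sigma> * c + \<tau> \<notin> J" using c by (simp add: edge_def)
      fix e :: real assume "e > 0"
      then obtain t where "t \<in> ?J" "dist t c < e" using c by (auto simp: edge_def)
      then show "\<exists>t\<in>J. dist t (\<sigma> * c + \<tau>) < e" using ds by (intro bexI[of _ "\<sigma> * t + \<tau>"]) auto
    qed
    then obtain b where b: "b \<in> qd_zeros A \<phi>" "ends_at \<psi> J (\<sigma> * c + \<tau>) b" using d(7) by blast
    have cx: "of_real \<sigma> * Complex 0 t + \<i> * of_real \<tau> = Complex 0 (\<sigma> * t + \<tau>)" for t by (simp add: complex_eq_iff)
    have "ends_at ?\<psi> ?J c b"
      unfolding ends_at_def cx
    proof (intro allI impI)
      fix S assume "open S \<and> b \<in> S"
      then obtain e where e: "e > 0" "\<forall>t\<in>J. dist t (\<sigma> * c + \<tau>) < e \<longrightarrow> \<psi> (Complex 0 t) \<in> S" using b(2) by (auto simp: ends_at_def)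
      then show "\<exists>e>0. \<forall>t\<in>?J. dist t c < e \<longrightarrow> \<psi> (Complex 0 (\<sigma> * t + \<tau>)) \<in> S"
        using ds by (intro exI[of _ e]) auto
    qed
    then show ?thesis using b(1) by blast
  qed
  show "maxstrip ?J ?\<psi>" unfolding maxstrip_def using op iv ne nu fl fv e by blast
qed

text \<open>Were J not contained in K, some edge c of K would be interior to J. There \<theta> tends
  to a zero while \<psi> takes a regular value, although both maps agree at the heights of K near
  c.\<close>

lemma maxstrip_subset:
  assumes m: "maxstrip J \<psi>" "maxstrip K \<theta>" and t0: "t0 \<in> J" "t0 \<in> K" and ag: "\<And>z. z \<in> band (J \<inter> K) \<Longrightarrow> \<psi> z = \<theta> z"
  shows "J \<subseteq> K"
proof
  fix t assume t: "t \<in> J"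
  note d = maxstripD[OF m(1)] and e = maxstripD[OF m(2)]
  show "t \<in> K"
  proof (rule ccontr)
    assume tK: "t \<notin> K"
    let ?S = "closed_segment t0 t"
    have SJ: "?S \<subseteq> J" using t t0(1) d(2) by (simp add: closed_segment_subset is_interval_convex_1)
    have "\<exists>c\<in>?S. c \<notin> K \<and> c \<in> closure K"
    proof (rule ccontr)
      assume n: "\<not> (\<exists>c\<in>?S. c \<notin> K \<and> c \<in> closure K)"
      have "K \<inter> ?S = {} \<or> - closure K \<inter> ?S = {}"
      proof (rule connectedD[OF connected_segment e(1)])
        show "open (- closure K)" by (rule open_Compl[OF closed_closure])
        show "K \<inter> - closure K \<inter> ?S = {}" using closure_subset[of K] by blast
        show "?S \<subseteq> K \<union> - closure K" using n by blast
      qed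
      moreover have "t0 \<in> K \<inter> ?S" using t0(2) by simp
      moreover have "t \<in> ?S" by simp
      then have "t \<in> - closure K \<inter> ?S" using n tK by blast
      ultimately show False by blast
    qed
    then obtain c where c: "c \<in> J" "c \<notin> K" "c \<in> closure K" using SJ by blast
    have "edge K c" using c by (simp add: edge_def closure_approachable)
    then obtain b where b: "b \<in> qd_zeros A \<phi>" "ends_at \<theta> K c b" using e(7) by blast
    have cJ: "Complex 0 c \<in> band J" using c(1) by (simp add: band_def)
    have ne: "\<psi> (Complex 0 c) \<noteq> b" using flatmap_C_circ[OF d(5) cJ] b(1) zeros_C_circ_disjoint by blast
    obtain P Q where PQ: "open P" "open Q" "\<psi> (Complex 0 c) \<in> P" "b \<in> Q" "P \<inter> Q = {}" using hausdorff[OF ne] by blast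
    obtain e1 where e1: "e1 > 0" "\<forall>t\<in>K. dist t c < e1 \<longrightarrow> \<theta> (Complex 0 t) \<in> Q" using b(2) PQ by (auto simp: ends_at_def)
    have "open {z \<in> band J. \<psi> z \<in> P}" using flatmap_preimage_open[OF d(5) PQ(1)] .
    moreover have "Complex 0 c \<in> {z \<in> band J. \<psi> z \<in> P}" using cJ PQ(3) by simp
    ultimately obtain e2 where e2: "e2 > 0" "ball (Complex 0 c) e2 \<subseteq> {z \<in> band J. \<psi> z \<in> P}"
      by (rule openE[of _ "Complex 0 c"])
    have "min e1 e2 > 0" using e1 e2 by simp
    then obtain u where u: "u \<in> K" "dist u c < min e1 e2" using c(3) unfolding closure_approachable by blast
    have "dist (Complex 0 c) (Complex 0 u) = dist u c" by (simp add: dist_norm cmod_def dist_real_def abs_minus_commute)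
    then have uz: "Complex 0 u \<in> {z \<in> band J. \<psi> z \<in> P}" using e2(2) u(2) by (auto simp: subset_iff)
    then have "Complex 0 u \<in> band (J \<inter> K)" using u(1) by (simp add: band_def)
    then show False using ag uz e1(2) u PQ(5) by auto
  qed
qed

text \<open>The values of f fix the real part, so coordinates with equal lifts differ by a vertical
  translation; \<open>maxstrip_subset\<close> in both directions identifies the intervals.\<close>

lemma maxstrip_unique:
  assumes m: "maxstrip J1 \<psi>1" "maxstrip J2 \<psi>2" and z: "z1 \<in> band J1" "z2 \<in> band J2" and l: "lift \<psi>1 z1 = lift \<psi>2 z2"
  defines "\<tau> \<equiv> Im z2 - Im z1"
  shows "Re z1 = Re z2" "J1 = {t. 1 * t + \<tau> \<in> J2}" "\<And>z. z \<in> band J1 \<Longrightarrow> \<psi>1 z = \<psi>2 (of_real 1 * z + \<i> * of_real \<tau>)"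
proof -
  show re: "Re z1 = Re z2" using maxstripD(6)[OF m(1) z(1)] maxstripD(6)[OF m(2) z(2)] l by simp
  let ?J = "{t. 1 * t + \<tau> \<in> J2}" and ?\<psi> = "\<lambda>z. \<psi>2 (of_real 1 * z + \<i> * of_real \<tau>)"
  have m2: "maxstrip ?J ?\<psi>" by (rule maxstrip_affine(1)[OF m(2)]) simp
  have zz: "of_real 1 * z1 + \<i> * of_real \<tau> = z2" using re by (simp add: complex_eq_iff \<tau>_def)
  have l2: "lift ?\<psi> z1 = lift \<psi>1 z1"
    using maxstrip_affine(2)[OF m(2), of 1 z1 \<tau>] z(2) l zz by simp
  have z1: "z1 \<in> band ?J" using z(2) by (simp add: band_def \<tau>_def)
  note d = maxstripD[OF m(1)] and e = maxstripD[OF m2]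
  have ag: "\<psi>1 z = ?\<psi> z" if "z \<in> band (J1 \<inter> ?J)" for z
  proof (rule flatmap_unique(1)[of "band (J1 \<inter> ?J)" \<psi>1 ?\<psi> z1])
    have o: "open (band (J1 \<inter> ?J))" using d(1) e(1) by (intro open_band open_Int)
    show "flatmap (band (J1 \<inter> ?J)) \<psi>1" by (rule flatmap_subset[OF d(5) o]) (auto simp: band_def)
    show "flatmap (band (J1 \<inter> ?J)) ?\<psi>" by (rule flatmap_subset[OF e(5) o]) (auto simp: band_def)
    show "connected (band (J1 \<inter> ?J))" using d(2) e(2) by (intro connected_band is_interval_Int)
    show "z1 \<in> band (J1 \<inter> ?J)" using z(1) z1 by (simp add: band_def)
    show "lift \<psi>1 z1 = lift ?\<psi> z1" using l2 by simp
  qed (rule that)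
  have t: "Im z1 \<in> J1" "Im z1 \<in> ?J" using z(1) z1 by (simp_all add: band_def)
  show J: "J1 = ?J"
  proof (rule equalityI)
    show "J1 \<subseteq> ?J" by (rule maxstrip_subset[OF m(1) m2 t ag])
    show "?J \<subseteq> J1" by (rule maxstrip_subset[OF m2 m(1) t(2,1)]) (use ag in \<open>simp add: Int_commute\<close>)
  qed
  show "\<psi>1 z = ?\<psi> z" if "z \<in> band J1" for z
  proof (rule ag)
    have "J1 \<inter> ?J = J1" using J by blast
    then show "z \<in> band (J1 \<inter> ?J)" using that by simp
  qed
qed

lemma periodic_interval:
  assumes J: "is_interval J" "(t0::real) \<in> J" and \<tau>: "\<tau> \<noteq> 0" and p: "J = {t. 1 * t + \<tau> \<in> J}"
  shows "J = UNIV"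
proof -
  have p': "t \<in> J \<longleftrightarrow> t + \<tau> \<in> J" for t using p by auto
  have m: "t0 + real n * \<tau> \<in> J \<and> t0 - real n * \<tau> \<in> J" for n
  proof (induction n)
    case (Suc n)
    then show ?case using p'[of "t0 + real n * \<tau>"] p'[of "t0 - real (Suc n) * \<tau>"] by (simp add: algebra_simps)
  qed (use J in simp)
  have "u \<in> J" for u
  proof -
    obtain n where n: "\<bar>u - t0\<bar> < real n * \<bar>\<tau>\<bar>" using reals_Archimedean3[of "\<bar>\<tau>\<bar>"] \<tau> by auto
    consider "\<tau> > 0" | "\<tau> < 0" using \<tau> by linarith
    then show ?thesis
    proof cases
      case 1
      then have "t0 - real n * \<tau> \<le> u" "u \<le> t0 + real n * \<tau>" using n by (auto simp: abs_if split: if_splits)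
      then show ?thesis using J(1) m[of n] unfolding is_interval_1 by blast
    next
      case 2
      then have "t0 + real n * \<tau> \<le> u" "u \<le> t0 - real n * \<tau>" using n by (auto simp: abs_if split: if_splits)
      then show ?thesis using J(1) m[of n] unfolding is_interval_1 by blast
    qed
  qed
  then show ?thesis by blast
qed

text \<open>Let z and z' have the same image. If the lifts agree as well, J has the period Im z' -
  Im z, which must vanish since J is not the whole line. If they are opposite, \<psi> is invariant
  under the half turn about the midpoint of z and z', and at this fixed point the lift would equal
  its own negative.\<close>

lemma maxstrip_inj:
  assumes m: "maxstrip J \<psi>"
  shows "inj_on \<psi> (band J)"
proof (rule inj_onI)
  fix z z' assume z: "z \<in> band J" "z' \<in> band J" "\<psi> z = \<psi> z'"
  note d = maxstripD[OF m]
  obtain \<sigma> where s: "\<sigma> \<in> {1,-1}" "\<sigma>\<^sup>2 = 1" "lift \<psi> z = smul \<sigma> (lift \<psi> z')"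
    using lift_sign[OF d(5) d(5) z] .
  from s(1) consider "\<sigma> = 1" | "\<sigma> = -1" by blast
  then show "z = z'"
  proof cases
    case 1
    then have l: "lift \<psi> z = lift \<psi> z'" using s(3) by simp
    note u = maxstrip_unique[OF m m z(1,2) l]
    have "Im z' - Im z = 0"
    proof (rule ccontr)
      assume "Im z' - Im z \<noteq> 0"
      from periodic_interval[OF d(2) _ this u(2)] z(1) d(4) show False by (auto simp: band_def)
    qed
    then show ?thesis using u(1) by (simp add: complex_eq_iff)
  next
    case 2
    define Q where "Q = {q. 1 * q + z \<in> band J} \<inter> {q. (-1) * q + z' \<in> band J}"
    have Q1: "{q. 1 * q + z \<in> band J} = band {t. t + Im z \<in> J}" "{q. (-1) * q + z' \<in> band J} = band {t. - t + Im z' \<in> J}"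
      by (auto simp: band_def)
    have oQ: "open Q" unfolding Q_def using open_affine_preimage[OF flatmap_open[OF d(5)]] by (intro open_Int) blast+
    have "is_interval {t. t + Im z \<in> J}" "is_interval {t. - t + Im z' \<in> J}"
      using maxstripD(2)[OF maxstrip_affine(1)[OF m, of 1 "Im z"]] maxstripD(2)[OF maxstrip_affine(1)[OF m, of "-1" "Im z'"]] by simp_all
    then have cQ: "convex Q" unfolding Q_def Q1 by (intro convex_Int convex_band)
    have q0: "0 \<in> Q" using z by (simp add: Q_def)
    let ?q = "(z' - z) / 2"
    have "z' - z \<in> Q" using z by (simp add: Q_def)
    then have "(1/2) *\<^sub>R 0 + (1/2) *\<^sub>R (z' - z) \<in> Q" using q0 by (intro convexD[OF cQ]) auto
    then have q: "?q \<in> Q" by (simp add: scaleR_conv_of_real)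
    have dom: "z + p \<in> band J \<and> z' + \<sigma> * p \<in> band J" if "p \<in> Q" for p using that 2 by (simp add: Q_def add.commute)
    have "lift \<psi> (z + ?q) = smul \<sigma> (lift \<psi> (z' + \<sigma> * ?q))"
      by (rule flatmap_matching(2)[OF d(5) d(5) z(1,2) s(2,3) oQ convex_connected[OF cQ] q0 dom q])
    moreover have mid: "z' + \<sigma> * ?q = z + ?q" using 2 by (simp add: field_simps)
    ultimately have e: "lift \<psi> (z + ?q) = smul (-1) (lift \<psi> (z + ?q))" using 2 by simp
    obtain k where k: "k \<in> A" "\<psi> (z + ?q) \<in> cim k" using exists_chart by blast
    have "snd (lift \<psi> (z + ?q)) k = - snd (lift \<psi> (z + ?q)) k" using arg_cong[OF e, of "\<lambda>y. snd y k"] by (simp add: smul_def)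
    moreover have "z + ?q \<in> band J" using dom[OF q] by blast
    ultimately show ?thesis using lift_nonzero[OF d(5) _ k(1) k(2)] by simp
  qed
qed

lemma maxstrip_flat_coordinate: "maxstrip J \<psi> \<Longrightarrow> (band J, \<psi>) \<in> flat_coordinates A \<phi>"
  using flatmap_flat_coordinate maxstripD(5) maxstrip_inj by blast

text \<open>Lifts over a common point agree up to sign, and a half turn of the second strip reduces
  the negative sign to the positive one.\<close>

lemma maxstrip_meet:
  assumes m: "maxstrip J1 \<psi>1" "maxstrip J2 \<psi>2" and z: "z1 \<in> band J1" "z2 \<in> band J2" "\<psi>1 z1 = \<psi>2 z2"
  shows "\<exists>\<sigma>\<in>{1,-1}. \<exists>\<tau>. J1 = {t. \<sigma> * t + \<tau> \<in> J2} \<and> (\<forall>z\<in>band J1. \<psi>1 z = \<psi>2 (of_real \<sigma> * z + \<i> * of_real \<tau>))"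
proof -
  obtain \<sigma> where s: "\<sigma> \<in> {1,-1}" "\<sigma>\<^sup>2 = 1" "lift \<psi>1 z1 = smul \<sigma> (lift \<psi>2 z2)"
    using lift_sign[OF maxstripD(5)[OF m(1)] maxstripD(5)[OF m(2)] z] .
  from s(1) consider "\<sigma> = 1" | "\<sigma> = -1" by blast
  then show ?thesis
  proof cases
    case 1
    then have l: "lift \<psi>1 z1 = lift \<psi>2 z2" using s(3) by simp
    note u = maxstrip_unique[OF m z(1,2) l]
    show ?thesis using u(2,3) by (intro bexI[of _ 1] exI[of _ "Im z2 - Im z1"]) auto
  next
    case 2
    let ?J = "{t. (-1) * t + 0 \<in> J2}" and ?\<psi> = "\<lambda>z. \<psi>2 (of_real (-1) * z + \<i> * of_real 0)"
    have m2: "maxstrip ?J ?\<psi>" by (rule maxstrip_affine(1)[OF m(2)]) simp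
    have z2: "- z2 \<in> band ?J" using z(2) by (simp add: band_def)
    have "lift ?\<psi> (- z2) = smul (of_real (-1)) (lift \<psi>2 (of_real (-1) * (- z2) + \<i> * of_real 0))"
      by (rule maxstrip_affine(2)[OF m(2)]) (use z(2) in simp_all)
    then have l: "lift \<psi>1 z1 = lift ?\<psi> (- z2)" using s(3) 2 by simp
    define \<tau> where "\<tau> = Im (- z2) - Im z1"
    note u = maxstrip_unique[OF m(1) m2 z(1) z2 l, folded \<tau>_def]
    have "J1 = {t. - 1 * t + (- \<tau>) \<in> J2}" using u(2) by simp
    moreover have "\<psi>1 z = \<psi>2 (of_real (-1) * z + \<i> * of_real (- \<tau>))" if "z \<in> band J1" for z
      using u(3)[OF that] by (simp add: algebra_simps)
    ultimately show ?thesis by (intro bexI[of _ "-1"] exI[of _ "- \<tau>"]) auto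
  qed
qed

lemma left_end_nontrivial: "I \<noteq> {} \<Longrightarrow> left_end I \<noteq> bot" and right_end_nontrivial: "I \<noteq> {} \<Longrightarrow> right_end I \<noteq> bot"
proof -
  assume I: "I \<noteq> {}"
  have "eventually P (left_end I) \<longleftrightarrow> (\<exists>t\<in>I. eventually P (principal (I \<inter> {..t})))" for P
    unfolding left_end_def
  proof (rule eventually_INF_base[OF I])
    fix a b assume "a \<in> I" "b \<in> I"
    then show "\<exists>x\<in>I. principal (I \<inter> {..x}) \<le> inf (principal (I \<inter> {..a})) (principal (I \<inter> {..b}))"
      by (intro bexI[of _ "min a b"]) (auto simp: min_def)
  qed
  from this[of "\<lambda>_. False"] show "left_end I \<noteq> bot"
    unfolding trivial_limit_def by (auto simp: eventually_principal)
  have "eventually P (right_end I) \<longleftrightarrow> (\<exists>t\<in>I. eventually P (principal (I \<inter> {t..})))" for P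
    unfolding right_end_def
  proof (rule eventually_INF_base[OF I])
    fix a b assume "a \<in> I" "b \<in> I"
    then show "\<exists>x\<in>I. principal (I \<inter> {x..}) \<le> inf (principal (I \<inter> {a..})) (principal (I \<inter> {b..}))"
      by (intro bexI[of _ "max a b"]) (auto simp: max_def)
  qed
  from this[of "\<lambda>_. False"] show "right_end I \<noteq> bot"
    unfolding trivial_limit_def by (auto simp: eventually_principal)
qed

lemma eventually_ends: "I \<noteq> {} \<Longrightarrow> eventually (\<lambda>t. t \<in> I) (left_end I)" "I \<noteq> {} \<Longrightarrow> eventually (\<lambda>t. t \<in> I) (right_end I)"
proof -
  assume "I \<noteq> {}"
  then obtain t where t: "t \<in> I" by blast
  have "left_end I \<le> principal (I \<inter> {..t})" unfolding left_end_def by (rule INF_lower[OF t])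
  then show "eventually (\<lambda>t. t \<in> I) (left_end I)" by (rule filter_leD) (simp add: eventually_principal)
  have "right_end I \<le> principal (I \<inter> {t..})" unfolding right_end_def by (rule INF_lower[OF t])
  then show "eventually (\<lambda>t. t \<in> I) (right_end I)" by (rule filter_leD) (simp add: eventually_principal)
qed

text \<open>The image of a horizontal line L of the band is closed in
  \<open>C_tilde A \<phi>\<close>, so a trajectory meeting it stays in it for all time. A zero at an
  end of the trajectory would then lie in the closure of this image, hence in the image itself,
  which consists of regular points. A network trajectory has such an end.\<close>

lemma maxstrip_avoids_network:
  assumes m: "maxstrip J \<psi>"
  shows "\<psi> ` band J \<inter> spectral_network A \<phi> = {}"
proof (rule ccontr)
  assume "\<psi> ` band J \<inter> spectral_network A \<phi> \<noteq> {}"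
  then obtain z0 where z0: "z0 \<in> band J" "\<psi> z0 \<in> spectral_network A \<phi>" by blast
  note d = maxstripD[OF m]
  have "\<psi> z0 \<notin> qd_zeros A \<phi>" using flatmap_C_circ[OF d(5) z0(1)] zeros_C_circ_disjoint by blast
  then obtain I \<gamma> where g: "\<psi> z0 \<in> \<gamma> ` I" "horizontal_trajectory A \<phi> I \<gamma>"
    "(\<exists>b\<in>qd_zeros A \<phi>. (\<gamma> \<longlongrightarrow> b) (left_end I)) \<noteq> (\<exists>b\<in>qd_zeros A \<phi>. (\<gamma> \<longlongrightarrow> b) (right_end I))"
    using z0(2) unfolding spectral_network_def by blast
  obtain u0 where u0: "u0 \<in> I" "\<gamma> u0 = \<psi> z0" using g(1) by force
  have hc: "open I" "is_interval I" "continuous_on I \<gamma>" "\<gamma> ` I \<subseteq> C_circ A \<phi>"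
    and hor: "\<And>k I' s t. k \<in> flat_coordinates A \<phi> \<Longrightarrow> is_interval I' \<Longrightarrow> I' \<subseteq> I \<Longrightarrow> \<gamma> ` I' \<subseteq> cim k \<Longrightarrow> s \<in> I' \<Longrightarrow> t \<in> I' \<Longrightarrow>
       Im (cinv k (\<gamma> s)) = Im (cinv k (\<gamma> t))"
    using g(2) unfolding horizontal_trajectory_def horizontal_curve_def by blast+
  have Ine: "I \<noteq> {}" using u0 by blast
  obtain e where e: "e > 0" "ball (Im z0) e \<subseteq> J" using d(1) z0(1) by (auto simp: band_def elim!: openE[where x = "Im z0"])
  define L where "L = band {Im z0}"
  have L: "closed L" unfolding L_def band_def
    using continuous_closed_preimage[of UNIV Im "{Im z0}"] by (simp add: vimage_def continuous_intros)
  have Lb: "ball z e \<subseteq> band J" if "z \<in> L" for z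
  proof
    fix w assume "w \<in> ball z e"
    then have "\<bar>Im (z - w)\<bar> < e" using abs_Im_le_cmod[of "z - w"] by (simp add: dist_norm)
    then have "Im w \<in> ball (Im z0) e" using that by (simp add: L_def band_def dist_real_def)
    then show "w \<in> band J" using e(2) by (auto simp: band_def)
  qed
  have cl: "x \<in> \<psi> ` L" if "x \<in> C_tilde A \<phi>" "x \<in> closure (\<psi> ` L)" for x
    by (rule closed_flat_image[OF d(5) maxstrip_inj[OF m] e(1) Lb L that])
  let ?k = "(band J, \<psi>)"
  have k: "?k \<in> flat_coordinates A \<phi>" by (rule maxstrip_flat_coordinate[OF m])
  note kA = flat_coordinates_atlas[OF k]
  define E where "E = {u \<in> I. \<gamma> u \<in> \<psi> ` L}"
  have LJ: "L \<subseteq> band J" using z0(1) by (auto simp: L_def band_def)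
  have "open E"
    unfolding open_contains_ball
  proof
    fix u1 assume u1: "u1 \<in> E"
    then have u1': "u1 \<in> I" "\<gamma> u1 \<in> \<psi> ` L" by (auto simp: E_def)
    then have "\<gamma> u1 \<in> cim ?k" using LJ by auto
    moreover have "open (I \<inter> \<gamma> -` cim ?k)" by (rule continuous_open_preimage[OF hc(3,1) open_cim[OF kA]])
    ultimately obtain r where r: "r > 0" "ball u1 r \<subseteq> I \<inter> \<gamma> -` cim ?k" using u1'(1) by (auto elim!: openE[where x = u1])
    have "ball u1 r \<subseteq> E"
    proof
      fix u assume u: "u \<in> ball u1 r"
      have "Im (cinv ?k (\<gamma> u)) = Im (cinv ?k (\<gamma> u1))"
        by (rule hor[OF k, of "ball u1 r"]) (use r u in \<open>auto simp: is_interval_convex_1\<close>)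
      moreover obtain z1 where z1: "z1 \<in> L" "\<gamma> u1 = \<psi> z1" using u1'(2) by blast
      then have "cinv ?k (\<gamma> u1) = z1" using cinv_cmap[OF kA, of z1] LJ by auto
      ultimately have "cinv ?k (\<gamma> u) \<in> L" using z1(1) by (simp add: L_def band_def)
      moreover have "\<psi> (cinv ?k (\<gamma> u)) = \<gamma> u" using cmap_cinv[of "\<gamma> u" ?k] r(2) u by auto
      ultimately have "\<gamma> u \<in> \<psi> ` L" by (intro image_eqI[of _ _ "cinv ?k (\<gamma> u)"]) simp_all
      then show "u \<in> E" using r(2) u by (auto simp: E_def)
    qed
    then show "\<exists>e>0. ball u1 e \<subseteq> E" using r(1) by blast
  qed
  then have o: "openin (top_of_set I) E" using hc(1) by (auto simp: openin_open_eq E_def)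
  have "closedin (top_of_set I) (I \<inter> \<gamma> -` closure (\<psi> ` L))"
    by (rule continuous_closedin_preimage[OF hc(3) closed_closure])
  moreover have "I \<inter> \<gamma> -` closure (\<psi> ` L) = E"
    using cl hc(4) C_circ_subset closure_subset[of "\<psi> ` L"] by (auto simp: E_def)
  ultimately have c: "closedin (top_of_set I) E" by simp
  have "u0 \<in> E" using u0 z0(1) by (auto simp: E_def L_def band_def)
  then have EI: "E = I" using o c connected_clopen[of I] hc(2) is_interval_connected by blast
  have noend: False if b: "b \<in> qd_zeros A \<phi>" "(\<gamma> \<longlongrightarrow> b) F" "F \<noteq> bot" "eventually (\<lambda>t. t \<in> I) F" for b F
  proof -
    have "eventually (\<lambda>t. \<gamma> t \<in> closure (\<psi> ` L)) F"
      using b(4) by (rule eventually_mono) (use EI closure_subset[of "\<psi> ` L"] in \<open>auto simp: E_def\<close>)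
    then have "b \<in> closure (\<psi> ` L)" by (rule Lim_in_closed_set[OF closed_closure _ b(3,2)])
    then have "b \<in> \<psi> ` L" using cl b(1) unfolding C_tilde_eq by blast
    then have "b \<in> C_circ A \<phi>" using flatmap_C_circ[OF d(5)] LJ by blast
    then show False using b(1) zeros_C_circ_disjoint by blast
  qed
  have "\<not> (\<exists>b\<in>qd_zeros A \<phi>. (\<gamma> \<longlongrightarrow> b) (left_end I))"
    using noend[OF _ _ left_end_nontrivial[OF Ine] eventually_ends(1)[OF Ine]] by blast
  moreover have "\<not> (\<exists>b\<in>qd_zeros A \<phi>. (\<gamma> \<longlongrightarrow> b) (right_end I))"
    using noend[OF _ _ right_end_nontrivial[OF Ine] eventually_ends(2)[OF Ine]] by blast
  ultimately show False using g(3) by argo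
qed

section \<open>Existence of maximal strips\<close>

lemma exists_lift_nonneg:
  assumes "x \<in> C_circ A \<phi>"
  obtains y where "y \<in> spectral_curve A \<phi>" "fst y = x" "f y \<ge> 0" "0 \<in> devdom y"
proof -
  obtain r \<theta> where r: "r > 0" "flatmap (ball 0 r) \<theta>" "inj_on \<theta> (ball 0 r)" "\<theta> 0 = x" using flat_disc_C_circ[OF assms] .
  have y0: "lift \<theta> 0 \<in> spectral_curve A \<phi>" using lift_in_spectral_curve[OF r(2), of 0] r(1) by simp
  define y where "y = (if f (lift \<theta> 0) \<ge> 0 then lift \<theta> 0 else smul (-1) (lift \<theta> 0))"
  have "y \<in> spectral_curve A \<phi>" using y0 spectral_smul[OF y0, of "-1"] by (simp add: y_def)
  moreover have "fst y = x" using r(4) by (simp add: y_def)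
  moreover have "f y \<ge> 0" using f_odd[of "lift \<theta> 0"] by (simp add: y_def)
  ultimately show ?thesis using that dev_exists assms by blast
qed

text \<open>Starting at f = 1, blocking along the horizontal line can happen only where f = 0, that
  is, at displacement -1. If that point is free, so is the whole line.\<close>

lemma visible_line:
  assumes h: "half_plane_map \<Psi>" and n: "-1 \<in> devdom (lift \<Psi> (Complex 1 t))"
  shows "of_real s \<in> devdom (lift \<Psi> (Complex 1 t))"
proof (rule ccontr)
  let ?y = "lift \<Psi> (Complex 1 t)"
  assume nd: "of_real s \<notin> devdom ?y"
  have fy: "0 \<in> devdom ?y" "f ?y = 1" using half_plane_dev[OF h, of "Complex 1 t"] by simp_all
  obtain t1 where t1: "0 < t1" "t1 \<le> 1" "of_real t1 * of_real s \<notin> devdom ?y" "f ?y + t1 * Re (of_real s) = 0"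
    using blocked_first[OF fy(1) nd] by blast
  then have "t1 * s = -1" using fy(2) by simp
  then have "of_real t1 * of_real s = (-1 :: complex)" by (metis of_real_mult of_real_minus of_real_1)
  then show False using t1(3) n by simp
qed

text \<open>Blocking requires f = 0, which forces \<open>t1 = 1\<close>: the zero is reached exactly
  at the boundary line Re = 0.\<close>

lemma invisible_limit:
  assumes h: "half_plane_map \<Psi>" and n: "-1 \<notin> devdom (lift \<Psi> (Complex 1 t))"
  obtains b where "b \<in> qd_zeros A \<phi>" "((\<lambda>s. \<Psi> (Complex s t)) \<longlongrightarrow> b) (at_right 0)"
proof -
  let ?y = "lift \<Psi> (Complex 1 t)"
  have fy: "0 \<in> devdom ?y" "f ?y = 1" using half_plane_dev[OF h, of "Complex 1 t"] by simp_all
  obtain t1 b where t1: "f ?y + t1 * Re (-1) = 0" "b \<in> qd_zeros A \<phi>" "((\<lambda>\<tau>. Exp ?y (of_real \<tau> * (of_real t1 * (-1)))) \<longlongrightarrow> b) (at_left 1)"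
    using blocked_first[OF fy(1) n] by blast
  have "t1 = 1" using t1(1) fy(2) by simp
  then have l: "((\<lambda>\<tau>. Exp ?y (of_real \<tau> * (-1))) \<longlongrightarrow> b) (at_left 1)" using t1(3) by simp
  have "filterlim (\<lambda>s::real. 1 - s) (at_left 1) (at_right 0)"
    unfolding filterlim_at by (auto intro!: tendsto_eq_intros simp: eventually_at_filter)
  from filterlim_compose[OF l this]
  have l2: "((\<lambda>s. Exp ?y (of_real (1 - s) * (-1))) \<longlongrightarrow> b) (at_right 0)" .
  have "eventually (\<lambda>s. Exp ?y (of_real (1 - s) * (-1)) = \<Psi> (Complex s t)) (at_right 0)"
  proof (rule eventually_mono[OF eventually_at_right_less])
    fix s :: real assume s: "0 < s"
    have "Exp ?y (of_real (1 - s) * (-1)) = \<Psi> (Complex 1 t + of_real (1 - s) * (-1))"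
      using half_plane_dev(3)[OF h, of "Complex 1 t" "of_real (1 - s) * (-1)"] s by simp
    moreover have "Complex 1 t + of_real (1 - s) * (-1) = Complex s t" by (simp add: complex_eq_iff)
    ultimately show "Exp ?y (of_real (1 - s) * (-1)) = \<Psi> (Complex s t)" by simp
  qed
  from Lim_transform_eventually[OF l2 this] show ?thesis using that t1(2) by blast
qed

text \<open>The base point \<open>lift \<Psi> (Complex 1 t)\<close> varies with t. A development
  from one height, recentred by a vertical translation, is a development from the neighbouring
  heights, so the leftward continuations fit together to one flat map.\<close>

lemma visible_local:
  assumes h: "half_plane_map \<Psi>" and d: "of_real (x0 - 1) \<in> devdom (lift \<Psi> (Complex 1 t0))"
  obtains e \<theta> where "e > 0" "flatmap (ball (Complex x0 t0) e) \<theta>"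
    "\<forall>z\<in>ball (Complex x0 t0) e. of_real (Re z - 1) \<in> devdom (lift \<Psi> (Complex 1 (Im z))) \<and>
      Exp (lift \<Psi> (Complex 1 (Im z))) (of_real (Re z - 1)) = \<theta> z"
proof -
  let ?y = "\<lambda>t. lift \<Psi> (Complex 1 t)"
  obtain U \<theta> where U: "dev (?y t0) U \<theta>" "of_real (x0 - 1) \<in> U" using d by (rule devdomE)
  have u: "convex U" "0 \<in> U" "flatmap U \<theta>" using U(1) by (auto simp: dev_def)
  have oU: "open U" using flatmap_open[OF u(3)] .
  obtain e1 where e1: "e1 > 0" "ball 0 e1 \<subseteq> U" using openE[OF oU u(2)] .
  obtain e2 where e2: "e2 > 0" "ball (of_real (x0 - 1)) e2 \<subseteq> U" using openE[OF oU U(2)] .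
  define e where "e = min (min e1 e2) 1"
  have e: "e > 0" "e \<le> e1" "e \<le> e2" "e \<le> 1" using e1 e2 by (auto simp: e_def)
  let ?\<theta> = "\<lambda>z. \<theta> (1 * z + - Complex 1 t0)"
  have sh: "1 * z + - Complex 1 t0 \<in> U" if "z \<in> ball (Complex x0 t0) e" for z
  proof -
    have "of_real (x0 - 1) - (1 * z + - Complex 1 t0) = Complex x0 t0 - z" by (simp add: complex_eq_iff)
    then have "dist (of_real (x0 - 1)) (1 * z + - Complex 1 t0) = dist (Complex x0 t0) z"
      by (simp only: dist_norm)
    then show ?thesis using that e(3) e2(2) by (auto simp: subset_iff)
  qed
  have fl: "flatmap (ball (Complex x0 t0) e) ?\<theta>"
    by (rule flatmap_subset[OF flatmap_affine(1)[OF u(3)] open_ball]) (use sh in auto)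
  have "of_real (Re z - 1) \<in> devdom (?y (Im z)) \<and> Exp (?y (Im z)) (of_real (Re z - 1)) = ?\<theta> z"
    if z: "z \<in> ball (Complex x0 t0) e" for z
  proof -
    let ?c = "\<i> * of_real (Im z - t0)"
    let ?U = "{w. 1 * w + ?c \<in> U}" and ?t = "\<lambda>w. \<theta> (1 * w + ?c)"
    have "\<bar>Im z - t0\<bar> \<le> dist (Complex x0 t0) z" using abs_Im_le_cmod[of "Complex x0 t0 - z"] by (simp add: dist_norm)
    moreover have "cmod ?c = \<bar>Im z - t0\<bar>" by (simp only: norm_mult norm_ii mult_1 norm_of_real)
    ultimately have "cmod ?c < e1" using z e(2) by simp
    then have cU: "?c \<in> U" using e1(2) by auto
    have fU: "flatmap ?U ?t" by (rule flatmap_affine(1)[OF u(3)]) simp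
    have "?U = (\<lambda>w. w + ?c) -` U" by auto
    also have "\<dots> = (\<lambda>w. - ?c + w) ` U" by (force simp: image_iff algebra_simps)
    finally have cvU: "convex ?U" using convex_translation[OF u(1), of "- ?c"] by simp
    have "lift ?t 0 = lift \<theta> ?c" using lift_affine[OF u(3), of 1 0 ?c] cU by simp
    also have "\<dots> = lift (Exp (?y t0)) ?c" using lift_Exp_eq[OF U(1) cU] by simp
    also have "\<dots> = lift \<Psi> (Complex 1 t0 + ?c)" using half_plane_dev(3)[OF h, of "Complex 1 t0" ?c] by simp
    also have "Complex 1 t0 + ?c = Complex 1 (Im z)" by (simp add: complex_eq_iff)
    finally have dv: "dev (?y (Im z)) ?U ?t" using fU cvU cU by (simp add: dev_def)
    have eq: "of_real (Re z - 1) + ?c = 1 * z + - Complex 1 t0" by (simp add: complex_eq_iff)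
    have m: "of_real (Re z - 1) \<in> ?U" using sh[OF z] eq by simp
    show ?thesis using subsetD[OF dev_subset_devdom[OF dv] m] Exp_eq[OF dv m] eq by simp
  qed
  then show ?thesis using that[OF e(1) fl] by blast
qed

text \<open>N is the set of heights at which the developed half plane continues to the left of Re =
  0. It is open by \<open>visible_local\<close>, and it contains the height 0 of x, since a blocked
  line would place x on the network. Its component J at 0 carries the strip; at an edge of J the
  line is blocked, by the zero required there.\<close>

lemma maxstrip_exists:
  assumes x: "x \<in> C_tilde A \<phi>" "x \<notin> spectral_network A \<phi>"
  shows "\<exists>J \<psi> z. maxstrip J \<psi> \<and> z \<in> band J \<and> \<psi> z = x"
proof -
  have "x \<notin> qd_zeros A \<phi>" using x(2) by (auto simp: spectral_network_def)
  then have xc: "x \<in> C_circ A \<phi>" using x(1) unfolding C_tilde_eq by blast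
  obtain y where y: "y \<in> spectral_curve A \<phi>" "fst y = x" "f y \<ge> 0" "0 \<in> devdom y" using exists_lift_nonneg[OF xc] .
  define \<Psi> where "\<Psi> = (\<lambda>z. Exp y (1 * z + - of_real (f y)))"
  have h: "half_plane_map \<Psi>" unfolding \<Psi>_def by (rule half_plane_map_Exp(1)[OF y(4,3)])
  have fl: "flatmap {z. Re z > 0} \<Psi>" and fv: "\<And>z. Re z > 0 \<Longrightarrow> f (lift \<Psi> z) = Re z" using h by (auto simp: half_plane_map_def)
  have Exp0: "Exp y 0 = x" using lift_Exp_0[OF y(4)] y(2) by (metis fst_lift)
  \<comment> \<open>If f y = 0, then x sits on the boundary line Re = 0 of the half plane, so x is
    described as a limit from the right.\<close>
  have lim0: "((\<lambda>s. \<Psi> (Complex (f y + s) 0)) \<longlongrightarrow> x) (at_right 0)"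
  proof -
    have "isCont (Exp y) 0"
      using flatmap_continuous[OF flatmap_Exp] y(4) continuous_on_eq_continuous_at[OF open_devdom] by blast
    moreover have "((\<lambda>s::real. complex_of_real s) \<longlongrightarrow> of_real 0) (at_right 0)" by (intro tendsto_intros)
    ultimately have "((\<lambda>s. Exp y (of_real s)) \<longlongrightarrow> x) (at_right 0)"
      using isCont_tendsto_compose[of 0 "Exp y" complex_of_real "at_right 0"] Exp0 by simp
    moreover have "\<Psi> (Complex (f y + s) 0) = Exp y (of_real s)" for s
    proof -
      have "1 * Complex (f y + s) 0 + - of_real (f y) = of_real s" by (simp add: complex_eq_iff)
      then show ?thesis by (simp only: \<Psi>_def)
    qed
    ultimately show ?thesis by simp
  qed
  define N where "N = {t. -1 \<in> devdom (lift \<Psi> (Complex 1 t))}"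
  have oN: "open N"
    unfolding open_contains_ball
  proof
    fix t0 assume "t0 \<in> N"
    then have "of_real (0 - 1) \<in> devdom (lift \<Psi> (Complex 1 t0))" by (simp add: N_def)
    then obtain e where e: "e > 0" "\<forall>z\<in>ball (Complex 0 t0) e. of_real (Re z - 1) \<in> devdom (lift \<Psi> (Complex 1 (Im z)))"
      by (rule visible_local[OF h]) blast
    have "ball t0 e \<subseteq> N"
    proof
      fix t assume "t \<in> ball t0 e"
      then have "Complex 0 t \<in> ball (Complex 0 t0) e" by (simp add: dist_norm cmod_def dist_real_def)
      from bspec[OF e(2) this] show "t \<in> N" by (simp add: N_def)
    qed
    then show "\<exists>e>0. ball t0 e \<subseteq> N" using e(1) by blast
  qed
  have N0: "0 \<in> N"
  proof (rule ccontr)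
    assume "0 \<notin> N"
    then obtain b where b: "b \<in> qd_zeros A \<phi>" "((\<lambda>s. \<Psi> (Complex s 0)) \<longlongrightarrow> b) (at_right 0)"
      using invisible_limit[OF h, of 0] by (auto simp: N_def)
    show False
    proof (cases "f y = 0")
      case True
      then have "((\<lambda>s. \<Psi> (Complex s 0)) \<longlongrightarrow> x) (at_right 0)" using lim0 by simp
      then have "b = x" using tendsto_unique[OF trivial_limit_at_right_real b(2)] by blast
      then show False using b(1) xc zeros_C_circ_disjoint by blast
    next
      case False
      then have "\<Psi> (Complex (f y) 0) \<in> spectral_network A \<phi>"
        using half_plane_ray_in_network[OF h b] y(3) by simp
      moreover have "1 * Complex (f y) 0 + - of_real (f y) = 0" by (simp add: complex_eq_iff)
      then have "\<Psi> (Complex (f y) 0) = x" using Exp0 by (simp only: \<Psi>_def)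
      ultimately show False using x(2) by simp
    qed
  qed
  define J where "J = connected_component_set N 0"
  have J: "open J" "is_interval J" "J \<subseteq> N" "0 \<in> J"
    using oN N0 by (simp_all add: J_def open_connected_component connected_component_subset is_interval_connected_1 connected_component_refl)
  define \<psi> where "\<psi> z = Exp (lift \<Psi> (Complex 1 (Im z))) (of_real (Re z - 1))" for z
  have flb: "flatmap (band J) \<psi>"
  proof (rule flatmap_cong_local[OF open_band[OF J(1)]])
    fix z assume "z \<in> band J"
    then have "Im z \<in> N" using J(3) by (auto simp: band_def)
    then have "of_real (Re z - 1) \<in> devdom (lift \<Psi> (Complex 1 (Im z)))"
      by (intro visible_line[OF h]) (simp add: N_def)
    then obtain e \<theta> where e: "e > 0" "flatmap (ball z e) \<theta>" "\<forall>w\<in>ball z e. \<psi> w = \<theta> w"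
      unfolding \<psi>_def by (rule visible_local[OF h, of "Re z" "Im z", unfolded complex_surj]) blast
    then show "\<exists>V \<theta>. flatmap V \<theta> \<and> z \<in> V \<and> (\<forall>w\<in>V \<inter> band J. \<psi> w = \<theta> w)"
      by (intro exI[of _ "ball z e"] exI[of _ \<theta>]) simp
  qed
  have agree: "\<psi> z = \<Psi> z" if "Re z > 0" for z
  proof -
    have "Complex 1 (Im z) + of_real (Re z - 1) = z" by (simp add: complex_eq_iff)
    then show ?thesis using half_plane_dev(3)[OF h, of "Complex 1 (Im z)" "of_real (Re z - 1)"] that by (simp add: \<psi>_def)
  qed
  have oR: "open {z. Re z > 0}" by (rule open_halfspace_Re_gt)
  have lagree: "lift \<psi> z = lift \<Psi> z" if "Re z > 0" for z
    by (rule lift_cong[OF oR]) (use that agree in simp_all)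
  have fvb: "f (lift \<psi> z) = Re z" if "z \<in> band J" for z
  proof -
    have "1 \<in> band J" using J(4) by (simp add: band_def)
    then have "f (lift \<psi> z) - f (lift \<psi> 1) = Re z - Re 1" by (intro f_lift[OF flb convex_band[OF J(2)]] that)
    then show ?thesis using lagree[of 1] fv[of 1] by simp
  qed
  have nU: "J \<noteq> UNIV"
  proof
    assume "J = UNIV"
    then have "band J = UNIV" by (auto simp: band_def)
    then show False using flb no_flat_plane[of \<psi>] by simp
  qed
  have ends: "\<exists>b\<in>qd_zeros A \<phi>. ends_at \<psi> J c b" if c: "edge J c" for c
  proof -
    \<comment> \<open>A component of N is closed in N, so an edge of J cannot belong to N.\<close>
    have "c \<notin> N"
    proof
      assume cN: "c \<in> N"
      have "c \<in> closure J" using c by (simp add: edge_def closure_approachable)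
      moreover have "closedin (top_of_set N) J" unfolding J_def by (rule closedin_connected_component)
      ultimately have "c \<in> J" using cN by (auto simp: closedin_closed closure_minimal subset_iff) (metis (no_types, lifting) closure_minimal closure_mono closed_closure Int_lower2 closure_closed subsetD)
      then show False using c by (simp add: edge_def)
    qed
    then obtain b where b: "b \<in> qd_zeros A \<phi>" "((\<lambda>s. \<Psi> (Complex s c)) \<longlongrightarrow> b) (at_right 0)"
      using invisible_limit[OF h, of c] by (auto simp: N_def)
    have "\<rho> b ^ 3 > 0" using zchart(2)[OF b(1)] by simp
    define r where "r = min 1 (\<rho> b ^ 3 / 9)"
    have r: "0 < r" "r \<le> 1" "r \<le> \<rho> b ^ 3 / 9" using \<open>\<rho> b ^ 3 > 0\<close> by (auto simp: r_def)
    have "r\<^sup>2 \<le> r" using r by (simp add: power2_eq_square mult_le_one mult_left_le)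
    then have r9: "9 * r\<^sup>2 < 4 * \<rho> b ^ 3" using r(3) \<open>\<rho> b ^ 3 > 0\<close> by linarith
    let ?c = "Complex 0 c"
    let ?Q = "{z. Re z > 0} \<inter> ball ?c r"
    have Q: "convex ?Q" "open ?Q" by (intro convex_Int convex_halfspace_Re_gt convex_ball) (intro open_Int oR open_ball)
    have cpt: "?c + of_real s * (of_real (r/2)) = Complex (s * (r/2)) c" for s by (simp add: complex_eq_iff)
    have fQ: "flatmap ?Q \<Psi>" by (rule flatmap_subset[OF fl Q(2)]) blast
    have inQ: "?c + of_real s * of_real (r/2) \<in> ?Q" if "0 < s" "s \<le> 1" for s
    proof -
      have "dist ?c (?c + of_real s * of_real (r/2)) = s * (r/2)" using that r by (simp add: dist_norm norm_mult)
      also have "\<dots> < r" using that r mult_right_mono[of s 1 "r/2"] by simp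
      finally show ?thesis using that r unfolding cpt by simp
    qed
    have "filterlim (\<lambda>s::real. s * (r/2)) (at_right 0) (at_right 0)"
      unfolding filterlim_at using r by (auto intro!: tendsto_eq_intros simp: eventually_at_filter)
    from filterlim_compose[OF b(2) this]
    have lim: "((\<lambda>s. \<Psi> (?c + of_real s * of_real (r/2))) \<longlongrightarrow> b) (at_right 0)" unfolding cpt .
    have "\<exists>u\<in>J. dist u c < r/2" using c half_gt_zero[OF r(1)] unfolding edge_def by blast
    then obtain u where u: "u \<in> J" "dist u c < r/2" by blast
    \<comment> \<open>A point common to the band and to the right half disc at c:
      \<open>corner\<close> identifies the zero chart on the half disc, and from here the relation
      is continued across Re = 0 within the band.\<close>
    let ?z0 = "Complex (r/4) u"
    have z0: "?z0 \<in> ?Q" "?z0 \<in> band J \<inter> ball ?c r"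
    proof -
      have "dist ?c ?z0 \<le> \<bar>r/4\<bar> + \<bar>c - u\<bar>" using cmod_le[of "?c - ?z0"] by (simp add: dist_norm)
      also have "\<dots> < r" using u(2) r(1) by (simp add: dist_real_def abs_minus_commute)
      finally show "?z0 \<in> ?Q" "?z0 \<in> band J \<inter> ball ?c r" using r(1) u(1) by (simp_all add: band_def)
    qed
    note cor = corner[OF b(1) fQ Q(1) Int_lower2 r9 inQ lim z0(1)]
    have zd: "zdisp b \<psi> ?z0 = ?z0 - ?c"
    proof -
      have "deriv (cinv (zchart b) \<circ> \<psi>) ?z0 = deriv (cinv (zchart b) \<circ> \<Psi>) ?z0"
        by (rule deriv_cong_ev[OF eventually_mono[OF eventually_nhds_in_open[OF oR]]]) (use agree r(1) in simp_all)
      then show ?thesis using cor(2) agree[of ?z0] r(1) by (simp add: zdisp_def)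
    qed
    have fB: "flatmap (band J \<inter> ball ?c r) \<psi>"
      by (rule flatmap_subset[OF flb]) (use open_band[OF J(1)] in blast)+
    have cB: "connected (band J \<inter> ball ?c r)" by (intro convex_connected convex_Int convex_band[OF J(2)] convex_ball)
    have k0: "\<psi> ?z0 \<in> cim (zchart b)" using cor(1) agree[of ?z0] r(1) by simp
    note ext = zero_chart_extend'[OF b(1) fB cB Int_lower2 r9 z0(2) k0 zd]
    have "ends_at \<psi> J c b"
      unfolding ends_at_def
    proof (intro allI impI)
      fix S assume S: "open S \<and> b \<in> S"
      obtain e where e: "e > 0" "\<And>x d. x \<in> cim (zchart b) \<Longrightarrow> 4/9 * (cmod (cinv (zchart b) x)) ^ 3 = d\<^sup>2 \<Longrightarrow> \<bar>d\<bar> < e \<Longrightarrow> x \<in> S"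
        using zero_near_distance[OF b(1)] S by blast
      have "\<psi> (Complex 0 t) \<in> S" if t: "t \<in> J" "dist t c < min e r" for t
      proof -
        have dt: "dist ?c (Complex 0 t) = dist t c" "cmod (Complex 0 t - ?c) = dist t c"
          by (simp_all add: dist_norm cmod_def dist_real_def abs_minus_commute)
        have m: "Complex 0 t \<in> band J \<inter> ball ?c r" using t dt by (simp add: band_def)
        show ?thesis using e(2)[OF ext(1)[OF m] ext(3)[OF m]] t(2) dt by simp
      qed
      then show "\<exists>e>0. \<forall>t\<in>J. dist t c < e \<longrightarrow> \<psi> (Complex 0 t) \<in> S" using e(1) r(1) by (intro exI[of _ "min e r"]) simp
    qed
    then show ?thesis using b(1) by blast
  qed
  have "maxstrip J \<psi>" unfolding maxstrip_def using J flb fvb nU ends by blast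
  moreover have "of_real (f y) \<in> band J" using J(4) by (simp add: band_def)
  moreover have "\<psi> (of_real (f y)) = x"
  proof (rule tendsto_unique[OF trivial_limit_at_right_real _ lim0])
    have "isCont \<psi> (of_real (f y))"
      using flatmap_continuous[OF flb] calculation(2) continuous_on_eq_continuous_at[OF open_band[OF J(1)]] by blast
    moreover have "((\<lambda>s. Complex (f y + s) 0) \<longlongrightarrow> of_real (f y)) (at_right 0)"
      unfolding complex_of_real_def by (intro tendsto_eq_intros) auto
    ultimately have "((\<lambda>s. \<psi> (Complex (f y + s) 0)) \<longlongrightarrow> \<psi> (of_real (f y))) (at_right 0)"
      by (rule isCont_tendsto_compose)
    moreover have "eventually (\<lambda>s. \<psi> (Complex (f y + s) 0) = \<Psi> (Complex (f y + s) 0)) (at_right 0)"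
      by (rule eventually_mono[OF eventually_at_right_less]) (use agree y(3) in simp)
    ultimately show "((\<lambda>s. \<Psi> (Complex (f y + s) 0)) \<longlongrightarrow> \<psi> (of_real (f y))) (at_right 0)"
      by (rule Lim_transform_eventually)
  qed
  ultimately show ?thesis by blast
qed

text \<open>By \<open>maxstrip_meet\<close> two images coincide or are disjoint. They are open,
  connected and, by \<open>maxstrip_exists\<close>, cover the complement of the network, so each one
  is a component.\<close>

lemma maxstrip_component:
  assumes m: "maxstrip J \<psi>"
  shows "\<psi> ` band J \<in> components (C_tilde A \<phi> - spectral_network A \<phi>)"
proof -
  let ?X = "C_tilde A \<phi> - spectral_network A \<phi>"
  have sub: "\<theta> ` band K \<subseteq> ?X" if "maxstrip K \<theta>" for K \<theta>
  proof -
    have "\<theta> ` band K \<subseteq> C_circ A \<phi>" using flatmap_C_circ[OF maxstripD(5)[OF that]] by blast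
    then show ?thesis using maxstrip_avoids_network[OF that] C_circ_subset by blast
  qed
  have op: "open (\<theta> ` band K)" if "maxstrip K \<theta>" for K \<theta> using flatmap_open_image[OF maxstripD(5)[OF that]] .
  have eq: "\<theta> ` band K = \<psi> ` band J" if K: "maxstrip K \<theta>" and ne: "\<theta> ` band K \<inter> \<psi> ` band J \<noteq> {}" for K \<theta>
  proof -
    have le: "\<theta>1 ` band K1 \<subseteq> \<theta>2 ` band K2" if mm: "maxstrip K1 \<theta>1" "maxstrip K2 \<theta>2" "\<theta>1 ` band K1 \<inter> \<theta>2 ` band K2 \<noteq> {}" for K1 \<theta>1 K2 \<theta>2
    proof -
      obtain z1 z2 where z: "z1 \<in> band K1" "z2 \<in> band K2" "\<theta>1 z1 = \<theta>2 z2" using mm(3) by (auto simp: disjoint_iff)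
      obtain \<sigma> \<tau> where s: "\<sigma> \<in> {1,-1}" "K1 = {t. \<sigma> * t + \<tau> \<in> K2}" "\<forall>z\<in>band K1. \<theta>1 z = \<theta>2 (of_real \<sigma> * z + \<i> * of_real \<tau>)"
        using maxstrip_meet[OF mm(1,2) z] by blast
      show ?thesis
      proof
        fix x assume "x \<in> \<theta>1 ` band K1"
        then obtain z where z: "z \<in> band K1" "x = \<theta>1 z" by blast
        then have "of_real \<sigma> * z + \<i> * of_real \<tau> \<in> band K2" using s(2) by (simp add: band_def)
        then show "x \<in> \<theta>2 ` band K2" using s(3) z by blast
      qed
    qed
    have ne': "\<psi> ` band J \<inter> \<theta> ` band K \<noteq> {}" using ne by blast
    show ?thesis using le[OF K m ne] le[OF m K ne'] by (rule equalityI)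
  qed
  define R where "R = \<Union>{\<theta> ` band K | K \<theta>. maxstrip K \<theta> \<and> \<theta> ` band K \<inter> \<psi> ` band J = {}}"
  have oR: "open R" unfolding R_def using op by (intro open_Union) blast
  have XR: "?X \<subseteq> \<psi> ` band J \<union> R"
  proof
    fix x assume "x \<in> ?X"
    then obtain K \<theta> z where K: "maxstrip K \<theta>" "z \<in> band K" "\<theta> z = x" using maxstrip_exists by blast
    then have xK: "x \<in> \<theta> ` band K" by blast
    show "x \<in> \<psi> ` band J \<union> R"
    proof (cases "\<theta> ` band K \<inter> \<psi> ` band J = {}")
      case True
      then have "\<theta> ` band K \<subseteq> R" unfolding R_def using K(1) by blast
      then show ?thesis using xK by blast
    qed (use eq[OF K(1)] xK in blast)
  qed
  have disj: "\<psi> ` band J \<inter> R = {}" unfolding R_def by blast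
  have conn: "connected (\<psi> ` band J)"
    using connected_continuous_image[OF flatmap_continuous[OF maxstripD(5)[OF m]] connected_band[OF maxstripD(2)[OF m]]] .
  obtain t where "t \<in> J" using maxstripD(3)[OF m] by blast
  then have "Complex 0 t \<in> band J" by (simp add: band_def)
  then have ne: "\<psi> ` band J \<noteq> {}" by blast
  show ?thesis
    unfolding in_components_maximal
  proof (intro conjI allI impI ne conn sub[OF m])
    fix D assume D: "D \<noteq> {} \<and> \<psi> ` band J \<subseteq> D \<and> D \<subseteq> ?X \<and> connected D"
    have "\<psi> ` band J \<inter> D = {} \<or> R \<inter> D = {}"
    proof (rule connectedD[OF _ op[OF m] oR])
      show "connected D" using D by blast
      show "\<psi> ` band J \<inter> R \<inter> D = {}" using disj by blast
      show "D \<subseteq> \<psi> ` band J \<union> R" using D XR by blast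
    qed
    then have "R \<inter> D = {}" using ne D by blast
    then show "D = \<psi> ` band J" using D XR by blast
  qed
qed

end

section \<open>Normalized coordinates of the components\<close>

text \<open>Write c' = c + s (t - c). For s > 0 the point c' lies strictly between c and t, hence in
  J. For s < 0 some points of J close to c' lie beyond c, so that c would lie between points of
  J.\<close>

lemma edge_isolated:
  assumes J: "is_interval J" "open J" and c: "edge J c" and t: "t \<in> J" and c': "edge J c'" "\<bar>c' - c\<bar> < \<bar>t - c\<bar>"
  shows "c' = c"
proof (rule ccontr)
  assume n: "c' \<noteq> c"
  have cJ: "c \<notin> J" "c' \<notin> J" using c c' by (auto simp: edge_def)
  then have tc: "t \<noteq> c" using t by auto
  define s where "s = (c' - c) / (t - c)"
  have c's: "c' = c + s * (t - c)" using tc by (simp add: s_def)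
  show False
  proof (cases "s > 0")
    case True
    have "\<bar>s\<bar> * \<bar>t - c\<bar> = \<bar>c' - c\<bar>" unfolding c's by (simp add: abs_mult)
    then have "\<bar>s\<bar> < 1" using c'(2) tc by (smt (verit) mult_le_cancel_right1 abs_ge_zero)
    then show False using edge_segment[OF J c t True] c's cJ by simp
  next
    case False
    have "s \<noteq> 0" using n c's by auto
    then have s: "s < 0" using False by simp
    have "\<bar>c - c'\<bar> > 0" using n by simp
    then obtain u where u: "u \<in> J" "dist u c' < \<bar>c - c'\<bar>" using c'(1) unfolding edge_def by blast
    consider "t > c" | "t < c" using tc by linarith
    then show False
    proof cases
      case 1
      then have "c' < c" using c's s by (simp add: mult_neg_pos)
      then have "u \<le> c" "c \<le> t" using u(2) 1 by (auto simp: dist_real_def abs_if split: if_splits)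
      then show False using J(1) u(1) t cJ(1) unfolding is_interval_1 by blast
    next
      case 2
      then have "c' > c" using c's s by (simp add: mult_neg_neg)
      then have "c \<le> u" "t \<le> c" using u(2) 2 by (auto simp: dist_real_def abs_if split: if_splits)
      then show False using J(1) u(1) t cJ(1) unfolding is_interval_1 by blast
    qed
  qed
qed

lemma edge_greaterThanLessThan: "a < b \<Longrightarrow> edge {a<..<b} c \<longleftrightarrow> c = a \<or> c = b"
proof -
  assume ab: "a < b"
  have "c \<in> closure {a<..<b} \<longleftrightarrow> (\<forall>e>0. \<exists>t\<in>{a<..<b}. dist t c < e)" by (rule closure_approachable)
  then have "edge {a<..<b} c \<longleftrightarrow> c \<notin> {a<..<b} \<and> c \<in> {a..b}" using ab by (simp add: edge_def)
  then show ?thesis using ab by auto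
qed

lemma edge_greaterThan: "edge {a<..} c \<longleftrightarrow> c = (a::real)"
proof -
  have "c \<in> closure {a<..} \<longleftrightarrow> (\<forall>e>0. \<exists>t\<in>{a<..}. dist t c < e)" by (rule closure_approachable)
  then have "edge {a<..} c \<longleftrightarrow> c \<notin> {a<..} \<and> c \<in> {a..}" by (simp add: edge_def)
  then show ?thesis by auto
qed

lemma open_interval_cases:
  fixes J :: "real set"
  assumes "open J" "is_interval J" "J \<noteq> {}" "J \<noteq> UNIV"
  obtains a b where "a < b" "J = {a<..<b}" | a where "J = {a<..}" | b where "J = {..<b}"
proof -
  have nomax: "x < y" if "J = {..y} \<or> J = {a..y} \<or> J = {a<..y}" "x \<in> J" for a x y
  proof (rule ccontr)
    assume "\<not> x < y"
    then have "y \<in> J" "\<forall>u\<in>J. u \<le> y" using that by auto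
    then obtain e where e: "e > 0" "ball y e \<subseteq> J" using openE[OF assms(1)] by blast
    then have "y + e/2 \<in> J" by (auto simp: subset_iff dist_real_def)
    then show False using \<open>\<forall>u\<in>J. u \<le> y\<close> e(1) by fastforce
  qed
  have nomin: "y < x" if "J = {y..} \<or> J = {y..a} \<or> J = {y..<a}" "x \<in> J" for a x y
  proof (rule ccontr)
    assume "\<not> y < x"
    then have "y \<in> J" "\<forall>u\<in>J. y \<le> u" using that by auto
    then obtain e where e: "e > 0" "ball y e \<subseteq> J" using openE[OF assms(1)] by blast
    then have "y - e/2 \<in> J" by (auto simp: subset_iff dist_real_def)
    then show False using \<open>\<forall>u\<in>J. y \<le> u\<close> e(1) by fastforce
  qed
  have ivl: "\<And>a b x. a \<in> J \<Longrightarrow> b \<in> J \<Longrightarrow> a \<le> x \<Longrightarrow> x \<le> b \<Longrightarrow> x \<in> J" using assms(2) unfolding is_interval_1 by blast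
  have "\<exists>a b. J = {} \<or> J = UNIV \<or> J = {..<b} \<or> J = {..b} \<or> J = {a<..} \<or> J = {a..} \<or>
      J = {a<..<b} \<or> J = {a<..b} \<or> J = {a..<b} \<or> J = {a..b}"
    by (rule interval_cases[OF ivl])
  then obtain a b where "J = {} \<or> J = UNIV \<or> J = {..<b} \<or> J = {..b} \<or> J = {a<..} \<or> J = {a..} \<or>
      J = {a<..<b} \<or> J = {a<..b} \<or> J = {a..<b} \<or> J = {a..b}" by (elim exE)
  then consider "J = {..<b}" | "J = {..b}" | "J = {a<..}" | "J = {a..}" | "J = {a<..<b}" | "J = {a<..b}" | "J = {a..<b}" | "J = {a..b}"
    using assms(3,4) by argo
  then show ?thesis
  proof cases
    case 1 then show ?thesis using that by blast
  next
    case 2 then show ?thesis using nomax[of b 0 b] by auto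
  next
    case 3 then show ?thesis using that by blast
  next
    case 4 then show ?thesis using nomin[of a 0 a] by auto
  next
    case 5 then show ?thesis using that(1)[of a b] assms(3) by auto
  next
    case 6
    then have "b \<in> J" using assms(3) by auto
    then show ?thesis using nomax[of b a b] 6 by auto
  next
    case 7
    then have "a \<in> J" using assms(3) by auto
    then show ?thesis using nomin[of a b a] 7 by auto
  next
    case 8
    then have "a \<in> J" using assms(3) by auto
    then show ?thesis using nomin[of a b a] 8 by auto
  qed
qed

context gmn_surface
begin

lemma small_radius:
  obtains r where "r > 0" "r \<le> 1" "\<And>b. b \<in> qd_zeros A \<phi> \<Longrightarrow> 100 * r\<^sup>2 < \<rho> b ^ 3"
proof -
  define m where "m = Min ((\<lambda>b. \<rho> b ^ 3) ` qd_zeros A \<phi>)"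
  have fin: "finite ((\<lambda>b. \<rho> b ^ 3) ` qd_zeros A \<phi>)" using finite_zeros by (rule finite_imageI)
  have "m \<in> (\<lambda>b. \<rho> b ^ 3) ` qd_zeros A \<phi>" unfolding m_def
    by (rule Min_in[OF fin]) (simp only: image_is_empty zeros_nonempty not_False_eq_True)
  then have m: "m > 0" using zchart(2) by auto
  \<comment> \<open>With r \<le> 1 and r \<le> m / 200 one gets 100 r^2 \<le> 100 r < m.\<close>
  define r where "r = min 1 (m / 200)"
  have r: "0 < r" "r \<le> 1" "r \<le> m / 200" using m by (auto simp: r_def)
  have "r\<^sup>2 \<le> r" using r by (simp add: power2_eq_square mult_left_le)
  then have "100 * r\<^sup>2 < m" using r m by linarith
  moreover have "m \<le> \<rho> b ^ 3" if "b \<in> qd_zeros A \<phi>" for b unfolding m_def by (rule Min_le[OF fin imageI[OF that]])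
  ultimately show ?thesis using that[OF r(1,2)] by fastforce
qed

lemma zero_ball:
  assumes b: "b \<in> qd_zeros A \<phi>" and d: "d > 0"
  shows "open (\<xi> b ` {w \<in> ball 0 (\<rho> b). 4/9 * cmod w ^ 3 < d})" "b \<in> \<xi> b ` {w \<in> ball 0 (\<rho> b). 4/9 * cmod w ^ 3 < d}"
proof -
  have "open {w::complex. 4/9 * cmod w ^ 3 < d}" by (intro open_Collect_less continuous_intros)
  then have "open (ball 0 (\<rho> b) \<inter> {w::complex. 4/9 * cmod w ^ 3 < d})" by (intro open_Int open_ball)
  moreover have "ball 0 (\<rho> b) \<inter> {w::complex. 4/9 * cmod w ^ 3 < d} = {w \<in> ball 0 (\<rho> b). 4/9 * cmod w ^ 3 < d}" by blast
  ultimately show "open (\<xi> b ` {w \<in> ball 0 (\<rho> b). 4/9 * cmod w ^ 3 < d})"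
    using cmap_open_image[OF zchart(1)[OF b], of "{w \<in> ball 0 (\<rho> b). 4/9 * cmod w ^ 3 < d}"] by auto
  show "b \<in> \<xi> b ` {w \<in> ball 0 (\<rho> b). 4/9 * cmod w ^ 3 < d}" using zchart(2,3)[OF b] d by (intro image_eqI[of _ _ 0]) simp_all
qed

end

lemma dist_Complex_0: "dist (Complex 0 t) (Complex 0 c) = dist t c" "dist (Complex 0 c) (Complex 0 t) = dist t c"
    "cmod (Complex 0 t - Complex 0 c) = dist t c"
  by (simp_all add: dist_norm cmod_def dist_real_def abs_minus_commute)

section \<open>Corners, closures and heights of maximal strips\<close>

context exact_surface
begin

text \<open>The vertical approach of \<open>ends_at\<close> provides the segment for
  \<open>corner\<close>, with Q the part of the band within r of the corner.\<close>

lemma maxstrip_corner: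
  assumes m: "maxstrip J \<psi>" and c: "edge J c" and b: "b \<in> qd_zeros A \<phi>" "ends_at \<psi> J c b" and r: "r > 0" "9 * r\<^sup>2 < 4 * \<rho> b ^ 3"
    and z: "z \<in> band J" "dist z (Complex 0 c) < r"
  shows "\<psi> z \<in> cim (zchart b)" "zdisp b \<psi> z = z - Complex 0 c"
    "4/9 * (cmod (cinv (zchart b) (\<psi> z))) ^ 3 = (dist z (Complex 0 c))\<^sup>2"
proof -
  note d = maxstripD[OF m]
  let ?c = "Complex 0 c"
  let ?Q = "band J \<inter> ball ?c r"
  obtain t where t: "t \<in> J" "dist t c < r" using c r(1) unfolding edge_def by blast
  define v where "v = Complex 0 (t - c)"
  have pt: "?c + of_real s * v = Complex 0 (c + s * (t - c))" for s by (simp add: v_def complex_eq_iff)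
  have cQ: "convex ?Q" by (intro convex_Int convex_band[OF d(2)] convex_ball)
  have fQ: "flatmap ?Q \<psi>" by (rule flatmap_subset[OF d(5)]) (use open_band[OF d(1)] in blast)+
  have ds: "dist (c + s * (t - c)) c = \<bar>s\<bar> * dist t c" for s by (simp add: dist_real_def abs_mult)
  have inQ: "?c + of_real s * v \<in> ?Q" if "0 < s" "s \<le> 1" for s
  proof -
    have "\<bar>s\<bar> * dist t c \<le> 1 * dist t c" using that by (intro mult_right_mono) auto
    then have "dist (c + s * (t - c)) c < r" using t(2) unfolding ds by linarith
    then show ?thesis unfolding pt using edge_segment[OF d(2,1) c t(1) that] dist_Complex_0 by (simp add: band_def)
  qed
  have lim: "((\<lambda>s. \<psi> (?c + of_real s * v)) \<longlongrightarrow> b) (at_right 0)"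
  proof (rule topological_tendstoI)
    fix S assume "open S" "b \<in> S"
    then obtain e where e: "e > 0" "\<forall>t\<in>J. dist t c < e \<longrightarrow> \<psi> (Complex 0 t) \<in> S" using b(2) unfolding ends_at_def by blast
    define s0 where "s0 = min 1 (e / r)"
    have s0: "s0 > 0" using e r by (simp add: s0_def)
    have "\<psi> (?c + of_real s * v) \<in> S" if s: "0 < s" "s < s0" for s
    proof -
      have "s * r < e" "s \<le> 1" using s r(1) by (auto simp: s0_def pos_less_divide_eq)
      moreover have "s * dist t c \<le> s * r" by (rule mult_left_mono) (use t(2) s in linarith)+
      ultimately have "dist (c + s * (t - c)) c < e" unfolding ds abs_of_pos[OF s(1)] by linarith
      then show ?thesis unfolding pt using e(2) edge_segment[OF d(2,1) c t(1) s(1) \<open>s \<le> 1\<close>] by blast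
    qed
    then show "eventually (\<lambda>s. \<psi> (?c + of_real s * v) \<in> S) (at_right 0)"
      unfolding eventually_at_right[OF s0] using s0 by (intro exI[of _ s0]) simp
  qed
  have zQ: "z \<in> ?Q" using z by (simp add: dist_commute)
  note co = corner[OF b(1) fQ cQ Int_lower2 r(2) inQ lim zQ]
  show "\<psi> z \<in> cim (zchart b)" by (rule co(1))
  show "zdisp b \<psi> z = z - ?c" by (rule co(2))
  show "4/9 * (cmod (cinv (zchart b) (\<psi> z))) ^ 3 = (dist z ?c)\<^sup>2" using co(3) by (simp add: dist_norm)
qed

text \<open>The strip alone gives no boundary values on its edges. Its right part belongs to a
  developed half plane Re z > 0, which extends across the edges to the right of their zeroes; the
  distance formula at a corner is transported into the half plane from a point common to
  both.\<close>

lemma right_extension: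
  assumes m: "maxstrip J \<psi>"
  obtains \<Psi> where "flatmap {z. Re z > 0} \<Psi>" "\<forall>z\<in>band J. Re z > 0 \<longrightarrow> \<Psi> z = \<psi> z"
    "\<forall>c b r z. edge J c \<longrightarrow> b \<in> qd_zeros A \<phi> \<longrightarrow> ends_at \<psi> J c b \<longrightarrow> r > 0 \<longrightarrow> 9 * r\<^sup>2 < 4 * \<rho> b ^ 3 \<longrightarrow> Re z > 0 \<longrightarrow> dist z (Complex 0 c) < r \<longrightarrow>
       \<Psi> z \<in> cim (zchart b) \<and> 4/9 * (cmod (cinv (zchart b) (\<Psi> z))) ^ 3 = (dist z (Complex 0 c))\<^sup>2"
proof -
  note d = maxstripD[OF m]
  obtain t0 where t0: "t0 \<in> J" using d(3) by blast
  let ?p = "Complex 1 t0"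
  have p: "?p \<in> band J" using t0 by (simp add: band_def)
  let ?y = "lift \<psi> ?p"
  have y: "0 \<in> devdom ?y" "f ?y = 1"
    using dev_exists[OF lift_in_spectral_curve[OF d(5) p]] flatmap_C_circ[OF d(5) p] d(6)[OF p] by simp_all
  define \<Psi> where "\<Psi> = (\<lambda>z. Exp ?y (1 * z + - ?p))"
  have oR: "open {z. Re z > 0}" by (rule open_halfspace_Re_gt)
  have dom: "1 * z + - ?p \<in> devdom ?y" if "Re z > 0" for z
    by (rule devdom_half_plane[OF y(1)]) (use y(2) that in simp_all)
  have fl: "flatmap {z. Re z > 0} \<Psi>" unfolding \<Psi>_def
    by (rule flatmap_subset[OF flatmap_affine(1)[OF flatmap_Exp] oR]) (use dom in auto)
  have lp: "lift \<Psi> ?p = ?y"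
    using lift_affine[OF flatmap_Exp, of 1 ?p "- ?p" ?y] y(1) lift_Exp_0[OF y(1)] by (simp add: \<Psi>_def)
  have ag: "\<Psi> z = \<psi> z" if "z \<in> band J" "Re z > 0" for z
  proof (rule flatmap_unique(1)[of "band J \<inter> {z. Re z > 0}" \<Psi> \<psi> ?p])
    have o: "open (band J \<inter> {z. Re z > 0})" using open_band[OF d(1)] oR by (rule open_Int)
    show "flatmap (band J \<inter> {z. Re z > 0}) \<Psi>" by (rule flatmap_subset[OF fl o]) blast
    show "flatmap (band J \<inter> {z. Re z > 0}) \<psi>" by (rule flatmap_subset[OF d(5) o]) blast
    show "connected (band J \<inter> {z. Re z > 0})" by (intro convex_connected convex_Int convex_band[OF d(2)] convex_halfspace_Re_gt)
  qed (use p lp that in simp_all)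
  have "\<Psi> z \<in> cim (zchart b) \<and> 4/9 * (cmod (cinv (zchart b) (\<Psi> z))) ^ 3 = (dist z (Complex 0 c))\<^sup>2"
    if c: "edge J c" and b: "b \<in> qd_zeros A \<phi>" "ends_at \<psi> J c b" and r: "r > 0" "9 * r\<^sup>2 < 4 * \<rho> b ^ 3" and z: "Re z > 0" "dist z (Complex 0 c) < r"
    for c b r z
  proof -
    let ?c = "Complex 0 c"
    have "\<exists>u\<in>J. dist u c < r/2" using c half_gt_zero[OF r(1)] unfolding edge_def by blast
    then obtain u where u: "u \<in> J" "dist u c < r/2" by blast
    let ?z0 = "Complex (r/4) u"
    have dz: "dist ?z0 ?c < r"
    proof -
      have "dist ?z0 ?c \<le> \<bar>r/4\<bar> + \<bar>u - c\<bar>" using cmod_le[of "?z0 - ?c"] by (simp add: dist_norm)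
      then show ?thesis using u(2) r(1) by (simp add: dist_real_def)
    qed
    have z0: "?z0 \<in> band J" "Re ?z0 > 0" using u r by (simp_all add: band_def)
    note co = maxstrip_corner[OF m c b r z0(1) dz]
    let ?Q = "{z. Re z > 0} \<inter> ball ?c r"
    have fQ: "flatmap ?Q \<Psi>" by (rule flatmap_subset[OF fl]) (use oR in blast)+
    have cQ: "connected ?Q" by (intro convex_connected convex_Int convex_halfspace_Re_gt convex_ball)
    have ev: "eventually (\<lambda>w. w \<in> band J \<inter> {z. Re z > 0}) (nhds ?z0)"
      by (rule eventually_nhds_in_open[OF open_Int[OF open_band[OF d(1)] oR]]) (use z0 in simp)
    have "deriv (cinv (zchart b) \<circ> \<Psi>) ?z0 = deriv (cinv (zchart b) \<circ> \<psi>) ?z0"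
      by (rule deriv_cong_ev[OF eventually_mono[OF ev]]) (use ag in simp_all)
    then have zd: "zdisp b \<Psi> ?z0 = ?z0 - ?c" using co(2) ag[OF z0] by (simp add: zdisp_def)
    have z0Q: "?z0 \<in> ?Q" "z \<in> ?Q" using z0(2) dz z by (simp_all add: dist_commute)
    have k0: "\<Psi> ?z0 \<in> cim (zchart b)" using co(1) ag[OF z0] by simp
    note ex = zero_chart_extend'[OF b(1) fQ cQ Int_lower2 r(2) z0Q(1) k0 zd z0Q(2)]
    show ?thesis using ex(1,3) by (simp add: dist_norm)
  qed
  then show ?thesis using that[OF fl] ag by blast
qed

text \<open>The extension is \<psi> on the band, a developed half plane on either side of Re = 0,
  and the zero at each corner. Continuity at a corner follows from the distance formula, which holds
  on all three open pieces. The half planes consist of regular points, so an edge carries no further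
  zero.\<close>

lemma maxstrip_closure:
  assumes m: "maxstrip J \<psi>"
  obtains \<Psi> where "continuous_on (closure (band J)) \<Psi>" "\<forall>z\<in>band J. \<Psi> z = \<psi> z"
    "\<And>c. edge J c \<Longrightarrow> {z. Im z = c \<and> \<Psi> z \<in> qd_zeros A \<phi>} = {Complex 0 c}"
proof -
  note d = maxstripD[OF m]
  obtain \<Psi>r where r: "flatmap {z. Re z > 0} \<Psi>r" "\<forall>z\<in>band J. Re z > 0 \<longrightarrow> \<Psi>r z = \<psi> z"
    "\<forall>c b r z. edge J c \<longrightarrow> b \<in> qd_zeros A \<phi> \<longrightarrow> ends_at \<psi> J c b \<longrightarrow> r > 0 \<longrightarrow> 9 * r\<^sup>2 < 4 * \<rho> b ^ 3 \<longrightarrow> Re z > 0 \<longrightarrow> dist z (Complex 0 c) < r \<longrightarrow>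
       \<Psi>r z \<in> cim (zchart b) \<and> 4/9 * (cmod (cinv (zchart b) (\<Psi>r z))) ^ 3 = (dist z (Complex 0 c))\<^sup>2"
    by (rule right_extension[OF m])
  \<comment> \<open>The left side is the right side of the strip after a half turn.\<close>
  let ?J = "{t. (-1) * t + 0 \<in> J}" and ?\<psi> = "\<lambda>z. \<psi> (of_real (-1) * z + \<i> * of_real 0)"
  have m2: "maxstrip ?J ?\<psi>" by (rule maxstrip_affine(1)[OF m]) simp
  obtain \<Psi>l where l: "flatmap {z. Re z > 0} \<Psi>l" "\<forall>z\<in>band ?J. Re z > 0 \<longrightarrow> \<Psi>l z = ?\<psi> z"
    "\<forall>c b r z. edge ?J c \<longrightarrow> b \<in> qd_zeros A \<phi> \<longrightarrow> ends_at ?\<psi> ?J c b \<longrightarrow> r > 0 \<longrightarrow> 9 * r\<^sup>2 < 4 * \<rho> b ^ 3 \<longrightarrow> Re z > 0 \<longrightarrow> dist z (Complex 0 c) < r \<longrightarrow>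
       \<Psi>l z \<in> cim (zchart b) \<and> 4/9 * (cmod (cinv (zchart b) (\<Psi>l z))) ^ 3 = (dist z (Complex 0 c))\<^sup>2"
    by (rule right_extension[OF m2])
  define B where "B c = (SOME b. b \<in> qd_zeros A \<phi> \<and> ends_at \<psi> J c b)" for c
  have B: "B c \<in> qd_zeros A \<phi>" "ends_at \<psi> J c (B c)" if "edge J c" for c
  proof -
    have "\<exists>b. b \<in> qd_zeros A \<phi> \<and> ends_at \<psi> J c b" using d(7)[OF that] by blast
    from someI_ex[OF this] show "B c \<in> qd_zeros A \<phi>" "ends_at \<psi> J c (B c)" unfolding B_def by blast+
  qed
  have flip: "edge ?J (- c)" "ends_at ?\<psi> ?J (- c) b" if cc: "edge J c" "ends_at \<psi> J c b" for c b
  proof -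
    have dc: "dist (- t) (- c) = dist t c" for t c :: real by (simp add: dist_real_def)
    show "edge ?J (- c)"
      unfolding edge_def
    proof (intro conjI allI impI)
      show "- c \<notin> ?J" using cc(1) by (simp add: edge_def)
      fix e :: real assume "e > 0"
      then have "\<exists>t\<in>J. dist t c < e" using cc(1) unfolding edge_def by blast
      then obtain t where "t \<in> J" "dist t c < e" by blast
      then show "\<exists>t\<in>?J. dist t (- c) < e" using dc[of t c] by (intro bexI[of _ "- t"]) auto
    qed
    show "ends_at ?\<psi> ?J (- c) b"
      unfolding ends_at_def
    proof (intro allI impI)
      fix S assume "open S \<and> b \<in> S"
      then obtain e where e: "e > 0" "\<forall>t\<in>J. dist t c < e \<longrightarrow> \<psi> (Complex 0 t) \<in> S" using cc(2) unfolding ends_at_def by blast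
      have "?\<psi> (Complex 0 t) \<in> S" if tt: "t \<in> ?J" "dist t (- c) < e" for t
      proof -
        have "- t \<in> J" "dist (- t) c < e" using tt dc[of "- t" c] by simp_all
        then have "\<psi> (Complex 0 (- t)) \<in> S" using e(2) by blast
        moreover have "of_real (-1) * Complex 0 t + \<i> * of_real 0 = Complex 0 (- t)" by (simp add: complex_eq_iff)
        ultimately show ?thesis by simp
      qed
      then show "\<exists>e>0. \<forall>t\<in>?J. dist t (- c) < e \<longrightarrow> ?\<psi> (Complex 0 t) \<in> S" using e(1) by blast
    qed
  qed
  define \<Psi> where "\<Psi> z = (if z \<in> band J then \<psi> z else if Re z > 0 then \<Psi>r z else if Re z < 0 then \<Psi>l (- z) else B (Im z))" for z
  have \<Psi>r: "\<Psi> z = \<Psi>r z" if "Re z > 0" for z using that r(2) by (simp add: \<Psi>_def)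
  have \<Psi>l: "\<Psi> z = \<Psi>l (- z)" if "Re z < 0" for z
  proof (cases "z \<in> band J")
    case True
    then have "- z \<in> band ?J" by (simp add: band_def)
    then have "\<Psi>l (- z) = ?\<psi> (- z)" using l(2) that by simp
    then show ?thesis using True by (simp add: \<Psi>_def)
  qed (use that in \<open>simp add: \<Psi>_def\<close>)
  have cl: "edge J (Im z)" if "z \<in> closure (band J)" "z \<notin> band J" for z
  proof -
    have "closed (band (closure J))"
      using continuous_closed_preimage[of UNIV Im "closure J"] by (simp add: band_def vimage_def continuous_intros)
    then have "closure (band J) \<subseteq> band (closure J)" using closure_subset[of J] by (intro closure_minimal) (auto simp: band_def)
    then have "Im z \<in> closure J" "Im z \<notin> J" using that unfolding band_def by blast+
    then show ?thesis unfolding edge_def closure_approachable by blast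
  qed
  obtain rr where rr: "rr > 0" "rr \<le> 1" "\<And>b. b \<in> qd_zeros A \<phi> \<Longrightarrow> 100 * rr\<^sup>2 < \<rho> b ^ 3"
    by (rule small_radius) blast
  have rr9: "9 * rr\<^sup>2 < 4 * \<rho> b ^ 3" if "b \<in> qd_zeros A \<phi>" for b
    using rr(3)[OF that] zero_le_power2[of rr] by linarith
  have cont: "continuous_on (closure (band J)) \<Psi>"
    unfolding continuous_on_topological
  proof (intro ballI allI impI)
    fix z S assume z: "z \<in> closure (band J)" and S: "open S" "\<Psi> z \<in> S"
    consider "z \<in> band J" | "z \<notin> band J" "Re z > 0" | "z \<notin> band J" "Re z < 0" | "z \<notin> band J" "Re z = 0" by linarith
    then show "\<exists>A. open A \<and> z \<in> A \<and> (\<forall>y\<in>closure (band J). y \<in> A \<longrightarrow> \<Psi> y \<in> S)"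
    proof cases
      case 1
      then show ?thesis using flatmap_preimage_open[OF d(5) S(1)] S(2)
        by (intro exI[of _ "{z \<in> band J. \<psi> z \<in> S}"]) (simp add: \<Psi>_def)
    next
      case 2
      then show ?thesis using flatmap_preimage_open[OF r(1) S(1)] S(2) \<Psi>r
        by (intro exI[of _ "{z \<in> {z. Re z > 0}. \<Psi>r z \<in> S}"]) simp
    next
      case 3
      have "open {z. (-1) * z + 0 \<in> {z \<in> {z. Re z > 0}. \<Psi>l z \<in> S}}"
        by (rule open_affine_preimage[OF flatmap_preimage_open[OF l(1) S(1)]])
      then show ?thesis using S(2) \<Psi>l 3
        by (intro exI[of _ "{z. (-1) * z + 0 \<in> {z \<in> {z. Re z > 0}. \<Psi>l z \<in> S}}"]) simp
    next
      case 4
      define c where "c = Im z"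
      have c: "edge J c" using cl[OF z 4(1)] by (simp add: c_def)
      have zc: "z = Complex 0 c" using 4(2) by (simp add: c_def complex_eq_iff)
      let ?b = "B c"
      note b = B[OF c]
      have "?b \<in> S" using S(2) 4 by (simp add: \<Psi>_def c_def)
      then obtain e where e: "e > 0" "\<And>x d. x \<in> cim (zchart ?b) \<Longrightarrow> 4/9 * (cmod (cinv (zchart ?b) x)) ^ 3 = d\<^sup>2 \<Longrightarrow> \<bar>d\<bar> < e \<Longrightarrow> x \<in> S"
        using zero_near_distance[OF b(1) S(1)] by blast
      obtain t where t: "t \<in> J" using d(3) by blast
      have tc: "\<bar>t - c\<bar> > 0" using t c by (auto simp: edge_def)
      \<comment> \<open>The bound |t - c| excludes a second edge from the disc, by
        \<open>edge_isolated\<close>.\<close>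
      define q where "q = min (min e rr) \<bar>t - c\<bar>"
      have q: "q > 0" "q \<le> e" "q \<le> rr" "q \<le> \<bar>t - c\<bar>" using e(1) rr(1) tc by (auto simp: q_def)
      have "\<Psi> y \<in> S" if y: "y \<in> closure (band J)" "y \<in> ball z q" for y
      proof -
        have dy: "dist y (Complex 0 c) < q" using y(2) zc by (simp add: dist_commute)
        then have dr: "dist y (Complex 0 c) < rr" and de: "\<bar>dist y (Complex 0 c)\<bar> < e" using q by auto
        consider "y \<in> band J" | "y \<notin> band J" "Re y > 0" | "y \<notin> band J" "Re y < 0" | "y \<notin> band J" "Re y = 0" by linarith
        then show ?thesis
        proof cases
          case 1
          note co = maxstrip_corner[OF m c b rr(1) rr9[OF b(1)] 1 dr]
          show ?thesis using e(2)[OF co(1,3) de] 1 by (simp add: \<Psi>_def)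
        next
          case 2
          have "\<Psi>r y \<in> cim (zchart ?b) \<and> 4/9 * (cmod (cinv (zchart ?b) (\<Psi>r y))) ^ 3 = (dist y (Complex 0 c))\<^sup>2"
            using r(3)[rule_format, OF c b rr(1) rr9[OF b(1)] 2(2) dr] .
          then show ?thesis using e(2)[OF _ _ de] \<Psi>r[OF 2(2)] by simp
        next
          case 3
          have "- Complex 0 c = Complex 0 (- c)" by (simp add: complex_eq_iff)
          then have eqd: "dist (- y) (Complex 0 (- c)) = dist y (Complex 0 c)" by (metis dist_minus)
          have "\<Psi>l (- y) \<in> cim (zchart ?b) \<and> 4/9 * (cmod (cinv (zchart ?b) (\<Psi>l (- y)))) ^ 3 = (dist (- y) (Complex 0 (- c)))\<^sup>2"
            by (rule l(3)[rule_format, OF flip(1)[OF c b(2)] b(1) flip(2)[OF c b(2)] rr(1) rr9[OF b(1)]]) (use 3(2) dr eqd in simp_all)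
          then show ?thesis using e(2)[OF _ _ de] \<Psi>l[OF 3(2)] eqd by simp
        next
          case 4
          have "edge J (Im y)" using cl[OF y(1) 4(1)] .
          moreover have "\<bar>Im y - c\<bar> \<le> dist y (Complex 0 c)" using abs_Im_le_cmod[of "y - Complex 0 c"] by (simp add: dist_norm)
          ultimately have "Im y = c" using edge_isolated[OF d(2,1) c t, of "Im y"] dy q(4) by simp
          then show ?thesis using 4 \<open>?b \<in> S\<close> by (simp add: \<Psi>_def)
        qed
      qed
      then show ?thesis using q(1) by (intro exI[of _ "ball z q"]) simp
    qed
  qed
  have "{z. Im z = c \<and> \<Psi> z \<in> qd_zeros A \<phi>} = {Complex 0 c}" if c: "edge J c" for c
  proof (intro equalityI subsetI)
    fix z assume "z \<in> {z. Im z = c \<and> \<Psi> z \<in> qd_zeros A \<phi>}"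
    then have z: "Im z = c" "\<Psi> z \<in> qd_zeros A \<phi>" by auto
    then have nc: "\<Psi> z \<notin> C_circ A \<phi>" using zeros_C_circ_disjoint by blast
    have "\<not> Re z > 0" using flatmap_C_circ[OF r(1), of z] \<Psi>r[of z] nc by auto
    moreover have "\<not> Re z < 0" using flatmap_C_circ[OF l(1), of "- z"] \<Psi>l[of z] nc by auto
    ultimately show "z \<in> {Complex 0 c}" using z(1) by (simp add: complex_eq_iff)
  next
    fix z assume "z \<in> {Complex 0 c}"
    then show "z \<in> {z. Im z = c \<and> \<Psi> z \<in> qd_zeros A \<phi>}" using B(1)[OF c] c by (simp add: \<Psi>_def band_def edge_def)
  qed
  then show ?thesis using that[OF cont] by (simp add: \<Psi>_def)
qed

text \<open>In a strip lower than r the chart of the upper zero q covers the whole segment Re = 0.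
  Points near the lower zero p then lie in both charts, so p = q; but they are within (b - a) / 2 of
  p and at distance at least 3/4 (b - a) from q.\<close>

lemma maxstrip_height:
  assumes m: "maxstrip {a<..<b} \<psi>" and ab: "a < b" and r: "r > 0" "\<And>b. b \<in> qd_zeros A \<phi> \<Longrightarrow> 9 * r\<^sup>2 < 4 * \<rho> b ^ 3"
  shows "b - a \<ge> r"
proof (rule ccontr)
  assume n: "\<not> b - a \<ge> r"
  note d = maxstripD[OF m]
  have ea: "edge {a<..<b} a" "edge {a<..<b} b" using edge_greaterThanLessThan[OF ab] by auto
  obtain p where p: "p \<in> qd_zeros A \<phi>" "ends_at \<psi> {a<..<b} a p" using d(7)[OF ea(1)] by blast
  obtain q where q: "q \<in> qd_zeros A \<phi>" "ends_at \<psi> {a<..<b} b q" using d(7)[OF ea(2)] by blast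
  have co: "\<psi> (Complex 0 t) \<in> cim (zchart q) \<and> 4/9 * (cmod (cinv (zchart q) (\<psi> (Complex 0 t)))) ^ 3 = (b - t)\<^sup>2" if t: "t \<in> {a<..<b}" for t
  proof -
    have z: "Complex 0 t \<in> band {a<..<b}" "dist (Complex 0 t) (Complex 0 b) < r"
      using t n dist_Complex_0(1)[of t b] by (simp_all add: band_def dist_real_def)
    show ?thesis using maxstrip_corner(1,3)[OF m ea(2) q r(1) r(2)[OF q(1)] z] dist_Complex_0(1)[of t b]
      by (simp add: dist_real_def power2_commute)
  qed
  define S where "S = \<xi> p ` {w \<in> ball 0 (\<rho> p). 4/9 * cmod w ^ 3 < ((b - a) / 2)\<^sup>2}"
  have "open S" "p \<in> S" unfolding S_def using zero_ball[OF p(1), of "((b - a) / 2)\<^sup>2"] ab by simp_all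
  then obtain e where e: "e > 0" "\<forall>t\<in>{a<..<b}. dist t a < e \<longrightarrow> \<psi> (Complex 0 t) \<in> S" using p(2) unfolding ends_at_def by blast
  define t where "t = a + min (e/2) ((b - a) / 4)"
  have t: "t \<in> {a<..<b}" "dist t a < e" "t \<le> a + (b - a) / 4" using ab e(1) by (auto simp: t_def dist_real_def min_def field_simps)
  have "\<psi> (Complex 0 t) \<in> S" using e(2) t by blast
  then obtain w where w: "w \<in> ball 0 (\<rho> p)" "4/9 * cmod w ^ 3 < ((b - a) / 2)\<^sup>2" "\<psi> (Complex 0 t) = \<xi> p w" by (auto simp: S_def)
  have "\<psi> (Complex 0 t) \<in> cim (zchart p)" using w by simp
  then have pq: "p = q" using co[OF t(1)] zchart_disjoint[OF p(1) q(1)] by blast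
  have "cinv (zchart q) (\<psi> (Complex 0 t)) = w" using cinv_cmap[OF zchart(1)[OF p(1)], of w] w pq by simp
  then have "(b - t)\<^sup>2 < ((b - a) / 2)\<^sup>2" using co[OF t(1)] w(2) by simp
  moreover have "((b - a) / 2)\<^sup>2 \<le> (b - t)\<^sup>2" using t(3) ab by (intro power_mono) (auto simp: field_simps)
  ultimately show False by linarith
qed

lemma open_strip_band: "open_strip a b = band {a<..<b}" and upper_half_plane_band: "upper_half_plane = band {0<..}"
  by (auto simp: open_strip_def upper_half_plane_def band_def)

lemma maxstrip_strip_coordinate:
  assumes m: "maxstrip {a<..<b} \<psi>" and ab: "a < b"
  shows "strip_coordinate A \<phi> a b \<psi>"
proof -
  obtain \<Psi> where \<Psi>: "continuous_on (closure (band {a<..<b})) \<Psi>" "\<forall>z\<in>band {a<..<b}. \<Psi> z = \<psi> z"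
    "\<And>c. edge {a<..<b} c \<Longrightarrow> {z. Im z = c \<and> \<Psi> z \<in> qd_zeros A \<phi>} = {Complex 0 c}" using maxstrip_closure[OF m] by blast
  have e: "edge {a<..<b} a" "edge {a<..<b} b" using edge_greaterThanLessThan[OF ab] by auto
  show ?thesis
    unfolding strip_coordinate_def open_strip_band
    using ab maxstrip_flat_coordinate[OF m] maxstrip_component[OF m] \<Psi>(1,2) \<Psi>(3)[OF e(1)] \<Psi>(3)[OF e(2)]
    by (intro conjI exI[of _ \<Psi>])
qed

lemma maxstrip_half_plane_coordinate:
  assumes m: "maxstrip {0<..} \<psi>"
  shows "half_plane_coordinate A \<phi> \<psi>"
proof -
  obtain \<Psi> where \<Psi>: "continuous_on (closure (band {0<..})) \<Psi>" "\<forall>z\<in>band {0<..}. \<Psi> z = \<psi> z"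
    "\<And>c. edge {0<..} c \<Longrightarrow> {z. Im z = c \<and> \<Psi> z \<in> qd_zeros A \<phi>} = {Complex 0 c}" using maxstrip_closure[OF m] by blast
  have "Complex 0 0 = 0" by (simp add: complex_eq_iff)
  then have "{z. Im z = 0 \<and> \<Psi> z \<in> qd_zeros A \<phi>} = {0}" using \<Psi>(3)[of 0] by (simp add: edge_greaterThan)
  then show ?thesis
    unfolding half_plane_coordinate_def upper_half_plane_band
    using maxstrip_flat_coordinate[OF m] maxstrip_component[OF m] \<Psi>(1,2)
    by (intro conjI exI[of _ \<Psi>])
qed

section \<open>From normalized coordinates back to maximal strips\<close>

lemma flat_coordinate_flatmap:
  assumes k: "(U, \<psi>) \<in> flat_coordinates A \<phi>"
  shows "flatmap U \<psi>"
proof (rule flatmapI)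
  have kA: "(U, \<psi>) \<in> A" using k by (rule flat_coordinates_atlas)
  show o: "open U" using open_cdom[OF kA] by simp
  show "continuous_on U \<psi>" using cmap_continuous[OF kA] by simp
  fix z assume z: "z \<in> U"
  have id: "(cinv (U, \<psi>) \<circ> \<psi>) w = w" if "w \<in> U" for w using cinv_cmap[OF kA, of w] that by simp
  have "((\<lambda>w. w) has_field_derivative 1) (at z)" by simp
  then have "((cinv (U, \<psi>) \<circ> \<psi>) has_field_derivative 1) (at z)"
    by (rule has_field_derivative_transform_within_open[OF _ o z]) (simp only: id)
  moreover have "\<phi> (U, \<psi>) (cinv (U, \<psi>) (\<psi> z)) * 1\<^sup>2 = 1" using id[OF z] k z by (simp add: flat_coordinates_def)
  ultimately show "\<exists>k\<in>A. \<psi> z \<in> cim k \<and> (\<exists>d. ((cinv k \<circ> \<psi>) has_field_derivative d) (at z) \<and> \<phi> k (cinv k (\<psi> z)) * d\<^sup>2 = 1)"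
    using z by (intro bexI[OF _ kA] conjI exI[of _ 1]) auto
qed

text \<open>On the band f and Re differ by a constant C. The interval J, not being closed, has an
  edge; on the approach to it Re = 0 while f tends to 0, hence C = 0.\<close>

lemma coordinate_maxstrip:
  assumes k: "(band J, \<psi>) \<in> flat_coordinates A \<phi>" and J: "open J" "is_interval J" "J \<noteq> {}" "J \<noteq> UNIV"
    and \<Psi>: "continuous_on (closure (band J)) \<Psi>" "\<forall>z\<in>band J. \<Psi> z = \<psi> z"
    and z: "\<And>c. edge J c \<Longrightarrow> \<Psi> (Complex 0 c) \<in> qd_zeros A \<phi>"
  shows "maxstrip J \<psi>"
proof -
  have fl: "flatmap (band J) \<psi>" using k by (rule flat_coordinate_flatmap)
  have ends: "ends_at \<psi> J c (\<Psi> (Complex 0 c))" if c: "edge J c" for c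
    unfolding ends_at_def
  proof (intro allI impI)
    fix S assume S: "open S \<and> \<Psi> (Complex 0 c) \<in> S"
    have "Complex 0 c \<in> closure (band J)"
      unfolding closure_approachable
    proof (intro allI impI)
      fix e :: real assume "e > 0"
      then obtain t where "t \<in> J" "dist t c < e" using c unfolding edge_def by blast
      then show "\<exists>y\<in>band J. dist y (Complex 0 c) < e"
        using dist_Complex_0(1)[of t c] by (intro bexI[of _ "Complex 0 t"]) (simp_all add: band_def)
    qed
    then obtain W where W: "open W" "Complex 0 c \<in> W" "\<forall>y\<in>closure (band J). y \<in> W \<longrightarrow> \<Psi> y \<in> S"
      using \<Psi>(1) S unfolding continuous_on_topological by blast
    obtain e where e: "e > 0" "ball (Complex 0 c) e \<subseteq> W" using openE[OF W(1,2)] .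
    have "\<psi> (Complex 0 t) \<in> S" if t: "t \<in> J" "dist t c < e" for t
    proof -
      have "Complex 0 t \<in> band J" using t by (simp add: band_def)
      moreover have "Complex 0 t \<in> W" using e(2) t(2) dist_Complex_0(2)[of c t] by (auto simp: subset_iff)
      ultimately show ?thesis using W(3) \<Psi>(2) closure_subset[of "band J"] by fastforce
    qed
    then show "\<exists>e>0. \<forall>t\<in>J. dist t c < e \<longrightarrow> \<psi> (Complex 0 t) \<in> S" using e(1) by blast
  qed
  obtain t0 where t0: "t0 \<in> J" using J(3) by blast
  have "\<exists>c. edge J c"
  proof (rule ccontr)
    assume n: "\<not> (\<exists>c. edge J c)"
    have "closure J \<subseteq> J"
    proof
      fix x assume "x \<in> closure J"
      then have "\<forall>e>0. \<exists>t\<in>J. dist t x < e" unfolding closure_approachable .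
      then show "x \<in> J" using n unfolding edge_def by blast
    qed
    then have "closed J" using closure_subset[of J] by (metis closed_closure equalityI)
    then show False using J clopen[of J] by blast
  qed
  then obtain c where c: "edge J c" by blast
  have p: "Complex 0 t0 \<in> band J" using t0 by (simp add: band_def)
  define C where "C = f (lift \<psi> (Complex 0 t0))"
  have fC: "f (lift \<psi> z) = Re z + C" if "z \<in> band J" for z
    using f_lift[OF fl convex_band[OF J(2)] p that] by (simp add: C_def)
  have "\<bar>C\<bar> \<le> 0"
  proof (rule ccontr)
    assume nC: "\<not> \<bar>C\<bar> \<le> 0"
    then have C0: "\<bar>C\<bar> > 0" by simp
    obtain S where S: "open S" "\<Psi> (Complex 0 c) \<in> S" "\<And>y. y \<in> spectral_curve A \<phi> \<Longrightarrow> fst y \<in> S \<Longrightarrow> \<bar>f y\<bar> < \<bar>C\<bar>"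
      by (rule f_near_zero_point[OF z[OF c] C0]) blast
    then obtain e where e: "e > 0" "\<forall>t\<in>J. dist t c < e \<longrightarrow> \<psi> (Complex 0 t) \<in> S" using ends[OF c] unfolding ends_at_def by blast
    then obtain t where t: "t \<in> J" "dist t c < e" using c unfolding edge_def by blast
    have tb: "Complex 0 t \<in> band J" using t by (simp add: band_def)
    have "\<bar>f (lift \<psi> (Complex 0 t))\<bar> < \<bar>C\<bar>"
      by (rule S(3)[OF lift_in_spectral_curve[OF fl tb]]) (use e(2) t in simp)
    then show False using fC[OF tb] by simp
  qed
  then show ?thesis using J fl fC ends z unfolding maxstrip_def by auto
qed

lemma strip_coordinate_maxstrip:
  assumes "strip_coordinate A \<phi> a b \<psi>"
  shows "a < b" "maxstrip {a<..<b} \<psi>"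
proof -
  show ab: "a < b" using assms by (simp add: strip_coordinate_def)
  obtain \<Psi> where \<Psi>: "continuous_on (closure (band {a<..<b})) \<Psi>" "\<forall>z\<in>band {a<..<b}. \<Psi> z = \<psi> z"
    "{z. Im z = a \<and> \<Psi> z \<in> qd_zeros A \<phi>} = {Complex 0 a}" "{z. Im z = b \<and> \<Psi> z \<in> qd_zeros A \<phi>} = {Complex 0 b}"
    using assms unfolding strip_coordinate_def open_strip_band by blast
  show "maxstrip {a<..<b} \<psi>"
  proof (rule coordinate_maxstrip[OF _ _ _ _ _ \<Psi>(1,2)])
    show "(band {a<..<b}, \<psi>) \<in> flat_coordinates A \<phi>" using assms by (simp add: strip_coordinate_def open_strip_band)
    show "{a<..<b} \<noteq> UNIV" using lt_ex by (metis UNIV_I greaterThanLessThan_iff less_irrefl)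
    fix c assume "edge {a<..<b} c"
    then show "\<Psi> (Complex 0 c) \<in> qd_zeros A \<phi>" using edge_greaterThanLessThan[OF ab] \<Psi>(3,4) by blast
  qed (use ab in \<open>simp_all add: is_interval_1\<close>)
qed

lemma half_plane_coordinate_maxstrip:
  assumes "half_plane_coordinate A \<phi> \<psi>"
  shows "maxstrip {0<..} \<psi>"
proof -
  obtain \<Psi> where \<Psi>: "continuous_on (closure (band {0<..})) \<Psi>" "\<forall>z\<in>band {0<..}. \<Psi> z = \<psi> z"
    "{z. Im z = 0 \<and> \<Psi> z \<in> qd_zeros A \<phi>} = {0}"
    using assms unfolding half_plane_coordinate_def upper_half_plane_band by blast
  show ?thesis
  proof (rule coordinate_maxstrip[OF _ _ _ _ _ \<Psi>(1,2)])
    show "(band {0<..}, \<psi>) \<in> flat_coordinates A \<phi>" using assms by (simp add: half_plane_coordinate_def upper_half_plane_band)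
    show "{0::real<..} \<noteq> UNIV" by (metis UNIV_I greaterThan_iff less_irrefl)
    fix c assume "edge {0<..} c"
    then have "c = 0" by (simp add: edge_greaterThan)
    moreover have "Complex 0 0 = 0" by (simp add: complex_eq_iff)
    ultimately show "\<Psi> (Complex 0 c) \<in> qd_zeros A \<phi>" using \<Psi>(3) by auto
  qed (auto simp: is_interval_1)
qed

end

section \<open>The region and its retraction\<close>

text \<open>One formula for both kinds of boxes, depending on J alone and therefore compatible with
  half turns and translations. The closed interval of radius e in J keeps the height off the edges;
  for a half plane, the demand that the open interval of radius E leave J bounds the height by
  E.\<close>

definition flat_box :: "real \<Rightarrow> real \<Rightarrow> real set \<Rightarrow> complex set" where
  "flat_box e E J = {z. \<bar>Re z\<bar> < E \<and> cball (Im z) e \<subseteq> J \<and> (bounded J \<or> \<not> ball (Im z) E \<subseteq> J)}"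

definition standard_interval :: "real set \<Rightarrow> bool" where
  "standard_interval J \<longleftrightarrow> (\<exists>a b. a < b \<and> J = {a<..<b}) \<or> J = {0<..}"

lemma unbounded_greaterThan: "\<not> bounded {a<..}" for a :: real
proof
  assume "bounded {a<..}"
  then obtain M where "\<forall>x\<in>{a<..}. norm x \<le> M" unfolding bounded_iff by blast
  then have "norm (\<bar>M\<bar> + \<bar>a\<bar> + 1) \<le> M" by (rule bspec) simp
  then show False by simp
qed

lemma box_greaterThanLessThan:
  "0 \<le> e \<Longrightarrow> flat_box e E {a<..<b} = {z. a + e < Im z \<and> Im z < b - e \<and> \<bar>Re z\<bar> < E}"
proof -
  assume e: "0 \<le> e"
  have "cball t e \<subseteq> {a<..<b} \<longleftrightarrow> a + e < t \<and> t < b - e" for t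
  proof
    assume s: "cball t e \<subseteq> {a<..<b}"
    have "t - e \<in> cball t e" "t + e \<in> cball t e" using e by (simp_all add: dist_real_def)
    then have "t - e \<in> {a<..<b}" "t + e \<in> {a<..<b}" using s by blast+
    then show "a + e < t \<and> t < b - e" by simp
  qed (auto simp: cball_eq_atLeastAtMost)
  moreover have "bounded {a<..<b}" by (rule bounded_subset[of "{a..b}"]) auto
  ultimately show ?thesis by (auto simp: flat_box_def)
qed

lemma box_greaterThan_0:
  "0 < e \<Longrightarrow> e < E \<Longrightarrow> flat_box e E {0<..} = {z. Im z > e \<and> \<bar>Re z\<bar> < E \<and> \<bar>Im z\<bar> < E}"
proof -
  assume e: "0 < e" "e < E"
  have c: "cball t e \<subseteq> {0<..} \<longleftrightarrow> e < t" for t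
  proof
    assume s: "cball t e \<subseteq> {0<..}"
    have "t - e \<in> cball t e" using e by (simp add: dist_real_def)
    then have "t - e \<in> {0<..}" using s by blast
    then show "e < t" by simp
  qed (auto simp: cball_eq_atLeastAtMost)
  have b: "ball t E \<subseteq> {0<..} \<longleftrightarrow> E \<le> t" if "e < t" for t
  proof
    assume s: "ball t E \<subseteq> {0<..}"
    show "E \<le> t"
    proof (rule ccontr)
      assume "\<not> E \<le> t"
      then have "0 \<in> ball t E" using that e by (simp add: dist_real_def)
      from subsetD[OF s this] show False by simp
    qed
  qed (auto simp: ball_eq_greaterThanLessThan)
  have "\<not> bounded {0::real<..}" by (rule unbounded_greaterThan)
  then have "z \<in> flat_box e E {0<..} \<longleftrightarrow> Im z > e \<and> \<bar>Re z\<bar> < E \<and> \<bar>Im z\<bar> < E" for z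
    using c[of "Im z"] b[of "Im z"] e unfolding flat_box_def mem_Collect_eq by linarith
  then show ?thesis by blast
qed

lemma box_affine:
  assumes s: "\<sigma> \<in> {1,-1::real}" and J: "J = {t. \<sigma> * t + \<tau> \<in> K}"
  shows "z \<in> flat_box e E J \<longleftrightarrow> of_real \<sigma> * z + \<i> * of_real \<tau> \<in> flat_box e E K"
proof -
  let ?w = "of_real \<sigma> * z + \<i> * of_real \<tau>"
  have w: "Re ?w = \<sigma> * Re z" "Im ?w = \<sigma> * Im z + \<tau>" by simp_all
  have ss: "\<sigma> * \<sigma> = 1" "\<bar>\<sigma>\<bar> = 1" using s by auto
  define g where "g = (\<lambda>t. \<sigma> * t + \<tau>)"
  define h where "h = (\<lambda>t. \<sigma> * t - \<sigma> * \<tau>)"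
  have gh: "g (h t) = t" "h (g t) = t" for t using ss(1) by (simp_all add: g_def h_def algebra_simps flip: mult.assoc)
  have JK: "t \<in> J \<longleftrightarrow> g t \<in> K" for t using J by (simp add: g_def)
  have dg: "dist (g t) (g u) = dist t u" for t u
    using ss(2) by (simp add: g_def dist_real_def abs_mult flip: right_diff_distrib)
  have "cball t r \<subseteq> J \<longleftrightarrow> cball (g t) r \<subseteq> K" for t r
  proof
    assume a: "cball t r \<subseteq> J"
    show "cball (g t) r \<subseteq> K"
    proof
      fix u assume "u \<in> cball (g t) r"
      then have "h u \<in> cball t r" using dg[of t "h u"] gh by simp
      then show "u \<in> K" using a JK[of "h u"] gh by auto
    qed
  next
    assume a: "cball (g t) r \<subseteq> K"
    show "cball t r \<subseteq> J"
    proof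
      fix u assume "u \<in> cball t r"
      then have "g u \<in> cball (g t) r" using dg by simp
      then show "u \<in> J" using a JK by blast
    qed
  qed
  moreover have "ball t r \<subseteq> J \<longleftrightarrow> ball (g t) r \<subseteq> K" for t r
  proof
    assume a: "ball t r \<subseteq> J"
    show "ball (g t) r \<subseteq> K"
    proof
      fix u assume "u \<in> ball (g t) r"
      then have "h u \<in> ball t r" using dg[of t "h u"] gh by simp
      then show "u \<in> K" using a JK[of "h u"] gh by auto
    qed
  next
    assume a: "ball (g t) r \<subseteq> K"
    show "ball t r \<subseteq> J"
    proof
      fix u assume "u \<in> ball t r"
      then have "g u \<in> ball (g t) r" using dg by simp
      then show "u \<in> J" using a JK by blast
    qed
  qed
  moreover have "bounded J \<longleftrightarrow> bounded K"
  proof -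
    have "K = g ` J" "J = h ` K" using gh JK by (auto simp: image_iff) metis+
    moreover have "bounded (g ` X)" "bounded (h ` X)" if "bounded X" for X
    proof -
      have "bounded ((\<lambda>t. \<sigma> * t) ` X)" by (rule bounded_linear_image[OF that bounded_linear_mult_right])
      then have "bounded ((\<lambda>t. \<tau> + t) ` (\<lambda>t. \<sigma> * t) ` X)" "bounded ((\<lambda>t. - (\<sigma> * \<tau>) + t) ` (\<lambda>t. \<sigma> * t) ` X)"
        by (intro bounded_translation; assumption)+
      then show "bounded (g ` X)" "bounded (h ` X)" by (simp_all add: g_def h_def image_image add.commute)
    qed
    ultimately show ?thesis by metis
  qed
  moreover have "\<bar>Re ?w\<bar> = \<bar>Re z\<bar>" unfolding w abs_mult ss(2) by simp
  ultimately show ?thesis unfolding flat_box_def mem_Collect_eq w(2) g_def by metis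
qed

lemma box_subset_band: "0 \<le> e \<Longrightarrow> flat_box e E J \<subseteq> band J"
  by (auto simp: flat_box_def band_def subset_iff)

lemma box_ball_subset: "z \<in> flat_box e E J \<Longrightarrow> ball z e \<subseteq> band J"
proof
  fix w assume z: "z \<in> flat_box e E J" and w: "w \<in> ball z e"
  have "\<bar>Im z - Im w\<bar> \<le> dist z w" using abs_Im_le_cmod[of "z - w"] by (simp add: dist_norm)
  then have "Im w \<in> cball (Im z) e" using w by (simp add: dist_real_def)
  then show "w \<in> band J" using z unfolding flat_box_def band_def by blast
qed

lemma standard_interval_affine:
  fixes J :: "real set"
  assumes "open J" "is_interval J" "J \<noteq> {}" "J \<noteq> UNIV"
  shows "\<exists>\<sigma>\<in>{1,-1::real}. \<exists>\<tau>. standard_interval {t. \<sigma> * t + \<tau> \<in> J}"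
  using assms
proof (rule open_interval_cases)
  fix a b :: real assume "a < b" "J = {a<..<b}"
  moreover have "{t. 1 * t + 0 \<in> {a<..<b}} = {a<..<b}" by auto
  ultimately have "standard_interval {t. 1 * t + 0 \<in> J}" unfolding standard_interval_def by blast
  then show ?thesis by blast
next
  fix a assume "J = {a<..}"
  moreover have "{t. 1 * t + a \<in> {a<..}} = {0<..}" by auto
  ultimately have "standard_interval {t. 1 * t + a \<in> J}" unfolding standard_interval_def by simp
  then show ?thesis by blast
next
  fix b assume "J = {..<b}"
  moreover have "{t. (-1) * t + b \<in> {..<b}} = {0<..}" by auto
  ultimately have "standard_interval {t. (-1) * t + b \<in> J}" unfolding standard_interval_def by simp
  then show ?thesis by blast
qed

context exact_surface
begin

lemma maxstrip_standard:
  assumes x: "x \<in> C_tilde A \<phi>" "x \<notin> spectral_network A \<phi>"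
  obtains K \<theta> where "maxstrip K \<theta>" "standard_interval K" "x \<in> \<theta> ` band K"
proof -
  obtain J \<psi> z where m: "maxstrip J \<psi>" "z \<in> band J" "\<psi> z = x" using maxstrip_exists[OF x] by blast
  obtain \<sigma> \<tau> where s: "\<sigma> \<in> {1,-1::real}" "standard_interval {t. \<sigma> * t + \<tau> \<in> J}"
    using standard_interval_affine[OF maxstripD(1-4)[OF m(1)]] by blast
  let ?w = "of_real \<sigma> * (z - \<i> * of_real \<tau>)"
  have "complex_of_real \<sigma> * of_real \<sigma> = 1" using s(1) by auto
  then have zw: "of_real \<sigma> * ?w + \<i> * of_real \<tau> = z" by (simp flip: mult.assoc)
  moreover have "Im (of_real \<sigma> * ?w + \<i> * of_real \<tau>) = \<sigma> * Im ?w + \<tau>" by simp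
  ultimately have "Im z = \<sigma> * Im ?w + \<tau>" by metis
  then have wb: "?w \<in> band {t. \<sigma> * t + \<tau> \<in> J}" using m(2) unfolding band_def by simp
  have "x = \<psi> (of_real \<sigma> * ?w + \<i> * of_real \<tau>)" unfolding zw m(3) ..
  from image_eqI[of x "\<lambda>w. \<psi> (of_real \<sigma> * w + \<i> * of_real \<tau>)", OF this wb]
  show ?thesis using that[OF maxstrip_affine(1)[OF m(1) s(1)] s(2)] by blast
qed

lemma C_region_iff:
  assumes e: "0 < e" "e < E"
  shows "x \<in> C_region A \<phi> e E \<longleftrightarrow> (\<exists>J \<psi>. maxstrip J \<psi> \<and> standard_interval J \<and> x \<in> \<psi> ` flat_box e E J)"
proof -
  have s: "strip_coordinate A \<phi> a b \<psi> \<longleftrightarrow> a < b \<and> maxstrip {a<..<b} \<psi>" for a b \<psi>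
    using strip_coordinate_maxstrip[of a b \<psi>] maxstrip_strip_coordinate[of a b \<psi>] by blast
  have p: "half_plane_coordinate A \<phi> \<psi> \<longleftrightarrow> maxstrip {0<..} \<psi>" for \<psi>
    using half_plane_coordinate_maxstrip[of \<psi>] maxstrip_half_plane_coordinate[of \<psi>] by blast
  have "x \<in> C_region A \<phi> e E \<longleftrightarrow> (\<exists>a b \<psi>. strip_coordinate A \<phi> a b \<psi> \<and> x \<in> \<psi> ` flat_box e E {a<..<b}) \<or>
      (\<exists>\<psi>. half_plane_coordinate A \<phi> \<psi> \<and> x \<in> \<psi> ` flat_box e E {0<..})"
    unfolding C_region_def box_greaterThanLessThan[OF less_imp_le[OF e(1)]] box_greaterThan_0[OF e] by blast
  also have "\<dots> \<longleftrightarrow> (\<exists>J \<psi>. maxstrip J \<psi> \<and> standard_interval J \<and> x \<in> \<psi> ` flat_box e E J)"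
    unfolding s p standard_interval_def by (simp only: ex_disj_distrib conj_disj_distribL conj_disj_distribR) metis
  finally show ?thesis .
qed

text \<open>Membership can be tested in any maximal coordinate around the point: two such
  coordinates differ by an affine map, under which boxes correspond.\<close>

lemma C_region_box_iff:
  assumes e: "0 < e" "e < E" and m: "maxstrip J \<psi>" "z \<in> band J"
  shows "\<psi> z \<in> C_region A \<phi> e E \<longleftrightarrow> z \<in> flat_box e E J"
proof -
  have tr: "w \<in> flat_box e E K \<longleftrightarrow> z \<in> flat_box e E J" if n: "maxstrip K \<theta>" "w \<in> band K" "\<theta> w = \<psi> z" for K \<theta> w
  proof -
    obtain \<sigma> \<tau> where s: "\<sigma> \<in> {1,-1}" "K = {t. \<sigma> * t + \<tau> \<in> J}" "\<forall>z\<in>band K. \<theta> z = \<psi> (of_real \<sigma> * z + \<i> * of_real \<tau>)"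
      using maxstrip_meet[OF n(1) m(1) n(2) m(2) n(3)] by blast
    let ?w = "of_real \<sigma> * w + \<i> * of_real \<tau>"
    have "\<psi> ?w = \<psi> z" using s(3) n(2,3) by metis
    moreover have "?w \<in> band J" using n(2) unfolding band_def s(2) by simp
    ultimately have "?w = z" using maxstrip_inj[OF m(1)] m(2) by (metis inj_onD)
    then show ?thesis using box_affine[OF s(1,2), of w e E] by metis
  qed
  show ?thesis
  proof
    assume "\<psi> z \<in> C_region A \<phi> e E"
    then obtain K \<theta> where k: "maxstrip K \<theta>" "\<psi> z \<in> \<theta> ` flat_box e E K" unfolding C_region_iff[OF e] by (elim exE conjE)
    obtain w where w: "w \<in> flat_box e E K" "\<theta> w = \<psi> z" using imageE[OF k(2)] by metis
    have "w \<in> band K" by (rule subsetD[OF box_subset_band[OF less_imp_le[OF e(1)]] w(1)])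
    from tr[OF k(1) this w(2)] w(1) show "z \<in> flat_box e E J" by blast
  next
    assume z: "z \<in> flat_box e E J"
    have "\<psi> z \<in> \<Union> (components (C_tilde A \<phi> - spectral_network A \<phi>))" using maxstrip_component[OF m(1)] m(2) by blast
    then have "\<psi> z \<in> C_tilde A \<phi>" "\<psi> z \<notin> spectral_network A \<phi>" by (simp_all add: Union_components)
    then obtain K \<theta> where k: "maxstrip K \<theta>" "standard_interval K" "\<psi> z \<in> \<theta> ` band K" by (rule maxstrip_standard)
    obtain w where w: "w \<in> band K" "\<theta> w = \<psi> z" using imageE[OF k(3)] by metis
    have "w \<in> flat_box e E K" using tr[OF k(1) w] z by blast
    from imageI[OF this, of \<theta>] have "\<psi> z \<in> \<theta> ` flat_box e E K" unfolding w(2) .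
    then show "\<psi> z \<in> C_region A \<phi> e E" unfolding C_region_iff[OF e] using k(1,2) by (intro exI conjI)
  qed
qed

lemma C_region_in_maxstrip:
  assumes e: "0 < e" "e < E" and x: "x \<in> C_region A \<phi> e E"
  obtains J \<psi> z where "maxstrip J \<psi>" "z \<in> flat_box e E J" "\<psi> z = x"
  using x unfolding C_region_iff[OF e] by (elim exE conjE imageE) (rule that, assumption+, simp)

lemma C_region_subset:
  assumes e: "0 < e" "e < E"
  shows "C_region A \<phi> e E \<subseteq> C_tilde A \<phi> - spectral_network A \<phi>"
proof
  fix x assume "x \<in> C_region A \<phi> e E"
  then obtain J \<psi> z where m: "maxstrip J \<psi>" "z \<in> flat_box e E J" "\<psi> z = x" by (rule C_region_in_maxstrip[OF e])
  have "z \<in> band J" using m(2) box_subset_band[of e] e(1) by force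
  then have "x \<in> \<Union> (components (C_tilde A \<phi> - spectral_network A \<phi>))" using maxstrip_component[OF m(1)] m(3) by blast
  then show "x \<in> C_tilde A \<phi> - spectral_network A \<phi>" by (simp add: Union_components)
qed

text \<open>One coordinate is fixed per component, so that the homotopy is given by a single formula
  on the whole component.\<close>

definition component_chart :: "'c set \<Rightarrow> real set \<times> (complex \<Rightarrow> 'c)" where
  "component_chart \<Omega> = (SOME p. maxstrip (fst p) (snd p) \<and> standard_interval (fst p) \<and> snd p ` band (fst p) = \<Omega>)"

lemma component_chart:
  assumes "x \<in> C_tilde A \<phi> - spectral_network A \<phi>" and \<Omega>: "\<Omega> = connected_component_set (C_tilde A \<phi> - spectral_network A \<phi>) x"
  shows "maxstrip (fst (component_chart \<Omega>)) (snd (component_chart \<Omega>)) \<and> standard_interval (fst (component_chart \<Omega>)) \<and>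
    snd (component_chart \<Omega>) ` band (fst (component_chart \<Omega>)) = \<Omega>"
  unfolding component_chart_def
proof (rule someI_ex)
  have x: "x \<in> C_tilde A \<phi>" "x \<notin> spectral_network A \<phi>" using assms(1) by blast+
  obtain K \<theta> where k: "maxstrip K \<theta>" "standard_interval K" "x \<in> \<theta> ` band K" by (rule maxstrip_standard[OF x])
  have "\<Omega> \<in> components (C_tilde A \<phi> - spectral_network A \<phi>)" "x \<in> \<Omega>" using assms by (simp_all add: componentsI)
  then have "\<theta> ` band K = \<Omega>" using components_eq[OF maxstrip_component[OF k(1)]] k(3) by blast
  then show "\<exists>p. maxstrip (fst p) (snd p) \<and> standard_interval (fst p) \<and> snd p ` band (fst p) = \<Omega>"
    using k(1,2) by (intro exI[of _ "(K, \<theta>)"]) simp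
qed

definition box_centre :: "real \<Rightarrow> real \<Rightarrow> real set \<Rightarrow> complex" where
  "box_centre e E J = (SOME m. m \<in> flat_box e E J)"

definition contraction :: "real \<Rightarrow> real \<Rightarrow> real set \<times> (complex \<Rightarrow> 'c) \<Rightarrow> real \<times> 'c \<Rightarrow> 'c" where
  "contraction e E p y = snd p (of_real (1 - fst y) * cinv (band (fst p), snd p) (snd y) + of_real (fst y) * box_centre e E (fst p))"

lemma box_standard:
  assumes J: "standard_interval J" and e: "0 < e" "e < E" and h: "\<And>a b. J = {a<..<b} \<Longrightarrow> a < b \<Longrightarrow> 2 * e < b - a"
  shows "convex (flat_box e E J)" "box_centre e E J \<in> flat_box e E J"
proof -
  have cR: "convex {z. \<bar>Re z\<bar> < E}"
  proof -
    have "{z. \<bar>Re z\<bar> < E} = {z. Re z < E} \<inter> {z. Re z > - E}" by auto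
    then show ?thesis by (simp add: convex_Int convex_right_half_plane convex_left_half_plane)
  qed
  consider a b where "a < b" "J = {a<..<b}" | "J = {0<..}" using J unfolding standard_interval_def by blast
  then have "convex (flat_box e E J) \<and> flat_box e E J \<noteq> {}"
  proof cases
    case 1
    have eq: "flat_box e E J = band {a+e<..<b-e} \<inter> {z. \<bar>Re z\<bar> < E}" unfolding 1(2) box_greaterThanLessThan[OF less_imp_le[OF e(1)]] band_def by auto
    have "Complex 0 ((a + b) / 2) \<in> flat_box e E J" unfolding eq band_def using h[OF 1(2,1)] e by (simp add: field_simps)
    then show ?thesis using eq cR by (auto intro!: convex_Int convex_band simp: is_interval_1)
  next
    case 2
    have eq: "flat_box e E J = band {e<..<E} \<inter> {z. \<bar>Re z\<bar> < E}" unfolding 2 box_greaterThan_0[OF e] band_def using e by auto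
    have "Complex 0 ((e + E) / 2) \<in> flat_box e E J" unfolding eq band_def using e by (simp add: field_simps)
    then show ?thesis using eq cR by (auto intro!: convex_Int convex_band simp: is_interval_1)
  qed
  then show "convex (flat_box e E J)" "box_centre e E J \<in> flat_box e E J"
    unfolding box_centre_def using someI_ex[of "\<lambda>m. m \<in> flat_box e E J"] by blast+
qed

lemma contraction:
  assumes m: "maxstrip K \<theta>" and K: "standard_interval K" and e: "0 < e" "e < E"
    and h: "\<And>a b \<psi>. maxstrip {a<..<b} \<psi> \<Longrightarrow> a < b \<Longrightarrow> 2 * e < b - a"
  shows "continuous_on ({0..1} \<times> \<theta> ` band K) (contraction e E (K, \<theta>))"
    and "\<And>t x. t \<in> {0..1} \<Longrightarrow> x \<in> \<theta> ` band K \<Longrightarrow> contraction e E (K, \<theta>) (t, x) \<in> \<theta> ` band K"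
    and "\<And>x. x \<in> \<theta> ` band K \<Longrightarrow> contraction e E (K, \<theta>) (0, x) = x"
    and "\<And>t z. t \<in> {0..1} \<Longrightarrow> z \<in> flat_box e E K \<Longrightarrow> contraction e E (K, \<theta>) (t, \<theta> z) \<in> \<theta> ` flat_box e E K"
    and "\<And>x. contraction e E (K, \<theta>) (1, x) \<in> \<theta> ` flat_box e E K"
proof -
  let ?k = "(band K, \<theta>)" and ?m = "box_centre e E K"
  have kA: "?k \<in> A" using maxstrip_flat_coordinate[OF m] by (rule flat_coordinates_atlas)
  note b = box_standard[OF K e]
  have cb: "convex (flat_box e E K)" "?m \<in> flat_box e E K"
    by (rule b; use h m in blast)+
  have mb: "?m \<in> band K" using cb(2) box_subset_band[of e] e(1) by force
  have cB: "convex (band K)" by (rule convex_band[OF maxstripD(2)[OF m]])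
  have comb: "of_real (1 - t) * z + of_real t * w \<in> S" if "convex S" "z \<in> S" "w \<in> S" "t \<in> {0..1}" for t z w and S :: "complex set"
    using convexD[OF that(1-3), of "1 - t" t] that(4) by (simp add: scaleR_conv_of_real)
  have arg: "of_real (1 - t) * cinv ?k x + of_real t * ?m \<in> band K" if "t \<in> {0..1}" "x \<in> \<theta> ` band K" for t x
    using comb[OF cB _ mb that(1)] cinv_in_cdom[of x ?k] that(2) by simp
  show "continuous_on ({0..1} \<times> \<theta> ` band K) (contraction e E (K, \<theta>))"
  proof -
    have c1: "continuous_on ({0..1} \<times> \<theta> ` band K) (\<lambda>y. of_real (1 - fst y) * cinv ?k (snd y) + of_real (fst y) * ?m)"
      by (intro continuous_intros continuous_on_compose2[OF cinv_continuous[OF kA]]) auto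
    have c2: "continuous_on (band K) \<theta>" using cmap_continuous[OF kA] by simp
    have c3: "(\<lambda>y. of_real (1 - fst y) * cinv ?k (snd y) + of_real (fst y) * ?m) ` ({0..1} \<times> \<theta> ` band K) \<subseteq> band K"
    proof (rule image_subsetI)
      fix y :: "real \<times> 'c" assume y: "y \<in> {0..1} \<times> \<theta> ` band K"
      have "fst y \<in> {0..1}" "snd y \<in> \<theta> ` band K" using y unfolding mem_Times_iff by blast+
      then show "of_real (1 - fst y) * cinv ?k (snd y) + of_real (fst y) * ?m \<in> band K" by (rule arg)
    qed
    have "continuous_on ({0..1} \<times> \<theta> ` band K) (\<lambda>y. \<theta> (of_real (1 - fst y) * cinv ?k (snd y) + of_real (fst y) * ?m))"
      by (rule continuous_on_compose2[OF c2 c1 c3])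
    then show ?thesis by (simp add: contraction_def[abs_def])
  qed
  show "contraction e E (K, \<theta>) (t, x) \<in> \<theta> ` band K" if "t \<in> {0..1}" "x \<in> \<theta> ` band K" for t x
    using arg[OF that] by (simp add: contraction_def)
  show "contraction e E (K, \<theta>) (0, x) = x" if "x \<in> \<theta> ` band K" for x
    using cmap_cinv[of x ?k] that by (simp add: contraction_def)
  show "contraction e E (K, \<theta>) (t, \<theta> z) \<in> \<theta> ` flat_box e E K" if "t \<in> {0..1}" "z \<in> flat_box e E K" for t z
  proof -
    have "cinv ?k (\<theta> z) = z" using cinv_cmap[OF kA, of z] that(2) box_subset_band[of e E K] e(1) by auto
    then show ?thesis using comb[OF cb(1) that(2) cb(2) that(1)] by (simp add: contraction_def)
  qed
  show "contraction e E (K, \<theta>) (1, x) \<in> \<theta> ` flat_box e E K" for x using cb(2) by (simp add: contraction_def)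
qed

text \<open>Each component is contracted linearly, in its own coordinate, to a point of its convex
  box, so boxes are preserved at all times. The components are open, and the pieces therefore fit to
  a continuous homotopy. The bound on heights makes the boxes of strips nonempty.\<close>

lemma C_region_retract:
  assumes e: "0 < e" "e < E" and h: "\<And>a b \<psi>. maxstrip {a<..<b} \<psi> \<Longrightarrow> a < b \<Longrightarrow> 2 * e < b - a"
  shows "weak_deformation_retract_of (C_region A \<phi> e E) (C_tilde A \<phi> - spectral_network A \<phi>)"
proof -
  let ?X = "C_tilde A \<phi> - spectral_network A \<phi>" and ?R = "C_region A \<phi> e E"
  let ?cc = "connected_component_set ?X"
  define H where "H y = (if snd y \<in> ?X then contraction e E (component_chart (?cc (snd y))) y else snd y)" for y :: "real \<times> 'c"
  have RX: "?R \<subseteq> ?X" by (rule C_region_subset[OF e])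
  have cc: "\<exists>K \<theta>. component_chart (?cc x) = (K, \<theta>) \<and> maxstrip K \<theta> \<and> standard_interval K \<and> \<theta> ` band K = ?cc x \<and> x \<in> ?cc x" if "x \<in> ?X" for x
  proof -
    have "x \<in> ?cc x" using that by (simp add: connected_component_refl)
    then show ?thesis using component_chart[OF that refl]
      by (intro exI[of _ "fst (component_chart (?cc x))"] exI[of _ "snd (component_chart (?cc x))"] conjI) (rule surjective_pairing, simp_all only:)
  qed
  have ccX: "?cc x \<subseteq> ?X" for x by (rule connected_component_subset)
  have cont: "continuous_on ({0..1::real} \<times> ?X) H"
    unfolding continuous_on_eq_continuous_within
  proof
    fix y assume y: "y \<in> {0..1::real} \<times> ?X"
    let ?x = "snd y"
    have xX: "?x \<in> ?X" using y by auto
    obtain K \<theta> where k: "component_chart (?cc ?x) = (K, \<theta>)" "maxstrip K \<theta>" "standard_interval K" "\<theta> ` band K = ?cc ?x" "?x \<in> ?cc ?x"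
      using cc[OF xX] by blast
    let ?S = "UNIV \<times> ?cc ?x"
    have oS: "open ?S" using flatmap_open_image[OF maxstripD(5)[OF k(2)]] unfolding k(4) by (intro open_Times open_UNIV)
    have yS: "y \<in> ?S" using k(5) by (simp add: mem_Times_iff)
    have eqS: "({0..1::real} \<times> ?X) \<inter> ?S - {y} = ({0..1::real} \<times> ?cc ?x) \<inter> ?S - {y}" using ccX[of ?x] by blast
    have "continuous_on ({0..1::real} \<times> ?cc ?x) H"
    proof (rule continuous_on_eq)
      show "continuous_on ({0..1::real} \<times> ?cc ?x) (contraction e E (K, \<theta>))" using contraction(1)[OF k(2,3) e h] unfolding k(4) .
      fix y' :: "real \<times> 'c" assume "y' \<in> {0..1} \<times> ?cc ?x"
      then have y': "snd y' \<in> ?cc ?x" by auto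
      then have "?cc (snd y') = ?cc ?x" using connected_component_eq by metis
      then show "contraction e E (K, \<theta>) y' = H y'" using y' ccX[of ?x] k(1) unfolding H_def by auto
    qed
    moreover have "y \<in> {0..1::real} \<times> ?cc ?x" using y k(5) by (simp add: mem_Times_iff)
    ultimately have "continuous (at y within {0..1::real} \<times> ?cc ?x) H"
      unfolding continuous_on_eq_continuous_within by (rule bspec)
    then show "continuous (at y within {0..1::real} \<times> ?X) H" unfolding at_within_nhd[OF yS oS eqS] .
  qed
  have HX: "H (t, x) \<in> ?X" if tx: "t \<in> {0..1}" "x \<in> ?X" for t x
  proof -
    obtain K \<theta> where k: "component_chart (?cc x) = (K, \<theta>)" "maxstrip K \<theta>" "standard_interval K" "\<theta> ` band K = ?cc x" "x \<in> ?cc x"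
      using cc[OF tx(2)] by blast
    have "contraction e E (K, \<theta>) (t, x) \<in> ?cc x" using contraction(2)[OF k(2,3) e h tx(1)] k(4,5) by simp
    then show ?thesis using ccX[of x] tx(2) k(1) unfolding H_def by auto
  qed
  have HR: "H (t, x) \<in> ?R" if tx: "t \<in> {0..1}" "x \<in> ?R \<or> (t = 1 \<and> x \<in> ?X)" for t x
  proof -
    have xX: "x \<in> ?X" using tx(2) RX by blast
    obtain K \<theta> where k: "component_chart (?cc x) = (K, \<theta>)" "maxstrip K \<theta>" "standard_interval K" "\<theta> ` band K = ?cc x" "x \<in> ?cc x"
      using cc[OF xX] by blast
    have "contraction e E (K, \<theta>) (t, x) \<in> \<theta> ` flat_box e E K"
    proof (cases "t = 1")
      case True
      then show ?thesis using contraction(5)[OF k(2,3) e h] by simp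
    next
      case False
      then have xR: "x \<in> ?R" using tx(2) by blast
      obtain z where z: "z \<in> band K" "x = \<theta> z" using k(4,5) by blast
      then have "z \<in> flat_box e E K" using C_region_box_iff[OF e k(2) z(1)] xR by simp
      then show ?thesis using contraction(4)[OF k(2,3) e h tx(1)] z(2) by simp
    qed
    then have "contraction e E (K, \<theta>) (t, x) \<in> ?R" unfolding C_region_iff[OF e] using k(2,3) by (intro exI conjI)
    then show ?thesis using xX k(1) unfolding H_def by auto
  qed
  have H0: "H (0, x) = id x" for x
  proof (cases "x \<in> ?X")
    case True
    obtain K \<theta> where k: "component_chart (?cc x) = (K, \<theta>)" "maxstrip K \<theta>" "standard_interval K" "\<theta> ` band K = ?cc x" "x \<in> ?cc x"
      using cc[OF True] by blast
    have "contraction e E (K, \<theta>) (0, x) = x" using contraction(3)[OF k(2,3) e h] k(4,5) by simp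
    then show ?thesis using True k(1) unfolding H_def by auto
  qed (unfold H_def, auto)
  have "continuous_map (prod_topology (top_of_set {0..1}) (top_of_set ?X)) (top_of_set ?X) H"
    using cont HX by (auto simp: prod_topology_subtopology_eu continuous_map_in_subtopology image_subset_iff)
  then have "homotopic_with_canon (\<lambda>f. f ` ?R \<subseteq> ?R) ?X ?X id (\<lambda>x. H (1, x))"
    unfolding homotopic_with_def using H0 HR by (intro exI[of _ H]) (simp add: image_subset_iff)
  moreover have "(\<lambda>x. H (1, x)) ` ?X \<subseteq> ?R" using HR[of 1] by (simp add: image_subset_iff)
  ultimately show ?thesis unfolding weak_deformation_retract_of_def using RX by blast
qed

end

section \<open>The desingularized metric\<close>

lemma Ck_on_cmod_square:
  assumes "h holomorphic_on U" "open U"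
  shows "Ck_on n U (\<lambda>z. (cmod (h z))\<^sup>2)"
proof -
  have h: "Ck_on n U h" by (rule Ck_on_holomorphic[OF assms])
  have "Ck_on n U (\<lambda>z. Re (h z) * Re (h z) + Im (h z) * Im (h z))"
    by (intro Ck_on_add Ck_on_mult Ck_on_bounded_linear[OF bounded_linear_Re h] Ck_on_bounded_linear[OF bounded_linear_Im h])
  moreover have "(cmod (h z))\<^sup>2 = Re (h z) * Re (h z) + Im (h z) * Im (h z)" for z
    unfolding cmod_power2 unfolding power2_eq_square ..
  ultimately show ?thesis by simp
qed

lemma Ck_on_cmod:
  assumes "h holomorphic_on U" "open U" "\<And>z. z \<in> U \<Longrightarrow> h z \<noteq> 0"
  shows "Ck_on n U (\<lambda>z. cmod (h z))"
proof -
  have "Ck_on n U (\<lambda>z. 1 * (cmod (h z))\<^sup>2 powr (1/2))"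
    by (rule Ck_on_compose_real[OF Ck_on_powr Ck_on_cmod_square[OF assms(1,2)]]) (use assms(3) in auto)
  moreover have "1 * (cmod (h z))\<^sup>2 powr (1/2) = cmod (h z)" for z by (simp add: powr_half_sqrt)
  ultimately show ?thesis by simp
qed

context gmn_surface
begin

text \<open>The cutoff function of the desingularization, transplanted from the radii of the zero
  charts to the surface; the charts are disjoint, so the chosen zero is unique.\<close>

definition weight :: "real \<Rightarrow> 'c \<Rightarrow> real" where
  "weight \<delta> x = (if \<exists>b\<in>qd_zeros A \<phi>. x \<in> cim (zchart b)
     then profile \<delta> (cmod (cinv (zchart (SOME b. b \<in> qd_zeros A \<phi> \<and> x \<in> cim (zchart b))) x)) else 1)"

text \<open>Off the zeroes this is |\<phi>| divided by the weight. In the chart of a zero it equals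
  1 for small |w|, so smoothness forces the value 1 at the zero in that chart, and |T'|^2 in another
  chart with transition T.\<close>

definition conformal_factor :: "real \<Rightarrow> 'c coord \<Rightarrow> complex \<Rightarrow> real" where
  "conformal_factor \<delta> k z = (if cmap k z \<in> qd_zeros A \<phi> then (cmod (deriv (transition k (zchart (cmap k z))) z))\<^sup>2
     else cmod (\<phi> k z) * weight \<delta> (cmap k z) powr (-1))"

definition desing :: "real \<Rightarrow> 'c metric_field" where
  "desing \<delta> k z v w = conformal_factor \<delta> k z * (v \<bullet> w)"

lemma weight_chart:
  assumes b: "b \<in> qd_zeros A \<phi>" "x \<in> cim (zchart b)"
  shows "weight \<delta> x = profile \<delta> (cmod (cinv (zchart b) x))"
proof -
  have ex: "\<exists>b. b \<in> qd_zeros A \<phi> \<and> x \<in> cim (zchart b)" using b by blast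
  define b' where "b' = (SOME b. b \<in> qd_zeros A \<phi> \<and> x \<in> cim (zchart b))"
  have b': "b' \<in> qd_zeros A \<phi> \<and> x \<in> cim (zchart b')" unfolding b'_def by (rule someI_ex[OF ex])
  have "b' = b"
  proof (rule ccontr)
    assume "b' \<noteq> b"
    then have "cim (zchart b') \<inter> cim (zchart b) = {}" using zchart_disjoint[of b' b] b' b(1) by blast
    then show False using b' b(2) by blast
  qed
  moreover have "weight \<delta> x = profile \<delta> (cmod (cinv (zchart b') x))" unfolding weight_def b'_def using b by (metis (no_types, lifting))
  ultimately show ?thesis by simp
qed

lemma not_in_zero_nhd:
  assumes "x \<notin> zero_nhd A \<phi> \<xi> \<rho> r" "b \<in> qd_zeros A \<phi>" "x \<in> cim (zchart b)"
  shows "r \<le> cmod (cinv (zchart b) x)"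
proof (rule ccontr)
  assume "\<not> r \<le> cmod (cinv (zchart b) x)"
  then have "cinv (zchart b) x \<in> ball 0 (\<rho> b) \<inter> ball 0 r" using cinv_in_cdom[OF assms(3)] by simp
  moreover have "x = \<xi> b (cinv (zchart b) x)" using cmap_cinv[OF assms(3)] by simp
  ultimately have "x \<in> zero_nhd A \<phi> \<xi> \<rho> r" unfolding zero_nhd_def using assms(2) by blast
  then show False using assms(1) by blast
qed

lemma cinv_zero_iff:
  assumes "b \<in> qd_zeros A \<phi>" "x \<in> cim (zchart b)"
  shows "x \<in> qd_zeros A \<phi> \<longleftrightarrow> x = b" "x = b \<longleftrightarrow> cinv (zchart b) x = 0"
proof -
  show "x \<in> qd_zeros A \<phi> \<longleftrightarrow> x = b" using zchart_subset[OF assms(1)] assms zeros_C_circ_disjoint by blast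
  have "cinv (zchart b) b = 0" using cinv_cmap[OF zchart(1)[OF assms(1)], of 0] zchart(2,3)[OF assms(1)] by simp
  moreover have "x = b" if "cinv (zchart b) x = 0" using cmap_cinv[OF assms(2)] that zchart(3)[OF assms(1)] by simp
  ultimately show "x = b \<longleftrightarrow> cinv (zchart b) x = 0" by blast
qed

lemma profile_outer: "0 < \<delta> \<Longrightarrow> 3/2 * \<delta> \<le> r \<Longrightarrow> profile \<delta> r = 1"
proof -
  assume d: "0 < \<delta>" "3/2 * \<delta> \<le> r"
  have "1 \<le> (2 / \<delta>) * r - 2" using d by (simp add: field_simps)
  then show ?thesis by (simp add: profile_def smooth_step_1)
qed

lemma weight_outer:
  assumes "0 < \<delta>" "x \<notin> zero_nhd A \<phi> \<xi> \<rho> (3/2 * \<delta>)"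
  shows "weight \<delta> x = 1"
proof (cases "\<exists>b\<in>qd_zeros A \<phi>. x \<in> cim (zchart b)")
  case True
  then obtain b where b: "b \<in> qd_zeros A \<phi>" "x \<in> cim (zchart b)" by blast
  show ?thesis using weight_chart[OF b] profile_outer[OF assms(1) not_in_zero_nhd[OF assms(2) b]] by simp
qed (simp add: weight_def)

lemma zeros_in_zero_nhd: "0 < r \<Longrightarrow> qd_zeros A \<phi> \<subseteq> zero_nhd A \<phi> \<xi> \<rho> r"
proof
  fix b assume b: "b \<in> qd_zeros A \<phi>" and r: "0 < r"
  have "b = \<xi> b 0" "0 \<in> ball 0 (\<rho> b) \<inter> ball 0 r" using zchart(2,3)[OF b] r by simp_all
  then show "b \<in> zero_nhd A \<phi> \<xi> \<rho> r" unfolding zero_nhd_def using b by blast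
qed

lemma conformal_factor_outer:
  assumes "0 < \<delta>" "cmap k z \<notin> zero_nhd A \<phi> \<xi> \<rho> (3/2 * \<delta>)"
  shows "conformal_factor \<delta> k z = cmod (\<phi> k z)"
  using weight_outer[OF assms] zeros_in_zero_nhd[of "3/2 * \<delta>"] assms unfolding conformal_factor_def by auto

lemma conformal_factor_transition:
  assumes k: "k \<in> A" "k' \<in> A" "z \<in> overlap k k'"
  shows "conformal_factor \<delta> k z = conformal_factor \<delta> k' (transition k k' z) * (cmod (deriv (transition k k') z))\<^sup>2"
proof -
  have x: "cmap k' (transition k k' z) = cmap k z" by (rule cmap_transition[OF k(3)])
  show ?thesis
  proof (cases "cmap k z \<in> qd_zeros A \<phi>")
    case True
    let ?b = "cmap k z"
    have "z \<in> overlap k (zchart ?b)" using zero_in_zchart[OF True] k(3) by (simp add: overlap_def)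
    then have "deriv (transition k (zchart ?b)) z = deriv (transition k' (zchart ?b)) (transition k k' z) * deriv (transition k k') z"
      using transition_deriv_comp[OF k(1,2) zchart(1)[OF True] k(3)] by simp
    then show ?thesis unfolding conformal_factor_def x using True by (simp add: norm_mult power_mult_distrib)
  next
    case False
    then show ?thesis unfolding conformal_factor_def x phi_transition[OF k] by (simp add: norm_mult norm_power)
  qed
qed

lemma conformal_factor_zchart:
  assumes d: "0 < \<delta>" "\<delta> \<le> 2/3" and b: "b \<in> qd_zeros A \<phi>" and w: "w \<in> ball 0 (\<rho> b)"
  shows "w \<noteq> 0 \<Longrightarrow> conformal_factor \<delta> (zchart b) w = cmod w / profile \<delta> (cmod w)"
    and "cmod w < \<delta> \<Longrightarrow> conformal_factor \<delta> (zchart b) w = 1"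
proof -
  have x: "\<xi> b w \<in> cim (zchart b)" "cinv (zchart b) (\<xi> b w) = w" using w cinv_cmap[OF zchart(1)[OF b], of w] by simp_all
  note M = cutoff_profile_profile[OF d, unfolded cutoff_profile_def]
  show 1: "conformal_factor \<delta> (zchart b) w = cmod w / profile \<delta> (cmod w)" if "w \<noteq> 0"
  proof -
    have "\<xi> b w \<notin> qd_zeros A \<phi>" using cinv_zero_iff[OF b x(1)] x(2) that by simp
    moreover have "profile \<delta> (cmod w) > 0" using M that by simp
    ultimately show ?thesis using weight_chart[OF b x(1)] x(2) zchart(4)[OF b w]
      unfolding conformal_factor_def by (simp add: powr_minus_divide)
  qed
  show "conformal_factor \<delta> (zchart b) w = 1" if "cmod w < \<delta>"
  proof (cases "w = 0")
    case False
    have "profile \<delta> (cmod w) = cmod w" using M that by simp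
    then show ?thesis using 1[OF False] False by simp
  next
    case True
    have "((\<lambda>w. w) has_field_derivative 1) (at w)" by simp
    then have "(transition (zchart b) (zchart b) has_field_derivative 1) (at w)"
      by (rule has_field_derivative_transform_within_open[OF _ open_cdom[OF zchart(1)[OF b]]])
        (use w transition_same[OF zchart(1)[OF b]] in simp_all)
    then show ?thesis using True zchart(3)[OF b] b unfolding conformal_factor_def by (simp add: DERIV_imp_deriv)
  qed
qed

lemma weight_pos:
  assumes d: "0 < \<delta>" "\<delta> \<le> 2/3" and x: "x \<notin> qd_zeros A \<phi>"
  shows "weight \<delta> x > 0"
proof (cases "\<exists>b\<in>qd_zeros A \<phi>. x \<in> cim (zchart b)")
  case True
  then obtain b where b: "b \<in> qd_zeros A \<phi>" "x \<in> cim (zchart b)" by blast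
  have "x \<noteq> b" using b(1) x by blast
  then have "cmod (cinv (zchart b) x) > 0" using cinv_zero_iff(2)[OF b] by simp
  then show ?thesis using cutoff_profile_profile[OF d] weight_chart[OF b] unfolding cutoff_profile_def by simp
qed (simp add: weight_def)

lemma conformal_factor_pos:
  assumes d: "0 < \<delta>" "\<delta> \<le> 2/3" and k: "k \<in> A" "z \<in> cdom k" "cmap k z \<in> C_tilde A \<phi>"
  shows "conformal_factor \<delta> k z > 0"
proof (cases "cmap k z \<in> qd_zeros A \<phi>")
  case True
  have "z \<in> overlap k (zchart (cmap k z))" using zero_in_zchart[OF True] k(2) by (simp add: overlap_def)
  from transition_deriv_nonzero[OF k(1) zchart(1)[OF True] this] show ?thesis using True unfolding conformal_factor_def by simp
next
  case False
  then have "\<phi> k z \<noteq> 0" using k C_circ_chart[OF k(1,2)] C_tilde_eq by blast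
  then show ?thesis using False weight_pos[OF d False] unfolding conformal_factor_def by simp
qed

lemma open_chart_preimage: "k \<in> A \<Longrightarrow> open V \<Longrightarrow> open {z \<in> cdom k. cmap k z \<in> V}"
proof -
  assume k: "k \<in> A" and V: "open V"
  have "{z \<in> cdom k. cmap k z \<in> V} = cdom k \<inter> cmap k -` V" by blast
  then show ?thesis using continuous_open_preimage[OF cmap_continuous[OF k] open_cdom[OF k] V] by simp
qed

lemma phi_holomorphic:
  assumes k: "k \<in> A" and S: "S \<subseteq> {z \<in> cdom k. cmap k z \<in> C_tilde A \<phi>}"
  shows "\<phi> k holomorphic_on S"
proof (rule analytic_imp_holomorphic)
  have "\<phi> k analytic_on {z}" if "z \<in> S" for z
    using phi_analytic[OF k, of z] poles_chart[OF k, of z] S that unfolding C_tilde_def by blast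
  then show "\<phi> k analytic_on S" unfolding analytic_on_def by blast
qed

text \<open>Three local forms: |\<phi>| off the closed discs of radius 3/2 \<delta>, |T'|^2 within
  radius \<delta> of a zero, and |\<phi>| divided by the profile of |T| in a zero chart away from
  its centre, where |T| is smooth. The open sets on which they hold cover
  \<open>C_tilde A \<phi>\<close>.\<close>

lemma Ck_on_conformal_factor:
  assumes d: "0 < \<delta>" "\<delta> \<le> 2/3" "\<And>b. b \<in> qd_zeros A \<phi> \<Longrightarrow> 3/2 * \<delta> < \<rho> b" and k: "k \<in> A"
  shows "Ck_on n {z \<in> cdom k. cmap k z \<in> C_tilde A \<phi>} (conformal_factor \<delta> k)"
proof (rule Ck_on_local)
  let ?S = "{z \<in> cdom k. cmap k z \<in> C_tilde A \<phi>}"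
  show oS: "open ?S" by (rule open_chart_preimage[OF k open_C_tilde])
  have abs: "Ck_on n U (\<lambda>z. cmod (\<phi> k z))" if "open U" "U \<subseteq> ?S" "\<And>z. z \<in> U \<Longrightarrow> cmap k z \<notin> qd_zeros A \<phi>" for U
  proof (rule Ck_on_cmod[OF phi_holomorphic[OF k that(2)] that(1)])
    fix z assume z: "z \<in> U"
    then show "\<phi> k z \<noteq> 0" using that(2) that(3)[OF z] C_circ_chart[OF k, of z] C_tilde_eq by blast
  qed
  fix z assume z: "z \<in> ?S"
  let ?x = "cmap k z"
  let ?K = "\<Union>b\<in>qd_zeros A \<phi>. \<xi> b ` cball 0 (3/2 * \<delta>)"
  \<comment> \<open>Finiteness of the zeroes and compactness of the closed discs make their union
    closed, so that its complement is one of the open pieces.\<close>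
  have cK: "closed ?K" by (intro compact_imp_closed compact_UN finite_zeros compact_zchart_image d(3))
  show "\<exists>U. open U \<and> z \<in> U \<and> U \<subseteq> ?S \<and> Ck_on n U (conformal_factor \<delta> k)"
  proof (cases "?x \<in> ?K")
    case False
    let ?U = "{z \<in> cdom k. cmap k z \<in> C_tilde A \<phi> \<inter> - ?K}"
    have oU: "open ?U" by (rule open_chart_preimage[OF k open_Int[OF open_C_tilde open_Compl[OF cK]]])
    have out: "x \<notin> zero_nhd A \<phi> \<xi> \<rho> (3/2 * \<delta>)" if "x \<notin> ?K" for x using that unfolding zero_nhd_def by force
    have "Ck_on n ?U (\<lambda>z. cmod (\<phi> k z))"
    proof (rule abs[OF oU])
      show "?U \<subseteq> ?S" by blast
      fix y assume "y \<in> ?U"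
      then have "cmap k y \<notin> zero_nhd A \<phi> \<xi> \<rho> (3/2 * \<delta>)" by (intro out) blast
      then show "cmap k y \<notin> qd_zeros A \<phi>" using zeros_in_zero_nhd[of "3/2 * \<delta>"] d(1) by auto
    qed
    then have "Ck_on n ?U (conformal_factor \<delta> k)"
      by (subst Ck_on_cong[of _ _ "\<lambda>z. cmod (\<phi> k z)"]) (use conformal_factor_outer[OF d(1) out] in blast)
    then show ?thesis using oU z False by (intro exI[of _ ?U]) blast
  next
    case True
    then obtain b w where b: "b \<in> qd_zeros A \<phi>" "w \<in> cball 0 (3/2 * \<delta>)" "?x = \<xi> b w" by blast
    have w: "w \<in> ball 0 (\<rho> b)" using b(2) d(3)[OF b(1)] by simp
    let ?zc = "zchart b" let ?T = "transition k ?zc"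
    have zA: "?zc \<in> A" by (rule zchart(1)[OF b(1)])
    have zo: "z \<in> overlap k ?zc" using z b(3) w unfolding overlap_def by simp
    have Tz: "?T z = w" using b(3) cinv_cmap[OF zA, of w] w by (simp add: transition_def)
    have oO: "open (overlap k ?zc)" by (rule open_overlap[OF k zA])
    have hT: "?T holomorphic_on overlap k ?zc" by (rule transition_holomorphic[OF k zA])
    have TO: "?T y \<in> ball 0 (\<rho> b)" if "y \<in> overlap k ?zc" for y using transition_overlap[OF k that] unfolding overlap_def by simp
    show ?thesis
    proof (cases "cmod w < \<delta>")
      case True
      let ?U = "?S \<inter> {y \<in> overlap k ?zc. ?T y \<in> ball 0 \<delta>}"
      have "{y \<in> overlap k ?zc. ?T y \<in> ball 0 \<delta>} = overlap k ?zc \<inter> ?T -` ball 0 \<delta>" by blast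
      then have oU: "open ?U" using oS continuous_open_preimage[OF holomorphic_on_imp_continuous_on[OF hT] oO open_ball] by (simp add: open_Int)
      have c3: "Ck_on n ?U (\<lambda>y. (cmod (deriv ?T y))\<^sup>2)"
        by (rule Ck_on_cmod_square[OF holomorphic_on_subset[OF holomorphic_deriv[OF hT oO]] oU]) blast
      have ce: "conformal_factor \<delta> k y = (cmod (deriv ?T y))\<^sup>2" if "y \<in> ?U" for y
        using conformal_factor_transition[OF k zA, of y \<delta>] conformal_factor_zchart(2)[OF d(1,2) b(1) TO[of y]] that by simp
      have "Ck_on n ?U (conformal_factor \<delta> k)" by (rule iffD2[OF Ck_on_cong[OF ce] c3])
      then show ?thesis using oU z zo Tz True by (intro exI[of _ ?U]) simp
    next
      case False
      let ?U = "?S \<inter> {y \<in> overlap k ?zc. ?T y \<in> - {0}}"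
      have "{y \<in> overlap k ?zc. ?T y \<in> - {0}} = overlap k ?zc \<inter> ?T -` (- {0})" by blast
      then have oU: "open ?U" using oS continuous_open_preimage[OF holomorphic_on_imp_continuous_on[OF hT] oO, of "- {0}"]
        by (simp add: open_Int open_Compl)
      have yb: "cmap k y \<in> cim ?zc" "cinv ?zc (cmap k y) = ?T y" if "y \<in> ?U" for y
        using that unfolding overlap_def transition_def by auto
      have nz: "cmap k y \<notin> qd_zeros A \<phi>" if "y \<in> ?U" for y
        using cinv_zero_iff[OF b(1) yb(1)[OF that]] yb(2)[OF that] that by simp
      have m: "weight \<delta> (cmap k y) = profile \<delta> (cmod (?T y))" if "y \<in> ?U" for y
        using weight_chart[OF b(1) yb(1)[OF that]] yb(2)[OF that] by simp
      have "Ck_on n ?U (\<lambda>y. cmod (?T y))" by (rule Ck_on_cmod[OF holomorphic_on_subset[OF hT] oU]) blast+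
      from Ck_on_compose_real[OF Ck_on_profile[of n UNIV \<delta>] this]
      have "Ck_on n ?U (\<lambda>y. profile \<delta> (cmod (?T y)))" by blast
      moreover have "(\<lambda>y. profile \<delta> (cmod (?T y))) ` ?U \<subseteq> {0<..}"
      proof (rule image_subsetI)
        fix y assume y: "y \<in> ?U"
        show "profile \<delta> (cmod (?T y)) \<in> {0<..}" using weight_pos[OF d(1,2) nz[OF y]] unfolding m[OF y] by simp
      qed
      ultimately have c1: "Ck_on n ?U (\<lambda>y. 1 * profile \<delta> (cmod (?T y)) powr (-1))"
        by (rule Ck_on_compose_real[OF Ck_on_powr])
      have c2: "Ck_on n ?U (\<lambda>z. cmod (\<phi> k z))" by (rule abs[OF oU]) (use nz in blast)+
      have c3: "Ck_on n ?U (\<lambda>y. cmod (\<phi> k y) * (1 * profile \<delta> (cmod (?T y)) powr (-1)))" by (rule Ck_on_mult[OF c2 c1])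
      have ce: "conformal_factor \<delta> k y = cmod (\<phi> k y) * (1 * profile \<delta> (cmod (?T y)) powr (-1))" if "y \<in> ?U" for y
        using nz[OF that] m[OF that] unfolding conformal_factor_def by simp
      have "Ck_on n ?U (conformal_factor \<delta> k)" by (rule iffD2[OF Ck_on_cong[OF ce] c3])
      moreover have "w \<noteq> 0" using False d(1) by auto
      ultimately show ?thesis using oU z zo Tz by (intro exI[of _ ?U]) simp
    qed
  qed
qed

lemma desing_metric:
  assumes d: "0 < \<delta>" "\<delta> \<le> 2/3" "\<And>b. b \<in> qd_zeros A \<phi> \<Longrightarrow> 3/2 * \<delta> < \<rho> b"
  shows "riemannian_metric_on A (C_tilde A \<phi>) (desing \<delta>)"
    and "metrics_agree_on A (C_tilde A \<phi> - zero_nhd A \<phi> \<xi> \<rho> (3/2 * \<delta>)) (desing \<delta>) (flat_metric \<phi>)"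
    and "desingularized_metric A \<phi> \<xi> \<rho> \<delta> (desing \<delta>)"
proof -
  have "smooth_on {z \<in> cdom k. cmap k z \<in> C_tilde A \<phi>} (\<lambda>z. desing \<delta> k z v w)" if "k \<in> A" for k v w
    unfolding smooth_on_def desing_def using Ck_on_mult[OF Ck_on_conformal_factor[OF d that] Ck_on_const[of _ _ "v \<bullet> w"]] by blast
  moreover have "bilinear (desing \<delta> k z) \<and> (\<forall>v w. desing \<delta> k z v w = desing \<delta> k z w v) \<and> (\<forall>v. v \<noteq> 0 \<longrightarrow> desing \<delta> k z v v > 0)"
    if "k \<in> A" "z \<in> cdom k" "cmap k z \<in> C_tilde A \<phi>" for k z
  proof -
    have "bilinear (desing \<delta> k z)"
      unfolding bilinear_def linear_iff desing_def by (simp add: inner_add_left inner_add_right algebra_simps)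
    then show ?thesis using conformal_factor_pos[OF d(1,2) that] by (simp add: desing_def inner_commute)
  qed
  moreover have "desing \<delta> k z v w = desing \<delta> k' (transition k k' z) (deriv (transition k k') z * v) (deriv (transition k k') z * w)"
    if "k \<in> A" "k' \<in> A" "z \<in> overlap k k'" for k k' z v w
  proof -
    have "(a * v) \<bullet> (a * w) = (cmod a)\<^sup>2 * (v \<bullet> w)" for a
      unfolding cmod_power2 by (simp add: inner_complex_def algebra_simps power2_eq_square)
    then show ?thesis unfolding desing_def using conformal_factor_transition[OF that, of \<delta>] by simp
  qed
  ultimately show 1: "riemannian_metric_on A (C_tilde A \<phi>) (desing \<delta>)"
    unfolding riemannian_metric_on_def by blast
  show 2: "metrics_agree_on A (C_tilde A \<phi> - zero_nhd A \<phi> \<xi> \<rho> (3/2 * \<delta>)) (desing \<delta>) (flat_metric \<phi>)"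
    unfolding metrics_agree_on_def
  proof (intro ballI impI)
    fix k z assume "cmap k z \<in> C_tilde A \<phi> - zero_nhd A \<phi> \<xi> \<rho> (3/2 * \<delta>)"
    then have "conformal_factor \<delta> k z = cmod (\<phi> k z)" by (intro conformal_factor_outer[OF d(1)]) blast
    then show "desing \<delta> k z = flat_metric \<phi> k z" by (intro ext) (simp add: desing_def flat_metric_def)
  qed
  have 3: "\<forall>b\<in>qd_zeros A \<phi>. \<forall>w\<in>ball 0 (\<rho> b) - {0}. \<forall>v v'. desing \<delta> (zchart b) w v v' = cmod w / profile \<delta> (cmod w) * (v \<bullet> v')"
  proof (intro ballI allI)
    fix b and w v v' :: complex assume "b \<in> qd_zeros A \<phi>" "w \<in> ball 0 (\<rho> b) - {0}"
    then show "desing \<delta> (zchart b) w v v' = cmod w / profile \<delta> (cmod w) * (v \<bullet> v')"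
      using conformal_factor_zchart(1)[OF d(1,2), of b w] unfolding desing_def by simp
  qed
  show "desingularized_metric A \<phi> \<xi> \<rho> \<delta> (desing \<delta>)"
    unfolding desingularized_metric_def using 1 2 3 cutoff_profile_profile[OF d(1,2)] by blast
qed

section \<open>Lengths of paths in the desingularized metric\<close>

abbreviation velocity :: "'c coord \<Rightarrow> (real \<Rightarrow> 'c) \<Rightarrow> real \<Rightarrow> complex" where
  "velocity k c t \<equiv> vector_derivative (cinv k \<circ> c) (at t within {0..1})"

text \<open>Velocities are taken within the unit interval, smoothness within the part of it that is
  mapped into a chart; near a point of that part the two notions of limit agree.\<close>

lemma at_within_relatively_open:
  assumes c: "continuous_on {0..1::real} c" and V: "open V" and t: "t \<in> {0..1}" "c t \<in> V"
  shows "at t within {s \<in> {0..1}. c s \<in> V} = at t within {0..1}"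
proof -
  have "openin (top_of_set {0..1}) ({0..1} \<inter> c -` V)" by (rule continuous_openin_preimage_gen[OF c V])
  then obtain T where T: "open T" "{0..1} \<inter> c -` V = {0..1} \<inter> T" unfolding openin_open by blast
  show ?thesis by (rule at_within_nhd[of t T]) (use T t in blast)+
qed

lemma velocity:
  assumes c: "smooth_path_in A X c" and k: "k \<in> A"
  shows "\<And>t. t \<in> {0..1} \<Longrightarrow> c t \<in> cim k \<Longrightarrow> ((cinv k \<circ> c) has_vector_derivative velocity k c t) (at t within {0..1})"
    and "continuous_on {t \<in> {0..1}. c t \<in> cim k} (velocity k c)"
proof -
  let ?S = "{t \<in> {0..1}. c t \<in> cim k}"
  have cc: "continuous_on {0..1} c" using c by (simp add: smooth_path_in_def)
  have "Ck_on (Suc 0) ?S (cinv k \<circ> c)" using c k unfolding smooth_path_in_def smooth_on_def by blast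
  then obtain f' where f': "\<forall>x\<in>?S. ((cinv k \<circ> c) has_derivative f' x) (at x within ?S)" "\<forall>v. continuous_on ?S (\<lambda>x. f' x v)" by auto
  have 1: "((cinv k \<circ> c) has_vector_derivative f' t 1) (at t within {0..1})" if t: "t \<in> {0..1}" "c t \<in> cim k" for t
  proof -
    have "((cinv k \<circ> c) has_derivative f' t) (at t within {0..1})"
      using f'(1) t unfolding at_within_relatively_open[OF cc open_cim[OF k] t, symmetric] by blast
    moreover have "f' t = (\<lambda>x. x *\<^sub>R f' t 1)"
    proof
      fix x
      have "linear (f' t)" using has_derivative_linear[OF calculation] .
      from linear_scale[OF this, of x 1] show "f' t x = x *\<^sub>R f' t 1" by simp
    qed
    ultimately show ?thesis unfolding has_vector_derivative_def by metis
  qed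
  have 2: "velocity k c t = f' t 1" if "t \<in> {0..1}" "c t \<in> cim k" for t
    by (rule vector_derivative_within_closed_interval[OF _ that(1) 1[OF that]]) simp
  show "((cinv k \<circ> c) has_vector_derivative velocity k c t) (at t within {0..1})" if "t \<in> {0..1}" "c t \<in> cim k" for t
    using 1[OF that] 2[OF that] by simp
  show "continuous_on ?S (velocity k c)"
    using f'(2) by (rule_tac continuous_on_eq[of _ "\<lambda>x. f' x 1"]) (use 2 in auto)
qed

lemma velocity_transition:
  assumes c: "smooth_path_in A X c" and k: "k \<in> A" "k' \<in> A" and t: "t \<in> {0..1}" "c t \<in> cim k" "c t \<in> cim k'"
  shows "velocity k' c t = deriv (transition k k') (cinv k (c t)) * velocity k c t"
proof -
  let ?V = "cim k \<inter> cim k'" let ?S = "{s \<in> {0..1}. c s \<in> ?V}"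
  have cc: "continuous_on {0..1} c" using c by (simp add: smooth_path_in_def)
  have eqS: "at t within ?S = at t within {0..1}"
    by (rule at_within_relatively_open[OF cc open_Int[OF open_cim[OF k(1)] open_cim[OF k(2)]] t(1)]) (use t in blast)
  have o: "cinv k (c t) \<in> overlap k k'" using t cinv_in_cdom[OF t(2)] cmap_cinv[OF t(2)] by (simp add: overlap_def)
  have v: "((cinv k \<circ> c) has_vector_derivative velocity k c t) (at t within ?S)"
    using velocity(1)[OF c k(1) t(1,2)] unfolding eqS .
  have "(transition k k' has_field_derivative deriv (transition k k') (cinv k (c t))) (at ((cinv k \<circ> c) t) within (cinv k \<circ> c) ` ?S)"
    using transition_DERIV[OF k o] by (simp add: has_field_derivative_at_within)
  from field_vector_diff_chain_within[OF v this]
  have "((transition k k' \<circ> (cinv k \<circ> c)) has_vector_derivative velocity k c t * deriv (transition k k') (cinv k (c t))) (at t within ?S)" .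
  then have "((cinv k' \<circ> c) has_vector_derivative velocity k c t * deriv (transition k k') (cinv k (c t))) (at t within ?S)"
  proof (rule has_vector_derivative_transform[rotated 2])
    show "t \<in> ?S" using t by blast
    fix s assume "s \<in> ?S"
    then have "cmap k (cinv k (c s)) = c s" by (intro cmap_cinv) blast
    then show "(cinv k' \<circ> c) s = (transition k k' \<circ> (cinv k \<circ> c)) s" by (simp add: transition_def)
  qed
  then have "((cinv k' \<circ> c) has_vector_derivative velocity k c t * deriv (transition k k') (cinv k (c t))) (at t within {0..1})" unfolding eqS .
  from vector_derivative_within_closed_interval[OF _ t(1) this] show ?thesis by (simp add: mult.commute)
qed

text \<open>Conformal factor and velocity transform by compensating powers of |T'|, so the chart
  selected by choice in \<open>path_speed\<close> may be replaced by any other.\<close>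

lemma path_speed:
  assumes c: "smooth_path_in A (C_tilde A \<phi>) c" and k: "k \<in> A" and t: "t \<in> {0..1}" "c t \<in> cim k"
  shows "path_speed A (desing \<delta>) c t = sqrt (conformal_factor \<delta> k (cinv k (c t))) * cmod (velocity k c t)"
proof -
  define k' where "k' = (SOME k. k \<in> A \<and> c t \<in> cim k)"
  have k': "k' \<in> A" "c t \<in> cim k'" using someI_ex[of "\<lambda>k. k \<in> A \<and> c t \<in> cim k"] k t(2) unfolding k'_def by blast+
  have o: "cinv k (c t) \<in> overlap k k'" using k' cinv_in_cdom[OF t(2)] cmap_cinv[OF t(2)] by (simp add: overlap_def)
  have T: "transition k k' (cinv k (c t)) = cinv k' (c t)" using cmap_cinv[OF t(2)] by (simp add: transition_def)
  have "path_speed A (desing \<delta>) c t = sqrt (conformal_factor \<delta> k' (cinv k' (c t)) * (cmod (velocity k' c t))\<^sup>2)"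
    unfolding path_speed_def Let_def k'_def[symmetric] desing_def by (simp add: power2_norm_eq_inner)
  also have "\<dots> = sqrt (conformal_factor \<delta> k (cinv k (c t)) * (cmod (velocity k c t))\<^sup>2)"
    unfolding conformal_factor_transition[OF k k'(1) o, of \<delta>] T velocity_transition[OF c k k'(1) t k'(2)] by (simp add: norm_mult power_mult_distrib algebra_simps)
  finally show ?thesis by (simp add: real_sqrt_mult)
qed

lemma path_speed_continuous:
  assumes d: "0 < \<delta>" "\<delta> \<le> 2/3" "\<And>b. b \<in> qd_zeros A \<phi> \<Longrightarrow> 3/2 * \<delta> < \<rho> b" and c: "smooth_path_in A (C_tilde A \<phi>) c"
  shows "continuous_on {0..1} (path_speed A (desing \<delta>) c)"
  unfolding continuous_on_eq_continuous_within
proof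
  fix t :: real assume t: "t \<in> {0..1}"
  obtain k where k: "k \<in> A" "c t \<in> cim k" using exists_chart[of "c t"] by blast
  let ?S = "{s \<in> {0..1}. c s \<in> cim k}"
  have cc: "continuous_on {0..1} c" "c ` {0..1} \<subseteq> C_tilde A \<phi>" using c by (simp_all add: smooth_path_in_def)
  have c1: "continuous_on ?S (\<lambda>s. cinv k (c s))"
    by (rule continuous_on_compose2[OF cinv_continuous[OF k(1)] continuous_on_subset[OF cc(1)]]) blast+
  have c2: "continuous_on {z \<in> cdom k. cmap k z \<in> C_tilde A \<phi>} (conformal_factor \<delta> k)"
    using Ck_on_conformal_factor[OF d k(1), of 0] by simp
  have c3: "(\<lambda>s. cinv k (c s)) ` ?S \<subseteq> {z \<in> cdom k. cmap k z \<in> C_tilde A \<phi>}"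
  proof (rule image_subsetI)
    fix s assume s: "s \<in> ?S"
    have "c s \<in> cim k" "c s \<in> C_tilde A \<phi>" using s cc(2) by blast+
    then show "cinv k (c s) \<in> {z \<in> cdom k. cmap k z \<in> C_tilde A \<phi>}" using cinv_in_cdom[of "c s" k] cmap_cinv[of "c s" k] by simp
  qed
  have "continuous_on ?S (\<lambda>s. conformal_factor \<delta> k (cinv k (c s)))" by (rule continuous_on_compose2[OF c2 c1 c3])
  then have "continuous_on ?S (\<lambda>s. sqrt (conformal_factor \<delta> k (cinv k (c s))) * cmod (velocity k c s))"
    by (intro continuous_intros velocity(2)[OF c k(1)])
  then have "continuous_on ?S (path_speed A (desing \<delta>) c)"
    by (rule continuous_on_eq) (use path_speed[OF c k(1)] in simp)
  moreover have "t \<in> ?S" using t k(2) by blast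
  ultimately have "continuous (at t within ?S) (path_speed A (desing \<delta>) c)" unfolding continuous_on_eq_continuous_within by (rule bspec)
  then show "continuous (at t within {0..1}) (path_speed A (desing \<delta>) c)"
    unfolding at_within_relatively_open[OF cc(1) open_cim[OF k(1)] t k(2)] .
qed

end

section \<open>Distance to the zeroes and the admissible parameters\<close>

context exact_surface
begin

text \<open>Translates coordinate radii into flat lengths: the disc |w| < r in a zero chart lies
  within flat distance e of the zero when 4/9 r^3 < e^2.\<close>

lemma box_avoids_zero_nhd:
  assumes m: "maxstrip J \<psi>" and e: "0 < e" "\<And>b. b \<in> qd_zeros A \<phi> \<Longrightarrow> 9 * e\<^sup>2 < \<rho> b ^ 3" and z: "ball z e \<subseteq> band J"
    and r: "4/9 * r ^ 3 < e\<^sup>2"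
  shows "\<psi> z \<notin> zero_nhd A \<phi> \<xi> \<rho> r"
proof
  assume "\<psi> z \<in> zero_nhd A \<phi> \<xi> \<rho> r"
  then obtain b w where b: "b \<in> qd_zeros A \<phi>" "w \<in> ball 0 (\<rho> b)" "w \<in> ball 0 r" "\<psi> z = \<xi> b w" unfolding zero_nhd_def by blast
  have "cmod w ^ 3 \<le> r ^ 3" using b(3) by (intro power_mono) auto
  then have "4/9 * cmod w ^ 3 < e\<^sup>2" using r by linarith
  from no_zero_near[OF maxstripD(5)[OF m] z e(1) b(1) e(2)[OF b(1)] b(4,2) this] show False .
qed

text \<open>Until its first exit time T from the flat disc, the speed of the path is that of its
  flat coordinate, so the coordinate remains within the length L < e of z. At time T the path lies
  in the compact image of the disc of radius L, hence has not left. The margin 2 e keeps the metric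
  flat over the whole disc.\<close>

lemma short_path:
  assumes d: "0 < \<delta>" "\<delta> \<le> 2/3" "\<And>b. b \<in> qd_zeros A \<phi> \<Longrightarrow> 3/2 * \<delta> < \<rho> b"
    and e: "0 < e" "\<And>b. b \<in> qd_zeros A \<phi> \<Longrightarrow> 9 * e\<^sup>2 < \<rho> b ^ 3" "4/9 * (3/2 * \<delta>) ^ 3 < e\<^sup>2"
    and m: "maxstrip J \<psi>" and z: "ball z (2 * e) \<subseteq> band J"
    and c: "smooth_path_in A (C_tilde A \<phi>) c" "c 0 = \<psi> z" "integral {0..1} (path_speed A (desing \<delta>) c) < e"
  shows "c 1 \<in> \<psi> ` ball z e"
proof (rule ccontr)
  assume n: "c 1 \<notin> \<psi> ` ball z e"
  let ?k = "(band J, \<psi>)" and ?B = "\<psi> ` ball z e" and ?sp = "path_speed A (desing \<delta>) c"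
  have zB: "ball z e \<subseteq> band J" using z e(1) by (meson ball_subset_ball_iff order_trans subset_ball less_imp_le mult_le_cancel_right1 one_le_numeral)
  have kA: "?k \<in> A" using maxstrip_flat_coordinate[OF m] by (rule flat_coordinates_atlas)
  have k1: "\<phi> ?k w = 1" if "w \<in> band J" for w using maxstrip_flat_coordinate[OF m] that by (simp add: flat_coordinates_def)
  have cc: "continuous_on {0..1} c" using c(1) by (simp add: smooth_path_in_def)
  have oB: "open ?B" using cmap_open_image[OF kA open_ball, of z e] zB by simp
  have Bk: "cinv ?k x \<in> ball z e" "x \<in> cim ?k" if "x \<in> ?B" for x
    using that zB cinv_cmap[OF kA] by auto
  let ?X = "{t \<in> {0..1}. c t \<in> - ?B}"
  define T where "T = Inf ?X"
  have cX: "closed ?X" using continuous_closed_preimage[OF cc closed_atLeastAtMost closed_Compl[OF oB]] by (simp add: vimage_def Int_def)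
  have X1: "1 \<in> ?X" using n by simp
  have bX: "bdd_below ?X" by (rule bdd_belowI[of _ 0]) simp
  have TX: "T \<in> ?X" unfolding T_def by (rule closed_contains_Inf[OF _ bX cX]) (use X1 in blast)
  have before: "c t \<in> ?B" if "0 \<le> t" "t < T" for t
  proof (rule ccontr)
    assume "c t \<notin> ?B"
    then have "t \<in> ?X" using that TX by simp
    then have "T \<le> t" unfolding T_def by (intro cInf_lower bX)
    then show False using that by simp
  qed
  have c0: "c 0 \<in> ?B" using c(2) e(1) by simp
  have T: "0 < T" "T \<le> 1" using TX c0 by (auto simp: le_less)
  have speed: "?sp t = cmod (velocity ?k c t)" if t: "t \<in> {0..1}" "c t \<in> ?B" for t
  proof -
    obtain w where w: "c t = \<psi> w" "w \<in> ball z e" using t(2) by blast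
    have "ball w e \<subseteq> ball z (2 * e)"
    proof
      fix v assume "v \<in> ball w e"
      then show "v \<in> ball z (2 * e)" using w(2) dist_triangle[of z v w] by simp
    qed
    then have "ball w e \<subseteq> band J" using z by blast
    then have "\<psi> w \<notin> zero_nhd A \<phi> \<xi> \<rho> (3/2 * \<delta>)" by (intro box_avoids_zero_nhd[OF m e(1,2) _ e(3)])
    moreover have "cmap ?k (cinv ?k (c t)) = \<psi> w" using cmap_cinv[OF Bk(2)[OF t(2)]] w(1) by simp
    ultimately have "conformal_factor \<delta> ?k (cinv ?k (c t)) = cmod (\<phi> ?k (cinv ?k (c t)))" by (intro conformal_factor_outer[OF d(1)]) simp
    also have "\<dots> = 1" using k1 Bk(1)[OF t(2)] zB by (simp add: subset_iff)
    finally show ?thesis using path_speed[OF c(1) kA t(1) Bk(2)[OF t(2)], of \<delta>] by simp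
  qed
  have spc: "continuous_on {0..1} ?sp" by (rule path_speed_continuous[OF d c(1)])
  have sp0: "0 \<le> ?sp t" if t: "t \<in> {0..1}" for t
  proof -
    obtain k where k: "k \<in> A" "c t \<in> cim k" using exists_chart[of "c t"] by blast
    have "c t \<in> C_tilde A \<phi>" using c(1) t unfolding smooth_path_in_def by blast
    then have "0 < conformal_factor \<delta> k (cinv k (c t))"
      using conformal_factor_pos[OF d(1,2) k(1) cinv_in_cdom[OF k(2)]] cmap_cinv[OF k(2)] by simp
    then show ?thesis using path_speed[OF c(1) k(1) t k(2), of \<delta>] by simp
  qed
  define L where "L = integral {0..1} ?sp"
  have close: "cinv ?k (c t) \<in> cball z L" if t: "0 \<le> t" "t < T" for t
  proof -
    have tt: "s \<in> {0..1}" "c s \<in> ?B" if "s \<in> {0..t}" for s using that t T before[of s] by simp_all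
    have sub: "{0..t} \<subseteq> {0..1}" using t T by auto
    have "((cinv ?k \<circ> c) has_vector_derivative velocity ?k c s) (at s within {0..t})" if "s \<in> {0..t}" for s
      using velocity(1)[OF c(1) kA tt(1)[OF that] Bk(2)[OF tt(2)[OF that]]] sub by (rule has_vector_derivative_within_subset)
    then have int: "(velocity ?k c has_integral (cinv ?k \<circ> c) t - (cinv ?k \<circ> c) 0) {0..t}"
      by (intro fundamental_theorem_of_calculus t(1))
    have i1: "?sp integrable_on {0..1}" by (rule integrable_continuous_real[OF spc])
    have i2: "?sp integrable_on {0..t}" by (rule integrable_continuous_real[OF continuous_on_subset[OF spc sub]])
    have "cmod (integral {0..t} (velocity ?k c)) \<le> integral {0..t} ?sp"
      by (rule integral_norm_bound_integral[OF has_integral_integrable[OF int] i2]) (use speed tt in simp)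
    also have "\<dots> \<le> L" unfolding L_def by (rule integral_subset_le[OF sub i2 i1]) (use sp0 in blast)
    finally have "cmod (cinv ?k (c t) - cinv ?k (c 0)) \<le> L" using integral_unique[OF int] by simp
    moreover have "z \<in> band J" by (rule subsetD[OF zB]) (use e(1) in simp)
    then have "cinv ?k (c 0) = z" using cinv_cmap[OF kA, of z] c(2) by simp
    ultimately show ?thesis by (simp add: dist_norm norm_minus_commute)
  qed
  have Le: "L < e" using c(3) by (simp add: L_def)
  have cl: "closed (\<psi> ` cball z L)"
  proof (intro compact_imp_closed compact_continuous_image compact_cball)
    have "cball z L \<subseteq> band J" using Le zB by (auto simp: subset_iff)
    then show "continuous_on (cball z L) \<psi>" using cmap_continuous[OF kA] continuous_on_subset by fastforce
  qed
  have "c T \<in> \<psi> ` cball z L"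
  proof (rule Lim_in_closed_set[OF cl])
    have "(c \<longlongrightarrow> c T) (at T within {0..1})" using cc TX unfolding continuous_on_def by blast
    then show "(c \<longlongrightarrow> c T) (at T within {0..<T})" by (rule tendsto_within_subset) (use T in auto)
    show "at T within {0..<T} \<noteq> bot" using T by (simp add: at_within_eq_bot_iff closure_greaterThanLessThan)
    have "c t \<in> \<psi> ` cball z L" if t: "t \<in> {0..<T}" for t
    proof -
      have "c t \<in> ?B" "cinv ?k (c t) \<in> cball z L" using before[of t] close[of t] t by simp_all
      moreover have "\<psi> (cinv ?k (c t)) = c t" using cmap_cinv[OF Bk(2)[OF calculation(1)]] by simp
      ultimately show ?thesis by (metis imageI)
    qed
    then show "\<forall>\<^sub>F t in at T within {0..<T}. c t \<in> \<psi> ` cball z L" by (auto simp: eventually_at_filter)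
  qed
  moreover have "cball z L \<subseteq> ball z e" using Le by auto
  ultimately show False using TX by blast
qed

text \<open>With \<eta> = 1/2 the two radii are 3/2 \<delta> and 5/2 \<delta>. A path of length less
  than e starting more than 2 e from the edges ends in the flat disc of radius e, still farther than
  e from the edges, and \<open>box_avoids_zero_nhd\<close> applies.\<close>

lemma desing_admissible:
  assumes d: "0 < \<delta>" "\<delta> \<le> 2/3" "\<And>b. b \<in> qd_zeros A \<phi> \<Longrightarrow> 3/2 * \<delta> < \<rho> b"
    and e: "0 < e" "\<And>b. b \<in> qd_zeros A \<phi> \<Longrightarrow> 9 * e\<^sup>2 < \<rho> b ^ 3" "4/9 * (5/2 * \<delta>) ^ 3 < e\<^sup>2"
  shows "admissible_parameters A \<phi> \<xi> \<rho> \<delta> (desing \<delta>) (2 * e) e (1/2)"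
proof -
  have d3: "4/9 * (3/2 * \<delta>) ^ 3 < e\<^sup>2"
  proof -
    have "(3/2 * \<delta>) ^ 3 \<le> (5/2 * \<delta>) ^ 3" using d(1) by (intro power_mono) auto
    then show ?thesis using e(3) by linarith
  qed
  have far: "riemannian_nhd A (C_tilde A \<phi>) (desing \<delta>) e (\<gamma> ` I) \<inter> zero_nhd A \<phi> \<xi> \<rho> (5/2 * \<delta>) = {}"
    if m: "maxstrip J \<psi>" and g: "\<gamma> ` I \<subseteq> \<psi> ` Z" and Z: "\<And>z. z \<in> Z \<Longrightarrow> ball z (2 * e) \<subseteq> band J" for J \<psi> \<gamma> I Z
  proof (rule equals0I)
    fix x assume x: "x \<in> riemannian_nhd A (C_tilde A \<phi>) (desing \<delta>) e (\<gamma> ` I) \<inter> zero_nhd A \<phi> \<xi> \<rho> (5/2 * \<delta>)"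
    then obtain c where c: "smooth_path_in A (C_tilde A \<phi>) c" "c 0 \<in> \<gamma> ` I" "integral {0..1} (path_speed A (desing \<delta>) c) < e" "x = c 1"
      unfolding riemannian_nhd_def by blast
    have "c 0 \<in> \<psi> ` Z" using c(2) g by blast
    then obtain z where z: "c 0 = \<psi> z" "z \<in> Z" by blast
    have "c 1 \<in> \<psi> ` ball z e" by (rule short_path[OF d e(1,2) d3 m Z[OF z(2)] c(1) z(1) c(3)])
    then obtain w where w: "x = \<psi> w" "w \<in> ball z e" using c(4) by blast
    have "ball w e \<subseteq> ball z (2 * e)"
    proof
      fix v assume "v \<in> ball w e"
      then show "v \<in> ball z (2 * e)" using w(2) dist_triangle[of z v w] by simp
    qed
    from order_trans[OF this Z[OF z(2)]] have "\<psi> w \<notin> zero_nhd A \<phi> \<xi> \<rho> (5/2 * \<delta>)" by (intro box_avoids_zero_nhd[OF m e(1,2) _ e(3)])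
    then show False using x w(1) by blast
  qed
  have dI: "\<bar>Im v - Im z\<bar> < 2 * e" if "v \<in> ball z (2 * e)" for v z :: complex
    using abs_Im_le_cmod[of "v - z"] that by (simp add: dist_norm norm_minus_commute)
  have 1: "riemannian_nhd A (C_tilde A \<phi>) (desing \<delta>) e (\<gamma> ` I) \<inter> zero_nhd A \<phi> \<xi> \<rho> (5/2 * \<delta>) = {}"
    if s: "strip_coordinate A \<phi> a b \<psi>" "\<gamma> ` I \<subseteq> \<psi> ` open_strip (a + 2 * e) (b - 2 * e)" for a b \<psi> \<gamma> I
  proof (rule far[OF strip_coordinate_maxstrip(2)[OF s(1)] s(2)], rule subsetI)
    fix z v assume "z \<in> open_strip (a + 2 * e) (b - 2 * e)" "v \<in> ball z (2 * e)"
    then show "v \<in> band {a<..<b}" using dI[of v z] unfolding open_strip_def band_def by auto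
  qed
  have 2: "riemannian_nhd A (C_tilde A \<phi>) (desing \<delta>) e (\<gamma> ` I) \<inter> zero_nhd A \<phi> \<xi> \<rho> (5/2 * \<delta>) = {}"
    if s: "half_plane_coordinate A \<phi> \<psi>" "\<gamma> ` I \<subseteq> \<psi> ` {z. Im z > 2 * e}" for \<psi> \<gamma> I
  proof (rule far[OF half_plane_coordinate_maxstrip[OF s(1)] s(2)], rule subsetI)
    fix z v assume "z \<in> {z. Im z > 2 * e}" "v \<in> ball z (2 * e)"
    then show "v \<in> band {0<..}" using dI[of v z] unfolding band_def by auto
  qed
  have num: "(2 - 1/2) * \<delta> = 3/2 * \<delta>" "(2 + 1/2) * \<delta> = 5/2 * \<delta>" by simp_all
  show ?thesis
    unfolding admissible_parameters_def num
  proof (intro conjI allI impI)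
    fix I \<gamma>
    assume "horizontal_trajectory A \<phi> I \<gamma> \<and>
      ((\<exists>a b \<psi>. strip_coordinate A \<phi> a b \<psi> \<and> \<gamma> ` I \<subseteq> \<psi> ` open_strip (a + 2 * e) (b - 2 * e)) \<or>
       (\<exists>\<psi>. half_plane_coordinate A \<phi> \<psi> \<and> \<gamma> ` I \<subseteq> \<psi> ` {z. Im z > 2 * e}))"
    then show "riemannian_nhd A (C_tilde A \<phi>) (desing \<delta>) e (\<gamma> ` I) \<inter> zero_nhd A \<phi> \<xi> \<rho> (5/2 * \<delta>) = {}"
    proof (elim conjE disjE exE)
      fix a b \<psi> assume "strip_coordinate A \<phi> a b \<psi>" "\<gamma> ` I \<subseteq> \<psi> ` open_strip (a + 2 * e) (b - 2 * e)"
      then show ?thesis by (rule 1)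
    next
      fix \<psi> assume "half_plane_coordinate A \<phi> \<psi>" "\<gamma> ` I \<subseteq> \<psi> ` {z. Im z > 2 * e}"
      then show ?thesis by (rule 2)
    qed
  qed (use e(1) desing_metric(2)[OF d] in simp_all)
qed

lemma desing_flat_region:
  assumes d: "0 < \<delta>" and e: "0 < e" "e < E" "\<And>b. b \<in> qd_zeros A \<phi> \<Longrightarrow> 9 * e\<^sup>2 < \<rho> b ^ 3" "4/9 * (3/2 * \<delta>) ^ 3 < e\<^sup>2"
  shows "metrics_agree_on A (C_region A \<phi> e E) (desing \<delta>) (flat_metric \<phi>)"
  unfolding metrics_agree_on_def
proof (intro ballI impI)
  fix k z assume k: "cmap k z \<in> C_region A \<phi> e E"
  obtain J \<psi> w where w: "maxstrip J \<psi>" "w \<in> flat_box e E J" "\<psi> w = cmap k z" by (rule C_region_in_maxstrip[OF e(1,2) k])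
  have "conformal_factor \<delta> k z = cmod (\<phi> k z)"
    using conformal_factor_outer[OF d] box_avoids_zero_nhd[OF w(1) e(1,3) box_ball_subset[OF w(2)] e(4)] unfolding w(3) by blast
  then show "desing \<delta> k z = flat_metric \<phi> k z" by (intro ext) (simp add: desing_def flat_metric_def)
qed

end

section \<open>Holomorphic strips\<close>

definition strip_interior :: "complex set" where
  "strip_interior = {w. 0 < Im w \<and> Im w < 1}"

lemma strip_interior:
  "open strip_interior" "connected strip_interior" "strip_interior \<subseteq> closed_strip" "convex closed_strip" "closed closed_strip"
proof -
  have eq: "strip_interior = {w. Im w > 0} \<inter> {w. Im w < 1}" by (auto simp: strip_interior_def)
  show "open strip_interior" unfolding eq by (intro open_Int open_halfspace_Im_gt open_halfspace_Im_lt)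
  show "connected strip_interior" unfolding eq by (intro convex_connected convex_Int convex_halfspace_Im_gt convex_halfspace_Im_lt)
  show "strip_interior \<subseteq> closed_strip" by (auto simp: strip_interior_def closed_strip_def)
  have eq': "closed_strip = {w. Im w \<ge> 0} \<inter> {w. Im w \<le> 1}" by (auto simp: closed_strip_def)
  show "convex closed_strip" unfolding eq' by (intro convex_Int convex_halfspace_Im_ge convex_halfspace_Im_le)
  show "closed closed_strip" unfolding eq' by (intro closed_Int closed_halfspace_Im_ge closed_halfspace_Im_le)
qed

lemma closed_strip_closure: "closed_strip \<subseteq> closure strip_interior"
proof
  fix w assume w: "w \<in> closed_strip"
  show "w \<in> closure strip_interior"
    unfolding closure_approachable
  proof (intro allI impI)
    fix e :: real assume e: "e > 0"
    define s where "s = min (1/2) (e/2)"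
    have s: "0 < s" "s < 1" "s < e" using e by (auto simp: s_def)
    have wi: "0 \<le> Im w" "Im w \<le> 1" using w by (auto simp: closed_strip_def)
    define v where "v = Complex (Re w) ((1 - s) * Im w + s / 2)"
    have "(1 - s) * Im w \<le> 1 - s" "0 \<le> (1 - s) * Im w" using s wi by (simp_all add: mult_left_le)
    then have "0 < Im v" "Im v < 1" using s unfolding v_def complex.sel by linarith+
    then have "v \<in> strip_interior" by (simp add: strip_interior_def)
    moreover have "dist v w < e"
    proof -
      have "v - w = Complex 0 (s * (1/2 - Im w))" by (simp add: v_def complex_eq_iff algebra_simps)
      then have "dist v w = s * \<bar>1/2 - Im w\<bar>" using s by (simp add: dist_norm cmod_def abs_mult)
      also have "\<dots> \<le> s * 1" using wi s by (intro mult_left_mono) auto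
      finally show ?thesis using s by simp
    qed
    ultimately show "\<exists>y\<in>strip_interior. dist y w < e" by blast
  qed
qed

lemma closed_strip_const:
  fixes f :: "complex \<Rightarrow> real"
  assumes "continuous_on closed_strip f" "\<And>w. w \<in> strip_interior \<Longrightarrow> f w \<in> C" "closed C" "w \<in> closed_strip"
  shows "f w \<in> C"
proof -
  have "closed (closed_strip \<inter> f -` C)" by (rule continuous_closed_preimage[OF assms(1) strip_interior(5) assms(3)])
  moreover have "strip_interior \<subseteq> closed_strip \<inter> f -` C" using assms(2) strip_interior(3) by blast
  ultimately have "closure strip_interior \<subseteq> closed_strip \<inter> f -` C" by (rule closure_minimal[rotated])
  then show ?thesis using closed_strip_closure assms(4) by blast
qed

section \<open>The maximum principle on level sets in the strip\<close>

lemma holomorphic_const_Im: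
  assumes W: "W holomorphic_on S" "open S" "connected S" and c: "\<And>w. w \<in> S \<Longrightarrow> Im (W w) = c"
  shows "W constant_on S"
proof (rule ccontr)
  assume n: "\<not> W constant_on S"
  then obtain w where w: "w \<in> S" unfolding constant_on_def by blast
  have "open (W ` S)" by (rule open_mapping_thm[OF W W(2) order_refl n])
  then obtain e where e: "e > 0" "ball (W w) e \<subseteq> W ` S" using w by (meson imageI openE)
  have "W w + \<i> * of_real (e/2) \<in> ball (W w) e" using e(1) by (simp add: dist_norm norm_mult)
  then obtain v where v: "v \<in> S" "W v = W w + \<i> * of_real (e/2)" using e(2) by (metis imageE subsetD)
  have "Im (W v) = Im (W w) + e/2" unfolding v(2) by simp
  then show False using c[OF v(1)] c[OF w] e(1) by simp
qed

text \<open>On an arc of a level set of \<open>Im W\<close> the function \<open>Re W\<close> cannot have a local maximum, because \<open>W\<close> is open.\<close>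

lemma level_set_below:
  fixes p :: "complex \<Rightarrow> real"
  assumes K: "compact K" and p: "continuous_on K p" and bd: "\<And>w. w \<in> K \<Longrightarrow> w \<notin> strip_interior \<Longrightarrow> p w = p0"
    and loc: "\<And>w. w \<in> K \<Longrightarrow> w \<in> strip_interior \<Longrightarrow> \<exists>r>0. \<exists>W. W holomorphic_on ball w r \<and> ball w r \<subseteq> strip_interior \<and>
      (\<forall>v\<in>ball w r. v \<in> K \<longleftrightarrow> Im (W v) = \<kappa>) \<and> (\<forall>v\<in>ball w r. p v = Re (W v))"
    and w: "w \<in> K" "w \<in> strip_interior"
  shows "p w < p0"
proof (rule ccontr)
  assume n: "\<not> p w < p0"
  obtain m where m: "m \<in> K" "\<forall>v\<in>K. p v \<le> p m" using continuous_attains_sup[OF K _ p] w(1) by blast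
  let ?M = "{v \<in> K. v \<in> strip_interior \<and> p v = p m}"
  \<comment> \<open>If m lies on the boundary, the maximum is p0, which is at most p w, so w is
    itself an interior maximum.\<close>
  have ne: "?M \<noteq> {}"
  proof (cases "m \<in> strip_interior")
    case False
    then have "p w = p m" using bd[OF m(1)] n m(2) w(1) by fastforce
    then show ?thesis using w by blast
  qed (use m in blast)
  have "\<exists>r>0. ball v r \<subseteq> ?M" if v: "v \<in> ?M" for v
  proof -
    obtain r W where r: "r > 0" "W holomorphic_on ball v r" "ball v r \<subseteq> strip_interior"
      "\<forall>y\<in>ball v r. y \<in> K \<longleftrightarrow> Im (W y) = \<kappa>" "\<forall>y\<in>ball v r. p y = Re (W y)" using loc[of v] v by blast
    have vb: "v \<in> ball v r" using r(1) by simp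
    have Wv: "Im (W v) = \<kappa>" "Re (W v) = p m" using r(4,5) vb v by auto
    have "W constant_on ball v r"
    proof (rule ccontr)
      assume nc: "\<not> W constant_on ball v r"
      have "open (W ` ball v r)" by (rule open_mapping_thm[OF r(2) open_ball connected_ball open_ball order_refl nc])
      then obtain e where e: "e > 0" "ball (W v) e \<subseteq> W ` ball v r" using vb by (meson imageI openE)
      have "W v + of_real (e/2) \<in> ball (W v) e" using e(1) by (simp add: dist_norm)
      then obtain y where y: "y \<in> ball v r" "W y = W v + of_real (e/2)" using e(2) by (metis imageE subsetD)
      have "Im (W y) = \<kappa>" "Re (W y) = p m + e/2" unfolding y(2) using Wv by simp_all
      then have "y \<in> K" "p y = p m + e/2" using r(4,5) y(1) by auto
      then show False using m(2) e(1) by fastforce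
    qed
    then have "W y = W v" if "y \<in> ball v r" for y using that vb unfolding constant_on_def by metis
    then have "ball v r \<subseteq> ?M" using r(3,4,5) Wv by auto
    then show ?thesis using r(1) by blast
  qed
  then have oM: "open ?M" unfolding open_contains_ball by blast
  have "closed (K \<inter> p -` {p m})" by (rule continuous_closed_preimage[OF p compact_imp_closed[OF K] closed_singleton])
  moreover have "?M = strip_interior \<inter> (K \<inter> p -` {p m})" by blast
  ultimately have "closedin (top_of_set strip_interior) ?M" by (metis closedin_closed_Int)
  moreover have "openin (top_of_set strip_interior) ?M" using oM by (intro open_subset) blast
  ultimately have "?M = strip_interior" using strip_interior(2) ne unfolding connected_clopen by blast
  then have "strip_interior \<subseteq> K" by blast
  then have "bounded strip_interior" using compact_imp_bounded[OF K] bounded_subset by blast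
  then obtain B where B: "\<forall>x\<in>strip_interior. norm x \<le> B" unfolding bounded_iff by blast
  have "Complex (\<bar>B\<bar> + 1) (1/2) \<in> strip_interior" by (simp add: strip_interior_def)
  then have "norm (Complex (\<bar>B\<bar> + 1) (1/2)) \<le> B" using B by blast
  then show False using complex_Re_le_cmod[of "Complex (\<bar>B\<bar> + 1) (1/2)"] by simp
qed

text \<open>The estimate of \<open>level_set_below\<close> for p is incompatible with the one for -
  p, obtained with - W in place of W.\<close>

lemma level_set_empty:
  fixes p :: "complex \<Rightarrow> real"
  assumes K: "compact K" and p: "continuous_on K p" and bd: "\<And>w. w \<in> K \<Longrightarrow> w \<notin> strip_interior \<Longrightarrow> p w = p0"
    and loc: "\<And>w. w \<in> K \<Longrightarrow> w \<in> strip_interior \<Longrightarrow> \<exists>r>0. \<exists>W. W holomorphic_on ball w r \<and> ball w r \<subseteq> strip_interior \<and>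
      (\<forall>v\<in>ball w r. v \<in> K \<longleftrightarrow> Im (W v) = \<kappa>) \<and> (\<forall>v\<in>ball w r. p v = Re (W v))"
    and w: "w \<in> K" "w \<in> strip_interior"
  shows False
proof -
  have "p w < p0" by (rule level_set_below[OF K p bd loc w])
  moreover have "- p w < - p0"
  proof (rule level_set_below[OF K _ _ _ w])
    show "continuous_on K (\<lambda>w. - p w)" using p by (rule continuous_on_minus)
    fix v assume v: "v \<in> K"
    show "- p v = - p0" if "v \<notin> strip_interior" using bd[OF v that] by simp
    assume vi: "v \<in> strip_interior"
    obtain r W where r: "r > 0" "W holomorphic_on ball v r" "ball v r \<subseteq> strip_interior"
      "\<forall>y\<in>ball v r. y \<in> K \<longleftrightarrow> Im (W y) = \<kappa>" "\<forall>y\<in>ball v r. p y = Re (W y)" using loc[OF v vi] by blast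
    have "(\<lambda>y. - W y) holomorphic_on ball v r" using r(2) by (rule holomorphic_on_minus)
    moreover have "\<forall>y\<in>ball v r. y \<in> K \<longleftrightarrow> Im (- W y) = - \<kappa>" "\<forall>y\<in>ball v r. - p y = Re (- W y)" using r(4,5) by simp_all
    ultimately show "\<exists>r>0. \<exists>W. W holomorphic_on ball v r \<and> ball v r \<subseteq> strip_interior \<and>
      (\<forall>y\<in>ball v r. y \<in> K \<longleftrightarrow> Im (W y) = - \<kappa>) \<and> (\<forall>y\<in>ball v r. - p y = Re (W y))" using r(1,3) by blast
  qed
  ultimately show False by simp
qed

section \<open>The flat Sasaki structure and continuity in the cotangent bundle\<close>

lemma covector_coeff_inner: "covector_coeff (\<lambda>w. v \<bullet> w) = cnj v"
  by (simp add: covector_coeff_def inner_complex_def complex_eq_iff)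

text \<open>Constant coefficients have no connection term, so the splitting is the trivial one. The
  conjugations come from the identification of p with the covector w \<mapsto> Re (p w), under which
  the Euclidean dual of v has coefficient \<open>cnj v\<close>.\<close>

lemma sasaki_flat:
  assumes D: "open D" "z \<in> D" and G: "\<And>x v w. x \<in> D \<Longrightarrow> G x v w = v \<bullet> w"
  shows "sasaki G (z, p) X = (cnj (snd X), - cnj (fst X))"
proof -
  have fd: "frechet_derivative (\<lambda>x. G x b c) (at z) = (\<lambda>_. 0)" for b c
  proof -
    have "((\<lambda>x. b \<bullet> c) has_derivative (\<lambda>_. 0)) (at z)" by (rule has_derivative_const)
    then have "((\<lambda>x. G x b c) has_derivative (\<lambda>_. 0)) (at z)"
      by (rule has_derivative_transform_within_open[OF _ D]) (use G in simp)
    from frechet_derivative_at[OF this] show ?thesis by simp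
  qed
  have Gz: "G z v w = v \<bullet> w" for v w by (rule G[OF D(2)])
  have ch: "christoffel G z a b = 0" for a b
    unfolding christoffel_def Let_def fd Gz
  proof (rule the_equality)
    fix v :: complex assume "\<forall>c. v \<bullet> c = (0 + 0 - 0) / 2"
    from spec[OF this, of v] show "v = 0" by simp
  qed simp
  have ct: "connection_term G (z, p) v = 0" for v by (simp add: connection_term_def ch covector_coeff_def)
  have ii: "Re (\<alpha> * w) = cnj \<alpha> \<bullet> w" for \<alpha> w by (simp add: inner_complex_def)
  have sh: "sharp_op G z \<alpha> = cnj \<alpha>" for \<alpha>
    unfolding sharp_op_def Gz ii
  proof (rule the_equality)
    show "v = cnj \<alpha>" if "\<forall>w. v \<bullet> w = cnj \<alpha> \<bullet> w" for v using that unfolding vector_eq_rdot .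
  qed (rule allI, rule refl)
  have "G z v = (\<lambda>w. v \<bullet> w)" for v using Gz by blast
  then have fl: "flat_op G z v = cnj v" for v by (simp add: flat_op_def covector_coeff_inner)
  show ?thesis unfolding sasaki_def to_splitting_def from_splitting_def Let_def by (cases X) (simp add: ct sh fl)
qed

lemma complex_linear_has_field_derivative:
  assumes "(f has_derivative M) (at w)" "\<And>x. M (\<i> * x) = \<i> * M x"
  shows "(f has_field_derivative M 1) (at w)"
proof -
  have "M x = M 1 * x" for x
  proof -
    have l: "linear M" using assms(1) by (rule has_derivative_linear)
    have "x = Re x *\<^sub>R 1 + Im x *\<^sub>R (\<i> * 1)" by (simp add: complex_eq_iff)
    then have "M x = Re x *\<^sub>R M 1 + Im x *\<^sub>R M (\<i> * 1)" by (metis linear_add[OF l] linear_scale[OF l])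
    also have "\<dots> = M 1 * (of_real (Re x) + \<i> * of_real (Im x))" unfolding assms(2) by (simp add: scaleR_conv_of_real algebra_simps)
    finally show ?thesis by (simp flip: complex_eq)
  qed
  then have "M = (*) (M 1)" by blast
  then show ?thesis using assms(1) unfolding has_field_derivative_def by metis
qed

context gmn_surface
begin

lemma openin_cot_chart: "k \<in> A \<Longrightarrow> open W \<Longrightarrow> openin (cot_topology A \<phi>) {y \<in> cotangent_bundle A \<phi>. fst y \<in> cim k \<and> cot_chart k y \<in> W}"
  unfolding cot_topology_def openin_topology_generated_by_iff by (rule generate_topology_on.Basis) blast

lemma openin_cot_base:
  assumes "open V"
  shows "openin (cot_topology A \<phi>) {y \<in> cotangent_bundle A \<phi>. fst y \<in> V}"
proof (subst openin_subopen, intro ballI)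
  fix y assume y: "y \<in> {y \<in> cotangent_bundle A \<phi>. fst y \<in> V}"
  obtain k where k: "k \<in> A" "fst y \<in> cim k" using exists_chart[of "fst y"] by blast
  let ?W = "{z \<in> cdom k. cmap k z \<in> V} \<times> (UNIV :: complex set)"
  let ?N = "{y \<in> cotangent_bundle A \<phi>. fst y \<in> cim k \<and> cot_chart k y \<in> ?W}"
  have "open ?W" by (intro open_Times open_chart_preimage[OF k(1) assms] open_UNIV)
  from openin_cot_chart[OF k(1) this] have "openin (cot_topology A \<phi>) ?N" .
  moreover have "y \<in> ?N" using y k(2) cinv_in_cdom[OF k(2)] cmap_cinv[OF k(2)] by (simp add: cot_chart_def)
  moreover have "?N \<subseteq> {y \<in> cotangent_bundle A \<phi>. fst y \<in> V}"
  proof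
    fix y assume "y \<in> ?N"
    then have "y \<in> cotangent_bundle A \<phi>" "fst y \<in> cim k" "cmap k (cinv k (fst y)) \<in> V" by (simp_all add: cot_chart_def)
    then show "y \<in> {y \<in> cotangent_bundle A \<phi>. fst y \<in> V}" using cmap_cinv[of "fst y" k] by simp
  qed
  ultimately show "\<exists>T. openin (cot_topology A \<phi>) T \<and> y \<in> T \<and> T \<subseteq> {y \<in> cotangent_bundle A \<phi>. fst y \<in> V}"
    by (intro exI[of _ ?N] conjI)
qed

lemma topspace_cot: "topspace (cot_topology A \<phi>) \<subseteq> cotangent_bundle A \<phi>"
  unfolding cot_topology_def topology_generated_by_topspace
  by (rule Union_least, unfold mem_Collect_eq, elim exE conjE, simp only:, rule Collect_restrict)

lemma cot_map_base:
  assumes u: "continuous_map (top_of_set S) (cot_topology A \<phi>) u"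
  shows "w \<in> S \<Longrightarrow> u w \<in> cotangent_bundle A \<phi>" and "continuous_on S (\<lambda>w. fst (u w))"
proof -
  show cb: "u w \<in> cotangent_bundle A \<phi>" if "w \<in> S" for w
  proof -
    have "u w \<in> topspace (cot_topology A \<phi>)" using continuous_map_image_subset_topspace[OF u] that by auto
    then show ?thesis using topspace_cot by blast
  qed
  have "continuous_map (top_of_set S) euclidean (\<lambda>w. fst (u w))"
    unfolding continuous_map_def
  proof (intro conjI allI impI)
    fix V :: "'c set" assume "openin euclidean V"
    then have "openin (cot_topology A \<phi>) {y \<in> cotangent_bundle A \<phi>. fst y \<in> V}" by (intro openin_cot_base) simp
    note openin_continuous_map_preimage[OF u this]
    moreover have "{x \<in> topspace (top_of_set S). u x \<in> {y \<in> cotangent_bundle A \<phi>. fst y \<in> V}} = {x \<in> topspace (top_of_set S). fst (u x) \<in> V}"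
      by (rule Collect_cong) (use cb in auto)
    ultimately show "openin (top_of_set S) {x \<in> topspace (top_of_set S). fst (u x) \<in> V}" by (simp only:)
  qed simp
  then show "continuous_on S (\<lambda>w. fst (u w))" by simp
qed

end

text \<open>In a flat coordinate the rescaled curve over x has the fibre coordinates \<epsilon> and
  - \<epsilon>, so one open set W containing both points controls the two ends, whichever limits
  occur. Uniformity of the limits makes the exceptional part of the strip bounded.\<close>

lemma (in gmn_surface) strip_end:
  assumes hs: "holomorphic_strip A \<phi> g \<epsilon> x u" and k: "k \<in> flat_coordinates A \<phi>" "x \<in> cim k"
    and W: "open W" "(cinv k x, of_real \<epsilon>) \<in> W" "(cinv k x, - of_real \<epsilon>) \<in> W"
  obtains R where "\<And>w. w \<in> closed_strip \<Longrightarrow> R \<le> \<bar>Re w\<bar> \<Longrightarrow> fst (u w) \<in> cim k \<and> cot_chart k (u w) \<in> W"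
proof -
  have kA: "k \<in> A" using k(1) by (rule flat_coordinates_atlas)
  let ?N = "{y \<in> cotangent_bundle A \<phi>. fst y \<in> cim k \<and> cot_chart k y \<in> W}"
  have N: "y \<in> ?N" if y: "y \<in> cofibre A \<phi> x \<inter> rescale \<epsilon> ` spectral_curve A \<phi>" for y
  proof -
    obtain y' where y': "y' \<in> spectral_curve A \<phi>" "y = rescale \<epsilon> y'" using y by blast
    have fy: "fst y = x" "y \<in> cotangent_bundle A \<phi>" using y by (simp_all add: cofibre_def)
    have "fst y' = x" using fy(1) y'(2) by (simp add: rescale_def)
    then have "(snd y' k)\<^sup>2 = \<phi> k (cinv k x)" using spectral_sq[OF y'(1) kA] k(2) by simp
    also have "\<dots> = 1" using k(1) cinv_in_cdom[OF k(2)] unfolding flat_coordinates_def by blast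
    finally have "snd y' k = 1 \<or> snd y' k = -1" by (simp add: power2_eq_1_iff)
    then have "snd y k = of_real \<epsilon> \<or> snd y k = - of_real \<epsilon>" unfolding y'(2) rescale_def by auto
    then show ?thesis using fy k(2) W(2,3) by (auto simp: cot_chart_def)
  qed
  have oN: "openin (cot_topology A \<phi>) ?N" by (rule openin_cot_chart[OF kA W(1)])
  obtain y1 where y1: "y1 \<in> cofibre A \<phi> x \<inter> rescale \<epsilon> ` spectral_curve A \<phi>"
    "limitin (cot_topology A \<phi>) u y1 (inf (filtercomap Re at_top) (principal closed_strip))" using hs unfolding holomorphic_strip_def by blast
  obtain y2 where y2: "y2 \<in> cofibre A \<phi> x \<inter> rescale \<epsilon> ` spectral_curve A \<phi>"
    "limitin (cot_topology A \<phi>) u y2 (inf (filtercomap Re at_bot) (principal closed_strip))" using hs unfolding holomorphic_strip_def by blast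
  have "eventually (\<lambda>w. u w \<in> ?N) (inf (filtercomap Re at_top) (principal closed_strip))"
    using y1(2) oN N[OF y1(1)] unfolding limitin_def by blast
  then obtain R1 where R1: "\<And>w. R1 \<le> Re w \<Longrightarrow> w \<in> closed_strip \<Longrightarrow> u w \<in> ?N"
    unfolding eventually_inf_principal eventually_filtercomap_at_top_linorder by blast
  have "eventually (\<lambda>w. u w \<in> ?N) (inf (filtercomap Re at_bot) (principal closed_strip))"
    using y2(2) oN N[OF y2(1)] unfolding limitin_def by blast
  then obtain R2 where R2: "\<And>w. Re w \<le> R2 \<Longrightarrow> w \<in> closed_strip \<Longrightarrow> u w \<in> ?N"
    unfolding eventually_inf_principal eventually_filtercomap_at_bot_linorder by blast
  show ?thesis
  proof (rule that[of "max \<bar>R1\<bar> \<bar>R2\<bar>"])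
    fix w assume w: "w \<in> closed_strip" "max \<bar>R1\<bar> \<bar>R2\<bar> \<le> \<bar>Re w\<bar>"
    have "R1 \<le> Re w \<or> Re w \<le> R2" using w(2) by linarith
    then have "u w \<in> ?N" using R1[OF _ w(1)] R2[OF _ w(1)] by blast
    then show "fst (u w) \<in> cim k \<and> cot_chart k (u w) \<in> W" by blast
  qed
qed

lemma bounded_closed_strip:
  assumes "K \<subseteq> closed_strip" "\<And>w. w \<in> K \<Longrightarrow> \<bar>Re w\<bar> < R"
  shows "bounded K"
  unfolding bounded_iff
proof (intro exI ballI)
  fix w assume w: "w \<in> K"
  have "\<bar>Im w\<bar> \<le> 1" using assms(1) w by (auto simp: closed_strip_def)
  then show "norm w \<le> R + 1" using cmod_le[of w] assms(2)[OF w] by linarith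
qed

text \<open>The metric is known to be flat over the image of D only, so holomorphy is available on
  the open set \<open>Om\<close> of interior points lying over it. \<open>level_set_empty\<close> is
  used twice: for the levels of Im q, with \<open>Om\<close> possibly small, and for those of Re p,
  after \<open>Om\<close> has turned out to be the whole interior.\<close>

lemma (in exact_surface) flat_strip_constant:
  assumes f: "flatmap D \<psi>" "inj_on \<psi> D" and D: "D = {w. \<bar>Im w - Im z\<bar> < e}" "0 < e"
    and flat: "metrics_agree_on A (\<psi> ` D) g (flat_metric \<phi>)" and hs: "holomorphic_strip A \<phi> g \<epsilon> (\<psi> z) u"
  shows "u constant_on closed_strip"
proof -
  define k where "k = (D, \<psi>)"
  have kF: "k \<in> flat_coordinates A \<phi>" unfolding k_def by (rule flatmap_flat_coordinate[OF f])
  have kA: "k \<in> A" using kF by (rule flat_coordinates_atlas)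
  have ck: "cdom k = D" "cmap k = \<psi>" "cim k = \<psi> ` D" by (simp_all add: k_def)
  have oD: "open D" by (rule flatmap_open[OF f(1)])
  have zD: "z \<in> D" using D by simp
  have ci: "cinv k (\<psi> w) = w" if "w \<in> D" for w using cinv_cmap[OF kA, of w] that ck by simp
  have xz: "\<psi> z \<in> cim k" "cinv k (\<psi> z) = z" using ci[OF zD] zD ck by simp_all
  have gk: "g k x v w = v \<bullet> w" if "x \<in> D" for x v w
  proof -
    have "g k x = flat_metric \<phi> k x" using flat kA that ck unfolding metrics_agree_on_def by blast
    moreover have "\<phi> k x = 1" using kF that ck unfolding flat_coordinates_def by blast
    ultimately show ?thesis by (simp add: flat_metric_def)
  qed
  have J: "continuous_map (top_of_set closed_strip) (cot_topology A \<phi>) u" using hs unfolding holomorphic_strip_def J_holomorphic_on_def by blast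
  note ub = cot_map_base(1)[OF J] and Fc = cot_map_base(2)[OF J]
  define Z where "Z = cot_chart k \<circ> u"
  let ?S = "{w \<in> closed_strip. fst (u w) \<in> cim k}"
  have Zf: "fst (Z w) \<in> D" "\<psi> (fst (Z w)) = fst (u w)" if "w \<in> ?S" for w
  proof -
    have "fst (u w) \<in> cim k" using that by blast
    then show "fst (Z w) \<in> D" "\<psi> (fst (Z w)) = fst (u w)" using cinv_in_cdom[of "fst (u w)" k] cmap_cinv[of "fst (u w)" k] ck
      by (simp_all add: Z_def cot_chart_def)
  qed
  have JS: "smooth_on ?S Z" "\<forall>w\<in>?S. \<exists>L. (Z has_derivative L) (at w within ?S) \<and> (\<forall>\<zeta>. L (\<i> * \<zeta>) = sasaki (g k) (Z w) (L \<zeta>))"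
  proof -
    have "\<forall>k\<in>A. let S' = {w \<in> closed_strip. fst (u w) \<in> cim k} in smooth_on S' (cot_chart k \<circ> u) \<and>
        (\<forall>w\<in>S'. \<exists>L. ((cot_chart k \<circ> u) has_derivative L) (at w within S') \<and> (\<forall>\<zeta>. L (\<i> * \<zeta>) = sasaki (g k) (cot_chart k (u w)) (L \<zeta>)))"
      using hs unfolding holomorphic_strip_def J_holomorphic_on_def by (elim conjE)
    note jj = bspec[OF this kA, unfolded Let_def]
    show "smooth_on ?S Z" using conjunct1[OF jj] unfolding Z_def .
    show "\<forall>w\<in>?S. \<exists>L. (Z has_derivative L) (at w within ?S) \<and> (\<forall>\<zeta>. L (\<i> * \<zeta>) = sasaki (g k) (Z w) (L \<zeta>))"
      using conjunct2[OF jj] unfolding Z_def comp_apply .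
  qed
  have Zc: "continuous_on ?S Z" using spec[OF JS(1)[unfolded smooth_on_def], of 0] unfolding Ck_on.simps .
  define Om where "Om = {w \<in> strip_interior. fst (u w) \<in> cim k}"
  have OmS: "Om \<subseteq> ?S" "Om \<subseteq> strip_interior" using strip_interior(3) unfolding Om_def by blast+
  have oOm: "open Om"
  proof -
    have "Om = strip_interior \<inter> (\<lambda>w. fst (u w)) -` cim k" unfolding Om_def by blast
    then show ?thesis using continuous_open_preimage[OF continuous_on_subset[OF Fc strip_interior(3)] strip_interior(1) open_cim[OF kA]] by simp
  qed
  \<comment> \<open>In flat coordinates J sends (q, p) to (cnj p, - cnj q). A real-linear T that
    intertwines this with multiplication by \<i> makes T composed with the strip complex
    differentiable.\<close>
  have hol: "(\<lambda>w. T (Z w)) holomorphic_on Om" if T: "bounded_linear T" "\<And>q p. T (cnj p, - cnj q) = \<i> * T (q, p)" for T :: "complex \<times> complex \<Rightarrow> complex"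
    unfolding holomorphic_on_open[OF oOm]
  proof
    fix w assume w: "w \<in> Om"
    obtain L where L: "(Z has_derivative L) (at w within ?S)" "\<forall>\<zeta>. L (\<i> * \<zeta>) = sasaki (g k) (Z w) (L \<zeta>)" using JS(2) OmS(1) w by blast
    have "(Z has_derivative L) (at w)" using L(1) unfolding at_within_open_subset[OF w oOm OmS(1)] .
    from bounded_linear.has_derivative[OF T(1) this] have d: "((\<lambda>w. T (Z w)) has_derivative (\<lambda>x. T (L x))) (at w)" .
    have "fst (Z w) \<in> D" using Zf(1) OmS(1) w by blast
    then have "sasaki (g k) (fst (Z w), snd (Z w)) X = (cnj (snd X), - cnj (fst X))" for X by (rule sasaki_flat[OF oD _ gk])
    then have "L (\<i> * x) = (cnj (snd (L x)), - cnj (fst (L x)))" for x using L(2) by simp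
    then have "T (L (\<i> * x)) = \<i> * T (L x)" for x using T(2)[of "snd (L x)" "fst (L x)"] by simp
    from complex_linear_has_field_derivative[OF d this] show "\<exists>f'. ((\<lambda>w. T (Z w)) has_field_derivative f') (at w)" by blast
  qed
  \<comment> \<open>Up to the factor \<i> in \<open>T1\<close>, these are the two holomorphic
    combinations of the overview, arranged so that the imaginary part defines the level set and the
    real part is the function estimated on it.\<close>
  define T1 where "T1 = (\<lambda>y :: complex \<times> complex. - of_real (Re (fst y)) + \<i> * of_real (Re (snd y)) :: complex)"
  define T2 where "T2 = (\<lambda>y :: complex \<times> complex. - of_real (Im (snd y)) + \<i> * of_real (Im (fst y)) :: complex)"
  have T1: "bounded_linear T1" "Re (T1 y) = - Re (fst y)" "Im (T1 y) = Re (snd y)" "T1 (cnj p, - cnj q) = \<i> * T1 (q, p)" for y p q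
  proof -
    show "bounded_linear T1" unfolding T1_def
      by (intro bounded_linear_add bounded_linear_minus bounded_linear_const_mult bounded_linear_compose[OF bounded_linear_of_real]
        bounded_linear_compose[OF bounded_linear_Re] bounded_linear_fst bounded_linear_snd)
  qed (simp_all add: T1_def complex_eq_iff)
  have T2: "bounded_linear T2" "Re (T2 y) = - Im (snd y)" "Im (T2 y) = Im (fst y)" "T2 (cnj p, - cnj q) = \<i> * T2 (q, p)" for y p q
  proof -
    show "bounded_linear T2" unfolding T2_def
      by (intro bounded_linear_add bounded_linear_minus bounded_linear_const_mult bounded_linear_compose[OF bounded_linear_of_real]
        bounded_linear_compose[OF bounded_linear_Im] bounded_linear_fst bounded_linear_snd)
  qed (simp_all add: T2_def complex_eq_iff)
  have hol1: "(\<lambda>w. T1 (Z w)) holomorphic_on Om" by (rule hol[OF T1(1,4)])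
  have hol2: "(\<lambda>w. T2 (Z w)) holomorphic_on Om" by (rule hol[OF T2(1,4)])
  have bd0: "snd (Z w) = of_real \<epsilon> \<or> snd (Z w) = - of_real \<epsilon>" if w: "w \<in> ?S" "Im w = 0" for w
  proof -
    have "u (Complex (Re w) 0) \<in> rescale \<epsilon> ` spectral_curve A \<phi>" using hs unfolding holomorphic_strip_def by blast
    moreover have "Complex (Re w) 0 = w" using w(2) by (simp add: complex_eq_iff)
    ultimately obtain y where y: "y \<in> spectral_curve A \<phi>" "u w = rescale \<epsilon> y" by auto
    have fy: "fst y = fst (u w)" "fst (u w) \<in> cim k" using y(2) w(1) by (simp_all add: rescale_def)
    have "(snd y k)\<^sup>2 = \<phi> k (cinv k (fst y))" using spectral_sq[OF y(1) kA] fy by simp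
    also have "\<dots> = 1" using kF cinv_in_cdom[OF fy(2)] fy(1) unfolding flat_coordinates_def by simp
    finally have "snd y k = 1 \<or> snd y k = -1" by (simp add: power2_eq_1_iff)
    then show ?thesis unfolding Z_def cot_chart_def comp_apply y(2) rescale_def by auto
  qed
  have bd1: "w \<in> ?S" "fst (Z w) = z" "fst (u w) = \<psi> z" if w: "Im w = 1" for w
  proof -
    have "u (Complex (Re w) 1) \<in> cofibre A \<phi> (\<psi> z)" using hs unfolding holomorphic_strip_def by blast
    moreover have "Complex (Re w) 1 = w" using w by (simp add: complex_eq_iff)
    ultimately show "fst (u w) = \<psi> z" by (simp add: cofibre_def)
    then show "w \<in> ?S" "fst (Z w) = z" using xz w by (simp_all add: closed_strip_def Z_def cot_chart_def)
  qed
  have bdry: "w \<in> strip_interior \<or> Im w = 0 \<or> Im w = 1" if "w \<in> closed_strip" for w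
    using that by (auto simp: closed_strip_def strip_interior_def)
  have far: "\<exists>R. \<forall>w\<in>closed_strip. R \<le> \<bar>Re w\<bar> \<longrightarrow> w \<in> ?S \<and> Z w \<in> W" if W: "open W" "(z, of_real \<epsilon>) \<in> W" "(z, - of_real \<epsilon>) \<in> W" for W
  proof -
    have W': "(cinv k (\<psi> z), of_real \<epsilon>) \<in> W" "(cinv k (\<psi> z), - of_real \<epsilon>) \<in> W" using W(2,3) xz(2) by simp_all
    obtain R where "\<And>w. w \<in> closed_strip \<Longrightarrow> R \<le> \<bar>Re w\<bar> \<Longrightarrow> fst (u w) \<in> cim k \<and> cot_chart k (u w) \<in> W"
      by (rule strip_end[OF hs kF xz(1) W(1) W']) blast
    then show ?thesis unfolding Z_def comp_apply by blast
  qed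
  define Lev where "Lev r = {w \<in> ?S. Im (fst (Z w)) = Im z + r}" for r
  have Lcl: "closed (Lev r)" if r: "\<bar>r\<bar> < e" for r
  proof -
    let ?X = "{v. Im v = Im z + r}"
    have XD: "ball v (e - \<bar>r\<bar>) \<subseteq> D" if "v \<in> ?X" for v
    proof
      fix y assume "y \<in> ball v (e - \<bar>r\<bar>)"
      then have "\<bar>Im v - Im y\<bar> < e - \<bar>r\<bar>" using abs_Im_le_cmod[of "v - y"] by (simp add: dist_norm)
      then show "y \<in> D" using that unfolding D by simp
    qed
    have cX: "closed ?X" by (rule closed_halfspace_Im_eq)
    \<comment> \<open>The horizontal line at height Im z + r has a collar in D, so its image is
      closed in \<open>C_tilde A \<phi>\<close>. This makes the level set closed in the whole strip,
      not merely in the part over the chart.\<close>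
    have "Lev r = closed_strip \<inter> (\<lambda>w. fst (u w)) -` closure (\<psi> ` ?X)"
    proof (intro equalityI subsetI)
      fix w assume "w \<in> Lev r"
      then have "w \<in> ?S" "fst (Z w) \<in> ?X" unfolding Lev_def by blast+
      from imageI[OF this(2), of \<psi>] Zf(2)[OF this(1)] have "fst (u w) \<in> \<psi> ` ?X" by simp
      then show "w \<in> closed_strip \<inter> (\<lambda>w. fst (u w)) -` closure (\<psi> ` ?X)" using \<open>w \<in> ?S\<close> closure_subset[of "\<psi> ` ?X"] by blast
    next
      fix w assume w: "w \<in> closed_strip \<inter> (\<lambda>w. fst (u w)) -` closure (\<psi> ` ?X)"
      have "fst (u w) \<in> C_tilde A \<phi>" using ub[of w] w unfolding cotangent_bundle_iff by blast
      then have "fst (u w) \<in> \<psi> ` ?X" using w by (intro closed_flat_image[OF f _ XD cX]) (use r in auto)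
      then obtain v where v: "v \<in> ?X" "fst (u w) = \<psi> v" by blast
      have vD: "v \<in> D" using v(1) r unfolding D by simp
      show "w \<in> Lev r" using w v vD ci[OF vD] ck unfolding Lev_def Z_def cot_chart_def comp_apply by auto
    qed
    then show ?thesis using continuous_closed_preimage[OF Fc strip_interior(5) closed_closure] by simp
  qed
  have inter: "v \<in> Om \<longleftrightarrow> v \<in> ?S" if "v \<in> strip_interior" for v using that strip_interior(3) unfolding Om_def by blast
  have Lev0: "w \<notin> strip_interior" if r: "\<bar>r\<bar> < e" "r \<noteq> 0" and w: "w \<in> Lev r" for r w
  proof
    assume wi: "w \<in> strip_interior"
    have LS: "Lev r \<subseteq> ?S" unfolding Lev_def by blast
    \<comment> \<open>Near both ends Im q is within |r| of Im z, which keeps the level r \<noteq> 0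
      in a bounded part of the strip.\<close>
    let ?W = "{y :: complex \<times> complex. \<bar>Im (fst y) - Im z\<bar> < \<bar>r\<bar>}"
    have oW: "open ?W" by (intro open_Collect_less continuous_intros)
    have zW: "(z, of_real \<epsilon>) \<in> ?W" "(z, - of_real \<epsilon>) \<in> ?W" using r(2) by simp_all
    obtain R where R: "\<forall>w\<in>closed_strip. R \<le> \<bar>Re w\<bar> \<longrightarrow> w \<in> ?S \<and> Z w \<in> ?W" using far[OF oW zW] by blast
    have "\<bar>Re w\<bar> < R" if "w \<in> Lev r" for w
    proof (rule ccontr)
      assume "\<not> \<bar>Re w\<bar> < R"
      then have "Z w \<in> ?W" using R LS that by auto
      then show False using that unfolding Lev_def by simp
    qed
    then have "bounded (Lev r)" by (intro bounded_closed_strip) (use LS in blast)+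
    then have K: "compact (Lev r)" using Lcl[OF r(1)] by (simp add: compact_eq_bounded_closed)
    show False
    proof (rule level_set_empty[OF K, of "\<lambda>w. - Im (snd (Z w))" 0 "Im z + r"])
      show "continuous_on (Lev r) (\<lambda>w. - Im (snd (Z w)))" by (intro continuous_intros continuous_on_subset[OF Zc LS])
      show "- Im (snd (Z v)) = 0" if v: "v \<in> Lev r" "v \<notin> strip_interior" for v
      proof -
        have "Im v \<noteq> 1" using bd1(2)[of v] v(1) r(2) unfolding Lev_def by auto
        then have v0: "Im v = 0" using bdry[of v] v LS by blast
        have "v \<in> ?S" using v(1) LS by blast
        from bd0[OF this v0] show ?thesis by auto
      qed
      show "\<exists>s>0. \<exists>W. W holomorphic_on ball v s \<and> ball v s \<subseteq> strip_interior \<and>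
          (\<forall>y\<in>ball v s. y \<in> Lev r \<longleftrightarrow> Im (W y) = Im z + r) \<and> (\<forall>y\<in>ball v s. - Im (snd (Z y)) = Re (W y))"
        if v: "v \<in> Lev r" "v \<in> strip_interior" for v
      proof -
        have "v \<in> Om" using inter[OF v(2)] v(1) LS by blast
        then obtain s where s: "s > 0" "ball v s \<subseteq> Om" using oOm openE by blast
        have "y \<in> Lev r \<longleftrightarrow> Im (T2 (Z y)) = Im z + r" if "y \<in> ball v s" for y
        proof -
          have "y \<in> ?S" using that s(2) OmS(1) by blast
          then show ?thesis unfolding Lev_def T2(3) by blast
        qed
        then show ?thesis using s OmS(2) holomorphic_on_subset[OF hol2 s(2)] T2(2)
          by (intro exI[of _ s] conjI exI[of _ "\<lambda>y. T2 (Z y)"]) auto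
      qed
    qed (rule w, rule wi)
  qed
  have L0: "strip_interior \<subseteq> Lev 0"
  proof -
    let ?M = "strip_interior \<inter> Lev 0"
    \<comment> \<open>Over the band only the level 0 is left in the interior, so one and the same
      set is open as \<open>Om\<close> and closed as a level set.\<close>
    have "?M = Om"
    proof (intro equalityI subsetI)
      fix w assume w: "w \<in> Om"
      have wS: "w \<in> ?S" using OmS(1) w by blast
      define r where "r = Im (fst (Z w)) - Im z"
      have "w \<in> Lev r" using wS unfolding Lev_def r_def by simp
      moreover have "\<bar>r\<bar> < e" using Zf(1)[OF wS] unfolding r_def D by simp
      ultimately have "r = 0" using Lev0[of r w] OmS(2) w by blast
      then show "w \<in> ?M" using \<open>w \<in> Lev r\<close> OmS(2) w by blast
    qed (use inter in \<open>auto simp: Lev_def\<close>)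
    then have oM: "openin (top_of_set strip_interior) ?M" using oOm by (simp add: open_subset OmS(2))
    have cM: "closedin (top_of_set strip_interior) ?M" using Lcl[of 0] D(2) by (simp add: closedin_closed_Int)
    have "?M \<noteq> {}"
    proof -
      \<comment> \<open>Nonemptiness is read off at the boundary point \<i>, which is mapped over z:
        nearby interior points still lie over the chart.\<close>
      have i: "\<i> \<in> closed_strip" "Im \<i> = 1" by (simp_all add: closed_strip_def)
      have "openin (top_of_set closed_strip) (closed_strip \<inter> (\<lambda>w. fst (u w)) -` cim k)" by (rule continuous_openin_preimage_gen[OF Fc open_cim[OF kA]])
      then obtain N where N: "open N" "closed_strip \<inter> (\<lambda>w. fst (u w)) -` cim k = closed_strip \<inter> N" unfolding openin_open by blast
      have "\<i> \<in> N" using N(2) bd1(1)[OF i(2)] by blast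
      then have "N \<inter> strip_interior \<noteq> {}" using closed_strip_closure i(1) N(1) by (metis IntI empty_iff open_Int_closure_eq_empty subsetD)
      then have "Om \<noteq> {}" using N(2) strip_interior(3) unfolding Om_def by blast
      then show ?thesis using \<open>?M = Om\<close> by simp
    qed
    then have "?M = strip_interior" using strip_interior(2) oM cM unfolding connected_clopen by blast
    then show ?thesis by blast
  qed
  have SL: "closed_strip \<subseteq> Lev 0"
    using closure_minimal[OF L0] Lcl[of 0] D(2) closed_strip_closure by simp
  then have SS: "?S = closed_strip" unfolding Lev_def by blast
  have Omi: "Om = strip_interior" using inter SS strip_interior(3) OmS(2) by blast
  have Zc': "continuous_on closed_strip Z" using Zc unfolding SS .
  have q2: "Im (fst (Z w)) = Im z" if "w \<in> closed_strip" for w using SL that unfolding Lev_def by auto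
  have "(\<lambda>w. T2 (Z w)) constant_on strip_interior"
    by (rule holomorphic_const_Im[OF hol2[unfolded Omi] strip_interior(1,2)]) (use q2 strip_interior(3) in \<open>auto simp: T2(3)\<close>)
  then obtain c2 where c2: "\<And>w. w \<in> strip_interior \<Longrightarrow> T2 (Z w) = c2" unfolding constant_on_def by blast
  have p2: "Im (snd (Z w)) = - Re c2" if "w \<in> closed_strip" for w
  proof -
    have "Im (snd (Z w)) \<in> {- Re c2}"
      by (rule closed_strip_const[OF _ _ closed_singleton that]) (intro continuous_intros Zc', use c2 T2(2) in \<open>force simp: T2(2)\<close>)
    then show ?thesis by simp
  qed
  \<comment> \<open>A level \<kappa> of Re p other than \<epsilon> and - \<epsilon> avoids both ends
    and the boundary t = 0. On t = 1 the function Re q has the constant value Re z, so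
    \<open>level_set_empty\<close> applies.\<close>
  have p1i: "Re (snd (Z w)) \<in> {\<epsilon>, - \<epsilon>}" if w: "w \<in> strip_interior" for w
  proof (rule ccontr)
    assume n: "Re (snd (Z w)) \<notin> {\<epsilon>, - \<epsilon>}"
    define \<kappa> where "\<kappa> = Re (snd (Z w))"
    let ?K = "{w \<in> closed_strip. Re (snd (Z w)) = \<kappa>}"
    have "?K = closed_strip \<inter> (\<lambda>w. Re (snd (Z w))) -` {\<kappa>}" by blast
    moreover have "continuous_on closed_strip (\<lambda>w. Re (snd (Z w)))" by (intro continuous_intros Zc')
    ultimately have cK: "closed ?K" using continuous_closed_preimage[OF _ strip_interior(5) closed_singleton] by metis
    let ?W = "{y :: complex \<times> complex. Re (snd y) \<noteq> \<kappa>}"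
    have oW: "open ?W" by (intro open_Collect_neq continuous_intros)
    have zW: "(z, of_real \<epsilon>) \<in> ?W" "(z, - of_real \<epsilon>) \<in> ?W" using n by (auto simp: \<kappa>_def)
    obtain R where R: "\<forall>w\<in>closed_strip. R \<le> \<bar>Re w\<bar> \<longrightarrow> w \<in> ?S \<and> Z w \<in> ?W" using far[OF oW zW] by blast
    have "\<bar>Re v\<bar> < R" if "v \<in> ?K" for v
    proof (rule ccontr)
      assume "\<not> \<bar>Re v\<bar> < R"
      then have "Z v \<in> ?W" using R that by auto
      then show False using that by simp
    qed
    then have "bounded ?K" by (intro bounded_closed_strip) blast
    then have K: "compact ?K" using cK by (simp add: compact_eq_bounded_closed)
    show False
    proof (rule level_set_empty[OF K, of "\<lambda>w. - Re (fst (Z w))" "- Re z" \<kappa> w])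
      show "continuous_on ?K (\<lambda>w. - Re (fst (Z w)))" by (intro continuous_intros continuous_on_subset[OF Zc']) blast
      show "- Re (fst (Z v)) = - Re z" if v: "v \<in> ?K" "v \<notin> strip_interior" for v
      proof -
        have "Im v \<noteq> 0"
        proof
          assume "Im v = 0"
          then have "Re (snd (Z v)) \<in> {\<epsilon>, - \<epsilon>}" using bd0[of v] v(1) SS by auto
          then show False using v(1) n unfolding \<kappa>_def by simp
        qed
        then have "Im v = 1" using bdry[of v] v by blast
        then show ?thesis using bd1(2)[of v] by simp
      qed
      show "\<exists>s>0. \<exists>W. W holomorphic_on ball v s \<and> ball v s \<subseteq> strip_interior \<and>
          (\<forall>y\<in>ball v s. y \<in> ?K \<longleftrightarrow> Im (W y) = \<kappa>) \<and> (\<forall>y\<in>ball v s. - Re (fst (Z y)) = Re (W y))"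
        if v: "v \<in> ?K" "v \<in> strip_interior" for v
      proof -
        obtain s where s: "s > 0" "ball v s \<subseteq> Om" using oOm openE v(2) unfolding Omi by blast
        have "y \<in> ?K \<longleftrightarrow> Im (T1 (Z y)) = \<kappa>" if "y \<in> ball v s" for y
        proof -
          have "y \<in> closed_strip" using that s(2) OmS(1) by blast
          then show ?thesis unfolding T1(3) by blast
        qed
        then show ?thesis using s OmS(2) holomorphic_on_subset[OF hol1 s(2)] T1(2)
          by (intro exI[of _ s] conjI exI[of _ "\<lambda>y. T1 (Z y)"]) auto
      qed
      show "w \<in> ?K" using w strip_interior(3) unfolding \<kappa>_def by blast
    qed (rule w)
  qed
  have p1c: "continuous_on closed_strip (\<lambda>w. Re (snd (Z w)))" by (intro continuous_intros Zc')
  have p1: "Re (snd (Z w)) \<in> {\<epsilon>, - \<epsilon>}" if "w \<in> closed_strip" for w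
    by (rule closed_strip_const[OF p1c p1i _ that]) simp_all
  have "finite ((\<lambda>w. Re (snd (Z w))) ` closed_strip)" by (rule finite_subset[of _ "{\<epsilon>, - \<epsilon>}"]) (use p1 in blast, simp)
  from continuous_finite_range_constant[OF convex_connected[OF strip_interior(4)] p1c this]
  obtain c1 where c1: "\<And>w. w \<in> closed_strip \<Longrightarrow> Re (snd (Z w)) = c1" unfolding constant_on_def by blast
  have "(\<lambda>w. T1 (Z w)) constant_on strip_interior"
    by (rule holomorphic_const_Im[OF hol1[unfolded Omi] strip_interior(1,2)]) (use c1 strip_interior(3) in \<open>auto simp: T1(3)\<close>)
  then obtain d where d: "\<And>w. w \<in> strip_interior \<Longrightarrow> T1 (Z w) = d" unfolding constant_on_def by blast
  have q1: "Re (fst (Z w)) = - Re d" if "w \<in> closed_strip" for w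
  proof -
    have "Re (fst (Z w)) \<in> {- Re d}"
      by (rule closed_strip_const[OF _ _ closed_singleton that]) (intro continuous_intros Zc', use d T1(2) in \<open>force simp: T1(2)\<close>)
    then show ?thesis by simp
  qed
  have Zconst: "Z w = (Complex (- Re d) (Im z), Complex c1 (- Re c2))" if "w \<in> closed_strip" for w
    using q1[OF that] q2[OF that] c1[OF that] p2[OF that] by (simp add: prod_eq_iff complex_eq_iff)
  \<comment> \<open>\<open>Z\<close> determines the base point through \<psi> and the covector
    through its component in one chart.\<close>
  have "u w = u \<i>" if w: "w \<in> closed_strip" for w
  proof -
    have i: "\<i> \<in> closed_strip" by (simp add: closed_strip_def)
    have eq: "Z w = Z \<i>" using Zconst[OF w] Zconst[OF i] by simp
    have S: "w \<in> ?S" "\<i> \<in> ?S" using w i SS by simp_all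
    have "fst (u w) = fst (u \<i>)" using Zf(2)[OF S(1)] Zf(2)[OF S(2)] eq by simp
    moreover have "snd (u w) k = snd (u \<i>) k" using eq unfolding Z_def cot_chart_def by simp
    ultimately show ?thesis using S(1) by (intro cot_eqI[OF ub[OF w] ub[OF i] _ kA]) auto
  qed
  then show ?thesis unfolding constant_on_def by blast
qed

context exact_surface
begin

text \<open>The box keeps its heights at distance 2 e from the edges. Hence the infinite horizontal
  strip D of half-height e around the given point is still at distance e from them, and the metric
  is flat over all of D.\<close>

lemma no_strips:
  assumes d: "0 < \<delta>" and e: "0 < e" "2 * e < E" "\<And>b. b \<in> qd_zeros A \<phi> \<Longrightarrow> 9 * e\<^sup>2 < \<rho> b ^ 3" "4/9 * (3/2 * \<delta>) ^ 3 < e\<^sup>2"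
    and z: "z \<in> C_region A \<phi> (2 * e) E" and hs: "holomorphic_strip A \<phi> (desing \<delta>) \<epsilon> z u"
  shows "u constant_on closed_strip"
proof -
  have e2: "0 < 2 * e" using e(1) by simp
  obtain J \<psi> w where w: "maxstrip J \<psi>" "w \<in> flat_box (2 * e) E J" "\<psi> w = z" by (rule C_region_in_maxstrip[OF e2 e(2) z])
  let ?D = "{v. \<bar>Im v - Im w\<bar> < e}"
  have deep: "ball v e \<subseteq> band J" if v: "v \<in> ?D" for v
  proof
    fix y assume "y \<in> ball v e"
    then have "\<bar>Im v - Im y\<bar> < e" using abs_Im_le_cmod[of "v - y"] by (simp add: dist_norm)
    then have "Im y \<in> cball (Im w) (2 * e)" using v by (simp add: dist_real_def)
    then show "y \<in> band J" using w(2) unfolding flat_box_def band_def by blast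
  qed
  have DJ: "?D \<subseteq> band J"
  proof
    fix v assume "v \<in> ?D"
    from subsetD[OF deep[OF this], of v] show "v \<in> band J" using e(1) by simp
  qed
  have "open ?D" by (intro open_Collect_less continuous_intros)
  then have f: "flatmap ?D \<psi>" "inj_on \<psi> ?D"
    using flatmap_subset[OF maxstripD(5)[OF w(1)] _ DJ] inj_on_subset[OF maxstrip_inj[OF w(1)] DJ] by blast+
  have "metrics_agree_on A (\<psi> ` ?D) (desing \<delta>) (flat_metric \<phi>)"
    unfolding metrics_agree_on_def
  proof (intro ballI impI)
    fix k x assume "cmap k x \<in> \<psi> ` ?D"
    then obtain v where v: "v \<in> ?D" "cmap k x = \<psi> v" by blast
    have "\<psi> v \<notin> zero_nhd A \<phi> \<xi> \<rho> (3/2 * \<delta>)" by (rule box_avoids_zero_nhd[OF w(1) e(1,3) deep[OF v(1)] e(4)])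
    then have "conformal_factor \<delta> k x = cmod (\<phi> k x)" using conformal_factor_outer[OF d] v(2) by simp
    then show "desing \<delta> k x = flat_metric \<phi> k x" by (intro ext) (simp add: desing_def flat_metric_def)
  qed
  from flat_strip_constant[OF f refl e(1) this] show ?thesis using hs unfolding w(3)[symmetric] .
qed

end

theorem theorem1p2:
  fixes A :: "'c::t2_space coord set"
    and \<phi> :: "'c qd"
    and \<xi> :: "'c \<Rightarrow> complex \<Rightarrow> 'c"
    and \<rho> :: "'c \<Rightarrow> real"
  assumes "closed_riemann_surface A"
    and "complete_GMN A \<phi>"
    and "exact_spectral_curve A \<phi>"
    and "zero_charts A \<phi> \<xi> \<rho>"
  shows "\<exists>E\<^sub>0>0. \<exists>\<delta>\<^sub>0>0. \<forall>\<delta>. 0 < \<delta> \<and> \<delta> < \<delta>\<^sub>0 \<longrightarrow>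
    (\<exists>g e h \<eta>.
       desingularized_metric A \<phi> \<xi> \<rho> \<delta> g \<and>
       admissible_parameters A \<phi> \<xi> \<rho> \<delta> g e h \<eta> \<and>
       (\<forall>E\<ge>E\<^sub>0.
          weak_deformation_retract_of (C_region A \<phi> e E) (C_tilde A \<phi> - spectral_network A \<phi>) \<and>
          metrics_agree_on A (C_region A \<phi> e E) g (flat_metric \<phi>) \<and>
          (\<exists>\<epsilon>\<^sub>0>0. \<forall>\<epsilon>. 0 < \<epsilon> \<and> \<epsilon> \<le> \<epsilon>\<^sub>0 \<longrightarrow>
             (\<forall>z\<in>C_region A \<phi> e E.
                \<not> (\<exists>u. holomorphic_strip A \<phi> g \<epsilon> z u \<and> \<not> u constant_on closed_strip)))))"
proof -
  interpret gmn_surface A \<phi> \<xi> \<rho> by unfold_locales (rule assms)+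
  obtain f where "exact_surface A \<phi> \<xi> \<rho> f" using exact_surface_exists[OF assms(3)] by blast
  then interpret exact_surface A \<phi> \<xi> \<rho> f .
  obtain r where r: "r > 0" "r \<le> 1" "\<And>b. b \<in> qd_zeros A \<phi> \<Longrightarrow> 100 * r\<^sup>2 < \<rho> b ^ 3" by (rule small_radius) blast
  have r9: "9 * r\<^sup>2 < 4 * \<rho> b ^ 3" if "b \<in> qd_zeros A \<phi>" for b
    using r(3)[OF that] zero_le_power2[of r] by linarith
  \<comment> \<open>Strips have height at least r = 8 e, which exceeds the two margins 2 e removed
    at their edges; the bound 100 r^2 covers the requirements on 9 e^2 and 9 (2 e)^2.\<close>
  define e where "e = r / 8"
  have e: "0 < e" "e \<le> 1" "2 * e < 2" using r by (simp_all add: e_def)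
  have ee: "e\<^sup>2 \<le> 1" "e\<^sup>2 > 0" using e by (simp_all add: power_le_one)
  have r2: "r\<^sup>2 = 64 * e\<^sup>2" "(2 * e)\<^sup>2 = 4 * e\<^sup>2" by (simp_all add: e_def power_divide power_mult_distrib)
  have er: "9 * e\<^sup>2 < \<rho> b ^ 3" "9 * (2 * e)\<^sup>2 < \<rho> b ^ 3" "e\<^sup>2 < \<rho> b ^ 3" if "b \<in> qd_zeros A \<phi>" for b
    using r(3)[OF that] ee(2) unfolding r2 by linarith+
  have height: "2 * (2 * e) < b - a" if "maxstrip {a<..<b} \<psi>" "a < b" for a b \<psi>
    using maxstrip_height[OF that r(1) r9] r(1) by (simp add: e_def)
  show ?thesis
  \<comment> \<open>The lower bound 2 for E exceeds the margin 2 e. For \<delta> < e^2 / 10 the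
    lengths 3/2 \<delta> and 5/2 \<delta> are below both 1 and e^2, so their cubes are below
    e^2.\<close>
  proof (rule exI[of _ 2], intro conjI exI[of _ "e\<^sup>2 / 10"] allI impI)
    fix \<delta> :: real assume \<delta>: "0 < \<delta> \<and> \<delta> < e\<^sup>2 / 10"
    have d: "0 < \<delta>" "\<delta> \<le> 2/3" using \<delta> ee by simp_all
    have cube: "(c * \<delta>) ^ 3 < e\<^sup>2" if "0 < c" "c \<le> 5/2" for c
    proof -
      have c: "0 \<le> c * \<delta>" "c * \<delta> \<le> 5/2 * \<delta>" by (use that d(1) in simp, rule mult_right_mono) (use that d(1) in simp_all)
      then have "c * \<delta> \<le> 1" "c * \<delta> < e\<^sup>2" using \<delta> ee by linarith+
      then show ?thesis using power_decreasing[of 1 3 "c * \<delta>"] c(1) by simp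
    qed
    have c: "4/9 * (3/2 * \<delta>) ^ 3 < e\<^sup>2" "4/9 * (5/2 * \<delta>) ^ 3 < e\<^sup>2" "4/9 * (3/2 * \<delta>) ^ 3 < (2 * e)\<^sup>2"
    proof -
      have p: "0 < (3/2 * \<delta>) ^ 3" "0 < (5/2 * \<delta>) ^ 3" using d(1) by simp_all
      have q: "(3/2 * \<delta>) ^ 3 < e\<^sup>2" "(5/2 * \<delta>) ^ 3 < e\<^sup>2" by (rule cube; simp)+
      show "4/9 * (3/2 * \<delta>) ^ 3 < e\<^sup>2" "4/9 * (5/2 * \<delta>) ^ 3 < e\<^sup>2" "4/9 * (3/2 * \<delta>) ^ 3 < (2 * e)\<^sup>2"
        using p q ee(2) unfolding r2 by linarith+
    qed
    have d3: "3/2 * \<delta> < \<rho> b" if "b \<in> qd_zeros A \<phi>" for b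
    proof (rule power_less_imp_less_base)
      show "(3/2 * \<delta>) ^ 3 < \<rho> b ^ 3" using cube[of "3/2"] er(3)[OF that] by simp
      show "0 \<le> \<rho> b" using zchart(2)[OF that] by simp
    qed
    show "\<exists>g e h \<eta>.
       desingularized_metric A \<phi> \<xi> \<rho> \<delta> g \<and>
       admissible_parameters A \<phi> \<xi> \<rho> \<delta> g e h \<eta> \<and>
       (\<forall>E\<ge>2.
          weak_deformation_retract_of (C_region A \<phi> e E) (C_tilde A \<phi> - spectral_network A \<phi>) \<and>
          metrics_agree_on A (C_region A \<phi> e E) g (flat_metric \<phi>) \<and>
          (\<exists>\<epsilon>\<^sub>0>0. \<forall>\<epsilon>. 0 < \<epsilon> \<and> \<epsilon> \<le> \<epsilon>\<^sub>0 \<longrightarrow>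
             (\<forall>z\<in>C_region A \<phi> e E.
                \<not> (\<exists>u. holomorphic_strip A \<phi> g \<epsilon> z u \<and> \<not> u constant_on closed_strip))))"
    proof (intro exI conjI allI impI)
      show "desingularized_metric A \<phi> \<xi> \<rho> \<delta> (desing \<delta>)" by (rule desing_metric(3)[OF d d3])
      show "admissible_parameters A \<phi> \<xi> \<rho> \<delta> (desing \<delta>) (2 * e) e (1/2)" by (rule desing_admissible[OF d d3 e(1) er(1) c(2)])
      fix E :: real assume "2 \<le> E"
      then have E: "0 < 2 * e" "2 * e < E" using e by simp_all
      show "weak_deformation_retract_of (C_region A \<phi> (2 * e) E) (C_tilde A \<phi> - spectral_network A \<phi>)"
        by (rule C_region_retract[OF E height])
      show "metrics_agree_on A (C_region A \<phi> (2 * e) E) (desing \<delta>) (flat_metric \<phi>)"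
        by (rule desing_flat_region[OF d(1) E er(2) c(3)])
      \<comment> \<open>The scaling bound is witnessed by 1: the maximum principle behind
        \<open>no_strips\<close> works at every scale of the fibres.\<close>
      show "(0::real) < 1" by simp
      fix \<epsilon> :: real assume "0 < \<epsilon> \<and> \<epsilon> \<le> 1"
      show "\<forall>z\<in>C_region A \<phi> (2 * e) E. \<not> (\<exists>u. holomorphic_strip A \<phi> (desing \<delta>) \<epsilon> z u \<and> \<not> u constant_on closed_strip)"
        using no_strips[OF d(1) e(1) E(2) er(1) c(1)] by blast
    qed
  qed (use ee in simp_all)
qed

end
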